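(* Let $f\colon\mathcal D\to\mathbb R$ be a positive pluriharmonic function and take $h\in\Omega$. Then the following hold: (1) $f_{yh}\cdot\beta_{\mathrm b\mathcal D}$ has a vague limit $\mu$ for $y\to0^+$; (2) if $\pi_h$ denotes the (real) orthogonal projector of $E\times F_{\mathbb C}$ onto $(\mathbb Rh)^\perp$, then $\beta_h:=\chi_{\pi_h(\mathrm b\mathcal D)}\cdot\mathcal H^{2n+m-1}$ is a weak pseudo-image measure of $\mu$ under $\pi_h$, and is actually a pseudo-image measure if $\mu\neq0$; (3) there are a vaguely continuous disintegration $(\mu_{(\zeta,z)})$ of $\mu$ (relative to $\beta_h$) and $a\geq0$ such that \[ f(\zeta,z+wh)=\frac{|h|^2}{\pi}\int_{\mathrm b\mathcal D}\frac{\operatorname{Im}w}{|(\zeta,z+wh)-x|^2}\,d\mu_{(\zeta,z)}(x)+a\operatorname{Im}w \] for every $(\zeta,z)\in\pi_h(\mathrm b\mathcal D)$ and for every $w\in\mathbb C_+$; (4) if $\mu'_{(\zeta,z)}$ denotes the unique element of $\mathcal M_{\mathrm P}(\mathbb R,\mathbb C_+)$ of which the measure $\mu_{(\zeta,z)}$ defined in (3) is the image under the mapping $\mathbb R\ni x\mapsto(\zeta,z+xh)\in\mathrm b\mathcal D$, then the mapping $(\zeta,z)\mapsto\mu'_{(\zeta,z)}\in\mathcal M_{\mathrm P}(\mathbb R,\mathbb C_+)$ is (tightly) continuous.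
   Context: "Positive" means $\geq 0$; $\mathbb C_+=\mathbb R+i(0,\infty)$. A positive Hermitian Jordan triple system is a finite-dimensional complex vector space $Z$ with a triple product $\{x,y,z\}$ that is $\mathbb C$-bilinear and symmetric in $(x,z)$, $\mathbb C$-antilinear in $y$, such that, with $D(a,b)=\{a,b,\cdot\}$, $[D(a,b),D(x,y)]=D(D(a,b)x,y)-D(x,D(b,a)y)$, and such that $\{x,x,x\}=\lambda x$ with $x\neq0$ implies $\lambda>0$. $Z$ carries the scalar product $\langle x|y\rangle=\operatorname{Tr}D(x,y)$, with norm $|\cdot|$. A tripotent is an $x$ with $\{x,x,x\}=x$; two tripotents $x,y$ are orthogonal if $D(x,y)=0$; a non-zero tripotent is maximal if it is orthogonal to no non-zero tripotent. Fix such a $Z$ and a maximal tripotent $e$. Let $Z_\alpha(e)$ be the eigenspace of $D(e,e)$ for the eigenvalue $\alpha$; then $Z=Z_{1/2}(e)\oplus Z_1(e)$. Put $E=Z_{1/2}(e)$, $F=\{x\in Z_1(e):\{e,x,e\}=x\}$ (a real form of $Z_1(e)$), and identify $Z_1(e)=F_{\mathbb C}$ and $Z=E\times F_{\mathbb C}$; $F_{\mathbb C}$ is a Jordan algebra with product $(z,z')\mapsto\{z,e,z'\}$ and identity $e$. Set $n=\dim_{\mathbb C}E$ and $m=\dim_{\mathbb R}F$. Let $\Omega$ be the interior in $F$ of $\{x^2:x\in F\}$, $\Phi(\zeta,\zeta')=2\{\zeta,\zeta',e\}$ for $\zeta,\zeta'\in E$, $\Phi(\zeta)=\Phi(\zeta,\zeta)$.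 The symmetric Siegel domain is $\mathcal D=\{(\zeta,z)\in E\times F_{\mathbb C}:\operatorname{Im}z-\Phi(\zeta)\in\Omega\}$, with Šilov boundary $\mathrm b\mathcal D=\{(\zeta,z)\in E\times F_{\mathbb C}:\operatorname{Im}z-\Phi(\zeta)=0\}$. $\mathcal H^k$ denotes the $k$-dimensional Hausdorff measure, $\beta_{\mathrm b\mathcal D}$ is the Hausdorff measure $\mathcal H^{2n+m}$ on $\mathrm b\mathcal D$, and $\chi_A$ is the characteristic function of $A$. A real function on $\mathcal D$ is pluriharmonic if it is the real part of a holomorphic function. For $f\colon\mathcal D\to\mathbb C$ and $h\in\Omega$, $f_h$ is the function $\mathrm b\mathcal D\ni(\zeta,z)\mapsto f(\zeta,z+ih)$. Explicitly, the projector is $\pi_h(\zeta,z)=(\zeta,z-\langle\operatorname{Re}z|h\rangle h/|h|^2)$ for $(\zeta,z)\in E\times F_{\mathbb C}$. Vague convergence is convergence against compactly supported continuous functions. Given Radon measures $\mu$ on $X$ and $\nu$ on $Y$ ($X,Y$ locally compact with countable base) and a $\mu$-measurable $p\colon X\to Y$, $\nu$ is a weak pseudo-image measure of $\mu$ under $p$ if $p^{-1}(N)$ is $\mu$-negligible whenever $N\subseteq Y$ is $\nu$-negligible, and a pseudo-image measure if $N$ is $\nu$-negligible if and only if $p^{-1}(N)$ is $\mu$-negligible. If $\nu$ is a weak pseudo-image measure, a disintegration of $\mu$ relative to $\nu$ is a family $(\mu_y)_{y\in Y}$ of Radon measures on $X$ such that $\mu_y$ is concentrated on $p^{-1}(y)$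 for $\nu$-almost every $y$, and, for every $\mu$-integrable $g$, $g$ is $\mu_y$-integrable for $\nu$-almost every $y$, $y\mapsto\int_X g\,d\mu_y$ is $\nu$-integrable and $\int_X g\,d\mu=\int_Y\int_X g\,d\mu_y\,d\nu(y)$. It is vaguely continuous if $y\mapsto\int_X g\,d\mu_y$ is continuous for every $g\in C_c(X)$. Here $X=\mathrm b\mathcal D$, $Y=\pi_h(\mathrm b\mathcal D)$ and $p=\pi_h$. $\mathcal M_{\mathrm P}(\mathbb R,\mathbb C_+)$ is the space of Radon measures $\mu$ on $\mathbb R$ with $\int_{\mathbb R}(1+x^2)^{-1}\,d|\mu|(x)<\infty$; its tight topology is the weak topology defined by the duality with the space of continuous functions $g$ on $\mathbb R$ such that $(1+x^2)g(x)$ is bounded.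
   Formalization: In (3) the constant |h|²/π is replaced by |h|/π: as printed the formula fails for |h| ≠ 1 (on the upper half-plane with f = 1 the right-hand side is |h| + a Im w); the two constants agree for |h| = 1. *)

theory Defs
  imports "HOL-Analysis.Analysis"
begin

section \<open>Positive Hermitian Jordan triple systems\<close>

text \<open>The trace of a complex-linear endomorphism, computed in some basis of the complex vector
  space with scalar multiplication \<open>sc\<close>; its value does not depend on the basis.\<close>

definition complex_trace :: "(complex \<Rightarrow> 'z \<Rightarrow> 'z::ab_group_add) \<Rightarrow> ('z \<Rightarrow> 'z) \<Rightarrow> complex" where
  "complex_trace sc T =
     (let B = (SOME B. \<not> module.dependent sc B \<and> module.span sc B = UNIV)
      in \<Sum>b\<in>B. module.representation sc B (T b) b)"

text \<open>\<open>tp x y z\<close> is \<open>{x,y,z}\<close>, so that the operator \<open>D(a,b)\<close> is the partial application \<open>tp a b\<close>.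
  The scalar product of the triple system is \<open>\<langle>x|y\<rangle> = Tr D(x,y)\<close>. The last axiom says that the
  Euclidean structure of the type is the one underlying this scalar product; hence \<open>norm\<close>, \<open>dist\<close>,
  real orthogonality and the topology of the type are those of the triple system. It does not
  restrict the triple system, as \<open>\<langle>x|y\<rangle>\<close> is always positive definite.\<close>

locale positive_hermitian_jts = vector_space sc
  for sc :: "complex \<Rightarrow> 'z::euclidean_space \<Rightarrow> 'z" +
  fixes tp :: "'z \<Rightarrow> 'z \<Rightarrow> 'z \<Rightarrow> 'z"
  assumes sc_of_real: "sc (of_real r) x = r *\<^sub>R x"
    and tp_linear: "Vector_Spaces.linear sc sc (\<lambda>x. tp x y z)"
    and tp_commute: "tp x y z = tp z y x"
    and tp_add_middle: "tp x (y + y') z = tp x y z + tp x y' z"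
    and tp_sc_middle: "tp x (sc c y) z = sc (cnj c) (tp x y z)"
    and jordan_identity:
      "tp a b (tp x y z) - tp x y (tp a b z) = tp (tp a b x) y z - tp x (tp b a y) z"
    and tp_positive: "x \<noteq> 0 \<Longrightarrow> tp x x x = sc c x \<Longrightarrow> c \<in> \<real> \<and> Re c > 0"
    and inner_eq_trace: "x \<bullet> y = Re (complex_trace sc (tp x y))"

definition tripotent :: "('z \<Rightarrow> 'z \<Rightarrow> 'z \<Rightarrow> 'z) \<Rightarrow> 'z \<Rightarrow> bool" where
  "tripotent tp x \<longleftrightarrow> tp x x x = x"

definition maximal_tripotent :: "('z \<Rightarrow> 'z \<Rightarrow> 'z \<Rightarrow> 'z::zero) \<Rightarrow> 'z \<Rightarrow> bool" where
  "maximal_tripotent tp e \<longleftrightarrow> tripotent tp e \<and> e \<noteq> 0 \<and>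
     \<not> (\<exists>x. tripotent tp x \<and> x \<noteq> 0 \<and> (\<forall>z. tp e x z = 0))"

section \<open>The symmetric Siegel domain\<close>

definition peirce_space :: "('z \<Rightarrow> 'z \<Rightarrow> 'z \<Rightarrow> 'z::real_vector) \<Rightarrow> 'z \<Rightarrow> real \<Rightarrow> 'z set" where
  "peirce_space tp e \<alpha> = {x. tp e e x = \<alpha> *\<^sub>R x}"

definition jts_E :: "('z \<Rightarrow> 'z \<Rightarrow> 'z \<Rightarrow> 'z::real_vector) \<Rightarrow> 'z \<Rightarrow> 'z set" where
  "jts_E tp e = peirce_space tp e (1/2)"

definition jts_F :: "('z \<Rightarrow> 'z \<Rightarrow> 'z \<Rightarrow> 'z::real_vector) \<Rightarrow> 'z \<Rightarrow> 'z set" where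
  "jts_F tp e = {x \<in> peirce_space tp e 1. tp e x e = x}"

definition jts_cone :: "('z \<Rightarrow> 'z \<Rightarrow> 'z \<Rightarrow> 'z::euclidean_space) \<Rightarrow> 'z \<Rightarrow> 'z set" where
  "jts_cone tp e = top_of_set (jts_F tp e) interior_of {tp x e x | x. x \<in> jts_F tp e}"

definition jts_Phi :: "('z \<Rightarrow> 'z \<Rightarrow> 'z \<Rightarrow> 'z::real_vector) \<Rightarrow> 'z \<Rightarrow> 'z \<Rightarrow> 'z \<Rightarrow> 'z" where
  "jts_Phi tp e \<zeta> \<zeta>' = 2 *\<^sub>R tp \<zeta> \<zeta>' e"

text \<open>A point \<open>(\<zeta>, z)\<close> of \<open>E \<times> F\<^sub>\<complex>\<close> with \<open>z = x + i y\<close> and \<open>x, y \<in> F\<close> is the vector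
  \<open>\<zeta> + (x + i y)\<close>.\<close>

definition siegel_domain ::
    "(complex \<Rightarrow> 'z \<Rightarrow> 'z) \<Rightarrow> ('z \<Rightarrow> 'z \<Rightarrow> 'z \<Rightarrow> 'z::euclidean_space) \<Rightarrow> 'z \<Rightarrow> 'z set" where
  "siegel_domain sc tp e =
     {\<zeta> + (x + sc \<i> y) | \<zeta> x y. \<zeta> \<in> jts_E tp e \<and> x \<in> jts_F tp e \<and> y \<in> jts_F tp e \<and>
        y - jts_Phi tp e \<zeta> \<zeta> \<in> jts_cone tp e}"

definition silov_boundary ::
    "(complex \<Rightarrow> 'z \<Rightarrow> 'z) \<Rightarrow> ('z \<Rightarrow> 'z \<Rightarrow> 'z \<Rightarrow> 'z::euclidean_space) \<Rightarrow> 'z \<Rightarrow> 'z set" where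
  "silov_boundary sc tp e =
     {\<zeta> + (x + sc \<i> y) | \<zeta> x y. \<zeta> \<in> jts_E tp e \<and> x \<in> jts_F tp e \<and> y \<in> jts_F tp e \<and>
        y - jts_Phi tp e \<zeta> \<zeta> = 0}"

definition orth_projector :: "'z::real_inner \<Rightarrow> 'z \<Rightarrow> 'z" where
  "orth_projector h x = x - ((x \<bullet> h) / (norm h)\<^sup>2) *\<^sub>R h"

section \<open>Pluriharmonic functions\<close>

definition vs_holomorphic_on ::
    "(complex \<Rightarrow> 'z \<Rightarrow> 'z) \<Rightarrow> ('z::real_normed_vector \<Rightarrow> complex) \<Rightarrow> 'z set \<Rightarrow> bool" where
  "vs_holomorphic_on sc G S \<longleftrightarrow>
     (\<forall>x\<in>S. \<exists>G'. (G has_derivative G') (at x) \<and> (\<forall>c v. G' (sc c v) = c * G' v))"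

definition pluriharmonic_on ::
    "(complex \<Rightarrow> 'z \<Rightarrow> 'z) \<Rightarrow> ('z::real_normed_vector \<Rightarrow> real) \<Rightarrow> 'z set \<Rightarrow> bool" where
  "pluriharmonic_on sc f S \<longleftrightarrow> (\<exists>G. vs_holomorphic_on sc G S \<and> (\<forall>x\<in>S. f x = Re (G x)))"

section \<open>Hausdorff measures\<close>

text \<open>The measures are normalised so that the \<open>k\<close>-dimensional one is Lebesgue measure on
  \<open>k\<close>-dimensional Euclidean spaces. In particular the one-dimensional measure on the line
  \<open>\<real> h\<close>, parametrised by \<open>t \<mapsto> t h\<close>, is \<open>|h| dt\<close>. This factor determines the constant in a
  Poisson formula \<open>f(p + w h) = c \<integral> Im w / |p + w h - x|\<^sup>2 d\<mu>\<^sub>p(x) + a Im w\<close> for a disintegration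
  relative to the Hausdorff measure of the projection: it must be \<open>c = |h| / \<pi>\<close>, and \<open>|h|\<^sup>2 / \<pi>\<close>
  is correct only for \<open>|h| = 1\<close> (take \<open>f = 1\<close> on the upper half-plane).\<close>

definition hausdorff_content :: "nat \<Rightarrow> real \<Rightarrow> 'a::metric_space set \<Rightarrow> ennreal" where
  "hausdorff_content k \<delta> A =
     (INF U\<in>{U :: nat \<Rightarrow> 'a set. A \<subseteq> (\<Union>i. U i) \<and> (\<forall>i. bounded (U i) \<and> diameter (U i) \<le> \<delta>)}.
        \<Sum>i. if U i = {} then 0 else ennreal (unit_ball_vol (real k) * (diameter (U i) / 2) ^ k))"

definition hausdorff_outer :: "nat \<Rightarrow> 'a::metric_space set \<Rightarrow> ennreal" where
  "hausdorff_outer k A = (SUP \<delta>\<in>{0<..}. hausdorff_content k \<delta> A)"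

definition hausdorff_measure :: "nat \<Rightarrow> 'a::metric_space measure" where
  "hausdorff_measure k = measure_of UNIV (sets borel) (hausdorff_outer k)"

section \<open>Radon measures, vague convergence and disintegrations\<close>

text \<open>Positive Radon measures on a subspace \<open>X\<close>. They are used only for locally compact \<open>X\<close> with
  countable base, where every locally finite Borel measure is regular.\<close>

definition radon_measure_on :: "'a::topological_space set \<Rightarrow> 'a measure \<Rightarrow> bool" where
  "radon_measure_on X M \<longleftrightarrow>
     sets M = sets (restrict_space borel X) \<and> (\<forall>K. compact K \<and> K \<subseteq> X \<longrightarrow> emeasure M K < \<infinity>)"

definition Cc :: "'a::topological_space set \<Rightarrow> ('a \<Rightarrow> complex) set" where
  "Cc X = {g. continuous_on X g \<and> (\<exists>K. compact K \<and> K \<subseteq> X \<and> (\<forall>x\<in>X - K. g x = 0))}"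

definition vague_limit ::
    "'a::topological_space set \<Rightarrow> ('b \<Rightarrow> 'a measure) \<Rightarrow> 'a measure \<Rightarrow> 'b filter \<Rightarrow> bool" where
  "vague_limit X M \<mu> F \<longleftrightarrow>
     (\<forall>\<^sub>F t in F. radon_measure_on X (M t)) \<and> radon_measure_on X \<mu> \<and>
     (\<forall>g\<in>Cc X. ((\<lambda>t. \<integral>x. g x \<partial>M t) \<longlongrightarrow> (\<integral>x. g x \<partial>\<mu>)) F)"

text \<open>\<open>M\<close>-negligible, \<open>M\<close>-measurable and \<open>M\<close>-integrable are meant with respect to the completion.\<close>

definition negligible_for :: "'a measure \<Rightarrow> 'a set \<Rightarrow> bool" where
  "negligible_for M N \<longleftrightarrow> N \<in> null_sets (completion M)"

definition weak_pseudo_image ::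
    "'a::topological_space set \<Rightarrow> 'b::topological_space set \<Rightarrow> 'a measure \<Rightarrow> 'b measure
      \<Rightarrow> ('a \<Rightarrow> 'b) \<Rightarrow> bool" where
  "weak_pseudo_image X Y \<mu> \<nu> p \<longleftrightarrow>
     radon_measure_on X \<mu> \<and> radon_measure_on Y \<nu> \<and> p \<in> completion \<mu> \<rightarrow>\<^sub>M \<nu> \<and>
     (\<forall>N\<subseteq>Y. negligible_for \<nu> N \<longrightarrow> negligible_for \<mu> (p -` N \<inter> X))"

definition pseudo_image ::
    "'a::topological_space set \<Rightarrow> 'b::topological_space set \<Rightarrow> 'a measure \<Rightarrow> 'b measure
      \<Rightarrow> ('a \<Rightarrow> 'b) \<Rightarrow> bool" where
  "pseudo_image X Y \<mu> \<nu> p \<longleftrightarrow>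
     radon_measure_on X \<mu> \<and> radon_measure_on Y \<nu> \<and> p \<in> completion \<mu> \<rightarrow>\<^sub>M \<nu> \<and>
     (\<forall>N\<subseteq>Y. negligible_for \<nu> N \<longleftrightarrow> negligible_for \<mu> (p -` N \<inter> X))"

definition disintegration ::
    "'a::topological_space set \<Rightarrow> 'b::topological_space set \<Rightarrow> 'a measure \<Rightarrow> 'b measure
      \<Rightarrow> ('a \<Rightarrow> 'b) \<Rightarrow> ('b \<Rightarrow> 'a measure) \<Rightarrow> bool" where
  "disintegration X Y \<mu> \<nu> p M \<longleftrightarrow>
     weak_pseudo_image X Y \<mu> \<nu> p \<and>
     (\<forall>y\<in>Y. radon_measure_on X (M y)) \<and>
     (AE y in \<nu>. negligible_for (M y) (X - p -` {y})) \<and>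
     (\<forall>g :: 'a \<Rightarrow> complex. integrable (completion \<mu>) g \<longrightarrow>
        (AE y in \<nu>. integrable (completion (M y)) g) \<and>
        integrable (completion \<nu>) (\<lambda>y. \<integral>x. g x \<partial>completion (M y)) \<and>
        (\<integral>x. g x \<partial>completion \<mu>) = (\<integral>y. (\<integral>x. g x \<partial>completion (M y)) \<partial>completion \<nu>))"

definition vaguely_continuous ::
    "'a::topological_space set \<Rightarrow> 'b::topological_space set \<Rightarrow> ('b \<Rightarrow> 'a measure) \<Rightarrow> bool" where
  "vaguely_continuous X Y M \<longleftrightarrow> (\<forall>g\<in>Cc X. continuous_on Y (\<lambda>y. \<integral>x. g x \<partial>M y))"

text \<open>The positive elements of \<open>\<M>\<^sub>P(\<real>, \<complex>\<^sub>+)\<close>; an element whose image under an injective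
  continuous proper map is a positive measure is itself positive.\<close>

definition MP :: "real measure set" where
  "MP = {\<nu>. radon_measure_on UNIV \<nu> \<and> integrable \<nu> (\<lambda>x. 1 / (1 + x\<^sup>2))}"

definition tightly_continuous_on :: "'b::topological_space set \<Rightarrow> ('b \<Rightarrow> real measure) \<Rightarrow> bool" where
  "tightly_continuous_on Y M \<longleftrightarrow>
     (\<forall>g :: real \<Rightarrow> complex.
        continuous_on UNIV g \<and> bounded (range (\<lambda>x. of_real (1 + x\<^sup>2) * g x)) \<longrightarrow>
        continuous_on Y (\<lambda>y. \<integral>x. g x \<partial>M y))"

section \<open>The measures on the boundary and on its projection\<close>

definition real_dim_boundary ::
    "(complex \<Rightarrow> 'z \<Rightarrow> 'z) \<Rightarrow> ('z \<Rightarrow> 'z \<Rightarrow> 'z \<Rightarrow> 'z::euclidean_space) \<Rightarrow> 'z \<Rightarrow> nat" where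
  "real_dim_boundary sc tp e = 2 * vector_space.dim sc (jts_E tp e) + dim (jts_F tp e)"

definition boundary_measure ::
    "(complex \<Rightarrow> 'z \<Rightarrow> 'z) \<Rightarrow> ('z \<Rightarrow> 'z \<Rightarrow> 'z \<Rightarrow> 'z::euclidean_space) \<Rightarrow> 'z \<Rightarrow> 'z measure" where
  "boundary_measure sc tp e =
     restrict_space (hausdorff_measure (real_dim_boundary sc tp e)) (silov_boundary sc tp e)"

text \<open>The subtraction does not truncate for \<open>e \<noteq> 0\<close>, because \<open>e \<in> F\<close>.\<close>

definition projected_measure ::
    "(complex \<Rightarrow> 'z \<Rightarrow> 'z) \<Rightarrow> ('z \<Rightarrow> 'z \<Rightarrow> 'z \<Rightarrow> 'z::euclidean_space) \<Rightarrow> 'z \<Rightarrow> 'z \<Rightarrow> 'z measure"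
  where
  "projected_measure sc tp e h =
     restrict_space (hausdorff_measure (real_dim_boundary sc tp e - 1))
       (orth_projector h ` silov_boundary sc tp e)"

end

theory Submission
  imports Defs "HOL-Complex_Analysis.Complex_Analysis" "HOL-Probability.Probability"
begin

text \<open>For \<open>p \<in> \<pi>\<^sub>h(b D)\<close> the complex line \<open>w \<mapsto> p + w h\<close> maps the upper half-plane into \<open>D\<close>, so the
  Herglotz theorem represents \<open>f(p + w h)\<close> by a measure \<open>\<mu>'\<^sub>p\<close> on the real line and a slope \<open>a\<^sub>p \<ge> 0\<close>.
  Harnack's inequality on discs of radius of order \<open>\<surd>y\<close> in the complex line through \<open>p + i y h\<close> and
  \<open>p' + i y h\<close>, for \<open>y \<rightarrow> \<infinity>\<close>, shows that \<open>a\<^sub>p\<close> does not depend on \<open>p\<close>. The measures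
  \<open>\<mu>'\<^sub>p\<close> depend continuously on \<open>p\<close>, and \<open>\<mu> = \<integral> \<mu>\<^sub>p d\<beta>\<^sub>h(p)\<close> is the vague limit by dominated
  convergence, because the Hausdorff measure of the boundary is the product of \<open>\<beta>\<^sub>h\<close> and of the length
  \<open>|h| dt\<close> along \<open>h\<close>. The boundary is a graph invariant under translation by \<open>h\<close>, and the product
  formula follows by comparison with the tangent planes. Finally \<open>\<mu>\<^sub>p = 0\<close> exactly if \<open>f(p + i h) = a\<close>;
  this is a real-analytic condition on \<open>p\<close>, so unless \<open>\<mu> = 0\<close> it holds only on a \<open>\<beta>\<^sub>h\<close>-null set.\<close>

section \<open>Poisson integrals in the disc and in the half-plane\<close>

text \<open>Tightness is the first concern. On the line through p the representing measure has the
  form pi |h| (1 + s^2) d tau_p with tau_p finite. Because the slope a is common to all lines, the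
  mass of tau_p is f(p + i h) - a, which is continuous in p; so no mass escapes to infinity as p
  varies, and vague continuity becomes tight continuity. The radius of order sqrt y arises because
  Im z - Phi(zeta) grows at most quadratically on complex lines while y h absorbs perturbations of
  order y; as it tends to infinity, the Harnack factor tends to 1. The second concern is that the
  product formula must hold with constant 1, so Hausdorff and Lebesgue measure have to agree exactly
  on subspaces. One inequality is isodiametric, by Steiner symmetrization; for the other,
  translation invariance makes the two measures proportional, and a partial filling of the cube by
  small balls bounds the ratio by 1. Finally, mu_p may have infinite mass, so mu is assembled from
  normalised kernels and the density is restored afterwards.\<close>

definition poisson_disc :: "complex \<Rightarrow> complex \<Rightarrow> real" where
  "poisson_disc \<xi> z = Re ((\<xi> + z) / (\<xi> - z))"

text \<open>The first term is the Cauchy kernel at z, the second a kernel whose pole is the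
  reflection of z in the unit circle. On the circle \<xi> and its conjugate are inverse to each
  other, which turns the sum into 1 + q + cnj q with q = z / (\<xi> - z), a real number.\<close>

lemma poisson_disc_eq:
  assumes "norm \<xi> = 1" "norm z < 1"
  shows "\<xi> * (1 / (\<xi> - z) + cnj z / (1 - cnj z * \<xi>)) = of_real (poisson_disc \<xi> z)"
proof -
  have ne: "\<xi> - z \<noteq> 0" using assms by auto
  have x1: "\<xi> * cnj \<xi> = 1" using assms by (simp add: complex_norm_square [symmetric])
  have ne': "cnj \<xi> - cnj z \<noteq> 0" using ne by (metis complex_cnj_diff complex_cnj_zero_iff)
  have "1 - cnj z * \<xi> = \<xi> * (cnj \<xi> - cnj z)" using x1 by (simp add: algebra_simps)
  moreover have "\<xi> \<noteq> 0" using assms by auto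
  ultimately have "\<xi> * (cnj z / (1 - cnj z * \<xi>)) = cnj (z / (\<xi> - z))" by simp
  moreover have "\<xi> * (1 / (\<xi> - z)) = 1 + z / (\<xi> - z)" using ne by (simp add: field_simps)
  ultimately have "\<xi> * (1 / (\<xi> - z) + cnj z / (1 - cnj z * \<xi>)) = 1 + (z / (\<xi> - z) + cnj (z / (\<xi> - z)))"
    by (simp add: algebra_simps)
  also have "\<dots> = of_real (1 + 2 * Re (z / (\<xi> - z)))" by (subst complex_add_cnj) simp
  also have "1 + 2 * Re (z / (\<xi> - z)) = Re (1 + 2 * (z / (\<xi> - z)))"
    by (simp only: plus_complex.sel times_complex.sel one_complex.sel) simp
  also have "1 + 2 * (z / (\<xi> - z)) = (\<xi> + z) / (\<xi> - z)" using ne by (simp add: field_simps)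
  finally show ?thesis by (simp add: poisson_disc_def)
qed

text \<open>The kernel equals (1 - |z|^2) / |\<xi> - z|^2, and the denominator is at most (1 +
  |z|)^2.\<close>

lemma poisson_disc_ge:
  assumes "norm \<xi> = 1" "norm z < 1"
  shows "(1 - norm z) / (1 + norm z) \<le> poisson_disc \<xi> z"
proof -
  have ne: "\<xi> - z \<noteq> 0" using assms by auto
  have pos: "0 < norm (\<xi> - z)" using ne by simp
  have le: "norm (\<xi> - z) \<le> 1 + norm z" using norm_triangle_ineq4[of \<xi> z] assms by simp
  have "poisson_disc \<xi> z = Re ((\<xi> + z) * cnj (\<xi> - z)) / (norm (\<xi> - z))\<^sup>2"
    unfolding poisson_disc_def by (subst complex_div_cnj) (simp only: Re_divide_of_real)
  also have "Re ((\<xi> + z) * cnj (\<xi> - z)) = (norm \<xi>)\<^sup>2 - (norm z)\<^sup>2"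
    by (simp only: cmod_power2) (simp add: power2_eq_square algebra_simps)
  also have "\<dots> = (1 - norm z) * (1 + norm z)"
    using assms by (simp add: power2_eq_square algebra_simps)
  finally have e: "poisson_disc \<xi> z = (1 - norm z) * (1 + norm z) / (norm (\<xi> - z))\<^sup>2" .
  have "(1 - norm z) / (1 + norm z) = (1 - norm z) * (1 + norm z) / (1 + norm z)\<^sup>2"
    by (simp add: power2_eq_square add_eq_0_iff)
  also have "\<dots> \<le> poisson_disc \<xi> z"
    unfolding e using pos le assms by (intro divide_left_mono power_mono mult_nonneg_nonneg mult_pos_pos) (auto simp: add_pos_nonneg)
  finally show ?thesis .
qed

text \<open>To the Cauchy integral of \<open>g\<close> at \<open>z\<close> one adds the integral of
  \<open>g\<close> against the kernel with the reflected pole, which vanishes because that pole lies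
  outside the closed disc. The resulting kernel is real, so real parts can later be taken under the
  integral.\<close>

lemma has_integral_poisson_disc:
  assumes cont: "continuous_on (cball 0 1) g" and hol: "g holomorphic_on ball 0 1"
    and z: "norm z < 1"
  shows "((\<lambda>t. g (cis (2 * pi * t)) * of_real (poisson_disc (cis (2 * pi * t)) z)) has_integral g z) {0..1}"
proof -
  have nz: "1 - cnj z * u \<noteq> 0" if "norm u \<le> 1" for u
  proof
    assume "1 - cnj z * u = 0"
    then have "norm (cnj z * u) = 1" by (simp add: algebra_simps)
    moreover have "norm (cnj z * u) \<le> norm z * 1"
      unfolding norm_mult complex_mod_cnj by (rule mult_left_mono) (use that in auto)
    ultimately show False using z by simp
  qed
  have 1: "((\<lambda>u. g u / (u - z)) has_contour_integral 2 * of_real pi * \<i> * g z) (circlepath 0 1)"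
    by (rule Cauchy_integral_circlepath[OF cont hol]) (use z in auto)
  have 2: "((\<lambda>u. g u * (cnj z / (1 - cnj z * u))) has_contour_integral 0) (circlepath 0 1)"
  proof (rule Cauchy_theorem_disc[of "{}" 0 1])
    show "continuous_on (cball 0 1) (\<lambda>u. g u * (cnj z / (1 - cnj z * u)))"
      by (intro continuous_intros cont) (use nz in auto)
    show "(\<lambda>u. g u * (cnj z / (1 - cnj z * u))) field_differentiable at x" if "x \<in> ball 0 1 - {}" for x
    proof -
      have "(\<lambda>u. g u * (cnj z / (1 - cnj z * u))) holomorphic_on ball 0 1"
        by (intro holomorphic_intros hol) (use nz in auto)
      then show ?thesis using that by (auto simp: holomorphic_on_open field_differentiable_def)
    qed
  qed auto
  have "((\<lambda>u. g u * (1 / (u - z) + cnj z / (1 - cnj z * u))) has_contour_integral 2 * of_real pi * \<i> * g z) (circlepath 0 1)"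
    using has_contour_integral_add[OF 1 2] by (simp add: algebra_simps)
  then have "((\<lambda>t. g (circlepath 0 1 t) * (1 / (circlepath 0 1 t - z) + cnj z / (1 - cnj z * circlepath 0 1 t))
       * vector_derivative (circlepath 0 1) (at t within {0..1})) has_integral 2 * of_real pi * \<i> * g z) {0..1}"
    unfolding has_contour_integral_def .
  then have I: "((\<lambda>t. (1 / (2 * of_real pi * \<i>)) * (g (circlepath 0 1 t) * (1 / (circlepath 0 1 t - z) + cnj z / (1 - cnj z * circlepath 0 1 t))
       * vector_derivative (circlepath 0 1) (at t within {0..1}))) has_integral (1 / (2 * of_real pi * \<i>)) * (2 * of_real pi * \<i> * g z)) {0..1}"
    by (rule has_integral_mult_right)
  have v: "(1 / (2 * of_real pi * \<i>)) * (2 * of_real pi * \<i> * g z) = g z" by simp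
  have "(1 / (2 * of_real pi * \<i>)) * (g (circlepath 0 1 t) * (1 / (circlepath 0 1 t - z) + cnj z / (1 - cnj z * circlepath 0 1 t))
       * vector_derivative (circlepath 0 1) (at t within {0..1}))
     = g (cis (2 * pi * t)) * of_real (poisson_disc (cis (2 * pi * t)) z)" if "t \<in> {0..1}" for t
  proof -
    have c: "circlepath 0 1 t = cis (2 * pi * t)"
      by (simp add: circlepath cis_conv_exp mult_ac)
    have v: "vector_derivative (circlepath 0 1) (at t within {0..1}) = 2 * of_real pi * \<i> * cis (2 * pi * t)"
      using that by (subst vector_derivative_circlepath01) (auto simp: cis_conv_exp mult_ac)
    show ?thesis
      unfolding c v by (subst poisson_disc_eq[symmetric]) (use z in \<open>simp_all add: field_simps\<close>)
  qed
  from has_integral_eq[OF this I] show ?thesis unfolding v .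
qed

lemma continuous_poisson_disc_cis:
  assumes "norm z < 1"
  shows "continuous_on UNIV (\<lambda>t. poisson_disc (cis (2 * pi * t)) z)"
proof -
  have "cis (2 * pi * t) - z \<noteq> 0" for t using assms by (metis norm_cis eq_iff_diff_eq_0 less_irrefl)
  then show ?thesis unfolding poisson_disc_def
    by (intro continuous_intros) auto
qed

lemma poisson_disc_bound:
  assumes "norm \<xi> = 1" "norm z < 1"
  shows "\<bar>poisson_disc \<xi> z\<bar> \<le> 2 / (1 - norm z)"
proof -
  have "1 - norm z \<le> norm (\<xi> - z)" using norm_triangle_ineq2[of \<xi> z] assms by simp
  moreover have "norm (\<xi> + z) \<le> 2" using norm_triangle_ineq[of \<xi> z] assms by simp
  ultimately have "norm ((\<xi> + z) / (\<xi> - z)) \<le> 2 / (1 - norm z)"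
    unfolding norm_divide using assms by (intro frac_le) auto
  then show ?thesis unfolding poisson_disc_def using abs_Re_le_cmod order_trans by blast
qed

text \<open>By the mean value property, the boundary values of Re G on the circle of radius r < 1,
  divided by Re (G 0), are densities of probability measures. Parametrising the circle by
  \<open>t\<close> in [0,1] makes them measures on the real line with a common compact support, so a
  subsequence converges weakly as r tends to 1 and the Poisson formula passes to the limit.\<close>

proposition herglotz_disc:
  assumes hol: "G holomorphic_on ball 0 1" and nn: "\<And>z. norm z < 1 \<Longrightarrow> 0 \<le> Re (G z)"
  obtains M where "real_distribution M"
    "\<And>z. norm z < 1 \<Longrightarrow> Re (G z) = Re (G 0) * (\<integral>t. poisson_disc (cis (2 * pi * t)) z \<partial>M)"
proof -
  define U where "U r t = Re (G (of_real r * cis (2 * pi * t)))" for r t :: real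
  have contG: "continuous_on (ball 0 1) G" using hol by (rule holomorphic_on_imp_continuous_on)
  have U_nn: "0 \<le> U r t" if "0 \<le> r" "r < 1" for r t
    unfolding U_def using that by (intro nn) (simp add: norm_mult)
  have U_cont: "continuous_on UNIV (U r)" if "0 \<le> r" "r < 1" for r
    unfolding U_def
    by (intro continuous_intros continuous_on_compose2[OF contG]) (use that in \<open>auto simp: norm_mult\<close>)
  have P: "((\<lambda>t. U r t * poisson_disc (cis (2 * pi * t)) z) has_integral Re (G (of_real r * z))) {0..1}"
    if "0 \<le> r" "r < 1" "norm z < 1" for r z
  proof -
    have *: "norm (of_real r * w) < 1" if "norm w \<le> 1" for w :: complex
      using that \<open>0 \<le> r\<close> \<open>r < 1\<close> by (simp add: norm_mult) (metis mult_left_le le_less_trans)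
    have "((\<lambda>t. G (of_real r * cis (2 * pi * t)) * of_real (poisson_disc (cis (2 * pi * t)) z)) has_integral G (of_real r * z)) {0..1}"
    proof (rule has_integral_poisson_disc[of "\<lambda>w. G (of_real r * w)"])
      show "continuous_on (cball 0 1) (\<lambda>w. G (of_real r * w))"
        by (intro continuous_on_compose2[OF contG] continuous_intros) (use * in auto)
      show "(\<lambda>w. G (of_real r * w)) holomorphic_on ball 0 1"
        by (intro holomorphic_on_compose_gen[OF _ hol, unfolded o_def] holomorphic_intros) (use * in auto)
    qed fact
    from has_integral_Re[OF this] show ?thesis by (simp add: U_def)
  qed
  have P0: "((\<lambda>t. U r t) has_integral Re (G 0)) {0..1}" if "0 \<le> r" "r < 1" for r
    using P[OF that, of 0] by (simp add: poisson_disc_def)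
  show ?thesis
  proof (cases "Re (G 0) = 0")
    \<comment> \<open>The normalisation by Re (G 0) is impossible here. Nonnegative continuous
      boundary values with integral 0 vanish, hence so does Re G, and any probability measure
      serves.\<close>
    case True
    have "Re (G z) = 0" if z: "norm z < 1" for z
    proof -
      obtain r where r: "norm z < r" "r < 1" using dense[OF z] by blast
      have r0: "0 \<le> r" "0 < r" using r norm_ge_zero[of z] by linarith+
      have U0: "U r t = 0" if "t \<in> {0..1}" for t
        by (rule has_integral_0_cbox_imp_0[of 0 1 "U r"])
          (use P0[of r] True r r0 U_nn that in \<open>auto intro: continuous_on_subset[OF U_cont]\<close>)
      have "((\<lambda>t. U r t * poisson_disc (cis (2 * pi * t)) (z / of_real r)) has_integral Re (G z)) {0..1}"
        using P[of r "z / of_real r"] r r0 by (simp add: norm_divide)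
      moreover have "((\<lambda>t. U r t * poisson_disc (cis (2 * pi * t)) (z / of_real r)) has_integral 0) {0..1}"
        by (rule has_integral_is_0) (use U0 in auto)
      ultimately show ?thesis by (rule has_integral_unique)
    qed
    moreover have "real_distribution (return borel (0::real))"
      unfolding real_distribution_def real_distribution_axioms_def by (simp add: prob_space_return)
    ultimately show ?thesis using that[of "return borel 0"] True by simp
  next
    case False
    define c where "c = Re (G 0)"
    have c: "c > 0" using nn[of 0] False by (simp add: c_def)
    define rr where "rr n = 1 - 1 / (real n + 2)" for n
    have rr: "0 \<le> rr n" "rr n < 1" for n by (auto simp: rr_def field_simps)
    define D where "D n = density lborel (\<lambda>t. ennreal (indicator {0..1} t * U (rr n) t / c))" for n
    have meas [measurable]: "U (rr n) \<in> borel_measurable borel" for n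
      using U_cont[OF rr] by (rule borel_measurable_continuous_onI)
    have int: "integrable lborel (\<lambda>t. indicator {0..1} t *\<^sub>R (U (rr n) t * f t))"
      "(\<integral>t. indicator {0..1} t *\<^sub>R (U (rr n) t * f t) \<partial>lborel) = integral {0..1} (\<lambda>t. U (rr n) t * f t)"
      if "continuous_on UNIV f" for n and f :: "real \<Rightarrow> real"
    proof -
      have cc: "continuous_on {0..1} (\<lambda>t. U (rr n) t * f t)"
        using continuous_on_mult[OF U_cont[OF rr] that] continuous_on_subset by blast
      show 1: "integrable lborel (\<lambda>t. indicator {0..1} t *\<^sub>R (U (rr n) t * f t))"
        by (rule borel_integrable_compact[OF _ cc]) auto
      show "(\<integral>t. indicator {0..1} t *\<^sub>R (U (rr n) t * f t) \<partial>lborel) = integral {0..1} (\<lambda>t. U (rr n) t * f t)"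
        using set_borel_integral_eq_integral(2)[of "{0..1}" "\<lambda>t. U (rr n) t * f t"] 1
        unfolding set_lebesgue_integral_def set_integrable_def by simp
    qed
    have nnD: "AE t in lborel. 0 \<le> indicator {0..1} t * U (rr n) t / c" for n
      using U_nn[OF rr] c by auto
    have Dint: "(\<integral>t. f t \<partial>D n) = integral {0..1} (\<lambda>t. U (rr n) t * f t) / c"
      if "continuous_on UNIV f" for n f
    proof -
      have [measurable]: "f \<in> borel_measurable borel" using that by (rule borel_measurable_continuous_onI)
      have "(\<integral>t. f t \<partial>D n) = (\<integral>t. (indicator {0..1} t * U (rr n) t / c) *\<^sub>R f t \<partial>lborel)"
        unfolding D_def by (rule integral_density) (use nnD in auto)
      also have "\<dots> = (\<integral>t. (indicator {0..1} t *\<^sub>R (U (rr n) t * f t)) / c \<partial>lborel)"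
        by (simp add: field_simps)
      finally show ?thesis using int(2)[OF that] by simp
    qed
    have Dmass: "emeasure (D n) A = 1" if "{0..1} \<subseteq> A" "A \<in> sets borel" for n A
    proof -
      have "emeasure (D n) A = (\<integral>\<^sup>+t. ennreal (indicator {0..1} t * U (rr n) t / c) * indicator A t \<partial>lborel)"
        unfolding D_def using that by (subst emeasure_density) auto
      also have "\<dots> = (\<integral>\<^sup>+t. ennreal ((indicator {0..1} t *\<^sub>R (U (rr n) t * 1)) / c) \<partial>lborel)"
        using that by (intro nn_integral_cong) (auto simp: indicator_def)
      also have "\<dots> = ennreal (\<integral>t. (indicator {0..1} t *\<^sub>R (U (rr n) t * 1)) / c \<partial>lborel)"
        by (rule nn_integral_eq_integral) (use int(1)[of "\<lambda>_. 1"] U_nn[OF rr] c in \<open>auto\<close>)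
      also have "(\<integral>t. (indicator {0..1} t *\<^sub>R (U (rr n) t * 1)) / c \<partial>lborel) = integral {0..1} (U (rr n)) / c"
        using int(2)[of "\<lambda>_. 1"] by simp
      also have "integral {0..1} (U (rr n)) = c"
        using P0[OF rr] by (simp add: integral_unique c_def)
      finally show ?thesis using c by simp
    qed
    have rd: "real_distribution (D n)" for n
      unfolding real_distribution_def real_distribution_axioms_def
    proof (intro conjI prob_spaceI)
      show "emeasure (D n) (space (D n)) = 1" using Dmass[of UNIV n] by (simp add: D_def)
    qed (simp_all add: D_def)
    have "tight D"
      unfolding tight_def
    proof (intro conjI allI impI rd)
      fix e :: real assume "0 < e"
      \<comment> \<open>Tightness is phrased with intervals open on the left, and the support
        contains 0; hence the left end -1.\<close>
      have "measure (D n) {-1<..1} = 1" for n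
        using Dmass[of "{-1<..1}" n] by (simp add: measure_def subset_iff)
      then show "\<exists>a b. a < b \<and> (\<forall>n. 1 - e < measure (D n) {a<..b})"
        using \<open>0 < e\<close> by (intro exI[of _ "-1"] exI[of _ 1]) auto
    qed
    then obtain s M where s: "strict_mono s" and M: "real_distribution M" and w: "weak_conv_m (D \<circ> id \<circ> s) M"
      using tight_imp_convergent_subsubsequence[of D id] strict_mono_id by blast
    have "Re (G z) = Re (G 0) * (\<integral>t. poisson_disc (cis (2 * pi * t)) z \<partial>M)" if z: "norm z < 1" for z
    proof -
      let ?f = "\<lambda>t. poisson_disc (cis (2 * pi * t)) z"
      have cf: "continuous_on UNIV ?f" by (rule continuous_poisson_disc_cis[OF z])
      have l1: "(\<lambda>n. integral\<^sup>L ((D \<circ> id \<circ> s) n) ?f) \<longlonglongrightarrow> integral\<^sup>L M ?f"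
      proof (rule weak_conv_imp_integral_bdd_continuous_conv[OF _ M w])
        show "real_distribution ((D \<circ> id \<circ> s) n)" for n using rd by simp
        show "isCont ?f t" for t using cf by (simp add: continuous_on_eq_continuous_at)
        show "norm (?f t) \<le> 2 / (1 - norm z)" for t using poisson_disc_bound[OF _ z] by simp
      qed
      have l2: "integral\<^sup>L ((D \<circ> id \<circ> s) n) ?f = Re (G (of_real (rr (s n)) * z)) / c" for n
        using Dint[OF cf, of "s n"] integral_unique[OF P[OF rr z, of "s n"]] by simp
      have l3: "(\<lambda>n. Re (G (of_real (rr (s n)) * z)) / c) \<longlonglongrightarrow> Re (G (of_real 1 * z)) / c"
      proof -
        have "(\<lambda>n. rr n) \<longlonglongrightarrow> 1" unfolding rr_def by real_asymp
        then have "(\<lambda>n. rr (s n)) \<longlonglongrightarrow> 1" using s by (rule LIMSEQ_subseq_LIMSEQ[unfolded o_def])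
        moreover have "isCont G (of_real 1 * z)"
          using contG z by (simp add: continuous_on_eq_continuous_at)
        ultimately show ?thesis
          by (intro tendsto_intros isCont_tendsto_compose[where g = G]) (use c in auto)
      qed
      have "integral\<^sup>L M ?f = Re (G z) / c"
        using LIMSEQ_unique[OF l1[unfolded l2] l3] by simp
      then show ?thesis using c by (simp add: c_def)
    qed
    then show ?thesis using that[OF M] by blast
  qed
qed

text \<open>After scaling by \<open>R\<close>, the lower bound of the Poisson kernel is integrated
  against the Herglotz probability measure.\<close>

lemma harnack_disc:
  assumes hol: "G holomorphic_on ball 0 R" and nn: "\<And>z. norm z < R \<Longrightarrow> 0 \<le> Re (G z)" and z: "norm z < R"
  shows "(R - norm z) / (R + norm z) * Re (G 0) \<le> Re (G z)"
proof -
  have R: "R > 0" using z norm_ge_zero[of z] by linarith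
  have *: "norm (of_real R * w) < R" if "norm w < 1" for w :: complex
    using that R by (simp add: norm_mult)
  obtain M where M: "real_distribution M"
    "\<And>w. norm w < 1 \<Longrightarrow> Re (G (of_real R * w)) = Re (G (of_real R * 0)) * (\<integral>t. poisson_disc (cis (2 * pi * t)) w \<partial>M)"
  proof (rule herglotz_disc[of "\<lambda>w. G (of_real R * w)"])
    show "(\<lambda>w. G (of_real R * w)) holomorphic_on ball 0 1"
      by (intro holomorphic_on_compose_gen[OF _ hol, unfolded o_def] holomorphic_intros) (use * in auto)
    show "0 \<le> Re (G (of_real R * w))" if "norm w < 1" for w using nn *[OF that] by blast
  qed blast
  interpret real_distribution M by fact
  define w where "w = z / of_real R"
  have w: "norm w < 1" using z R by (simp add: w_def norm_divide)
  have "(1 - norm w) / (1 + norm w) = (\<integral>t. (1 - norm w) / (1 + norm w) \<partial>M)"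
    using prob_space by simp
  also have "\<dots> \<le> (\<integral>t. poisson_disc (cis (2 * pi * t)) w \<partial>M)"
  proof (rule integral_mono)
    have [measurable]: "(\<lambda>t. poisson_disc (cis (2 * pi * t)) w) \<in> borel_measurable borel"
      using continuous_poisson_disc_cis[OF w] by (rule borel_measurable_continuous_onI)
    show "integrable M (\<lambda>t. poisson_disc (cis (2 * pi * t)) w)"
      by (rule integrable_const_bound[of _ "2 / (1 - norm w)"]) (use poisson_disc_bound[OF _ w] in auto)
  qed (use poisson_disc_ge[OF _ w] in auto)
  finally have "(1 - norm w) / (1 + norm w) * Re (G 0) \<le> Re (G 0) * (\<integral>t. poisson_disc (cis (2 * pi * t)) w \<partial>M)"
    using nn[of 0] R unfolding mult.commute[of "Re (G 0)"] by (intro mult_right_mono) auto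
  moreover have "(1 - norm w) / (1 + norm w) = (R - norm z) / (R + norm z)"
  proof -
    have "1 - norm w = (R - norm z) / R" "1 + norm w = (R + norm z) / R"
      using R by (simp_all add: w_def norm_divide diff_divide_distrib add_divide_distrib)
    then show ?thesis using R by simp
  qed
  moreover have "of_real R * w = z" using R by (simp add: w_def)
  ultimately show ?thesis using M(2)[OF w] by simp
qed

section \<open>The Herglotz representation in the upper half-plane\<close>

definition poisson_half :: "complex \<Rightarrow> real \<Rightarrow> real" where
  "poisson_half w s = Im w / (norm (w - of_real s))\<^sup>2"

lemma poisson_half_altdef: "poisson_half w s = Im w / ((Re w - s)\<^sup>2 + (Im w)\<^sup>2)"
  by (simp add: poisson_half_def cmod_power2)

lemma poisson_half_nonneg: "0 < Im w \<Longrightarrow> 0 \<le> poisson_half w s"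
  by (simp add: poisson_half_def)

text \<open>The Cayley transform carries the Poisson kernel of the disc at a boundary point \<open>\<noteq> 1\<close> to that
  of the half-plane, up to the factor \<open>1 + s\<^sup>2\<close>; the boundary point \<open>1\<close> gives the linear term.\<close>

lemma poisson_disc_cayley:
  assumes "Im w > 0"
  shows "poisson_disc 1 ((w - \<i>) / (w + \<i>)) = Im w"
    and "poisson_disc ((of_real s - \<i>) / (of_real s + \<i>)) ((w - \<i>) / (w + \<i>)) = (1 + s\<^sup>2) * poisson_half w s"
proof -
  have w: "w + \<i> \<noteq> 0" using assms by (auto simp: complex_eq_iff)
  have s: "of_real s + \<i> \<noteq> 0" by (auto simp: complex_eq_iff)
  have ws: "w - of_real s \<noteq> 0" using assms by (auto simp: complex_eq_iff)
  have "1 + (w - \<i>) / (w + \<i>) = 2 * w / (w + \<i>)" "1 - (w - \<i>) / (w + \<i>) = 2 * \<i> / (w + \<i>)"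
    using w by (simp_all add: field_simps)
  then have "(1 + (w - \<i>) / (w + \<i>)) / (1 - (w - \<i>) / (w + \<i>)) = w / \<i>"
    using w by simp
  then show "poisson_disc 1 ((w - \<i>) / (w + \<i>)) = Im w" by (simp add: poisson_disc_def)
  have n: "(of_real s - \<i>) / (of_real s + \<i>) + (w - \<i>) / (w + \<i>) = 2 * (of_real s * w + 1) / ((of_real s + \<i>) * (w + \<i>))"
    unfolding add_frac_eq[OF s w] by (simp add: algebra_simps)
  have dd: "(of_real s - \<i>) / (of_real s + \<i>) - (w - \<i>) / (w + \<i>) = 2 * (\<i> * (of_real s - w)) / ((of_real s + \<i>) * (w + \<i>))"
    unfolding diff_frac_eq[OF s w] by (simp add: algebra_simps)
  define d where "d = w - of_real s"
  have d0: "d \<noteq> 0" using ws by (simp add: d_def)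
  have cancel: "2 * a / c / (2 * b / c) = a / b" if "c \<noteq> 0" for a b c :: complex
    using that by (simp add: divide_divide_eq_left mult.commute[of c])
  have prod0: "(of_real s + \<i>) * (w + \<i>) \<noteq> 0" using w s by simp
  have split: "(s' * d + b) / (- \<i> * d) = \<i> * s' + b * (\<i> / d)" for s' b
  proof -
    have "\<i> * s' + b * (\<i> / d) = (\<i> * s' * d + \<i> * b) / d" using d0 by (simp add: add_divide_distrib)
    also have "\<dots> = (- \<i>) * (\<i> * s' * d + \<i> * b) / (- \<i> * d)" using d0 by simp
    also have "(- \<i>) * (\<i> * s' * d + \<i> * b) = s' * d + b" by (simp add: distrib_left mult.assoc)
    finally show ?thesis by simp
  qed
  have e1: "of_real s * w + 1 = of_real s * d + of_real (1 + s\<^sup>2)"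
    by (simp add: d_def algebra_simps power2_eq_square)
  have e2: "\<i> * (of_real s - w) = - \<i> * d" by (simp add: d_def algebra_simps)
  have "poisson_disc ((of_real s - \<i>) / (of_real s + \<i>)) ((w - \<i>) / (w + \<i>))
     = Re ((of_real s * w + 1) / (\<i> * (of_real s - w)))"
    unfolding poisson_disc_def n dd cancel[OF prod0] ..
  also have "\<dots> = Re (\<i> * of_real s + of_real (1 + s\<^sup>2) * (\<i> / d))"
    unfolding e1 e2 split ..
  also have "\<dots> = (1 + s\<^sup>2) * Re (\<i> / d)"
  proof -
    have "Re (\<i> * of_real x + of_real b * q) = b * Re q" for x b :: real and q by simp
    then show ?thesis by blast
  qed
  also have "\<i> / d = (\<i> * cnj d) / of_real ((norm d)\<^sup>2)"
    by (rule complex_div_cnj)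
  also have "Re \<dots> = poisson_half w s"
    unfolding poisson_half_def Re_divide_of_real by (simp add: d_def)
  finally show "poisson_disc ((of_real s - \<i>) / (of_real s + \<i>)) ((w - \<i>) / (w + \<i>)) = (1 + s\<^sup>2) * poisson_half w s" .
qed

text \<open>The kernel decays like s^-2, so after multiplication by 1 + s^2 it stays bounded in s
  and every finite measure integrates it. With x = Re w, y = Im w and p = (x - s)^2 + y^2 the bound
  comes from s^2 \<le> 2 x^2 + 2 p and y^2 \<le> p.\<close>

lemma poisson_half_weighted_le:
  assumes "Im w > 0"
  shows "(1 + s\<^sup>2) * poisson_half w s \<le> 2 * Im w + (1 + 2 * (Re w)\<^sup>2) / Im w"
proof -
  define x y p where "x = Re w" and "y = Im w" and "p = (x - s)\<^sup>2 + y\<^sup>2"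
  have y: "y > 0" using assms by (simp add: y_def)
  have p: "p > 0" "y\<^sup>2 \<le> p" "(x - s)\<^sup>2 \<le> p" using y by (simp_all add: add_nonneg_pos p_def)
  have "s\<^sup>2 \<le> 2 * x\<^sup>2 + 2 * (x - s)\<^sup>2"
    using zero_le_power2[of "2 * x - s"] by (simp add: power2_eq_square algebra_simps)
  then have "(1 + s\<^sup>2) * y \<le> (2 * p + (1 + 2 * x\<^sup>2)) * y"
    using p y by (intro mult_right_mono) auto
  also have "\<dots> = 2 * p * y + (1 + 2 * x\<^sup>2) / y * y\<^sup>2" using y by (simp add: field_simps power2_eq_square)
  also have "\<dots> \<le> 2 * p * y + (1 + 2 * x\<^sup>2) / y * p"
    using p y by (intro add_left_mono mult_left_mono) auto
  finally have "(1 + s\<^sup>2) * y \<le> (2 * y + (1 + 2 * x\<^sup>2) / y) * p" by (simp add: algebra_simps)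
  then have "(1 + s\<^sup>2) * y / p \<le> 2 * y + (1 + 2 * x\<^sup>2) / y" using p by (simp add: pos_divide_le_eq)
  then show ?thesis by (simp add: poisson_half_altdef x_def y_def p_def)
qed

lemma measurable_poisson_half [measurable]: "poisson_half w \<in> borel_measurable borel"
  unfolding poisson_half_def by measurable

lemma integrable_poisson_half_weighted:
  assumes "finite_measure \<tau>" "sets \<tau> = sets borel" "Im w > 0"
  shows "integrable \<tau> (\<lambda>s. (1 + s\<^sup>2) * poisson_half w s)"
proof -
  interpret finite_measure \<tau> by fact
  have [measurable_cong]: "sets \<tau> = sets borel" by fact
  show ?thesis
    by (rule integrable_const_bound[of _ "2 * Im w + (1 + 2 * (Re w)\<^sup>2) / Im w"])
      (use poisson_half_weighted_le[OF assms(3)] poisson_half_nonneg[OF assms(3)] in auto)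
qed

text \<open>The representation in the disc is transported by the Cayley transform. The boundary
  point 1 corresponds to infinity: the mass sitting there becomes the slope \<open>a\<close>, and
  the remaining mass, moved to the real line, becomes \<open>\<tau>\<close>. The weight 1 + s^2 is
  left in the integrand so that \<open>\<tau>\<close> is finite.\<close>

proposition herglotz_half:
  assumes hol: "G holomorphic_on {w. 0 < Im w}" and nn: "\<And>w. 0 < Im w \<Longrightarrow> 0 \<le> Re (G w)"
  shows "\<exists>a \<tau>. 0 \<le> a \<and> finite_measure \<tau> \<and> sets \<tau> = sets (borel :: real measure) \<and>
    (\<forall>w. 0 < Im w \<longrightarrow> Re (G w) = a * Im w + (\<integral>s. (1 + s\<^sup>2) * poisson_half w s \<partial>\<tau>))"
proof -
  define C where "C z = \<i> * (1 + z) / (1 - z)" for z :: complex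
  have ImC: "Im (C z) = (1 - (norm z)\<^sup>2) / (norm (1 - z))\<^sup>2" for z
  proof -
    have "C z = \<i> * ((1 + z) * cnj (1 - z)) / of_real ((norm (1 - z))\<^sup>2)"
      unfolding C_def by (subst complex_div_cnj) (simp add: mult.assoc)
    then have "Im (C z) = Re ((1 + z) * cnj (1 - z)) / (norm (1 - z))\<^sup>2"
      by (simp only: Im_divide_of_real) simp
    also have "Re ((1 + z) * cnj (1 - z)) = 1 - (norm z)\<^sup>2"
      by (simp only: cmod_power2) (simp add: power2_eq_square algebra_simps)
    finally show ?thesis .
  qed
  have Cpos: "0 < Im (C z)" if "norm z < 1" for z
  proof -
    have "z \<noteq> 1" using that by auto
    then show ?thesis unfolding ImC using that by (auto intro!: divide_pos_pos simp: abs_square_less_1)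
  qed
  obtain M where M: "real_distribution M"
    "\<And>z. norm z < 1 \<Longrightarrow> Re (G (C z)) = Re (G (C 0)) * (\<integral>t. poisson_disc (cis (2 * pi * t)) z \<partial>M)"
  proof (rule herglotz_disc[of "\<lambda>z. G (C z)"])
    show "(\<lambda>z. G (C z)) holomorphic_on ball 0 1"
    proof (rule holomorphic_on_compose_gen[OF _ hol, unfolded o_def])
      show "C holomorphic_on ball 0 1" unfolding C_def by (intro holomorphic_intros) auto
    qed (use Cpos in auto)
    show "0 \<le> Re (G (C z))" if "norm z < 1" for z using nn Cpos[OF that] by blast
  qed blast
  interpret real_distribution M by fact
  define c where "c = Re (G \<i>)"
  have c0: "Re (G (C 0)) = c" by (simp add: c_def C_def)
  have c: "0 \<le> c" unfolding c_def by (rule nn) simp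
  define X where "X t = cis (2 * pi * t)" for t :: real
  have X [measurable]: "X \<in> borel_measurable borel"
    unfolding X_def by (intro borel_measurable_continuous_onI continuous_intros)
  \<comment> \<open>At points with \<open>X t = 1\<close> the division by zero makes
    \<open>S t\<close> equal to 0; these points receive density 0 in the definition of
    \<open>\<tau>\<close>.\<close>
  define S where "S t = Re (C (X t))" for t
  have S [measurable]: "S \<in> borel_measurable borel"
    unfolding S_def C_def by measurable
  define \<tau> where "\<tau> = distr (density M (\<lambda>t. ennreal (c * indicator {t. X t \<noteq> 1} t))) borel S"
  have Xs: "X t = (of_real (S t) - \<i>) / (of_real (S t) + \<i>)" if "X t \<noteq> 1" for t
  proof -
    have "Im (C (X t)) = 0" by (simp add: ImC X_def)
    then have e: "of_real (S t) = C (X t)" by (simp add: S_def complex_eq_iff)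
    have "C (X t) + \<i> = 2 * \<i> / (1 - X t)" "C (X t) - \<i> = 2 * \<i> * X t / (1 - X t)"
      using that by (simp_all add: C_def field_simps)
    then show ?thesis unfolding e using that by simp
  qed
  have fin: "finite_measure \<tau>"
  proof (rule finite_measureI)
    have "emeasure \<tau> (space \<tau>) = (\<integral>\<^sup>+t. ennreal (c * indicator {t. X t \<noteq> 1} t) \<partial>M)"
      unfolding \<tau>_def by (simp add: emeasure_distr emeasure_density)
    also have "\<dots> \<le> (\<integral>\<^sup>+t. ennreal c \<partial>M)"
      by (intro nn_integral_mono ennreal_leI) (use c in \<open>auto simp: indicator_def\<close>)
    also have "\<dots> < \<infinity>" using emeasure_space_1 by (simp add: ennreal_mult_less_top)
    finally show "emeasure \<tau> (space \<tau>) \<noteq> \<infinity>" by simp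
  qed
  have st: "sets \<tau> = sets borel" by (simp add: \<tau>_def)
  define a where "a = c * measure M {t. X t = 1}"
  have main: "Re (G w) = a * Im w + (\<integral>s. (1 + s\<^sup>2) * poisson_half w s \<partial>\<tau>)" if w: "0 < Im w" for w
  proof -
    define z where "z = (w - \<i>) / (w + \<i>)"
    have wi: "w + \<i> \<noteq> 0" using w by (auto simp: complex_eq_iff)
    have "(norm (w - \<i>))\<^sup>2 < (norm (w + \<i>))\<^sup>2"
      using w unfolding cmod_power2 by (simp add: power2_eq_square algebra_simps)
    then have "norm (w - \<i>) < norm (w + \<i>)" using power2_less_imp_less norm_ge_zero by blast
    then have z: "norm z < 1" using wi by (simp add: z_def norm_divide)
    have Cz: "C z = w"
    proof -
      have "1 + z = 2 * w / (w + \<i>)" "1 - z = 2 * \<i> / (w + \<i>)"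
        using wi by (simp_all add: z_def field_simps)
      then show ?thesis using wi by (simp add: C_def)
    qed
    let ?K = "\<lambda>s. (1 + s\<^sup>2) * poisson_half w s"
    have K: "poisson_disc (X t) z = indicator {t. X t = 1} t * Im w + indicator {t. X t \<noteq> 1} t * ?K (S t)" for t
      using poisson_disc_cayley(1)[OF w] poisson_disc_cayley(2)[OF w, of "S t"] Xs[of t]
      by (cases "X t = 1") (simp_all add: z_def)
    have i1: "integrable M (\<lambda>t. indicator {t. X t = 1} t * Im w)"
      by (rule integrable_const_bound[of _ "Im w"]) (use w in \<open>auto simp: indicator_def\<close>)
    have i2: "integrable M (\<lambda>t. indicator {t. X t \<noteq> 1} t * ?K (S t))"
      by (rule integrable_const_bound[of _ "2 * Im w + (1 + 2 * (Re w)\<^sup>2) / Im w"])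
        (use poisson_half_weighted_le[OF w] poisson_half_nonneg[OF w] w in \<open>auto simp: indicator_def\<close>)
    have "(\<integral>s. ?K s \<partial>\<tau>) = (\<integral>t. ?K (S t) \<partial>density M (\<lambda>t. ennreal (c * indicator {t. X t \<noteq> 1} t)))"
      unfolding \<tau>_def by (rule integral_distr) measurable
    also have "\<dots> = (\<integral>t. (c * indicator {t. X t \<noteq> 1} t) *\<^sub>R ?K (S t) \<partial>M)"
      by (rule integral_density) (use c in auto)
    also have "\<dots> = c * (\<integral>t. indicator {t. X t \<noteq> 1} t * ?K (S t) \<partial>M)"
      by (simp add: mult.assoc)
    finally have t: "(\<integral>s. ?K s \<partial>\<tau>) = c * (\<integral>t. indicator {t. X t \<noteq> 1} t * ?K (S t) \<partial>M)" .
    have "Re (G w) = c * (\<integral>t. poisson_disc (X t) z \<partial>M)"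
      using M(2)[OF z] Cz c0 by (simp add: X_def)
    also have "\<dots> = c * ((\<integral>t. indicator {t. X t = 1} t * Im w \<partial>M) + (\<integral>t. indicator {t. X t \<noteq> 1} t * ?K (S t) \<partial>M))"
      unfolding K by (subst Bochner_Integration.integral_add[OF i1 i2]) simp
    also have "(\<integral>t. indicator {t. X t = 1} t * Im w \<partial>M) = measure M {t. X t = 1} * Im w" by simp
    finally show ?thesis unfolding t a_def by (simp add: algebra_simps)
  qed
  show ?thesis
    by (rule exI[of _ a], rule exI[of _ \<tau>]) (use fin st main c in \<open>auto simp: a_def\<close>)
qed

text \<open>On the imaginary axis the weighted kernel divided by y is (1 + s^2) / (s^2 + y^2), which
  is at most 1 for y \<ge> 1 and tends to 0. This expresses \<open>a\<close> through
  \<open>u\<close> alone, and in this form the slopes of different lines can be compared.\<close>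

lemma herglotz_half_slope:
  assumes fin: "finite_measure \<tau>" and st: "sets \<tau> = sets borel"
    and rep: "\<And>w. 0 < Im w \<Longrightarrow> u w = a * Im w + (\<integral>s. (1 + s\<^sup>2) * poisson_half w s \<partial>\<tau>)"
  shows "((\<lambda>y. u (\<i> * of_real y) / y) \<longlongrightarrow> a) at_top"
proof -
  interpret finite_measure \<tau> by fact
  have [measurable_cong]: "sets \<tau> = sets borel" by fact
  have "((\<lambda>y. \<integral>s. (1 + s\<^sup>2) / (s\<^sup>2 + y\<^sup>2) \<partial>\<tau>) \<longlongrightarrow> (\<integral>s. 0 \<partial>\<tau>)) at_top"
  proof (rule integral_dominated_convergence_at_top[where w = "\<lambda>_. 1"])
    show "AE s in \<tau>. ((\<lambda>y. (1 + s\<^sup>2) / (s\<^sup>2 + y\<^sup>2)) \<longlongrightarrow> 0) at_top"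
      by (intro AE_I2) real_asymp
    show "\<forall>\<^sub>F y in at_top. AE s in \<tau>. norm ((1 + s\<^sup>2) / (s\<^sup>2 + y\<^sup>2)) \<le> 1"
      using eventually_ge_at_top[of "1 :: real"]
    proof eventually_elim
      case (elim y)
      then have "1 \<le> y\<^sup>2" by (simp add: one_le_power)
      moreover have "0 \<le> s\<^sup>2 + y\<^sup>2" "0 \<le> 1 + s\<^sup>2" "0 < s\<^sup>2 + y\<^sup>2" for s
        using elim by (auto intro: add_nonneg_pos)
      ultimately show ?case by (auto simp: divide_le_eq_1)
    qed
  qed auto
  then have "((\<lambda>y. a + (\<integral>s. (1 + s\<^sup>2) / (s\<^sup>2 + y\<^sup>2) \<partial>\<tau>)) \<longlongrightarrow> a + 0) at_top"
    by (intro tendsto_intros) simp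
  moreover have "\<forall>\<^sub>F y in at_top. a + (\<integral>s. (1 + s\<^sup>2) / (s\<^sup>2 + y\<^sup>2) \<partial>\<tau>) = u (\<i> * of_real y) / y"
    using eventually_gt_at_top[of "0 :: real"]
  proof eventually_elim
    case (elim y)
    have "(\<integral>s. (1 + s\<^sup>2) * poisson_half (\<i> * of_real y) s \<partial>\<tau>) = (\<integral>s. y * ((1 + s\<^sup>2) / (s\<^sup>2 + y\<^sup>2)) \<partial>\<tau>)"
      by (simp add: poisson_half_altdef mult.commute)
    then show ?case using elim rep[of "\<i> * of_real y"] by (simp add: add_divide_distrib)
  qed
  ultimately show ?thesis by (simp add: tendsto_cong)
qed

text \<open>The weight 1 + s^2 is the reciprocal of the kernel at \<open>\<i>\<close>, so the
  representation at this one point reads off the total mass.\<close>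

lemma herglotz_half_mass:
  assumes fin: "finite_measure \<tau>" and st: "sets \<tau> = sets borel"
    and rep: "u \<i> = a * Im \<i> + (\<integral>s. (1 + s\<^sup>2) * poisson_half \<i> s \<partial>\<tau>)"
  shows "measure \<tau> UNIV = u \<i> - a"
proof -
  have "(1 + s\<^sup>2) * poisson_half \<i> s = 1" for s
    using sum_power2_gt_zero_iff[of 1 s] by (simp add: poisson_half_altdef add.commute)
  then show ?thesis using rep sets_eq_imp_space_eq[OF st] by simp
qed

section \<open>Boundary behaviour of the Poisson kernel of the half-plane\<close>

lemma poisson_half_integral:
  assumes y: "0 < y"
  shows "integrable lborel (\<lambda>t. poisson_half (Complex t y) s)"
    and "(\<integral>t. poisson_half (Complex t y) s \<partial>lborel) = pi"
proof -
  have i: "integrable lborel (\<lambda>x::real. inverse (1 + x\<^sup>2))"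
    using integrable_inverse_1_plus_square by (simp add: set_integrable_def)
  have v: "(\<integral>x. inverse (1 + x\<^sup>2) \<partial>lborel) = pi"
    using LBINT_inverse_1_plus_square by (simp add: interval_lebesgue_integral_def set_lebesgue_integral_def)
  have e: "poisson_half (Complex t y) s = inverse y * inverse (1 + (- (s / y) + (1 / y) * t)\<^sup>2)" for t
  proof -
    have "(t - s)\<^sup>2 + y\<^sup>2 = y\<^sup>2 * (1 + ((t - s) / y)\<^sup>2)" using y by (simp add: distrib_left power_divide)
    moreover have "(t - s) / y = - (s / y) + (1 / y) * t" by (simp add: diff_divide_distrib)
    ultimately show ?thesis using y by (simp add: poisson_half_altdef power2_eq_square divide_inverse)
  qed
  show "integrable lborel (\<lambda>t. poisson_half (Complex t y) s)"
    unfolding e by (intro integrable_mult_right lborel_integrable_real_affine[OF i]) (use y in auto)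
  have "(\<integral>t. inverse (1 + (- (s / y) + (1 / y) * t)\<^sup>2) \<partial>lborel) = y * pi"
    using lborel_integral_real_affine[of "1 / y" "\<lambda>x. inverse (1 + x\<^sup>2)" "- (s / y)"] v y by (simp add: field_simps)
  then show "(\<integral>t. poisson_half (Complex t y) s \<partial>lborel) = pi"
    unfolding e using y by simp
qed

lemma continuous_poisson_half_line:
  "0 < y \<Longrightarrow> continuous_on UNIV (\<lambda>t. poisson_half (Complex t y) s)"
  unfolding poisson_half_altdef by (intro continuous_intros) (auto simp: add_nonneg_eq_0_iff)

lemma one_plus_square_le:
  fixes s t R :: real
  assumes "\<bar>t\<bar> \<le> R" "1 \<le> \<bar>t - s\<bar>"
  shows "1 + s\<^sup>2 \<le> 4 * (1 + R\<^sup>2) * (t - s)\<^sup>2"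
proof -
  have t: "t\<^sup>2 \<le> R\<^sup>2" using assms(1) by (metis abs_le_square_iff abs_of_nonneg abs_ge_zero order_trans)
  have d: "1 \<le> (t - s)\<^sup>2" using power_mono[OF assms(2), of 2] by simp
  have "s\<^sup>2 \<le> 2 * t\<^sup>2 + 2 * (t - s)\<^sup>2"
    using zero_le_power2[of "2 * t - s"] by (simp add: power2_eq_square algebra_simps)
  then have "1 + s\<^sup>2 \<le> 1 + 2 * R\<^sup>2 + 2 * (t - s)\<^sup>2" using t by linarith
  also have "\<dots> \<le> (1 + 2 * R\<^sup>2) * (t - s)\<^sup>2 + 2 * (t - s)\<^sup>2"
    using mult_left_mono[OF d, of "1 + 2 * R\<^sup>2"] by (simp add: add_nonneg_nonneg)
  also have "\<dots> \<le> 4 * (1 + R\<^sup>2) * (t - s)\<^sup>2"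
    using mult_nonneg_nonneg[of "R\<^sup>2" "(t - s)\<^sup>2"] d by (simp add: algebra_simps)
  finally show ?thesis .
qed

lemma poisson_half_weighted_far:
  assumes "0 < y" "\<bar>t\<bar> \<le> R" "1 \<le> \<bar>t - s\<bar>"
  shows "(1 + s\<^sup>2) * poisson_half (Complex t y) s \<le> 4 * (1 + R\<^sup>2) * y"
proof -
  have p: "0 < (t - s)\<^sup>2 + y\<^sup>2" using assms by (simp add: add_nonneg_pos)
  have "(1 + s\<^sup>2) * y \<le> 4 * (1 + R\<^sup>2) * (t - s)\<^sup>2 * y"
    using one_plus_square_le[OF assms(2,3)] assms(1) by (intro mult_right_mono) auto
  also have "\<dots> \<le> 4 * (1 + R\<^sup>2) * y * ((t - s)\<^sup>2 + y\<^sup>2)"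
    using assms(1) by (simp add: algebra_simps)
  finally show ?thesis using p by (simp add: poisson_half_altdef pos_divide_le_eq)
qed

text \<open>A bound uniform in s and in y \<le> 1; it will dominate the smoothed integrals in the
  passage to the boundary. For |s| \<le> R + 1 the kernel has integral at most pi and the weight is
  at most 1 + (R + 1)^2. For larger |s| every t in [-R, R] has distance at least 1 from s, the
  weighted kernel is at most 4 (1 + R^2) y, and the interval has length 2 R.\<close>

lemma poisson_half_interval_bound:
  assumes y: "0 < y" "y \<le> 1" and R: "0 \<le> R"
  shows "(1 + s\<^sup>2) * (\<integral>t. indicator {-R..R} t * poisson_half (Complex t y) s \<partial>lborel)
    \<le> pi * (1 + (R + 1)\<^sup>2) + 8 * R * (1 + R\<^sup>2)"
proof -
  have P0: "0 \<le> poisson_half (Complex t y) s" for t using y by (simp add: poisson_half_nonneg)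
  have int: "integrable lborel (\<lambda>t. indicator {-R..R} t * poisson_half (Complex t y) s)"
    using integrable_mult_indicator[OF _ poisson_half_integral(1)[OF y(1)], of "{-R..R}" s] by simp
  show ?thesis
  proof (cases "\<bar>s\<bar> \<le> R + 1")
    case True
    then have "s\<^sup>2 \<le> (R + 1)\<^sup>2" using R by (simp add: abs_le_square_iff[symmetric])
    moreover have "(\<integral>t. indicator {-R..R} t * poisson_half (Complex t y) s \<partial>lborel) \<le> (\<integral>t. poisson_half (Complex t y) s \<partial>lborel)"
      by (intro integral_mono int poisson_half_integral y) (use P0 in \<open>auto simp: indicator_def\<close>)
    moreover have "0 \<le> (\<integral>t. indicator {-R..R} t * poisson_half (Complex t y) s \<partial>lborel)"
      by (intro Bochner_Integration.integral_nonneg) (use P0 in auto)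
    ultimately have "(1 + s\<^sup>2) * (\<integral>t. indicator {-R..R} t * poisson_half (Complex t y) s \<partial>lborel) \<le> (1 + (R + 1)\<^sup>2) * pi"
      by (intro mult_mono) (auto simp: poisson_half_integral y)
    also have "\<dots> \<le> pi * (1 + (R + 1)\<^sup>2) + 8 * R * (1 + R\<^sup>2)" using R by simp
    finally show ?thesis .
  next
    case False
    have "(1 + s\<^sup>2) * (\<integral>t. indicator {-R..R} t * poisson_half (Complex t y) s \<partial>lborel)
      = (\<integral>t. indicator {-R..R} t * ((1 + s\<^sup>2) * poisson_half (Complex t y) s) \<partial>lborel)"
      by (subst integral_mult_right_zero[symmetric]) (simp add: mult_ac)
    also have "\<dots> \<le> (\<integral>t. indicator {-R..R} t * (4 * (1 + R\<^sup>2) * y) \<partial>lborel)"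
    proof (rule integral_mono)
      show "integrable lborel (\<lambda>t. indicator {-R..R} t * ((1 + s\<^sup>2) * poisson_half (Complex t y) s))"
        using integrable_mult_right[OF int, of "1 + s\<^sup>2"] by (simp add: mult_ac)
      show "indicator {-R..R} t * ((1 + s\<^sup>2) * poisson_half (Complex t y) s) \<le> indicator {-R..R} t * (4 * (1 + R\<^sup>2) * y)" for t
        using poisson_half_weighted_far[OF y(1), of t R s] False by (auto simp: indicator_def)
    qed (auto intro!: integrable_mult_left integrable_real_indicator simp: emeasure_lborel_Icc_eq)
    also have "\<dots> = 2 * R * (4 * (1 + R\<^sup>2) * y)" using R by simp
    also have "\<dots> \<le> 2 * R * (4 * (1 + R\<^sup>2) * 1)" using y R by (intro mult_left_mono) auto
    also have "\<dots> \<le> pi * (1 + (R + 1)\<^sup>2) + 8 * R * (1 + R\<^sup>2)"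
      by (simp add: algebra_simps add_nonneg_nonneg)
    finally show ?thesis .
  qed
qed

text \<open>The convergence has to be uniform over all s even with the weight 1 + s^2, because it is
  later integrated against finite measures of which only the mass is controlled. For |s| \<le> R + 1
  the weight is bounded, and the usual splitting into t near s and t far from s works; for larger
  |s| the value \<open>g s\<close> is 0 and the far estimate of the weighted kernel gives a bound of
  order y.\<close>

proposition poisson_half_approx_identity:
  fixes g :: "real \<Rightarrow> complex"
  assumes g: "continuous_on UNIV g" and R: "0 \<le> R" "\<And>t. R < \<bar>t\<bar> \<Longrightarrow> g t = 0" and e: "0 < e"
  shows "\<forall>\<^sub>F y in at_right 0. \<forall>s. norm ((1 + s\<^sup>2) *\<^sub>R (\<integral>t. poisson_half (Complex t y) s *\<^sub>R g t \<partial>lborel)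
      - (pi * (1 + s\<^sup>2)) *\<^sub>R g s) \<le> e"
proof -
  have [measurable]: "g \<in> borel_measurable borel" using g by (rule borel_measurable_continuous_onI)
  have "compact (g ` {-R..R})" by (intro compact_continuous_image continuous_on_subset[OF g]) auto
  then obtain B where B: "\<And>t. t \<in> {-R..R} \<Longrightarrow> norm (g t) \<le> B" and B0: "0 < B"
    using compact_imp_bounded bounded_pos by (metis imageI)
  have gB: "norm (g t) \<le> B" for t
    using B[of t] B0 R(2)[of t] by (cases "\<bar>t\<bar> \<le> R") (auto simp: abs_le_iff)
  \<comment> \<open>If two points are closer than 1 and one of them lies outside [-R-1, R+1], then
    both lie beyond R, where \<open>g\<close> vanishes.\<close>
  have uc: "uniformly_continuous_on UNIV g"
  proof -
    have "uniformly_continuous_on {-R-1..R+1} g"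
      by (rule compact_uniformly_continuous) (auto intro: continuous_on_subset[OF g])
    show ?thesis
      unfolding uniformly_continuous_on_def
    proof (intro allI impI)
      fix e' :: real assume "0 < e'"
      then obtain d where d: "0 < d" "\<And>x x'. x \<in> {-R-1..R+1} \<Longrightarrow> x' \<in> {-R-1..R+1} \<Longrightarrow> dist x' x < d \<Longrightarrow> dist (g x') (g x) < e'"
        using \<open>uniformly_continuous_on {-R-1..R+1} g\<close> unfolding uniformly_continuous_on_def by meson
      have "dist (g x') (g x) < e'" if "dist x' x < min d 1" for x x'
      proof (cases "x \<in> {-R-1..R+1} \<and> x' \<in> {-R-1..R+1}")
        case False
        then have "R < \<bar>x\<bar>" "R < \<bar>x'\<bar>" using that by (auto simp: dist_real_def)
        then show ?thesis using R(2) \<open>0 < e'\<close> by simp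
      qed (use d(2) that in auto)
      then show "\<exists>d>0. \<forall>x\<in>UNIV. \<forall>x'\<in>UNIV. dist x' x < d \<longrightarrow> dist (g x') (g x) < e'"
        using d(1) by (intro exI[of _ "min d 1"]) auto
    qed
  qed
  define K where "K = 1 + (R + 1)\<^sup>2"
  have K: "0 < K" by (simp add: K_def add_pos_nonneg)
  obtain d where d: "0 < d" "\<And>x x'. dist x' x < d \<Longrightarrow> dist (g x') (g x) < e / (2 * K * pi)"
    using uc K e unfolding uniformly_continuous_on_def by (metis UNIV_I divide_pos_pos mult_pos_pos pi_gt_zero zero_less_numeral)
  \<comment> \<open>The first summand is the contribution of the t far from s when |s| \<le> R + 1,
    the second the whole integral when |s| > R + 1.\<close>
  define L where "L = K * (2 * B * (1 + 1 / d\<^sup>2) * pi) + 8 * R * (1 + R\<^sup>2) * B"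
  have L: "0 \<le> L" using K B0 R by (simp add: L_def)
  have main: "norm ((1 + s\<^sup>2) *\<^sub>R (\<integral>t. poisson_half (Complex t y) s *\<^sub>R g t \<partial>lborel)
      - (pi * (1 + s\<^sup>2)) *\<^sub>R g s) \<le> e / 2 + L * y" if y: "0 < y" for y s
  proof -
    have P0: "0 \<le> poisson_half (Complex t y) s" for t using y by (simp add: poisson_half_nonneg)
    have mP [measurable]: "(\<lambda>t. poisson_half (Complex t y) s) \<in> borel_measurable borel" if "0 < y" for y
      using continuous_poisson_half_line[OF that] by (rule borel_measurable_continuous_onI)
    note mP[OF y, measurable]
    have ig: "integrable lborel (\<lambda>t. poisson_half (Complex t y) s *\<^sub>R g t)"
      by (rule Bochner_Integration.integrable_bound[OF integrable_mult_left[OF poisson_half_integral(1)[OF y, of s], of B]])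
        (use P0 gB B0 in \<open>auto intro!: mult_left_mono\<close>)
    have ic: "integrable lborel (\<lambda>t. poisson_half (Complex t y) s *\<^sub>R g s)"
      by (intro integrable_scaleR_left poisson_half_integral y)
    show ?thesis
    proof (cases "\<bar>s\<bar> \<le> R + 1")
      case True
      then have sK: "1 + s\<^sup>2 \<le> K" using R by (simp add: K_def abs_le_square_iff[symmetric])
      have pt: "norm (poisson_half (Complex t y) s *\<^sub>R (g t - g s)) \<le>
        e / (2 * K * pi) * poisson_half (Complex t y) s + 2 * B * (1 + 1 / d\<^sup>2) * y * poisson_half (Complex t 1) s" for t
      proof (cases "dist t s < d")
        case True
        then have "norm (g t - g s) \<le> e / (2 * K * pi)" using d(2)[OF True] by (simp add: dist_norm)
        then have "norm (poisson_half (Complex t y) s *\<^sub>R (g t - g s)) \<le> e / (2 * K * pi) * poisson_half (Complex t y) s"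
          unfolding mult.commute[of "e / (2 * K * pi)"] using P0[of t] by (simp only: norm_scaleR abs_of_nonneg mult_left_mono)
        moreover have "0 \<le> 2 * B * (1 + 1 / d\<^sup>2) * y * poisson_half (Complex t 1) s"
          using B0 y by (simp add: poisson_half_nonneg)
        ultimately show ?thesis by linarith
      next
        case False
        then have ds: "d\<^sup>2 \<le> (t - s)\<^sup>2" using d(1) by (simp add: dist_real_def abs_le_square_iff[symmetric])
        then have ts: "0 < (t - s)\<^sup>2" using d(1) by (meson less_le_trans zero_less_power)
        have "poisson_half (Complex t y) s \<le> y / (t - s)\<^sup>2"
          unfolding poisson_half_altdef using ts y by (auto intro!: divide_left_mono mult_pos_pos add_pos_nonneg)
        \<comment> \<open>Away from s the kernel of height y is compared with y times the kernel of
          height 1, whose integral over t is pi for every s.\<close>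
        also have "\<dots> \<le> y * ((1 + 1 / d\<^sup>2) / (1 + (t - s)\<^sup>2))"
        proof -
          have "1 + (t - s)\<^sup>2 \<le> (1 + 1 / d\<^sup>2) * (t - s)\<^sup>2"
            using ds d(1) by (simp add: distrib_right pos_le_divide_eq)
          then have "1 / (t - s)\<^sup>2 \<le> (1 + 1 / d\<^sup>2) / (1 + (t - s)\<^sup>2)"
            using ts by (simp add: divide_le_eq pos_le_divide_eq add_pos_pos mult.commute)
          then show ?thesis using y by (metis mult_left_mono less_imp_le mult.right_neutral times_divide_eq_right)
        qed
        also have "\<dots> = (1 + 1 / d\<^sup>2) * y * poisson_half (Complex t 1) s"
          by (simp add: poisson_half_altdef add.commute mult.commute)
        finally have p: "poisson_half (Complex t y) s \<le> (1 + 1 / d\<^sup>2) * y * poisson_half (Complex t 1) s" .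
        have "norm (g t - g s) \<le> 2 * B" using norm_triangle_ineq4[of "g t" "g s"] gB[of t] gB[of s] by linarith
        then have "norm (poisson_half (Complex t y) s *\<^sub>R (g t - g s)) \<le> poisson_half (Complex t y) s * (2 * B)"
          using P0[of t] by (simp only: norm_scaleR abs_of_nonneg mult_left_mono)
        also have "\<dots> \<le> (1 + 1 / d\<^sup>2) * y * poisson_half (Complex t 1) s * (2 * B)"
          using p B0 by (intro mult_right_mono) auto
        finally have "norm (poisson_half (Complex t y) s *\<^sub>R (g t - g s)) \<le> 2 * B * (1 + 1 / d\<^sup>2) * y * poisson_half (Complex t 1) s"
          by (simp only: mult_ac)
        moreover have "0 \<le> e / (2 * K * pi) * poisson_half (Complex t y) s" using P0[of t] e K by simp
        ultimately show ?thesis by linarith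
      qed
      have "norm ((\<integral>t. poisson_half (Complex t y) s *\<^sub>R g t \<partial>lborel) - pi *\<^sub>R g s)
        = norm (\<integral>t. poisson_half (Complex t y) s *\<^sub>R (g t - g s) \<partial>lborel)"
        unfolding scaleR_diff_right by (subst Bochner_Integration.integral_diff[OF ig ic]) (simp add: poisson_half_integral y)
      also have "\<dots> \<le> (\<integral>t. e / (2 * K * pi) * poisson_half (Complex t y) s + 2 * B * (1 + 1 / d\<^sup>2) * y * poisson_half (Complex t 1) s \<partial>lborel)"
        by (rule Bochner_Integration.integral_norm_bound_integral)
          (use pt in \<open>auto intro!: Bochner_Integration.integrable_add integrable_mult_right poisson_half_integral y
             Bochner_Integration.integrable_diff ig ic simp: scaleR_diff_right\<close>)
      also have "\<dots> = e / (2 * K * pi) * pi + 2 * B * (1 + 1 / d\<^sup>2) * y * pi"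
        by (subst Bochner_Integration.integral_add) (auto intro!: integrable_mult_right poisson_half_integral y simp: poisson_half_integral y)
      finally have b: "norm ((\<integral>t. poisson_half (Complex t y) s *\<^sub>R g t \<partial>lborel) - pi *\<^sub>R g s)
         \<le> e / (2 * K * pi) * pi + 2 * B * (1 + 1 / d\<^sup>2) * y * pi" .
      have "(1 + s\<^sup>2) *\<^sub>R (\<integral>t. poisson_half (Complex t y) s *\<^sub>R g t \<partial>lborel) - (pi * (1 + s\<^sup>2)) *\<^sub>R g s
        = (1 + s\<^sup>2) *\<^sub>R ((\<integral>t. poisson_half (Complex t y) s *\<^sub>R g t \<partial>lborel) - pi *\<^sub>R g s)"
        by (simp only: scaleR_diff_right scaleR_scaleR mult.commute)
      then have "norm ((1 + s\<^sup>2) *\<^sub>R (\<integral>t. poisson_half (Complex t y) s *\<^sub>R g t \<partial>lborel) - (pi * (1 + s\<^sup>2)) *\<^sub>R g s)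
        = (1 + s\<^sup>2) * norm ((\<integral>t. poisson_half (Complex t y) s *\<^sub>R g t \<partial>lborel) - pi *\<^sub>R g s)"
        by (simp add: add_nonneg_nonneg abs_of_nonneg)
      also have "\<dots> \<le> K * (e / (2 * K * pi) * pi + 2 * B * (1 + 1 / d\<^sup>2) * y * pi)"
        using sK b K by (intro mult_mono) auto
      also have "\<dots> = e / 2 + K * (2 * B * (1 + 1 / d\<^sup>2) * pi) * y"
        using K by (simp add: distrib_left mult_ac)
      also have "\<dots> \<le> e / 2 + L * y"
        using y R B0 by (intro add_left_mono mult_right_mono) (auto simp: L_def)
      finally show ?thesis .
    next
      case False
      then have "g s = 0" using R by auto
      moreover have "norm ((1 + s\<^sup>2) *\<^sub>R (\<integral>t. poisson_half (Complex t y) s *\<^sub>R g t \<partial>lborel)) \<le> L * y"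
      proof -
        have "(1 + s\<^sup>2) *\<^sub>R (\<integral>t. poisson_half (Complex t y) s *\<^sub>R g t \<partial>lborel)
          = (\<integral>t. (1 + s\<^sup>2) *\<^sub>R (poisson_half (Complex t y) s *\<^sub>R g t) \<partial>lborel)"
          by (rule integral_scaleR_right[symmetric])
        also have "norm \<dots> \<le> (\<integral>t. indicator {-R..R} t * (4 * (1 + R\<^sup>2) * y * B) \<partial>lborel)"
        proof (rule Bochner_Integration.integral_norm_bound_integral)
          show "norm ((1 + s\<^sup>2) *\<^sub>R (poisson_half (Complex t y) s *\<^sub>R g t)) \<le> indicator {-R..R} t * (4 * (1 + R\<^sup>2) * y * B)" for t
          proof (cases "\<bar>t\<bar> \<le> R")
            case True
            have "norm ((1 + s\<^sup>2) *\<^sub>R (poisson_half (Complex t y) s *\<^sub>R g t)) = ((1 + s\<^sup>2) * poisson_half (Complex t y) s) * norm (g t)"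
              using P0 by (simp add: abs_mult abs_of_nonneg add_nonneg_nonneg)
            also have "\<dots> \<le> (4 * (1 + R\<^sup>2) * y) * B"
              by (rule mult_mono[OF poisson_half_weighted_far[OF y True] gB]) (use False True y in auto)
            finally show ?thesis using True by (simp add: indicator_def abs_le_iff)
          qed (use R y B0 in \<open>simp add: indicator_def\<close>)
          show "integrable lborel (\<lambda>t. (1 + s\<^sup>2) *\<^sub>R (poisson_half (Complex t y) s *\<^sub>R g t))"
            by (rule integrable_scaleR_right[OF ig])
        qed (auto intro!: integrable_mult_left integrable_real_indicator simp: emeasure_lborel_Icc_eq)
        also have "\<dots> = 8 * R * (1 + R\<^sup>2) * B * y" using R by simp
        also have "\<dots> \<le> L * y" using y K B0 by (intro mult_right_mono) (auto simp: L_def)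
        finally show ?thesis .
      qed
      ultimately show ?thesis using e by simp
    qed
  qed
  have "\<forall>\<^sub>F y in at_right 0. y \<in> {0<..<e / (2 * (L + 1))}"
    by (rule eventually_at_right_real) (use L e in simp)
  then show ?thesis
  proof eventually_elim
    case (elim y)
    have "L * y \<le> (L + 1) * y" using elim by simp
    also have "\<dots> \<le> (L + 1) * (e / (2 * (L + 1)))" using elim L by (intro mult_left_mono) auto
    also have "\<dots> = e / 2"
    proof -
      have "l * (e / (2 * l)) = e / 2" if "l \<noteq> 0" for l :: real using that by simp
      then show ?thesis using L by (metis add_nonneg_eq_0_iff zero_le_one zero_neq_one)
    qed
    finally have "e / 2 + L * y \<le> e" by simp
    then show ?case using main[of y] elim by (meson greaterThanLessThan_iff order_trans)
  qed
qed

section \<open>Families of Herglotz measures with a common slope\<close>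

locale poisson_family =
  fixes Y :: "'z::metric_space set" and a :: real and \<tau> :: "'z \<Rightarrow> real measure" and U :: "'z \<Rightarrow> complex \<Rightarrow> real"
  assumes a_nonneg: "0 \<le> a"
    and fin: "\<And>p. p \<in> Y \<Longrightarrow> finite_measure (\<tau> p)"
    and sets_tau: "\<And>p. p \<in> Y \<Longrightarrow> sets (\<tau> p) = sets borel"
    and rep: "\<And>p w. p \<in> Y \<Longrightarrow> 0 < Im w \<Longrightarrow> U p w = a * Im w + (\<integral>s. (1 + s\<^sup>2) * poisson_half w s \<partial>\<tau> p)"
    and cont_U: "continuous_on (Y \<times> {w. 0 < Im w}) (\<lambda>(p, w). U p w)"
begin

lemma space_tau: "p \<in> Y \<Longrightarrow> space (\<tau> p) = UNIV"
  using sets_eq_imp_space_eq[OF sets_tau] by simp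

text \<open>Since \<open>a\<close> does not depend on p, the total mass inherits continuity in p
  from \<open>U p \<i>\<close>. This is the source of tightness.\<close>

lemma mass: "p \<in> Y \<Longrightarrow> measure (\<tau> p) UNIV = U p \<i> - a"
  by (rule herglotz_half_mass[of "\<tau> p" "U p", OF fin sets_tau rep]) auto

lemma cont_U_line: "0 < Im w \<Longrightarrow> continuous_on Y (\<lambda>p. U p w)"
  by (rule continuous_on_compose2[OF cont_U, where f = "\<lambda>p. (p, w)", simplified]) (auto intro!: continuous_intros)

lemma U_i_ge: "p \<in> Y \<Longrightarrow> a \<le> U p \<i>" "p \<in> Y \<Longrightarrow> 0 \<le> U p \<i>" "p \<in> Y \<Longrightarrow> measure (\<tau> p) UNIV \<le> U p \<i>"
  using mass[of p] measure_nonneg[of "\<tau> p" UNIV] a_nonneg by auto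

lemma integrable_bounded:
  fixes b :: "real \<Rightarrow> complex"
  assumes "p \<in> Y" "b \<in> borel_measurable borel" "\<And>s. norm (b s) \<le> B"
  shows "integrable (\<tau> p) b"
proof -
  interpret finite_measure "\<tau> p" by (rule fin[OF assms(1)])
  have [measurable_cong]: "sets (\<tau> p) = sets borel" by (rule sets_tau[OF assms(1)])
  show ?thesis by (rule integrable_const_bound[of _ B]) (use assms in auto)
qed

text \<open>Fubini for the product of \<open>\<tau> p\<close> and Lebesgue measure. For |t| \<le> R
  the weighted kernel is bounded by the constant \<open>C\<close> uniformly in s, \<open>g\<close>
  vanishes for other t, and \<open>\<tau> p\<close> is finite.\<close>

lemma poisson_smoothing:
  fixes g :: "real \<Rightarrow> complex"
  assumes p: "p \<in> Y" and y: "0 < y" and g: "g \<in> borel_measurable borel" "\<And>t. norm (g t) \<le> B" "\<And>t. R < \<bar>t\<bar> \<Longrightarrow> g t = 0"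
  shows "integrable lborel (\<lambda>t. U p (Complex t y) *\<^sub>R g t)"
    and "(\<integral>t. U p (Complex t y) *\<^sub>R g t \<partial>lborel) = (a * y) *\<^sub>R (\<integral>t. g t \<partial>lborel)
      + (\<integral>s. (1 + s\<^sup>2) *\<^sub>R (\<integral>t. poisson_half (Complex t y) s *\<^sub>R g t \<partial>lborel) \<partial>\<tau> p)"
    and "integrable (\<tau> p) (\<lambda>s. (1 + s\<^sup>2) *\<^sub>R (\<integral>t. poisson_half (Complex t y) s *\<^sub>R g t \<partial>lborel))"
proof -
  interpret finite_measure "\<tau> p" by (rule fin[OF p])
  have [measurable_cong]: "sets (\<tau> p) = sets borel" by (rule sets_tau[OF p])
  interpret P: pair_sigma_finite "\<tau> p" lborel by standard
  note [measurable] = g(1)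
  define C where "C = 2 * y + (1 + 2 * R\<^sup>2) / y"
  let ?k = "\<lambda>s t. ((1 + s\<^sup>2) * poisson_half (Complex t y) s) *\<^sub>R g t"
  have B0: "0 \<le> B" using g(2)[of 0] norm_ge_zero order_trans by blast
  have C0: "0 \<le> C" using y by (simp add: C_def add_nonneg_nonneg)
  have k_nn: "0 \<le> (1 + s\<^sup>2) * poisson_half (Complex t y) s" for s t
    using y by (intro mult_nonneg_nonneg poisson_half_nonneg) (auto simp: add_nonneg_nonneg)
  have kb: "norm (?k s t) \<le> indicator {-R..R} t * (C * B)" for s t
  proof (cases "R < \<bar>t\<bar>")
    case True
    then show ?thesis using g(3) B0 C0 by (simp add: indicator_def)
  next
    case False
    then have tR: "t\<^sup>2 \<le> R\<^sup>2" by (simp add: abs_le_square_iff[symmetric])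
    have "(1 + s\<^sup>2) * poisson_half (Complex t y) s \<le> 2 * y + (1 + 2 * t\<^sup>2) / y"
      using poisson_half_weighted_le[of "Complex t y" s] y by simp
    also have "\<dots> \<le> C" unfolding C_def using y tR by (intro add_left_mono divide_right_mono) auto
    finally have "norm (?k s t) \<le> C * B"
      unfolding norm_scaleR abs_of_nonneg[OF k_nn] using g(2) C0 by (intro mult_mono) auto
    moreover have "- R \<le> t" "t \<le> R" using False by linarith+
    ultimately show ?thesis by (simp add: indicator_def)
  qed
  have [measurable]: "(\<lambda>z. poisson_half (Complex (snd z) y) (fst z)) \<in> borel_measurable (\<tau> p \<Otimes>\<^sub>M lborel)"
    unfolding poisson_half_altdef by simp measurable
  have iI: "integrable lborel (\<lambda>t. indicator {-R..R} t * (C * B))"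
    by (intro integrable_mult_left integrable_real_indicator) (auto simp: emeasure_lborel_Icc_eq)
  have int: "integrable (\<tau> p \<Otimes>\<^sub>M lborel) (\<lambda>(s, t). ?k s t)"
  proof (rule P.Fubini_integrable)
    show "(\<lambda>(s, t). ?k s t) \<in> borel_measurable (\<tau> p \<Otimes>\<^sub>M lborel)"
      unfolding split_beta' by measurable
    have i1: "integrable lborel (\<lambda>t. ?k s t)" for s
    proof (rule Bochner_Integration.integrable_bound[OF iI])
      have "(\<lambda>t. poisson_half (Complex t y) s) \<in> borel_measurable borel"
        using continuous_poisson_half_line[OF y] by (rule borel_measurable_continuous_onI)
      then show "(\<lambda>t. ?k s t) \<in> borel_measurable lborel" by measurable
    qed (intro AE_I2 order_trans[OF kb], simp add: abs_le_iff)
    then show "AE s in \<tau> p. integrable lborel (\<lambda>t. (case (s, t) of (s, t) \<Rightarrow> ?k s t))" by simp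
    show "integrable (\<tau> p) (\<lambda>s. \<integral>t. norm (case (s, t) of (s, t) \<Rightarrow> ?k s t) \<partial>lborel)"
    proof (rule integrable_const_bound[of _ "\<integral>t. indicator {-R..R} t * (C * B) \<partial>lborel"])
      show "AE s in \<tau> p. norm (\<integral>t. norm (case (s, t) of (s, t) \<Rightarrow> ?k s t) \<partial>lborel) \<le> (\<integral>t. indicator {-R..R} t * (C * B) \<partial>lborel)"
      proof (rule AE_I2)
        fix s
        have "(\<integral>t. norm (?k s t) \<partial>lborel) \<le> (\<integral>t. indicator {-R..R} t * (C * B) \<partial>lborel)"
          by (rule integral_mono[OF integrable_norm[OF i1] iI kb])
        then show "norm (\<integral>t. norm (case (s, t) of (s, t) \<Rightarrow> ?k s t) \<partial>lborel) \<le> (\<integral>t. indicator {-R..R} t * (C * B) \<partial>lborel)"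
          by (simp only: prod.case real_norm_def abs_of_nonneg[OF Bochner_Integration.integral_nonneg[OF norm_ge_zero]])
      qed
      show "(\<lambda>s. \<integral>t. norm (case (s, t) of (s, t) \<Rightarrow> ?k s t) \<partial>lborel) \<in> borel_measurable (\<tau> p)"
        by (rule lborel.borel_measurable_lebesgue_integral) (simp add: split_beta', measurable)
    qed
  qed
  have k1: "(\<integral>t. ?k s t \<partial>lborel) = (1 + s\<^sup>2) *\<^sub>R (\<integral>t. poisson_half (Complex t y) s *\<^sub>R g t \<partial>lborel)" for s
    unfolding scaleR_scaleR[symmetric] by (rule integral_scaleR_right)
  show i_tau: "integrable (\<tau> p) (\<lambda>s. (1 + s\<^sup>2) *\<^sub>R (\<integral>t. poisson_half (Complex t y) s *\<^sub>R g t \<partial>lborel))"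
    using P.integrable_fst'[OF int] by (simp add: k1)
  have Ug: "U p (Complex t y) *\<^sub>R g t = (a * y) *\<^sub>R g t + (\<integral>s. ?k s t \<partial>\<tau> p)" for t
  proof -
    have "(\<integral>s. ?k s t \<partial>\<tau> p) = (\<integral>s. (1 + s\<^sup>2) * poisson_half (Complex t y) s \<partial>\<tau> p) *\<^sub>R g t"
      by (rule integral_scaleR_left) (use integrable_poisson_half_weighted[OF fin[OF p] sets_tau[OF p]] y in auto)
    then show ?thesis using rep[OF p, of "Complex t y"] y by (simp add: scaleR_add_left)
  qed
  have ig: "integrable lborel g"
  proof (rule Bochner_Integration.integrable_bound)
    show "integrable lborel (\<lambda>t. indicator {-R..R} t * B)"
      by (intro integrable_mult_left integrable_real_indicator) (auto simp: emeasure_lborel_Icc_eq)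
    have "norm (g t) \<le> norm (indicator {-R..R} t * B)" for t
      using g(2)[of t] g(3)[of t] B0 by (cases "R < \<bar>t\<bar>") (auto simp: indicator_def abs_le_iff)
    then show "AE t in lborel. norm (g t) \<le> norm (indicator {-R..R} t * B)" by simp
  qed measurable
  have i2: "integrable lborel (\<lambda>t. \<integral>s. ?k s t \<partial>\<tau> p)" using P.integrable_snd[OF int] by simp
  show "integrable lborel (\<lambda>t. U p (Complex t y) *\<^sub>R g t)"
    unfolding Ug by (intro Bochner_Integration.integrable_add integrable_scaleR_right ig i2)
  have "(\<integral>t. U p (Complex t y) *\<^sub>R g t \<partial>lborel) = (\<integral>t. (a * y) *\<^sub>R g t \<partial>lborel) + (\<integral>t. (\<integral>s. ?k s t \<partial>\<tau> p) \<partial>lborel)"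
    unfolding Ug by (rule Bochner_Integration.integral_add[OF integrable_scaleR_right[OF ig] i2])
  also have "(\<integral>t. (\<integral>s. ?k s t \<partial>\<tau> p) \<partial>lborel) = (\<integral>s. (\<integral>t. ?k s t \<partial>lborel) \<partial>\<tau> p)"
    by (rule P.Fubini_integral[OF int])
  finally show "(\<integral>t. U p (Complex t y) *\<^sub>R g t \<partial>lborel) = (a * y) *\<^sub>R (\<integral>t. g t \<partial>lborel)
      + (\<integral>s. (1 + s\<^sup>2) *\<^sub>R (\<integral>t. poisson_half (Complex t y) s *\<^sub>R g t \<partial>lborel) \<partial>\<tau> p)"
    by (simp only: k1 integral_scaleR_right)
qed

lemma compact_support_bounded:
  fixes g :: "real \<Rightarrow> complex"
  assumes "continuous_on UNIV g" "\<And>t. R < \<bar>t\<bar> \<Longrightarrow> g t = 0"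
  obtains B where "0 < B" "\<And>t. norm (g t) \<le> B"
proof -
  have "compact (g ` {-R..R})" by (intro compact_continuous_image continuous_on_subset[OF assms(1)]) auto
  then obtain B where B: "0 < B" "\<forall>x\<in>g ` {-R..R}. norm x \<le> B" using compact_imp_bounded bounded_pos by metis
  have "norm (g t) \<le> B" for t
    using B assms(2)[of t] by (cases "R < \<bar>t\<bar>") (auto simp: abs_le_iff not_less)
  then show ?thesis using that B(1) by blast
qed

text \<open>The limit, as y decreases to 0, of the integral of \<open>U p (Complex t y)\<close>
  against \<open>g\<close>; the factor pi is the integral of the Poisson kernel.\<close>

definition boundary_value :: "(real \<Rightarrow> complex) \<Rightarrow> 'z \<Rightarrow> complex" where
  "boundary_value g p = (\<integral>s. (pi * (1 + s\<^sup>2)) *\<^sub>R g s \<partial>\<tau> p)"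

lemma weighted_bounded:
  fixes g :: "real \<Rightarrow> complex"
  assumes "0 \<le> B" "\<And>t. norm (g t) \<le> B" "\<And>t. R < \<bar>t\<bar> \<Longrightarrow> g t = 0"
  shows "norm ((pi * (1 + s\<^sup>2)) *\<^sub>R g s) \<le> pi * (1 + R\<^sup>2) * B"
proof (cases "R < \<bar>s\<bar>")
  case False
  then have "s\<^sup>2 \<le> R\<^sup>2" by (simp add: abs_le_square_iff[symmetric])
  then have "pi * (1 + s\<^sup>2) \<le> pi * (1 + R\<^sup>2)" by simp
  moreover have "norm ((pi * (1 + s\<^sup>2)) *\<^sub>R g s) = (pi * (1 + s\<^sup>2)) * norm (g s)"
    by (simp add: abs_mult abs_of_nonneg add_nonneg_nonneg)
  ultimately show ?thesis using assms(2)[of s] by (auto intro!: mult_mono simp: add_nonneg_nonneg)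
qed (use assms in \<open>simp add: add_nonneg_nonneg\<close>)

text \<open>The error is measured relative to \<open>U p \<i>\<close>, which dominates both the
  slope and the mass of \<open>\<tau> p\<close>. One value of y therefore serves wherever
  \<open>U p \<i>\<close> is bounded. Half of \<open>\<epsilon>\<close> pays for the linear term,
  half for the approximate identity.\<close>

lemma boundary_value_uniform:
  fixes g :: "real \<Rightarrow> complex"
  assumes g: "continuous_on UNIV g" and R: "0 \<le> R" "\<And>t. R < \<bar>t\<bar> \<Longrightarrow> g t = 0" and e: "0 < \<epsilon>"
  shows "\<forall>\<^sub>F y in at_right 0. \<forall>p\<in>Y. norm ((\<integral>t. U p (Complex t y) *\<^sub>R g t \<partial>lborel) - boundary_value g p) \<le> \<epsilon> * U p \<i>"
proof -
  obtain B where B: "0 < B" "\<And>t. norm (g t) \<le> B" by (rule compact_support_bounded[OF g]) (use R(2) in auto)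
  have [measurable]: "g \<in> borel_measurable borel" using g by (rule borel_measurable_continuous_onI)
  define I where "I = norm (\<integral>t. g t \<partial>lborel)"
  have I: "0 \<le> I" by (simp add: I_def)
  have "\<forall>\<^sub>F y in at_right 0. y \<in> {0<..<\<epsilon> / (2 * (I + 1))}"
    by (rule eventually_at_right_real) (use I e in simp)
  moreover have "\<forall>\<^sub>F y in at_right 0. \<forall>s. norm ((1 + s\<^sup>2) *\<^sub>R (\<integral>t. poisson_half (Complex t y) s *\<^sub>R g t \<partial>lborel)
      - (pi * (1 + s\<^sup>2)) *\<^sub>R g s) \<le> \<epsilon> / 2"
    by (rule poisson_half_approx_identity[OF g R]) (use e in simp_all)
  ultimately show ?thesis
  proof eventually_elim
    case (elim y)
    show ?case
    proof
      fix p assume p: "p \<in> Y"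
      interpret finite_measure "\<tau> p" by (rule fin[OF p])
      have [measurable_cong]: "sets (\<tau> p) = sets borel" by (rule sets_tau[OF p])
      have y: "0 < y" using elim by simp
      note S = poisson_smoothing[OF p y _ B(2) R(2)]
      let ?A = "\<lambda>s. (1 + s\<^sup>2) *\<^sub>R (\<integral>t. poisson_half (Complex t y) s *\<^sub>R g t \<partial>lborel)" and ?B = "\<lambda>s. (pi * (1 + s\<^sup>2)) *\<^sub>R g s"
      have iA: "integrable (\<tau> p) ?A" by (rule S(3)) simp_all
      have iB: "integrable (\<tau> p) ?B"
        by (rule integrable_bounded[OF p _ weighted_bounded[OF less_imp_le[OF B(1)] B(2) R(2)]]) auto
      have "norm ((\<integral>t. U p (Complex t y) *\<^sub>R g t \<partial>lborel) - boundary_value g p)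
         = norm ((a * y) *\<^sub>R (\<integral>t. g t \<partial>lborel) + (\<integral>s. ?A s - ?B s \<partial>\<tau> p))"
        unfolding boundary_value_def Bochner_Integration.integral_diff[OF iA iB] by (subst S(2)) (simp_all add: algebra_simps)
      also have "\<dots> \<le> a * y * I + norm (\<integral>s. ?A s - ?B s \<partial>\<tau> p)"
        by (rule order_trans[OF norm_triangle_ineq]) (use a_nonneg y in \<open>simp add: I_def abs_mult\<close>)
      also have "norm (\<integral>s. ?A s - ?B s \<partial>\<tau> p) \<le> (\<integral>s. \<epsilon> / 2 \<partial>\<tau> p)"
        by (rule Bochner_Integration.integral_norm_bound_integral) (use elim(2) iA iB in auto)
      also have "(\<integral>s. \<epsilon> / 2 \<partial>\<tau> p) = \<epsilon> / 2 * measure (\<tau> p) UNIV" using space_tau[OF p] by simp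
      also have "\<dots> \<le> \<epsilon> / 2 * U p \<i>" using U_i_ge(3)[OF p] e by simp
      also have "a * y * I \<le> \<epsilon> / 2 * U p \<i>"
      proof -
        have "y * I \<le> y * (I + 1)" using y by simp
        also have "\<dots> \<le> (\<epsilon> / (2 * (I + 1))) * (I + 1)" using elim I by (intro mult_right_mono) auto
        also have "\<dots> = \<epsilon> / 2"
        proof -
          have "\<epsilon> / (2 * l) * l = \<epsilon> / 2" if "l \<noteq> 0" for l :: real using that by simp
          from this[of "I + 1"] I show ?thesis by linarith
        qed
        finally have "a * (y * I) \<le> a * (\<epsilon> / 2)" using a_nonneg by (rule mult_left_mono)
        also have "\<dots> \<le> U p \<i> * (\<epsilon> / 2)" using U_i_ge(1)[OF p] e by (intro mult_right_mono) auto
        finally show ?thesis by (simp add: mult_ac)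
      qed
      finally show "norm ((\<integral>t. U p (Complex t y) *\<^sub>R g t \<partial>lborel) - boundary_value g p) \<le> \<epsilon> * U p \<i>"
        by simp
    qed
  qed
qed

lemma interval_bound:
  assumes p: "p \<in> Y" and y: "0 < y" "y \<le> 1" and R: "0 \<le> R"
  shows "(\<integral>t. U p (Complex t y) * indicator {-R..R} t \<partial>lborel) \<le> (2 * R + (pi * (1 + (R + 1)\<^sup>2) + 8 * R * (1 + R\<^sup>2))) * U p \<i>"
    and "integrable lborel (\<lambda>t. U p (Complex t y) * indicator {-R..R} t)"
proof -
  interpret finite_measure "\<tau> p" by (rule fin[OF p])
  have [measurable_cong]: "sets (\<tau> p) = sets borel" by (rule sets_tau[OF p])
  \<comment> \<open>The smoothing formula asks only for a bounded measurable function that vanishes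
    outside an interval, so the indicator is admissible once it is made complex-valued.\<close>
  let ?g = "\<lambda>t. complex_of_real (indicator {-R..R} t)"
  have g: "?g \<in> borel_measurable borel" "\<And>t. norm (?g t) \<le> 1" "\<And>t. R < \<bar>t\<bar> \<Longrightarrow> ?g t = 0"
    by (auto simp: indicator_def)
  note S = poisson_smoothing[OF p y(1) g(1,2), where R = R, OF g(3)]
  have S2: "(\<integral>t. U p (Complex t y) *\<^sub>R ?g t \<partial>lborel) = (a * y) *\<^sub>R (\<integral>t. ?g t \<partial>lborel)
      + (\<integral>s. (1 + s\<^sup>2) *\<^sub>R (\<integral>t. poisson_half (Complex t y) s *\<^sub>R ?g t \<partial>lborel) \<partial>\<tau> p)"
    by (rule S(2))
  have S3: "integrable (\<tau> p) (\<lambda>s. (1 + s\<^sup>2) *\<^sub>R (\<integral>t. poisson_half (Complex t y) s *\<^sub>R ?g t \<partial>lborel))"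
    by (rule S(3))
  have e: "U p (Complex t y) *\<^sub>R ?g t = of_real (U p (Complex t y) * indicator {-R..R} t)" for t
    by (simp add: scaleR_conv_of_real)
  have e2: "poisson_half (Complex t y) s *\<^sub>R ?g t = of_real (indicator {-R..R} t * poisson_half (Complex t y) s)" for t s
    by (simp add: scaleR_conv_of_real mult.commute)
  have e3: "r *\<^sub>R complex_of_real x = of_real (r * x)" for r x by (simp add: scaleR_conv_of_real)
  have S1: "integrable lborel (\<lambda>t. complex_of_real (U p (Complex t y) * indicator {-R..R} t))" using S(1) unfolding e by simp
  show i: "integrable lborel (\<lambda>t. U p (Complex t y) * indicator {-R..R} t)"
    using integrable_Re[OF S1] by simp
  have P0: "0 \<le> (1 + s\<^sup>2) * (\<integral>t. indicator {-R..R} t * poisson_half (Complex t y) s \<partial>lborel)" for s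
    using y by (intro mult_nonneg_nonneg Bochner_Integration.integral_nonneg poisson_half_nonneg) (auto simp: add_nonneg_nonneg)
  have "complex_of_real (\<integral>t. U p (Complex t y) * indicator {-R..R} t \<partial>lborel)
     = of_real ((a * y) * (\<integral>t. indicator {-R..R} t \<partial>lborel)
      + (\<integral>s. (1 + s\<^sup>2) * (\<integral>t. indicator {-R..R} t * poisson_half (Complex t y) s \<partial>lborel) \<partial>\<tau> p))"
    using S2 unfolding e e2 by (simp only: e3 integral_complex_of_real of_real_add)
  then have "(\<integral>t. U p (Complex t y) * indicator {-R..R} t \<partial>lborel) = (a * y) * (\<integral>t. indicator {-R..R} t \<partial>lborel)
      + (\<integral>s. (1 + s\<^sup>2) * (\<integral>t. indicator {-R..R} t * poisson_half (Complex t y) s \<partial>lborel) \<partial>\<tau> p)"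
    by (simp only: of_real_eq_iff)
  also have "(\<integral>t. indicator {-R..R} t \<partial>lborel) = 2 * R" using R by simp
  also have "a * y * (2 * R) \<le> (2 * R) * U p \<i>"
  proof -
    have "a * y \<le> U p \<i> * 1" using U_i_ge[OF p] y a_nonneg by (intro mult_mono) auto
    from mult_right_mono[OF this, of "2 * R"] R show ?thesis by (simp add: mult_ac)
  qed
  also have "(\<integral>s. (1 + s\<^sup>2) * (\<integral>t. indicator {-R..R} t * poisson_half (Complex t y) s \<partial>lborel) \<partial>\<tau> p)
     \<le> (\<integral>s. pi * (1 + (R + 1)\<^sup>2) + 8 * R * (1 + R\<^sup>2) \<partial>\<tau> p)"
  proof (rule integral_mono)
    show "integrable (\<tau> p) (\<lambda>s. (1 + s\<^sup>2) * (\<integral>t. indicator {-R..R} t * poisson_half (Complex t y) s \<partial>lborel))"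
      using integrable_Re[OF S3] unfolding e2 by (simp only: integral_complex_of_real e3 Re_complex_of_real)
    show "(1 + s\<^sup>2) * (\<integral>t. indicator {-R..R} t * poisson_half (Complex t y) s \<partial>lborel) \<le> pi * (1 + (R + 1)\<^sup>2) + 8 * R * (1 + R\<^sup>2)" for s
      by (rule poisson_half_interval_bound[OF y R])
  qed simp
  also have "\<dots> = (pi * (1 + (R + 1)\<^sup>2) + 8 * R * (1 + R\<^sup>2)) * measure (\<tau> p) UNIV"
    using space_tau[OF p] by simp
  also have "\<dots> \<le> (pi * (1 + (R + 1)\<^sup>2) + 8 * R * (1 + R\<^sup>2)) * U p \<i>"
    using U_i_ge(3)[OF p] R by (intro mult_left_mono) (auto intro!: add_nonneg_nonneg mult_nonneg_nonneg)
  finally show "(\<integral>t. U p (Complex t y) * indicator {-R..R} t \<partial>lborel) \<le> (2 * R + (pi * (1 + (R + 1)\<^sup>2) + 8 * R * (1 + R\<^sup>2))) * U p \<i>"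
    by (simp add: distrib_right)
qed

lemma continuous_smoothed:
  fixes g :: "real \<Rightarrow> complex"
  assumes g: "continuous_on UNIV g" and R: "0 \<le> R" "\<And>t. R < \<bar>t\<bar> \<Longrightarrow> g t = 0" and y: "0 < y"
  shows "continuous_on Y (\<lambda>p. \<integral>t. U p (Complex t y) *\<^sub>R g t \<partial>lborel)"
proof -
  have c: "continuous_on (Y \<times> cbox (-R) R) (\<lambda>(p, t). U p (Complex t y) *\<^sub>R g t)"
  proof -
    have "continuous_on (Y \<times> cbox (-R) R) (\<lambda>z. U (fst z) (Complex (snd z) y))"
    proof (rule continuous_on_compose2[OF cont_U, where f = "\<lambda>z. (fst z, Complex (snd z) y)", unfolded prod.case])
      have "continuous_on (Y \<times> cbox (-R) R) (\<lambda>z. of_real (snd z) + \<i> * of_real y)" by (intro continuous_intros)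
      then have "continuous_on (Y \<times> cbox (-R) R) (\<lambda>z. Complex (snd z) y)" by (simp add: complex_eq_iff Complex_eq)
      then show "continuous_on (Y \<times> cbox (-R) R) (\<lambda>z. (fst z, Complex (snd z) y))"
        by (intro continuous_on_Pair continuous_on_fst continuous_on_id) auto
      show "(\<lambda>z. (fst z, Complex (snd z) y)) ` (Y \<times> cbox (-R) R) \<subseteq> Y \<times> {w. 0 < Im w}" using y by auto
    qed
    then show ?thesis unfolding split_beta'
      by (intro continuous_intros continuous_on_compose2[OF g]) auto
  qed
  have "continuous_on Y (\<lambda>p. integral (cbox (-R) R) (\<lambda>t. U p (Complex t y) *\<^sub>R g t))"
    by (rule integral_continuous_on_param[OF c])
  moreover have "integral (cbox (-R) R) (\<lambda>t. U p (Complex t y) *\<^sub>R g t) = (\<integral>t. U p (Complex t y) *\<^sub>R g t \<partial>lborel)" if p: "p \<in> Y" for p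
  proof -
    have cp: "continuous_on {-R..R} (\<lambda>t. U p (Complex t y) *\<^sub>R g t)"
    proof -
      have "continuous_on {-R..R} (\<lambda>t. (p, t))" by (intro continuous_on_Pair continuous_on_const continuous_on_id)
      from continuous_on_compose2[OF c this] p show ?thesis by auto
    qed
    then have "set_integrable lborel {-R..R} (\<lambda>t. U p (Complex t y) *\<^sub>R g t)"
      unfolding set_integrable_def by (intro borel_integrable_compact) auto
    then have I: "(\<integral>t. indicator {-R..R} t *\<^sub>R (U p (Complex t y) *\<^sub>R g t) \<partial>lborel) = integral {-R..R} (\<lambda>t. U p (Complex t y) *\<^sub>R g t)"
      using set_borel_integral_eq_integral(2) unfolding set_lebesgue_integral_def by blast
    have E: "indicator {-R..R} t *\<^sub>R (U p (Complex t y) *\<^sub>R g t) = U p (Complex t y) *\<^sub>R g t" for t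
      using R(2)[of t] by (cases "R < \<bar>t\<bar>") (auto simp: indicator_def abs_le_iff)
    show ?thesis using I unfolding E by simp
  qed
  ultimately show ?thesis by (simp cong: continuous_on_cong)
qed

text \<open>A locally uniform limit of continuous functions: near \<open>p0\<close> one has U p \<i>
  < U p0 \<i> + 1, so the relative error of \<open>boundary_value_uniform\<close> becomes
  absolute.\<close>

lemma continuous_boundary_value:
  fixes g :: "real \<Rightarrow> complex"
  assumes g: "continuous_on UNIV g" and R: "0 \<le> R" "\<And>t. R < \<bar>t\<bar> \<Longrightarrow> g t = 0"
  shows "continuous_on Y (boundary_value g)"
  unfolding continuous_on_iff
proof (intro ballI allI impI)
  fix p0 and e :: real assume p0: "p0 \<in> Y" and e: "0 < e"
  define m where "m = U p0 \<i> + 1"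
  have m: "0 < m" using U_i_ge(2)[OF p0] by (simp add: m_def)
  have em: "0 < e / (4 * m)" and em': "e / (4 * m) * m = e / 4" using e m by simp_all
  have "\<forall>\<^sub>F y in at_right 0. 0 < (y::real)" by (rule eventually_at_right_less)
  moreover have "\<forall>\<^sub>F y in at_right 0. \<forall>p\<in>Y. norm ((\<integral>t. U p (Complex t y) *\<^sub>R g t \<partial>lborel) - boundary_value g p) \<le> e / (4 * m) * U p \<i>"
    by (rule boundary_value_uniform[OF g R(1) _ em]) (use R(2) in auto)
  ultimately
  have "\<forall>\<^sub>F y in at_right 0. 0 < y \<and> (\<forall>p\<in>Y. norm ((\<integral>t. U p (Complex t y) *\<^sub>R g t \<partial>lborel) - boundary_value g p) \<le> e / (4 * m) * U p \<i>)"
    by eventually_elim auto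
  then obtain y where y: "0 < y" and unif: "\<And>p. p \<in> Y \<Longrightarrow> norm ((\<integral>t. U p (Complex t y) *\<^sub>R g t \<partial>lborel) - boundary_value g p) \<le> e / (4 * m) * U p \<i>"
    using eventually_happens'[OF trivial_limit_at_right_real] by blast
  let ?J = "\<lambda>p. \<integral>t. U p (Complex t y) *\<^sub>R g t \<partial>lborel"
  have "continuous_on Y ?J" by (rule continuous_smoothed[OF g R(1) _ y]) (use R(2) in auto)
  then obtain d1 where d1: "0 < d1" "\<And>p. p \<in> Y \<Longrightarrow> dist p p0 < d1 \<Longrightarrow> dist (?J p) (?J p0) < e / 4"
    unfolding continuous_on_iff using p0 e by (metis divide_pos_pos zero_less_numeral)
  have "continuous_on Y (\<lambda>p. U p \<i>)" by (rule cont_U_line) simp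
  then obtain d2 where d2: "0 < d2" "\<And>p. p \<in> Y \<Longrightarrow> dist p p0 < d2 \<Longrightarrow> dist (U p \<i>) (U p0 \<i>) < 1"
    unfolding continuous_on_iff using p0 by (metis zero_less_one)
  have "dist (boundary_value g p) (boundary_value g p0) < e" if p: "p \<in> Y" "dist p p0 < min d1 d2" for p
  proof -
    have "U p \<i> \<le> m" using d2(2)[OF p(1)] p(2) by (simp add: m_def dist_real_def)
    then have "e / (4 * m) * U p \<i> \<le> e / (4 * m) * m" using em by (intro mult_left_mono) auto
    then have 1: "dist (?J p) (boundary_value g p) \<le> e / 4"
      unfolding dist_norm using unif[OF p(1)] em' by linarith
    have "e / (4 * m) * U p0 \<i> \<le> e / (4 * m) * m" using em by (intro mult_left_mono) (auto simp: m_def)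
    then have 2: "dist (?J p0) (boundary_value g p0) \<le> e / 4"
      unfolding dist_norm using unif[OF p0] em' by linarith
    have 3: "dist (?J p) (?J p0) < e / 4" using d1(2)[OF p(1)] p(2) by simp
    have "dist (boundary_value g p) (boundary_value g p0) \<le> dist (?J p) (boundary_value g p) + dist (?J p) (?J p0) + dist (?J p0) (boundary_value g p0)"
      using dist_triangle[of "boundary_value g p" "boundary_value g p0" "?J p"] dist_triangle[of "?J p" "boundary_value g p0" "?J p0"]
      by (simp add: dist_commute)
    then show ?thesis using 1 2 3 e by linarith
  qed
  then show "\<exists>d>0. \<forall>p\<in>Y. dist p p0 < d \<longrightarrow> dist (boundary_value g p) (boundary_value g p0) < e"
    using d1(1) d2(1) by (intro exI[of _ "min d1 d2"]) auto
qed

text \<open>The variation of the test function is separated from that of the measure. Compactness of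
  [-R, R] makes \<open>g p\<close> uniformly close to \<open>g p0\<close>, which costs only the mass
  of \<open>\<tau> p\<close>, bounded near \<open>p0\<close>; the rest is continuity for the fixed
  function \<open>g p0\<close>.\<close>

lemma continuous_boundary_value_param:
  fixes g :: "'z \<Rightarrow> real \<Rightarrow> complex"
  assumes g: "continuous_on (Y \<times> UNIV) (\<lambda>(p, t). g p t)" and R: "0 \<le> R" "\<And>p t. p \<in> Y \<Longrightarrow> R < \<bar>t\<bar> \<Longrightarrow> g p t = 0"
  shows "continuous_on Y (\<lambda>p. boundary_value (g p) p)"
  unfolding continuous_on_iff
proof (intro ballI allI impI)
  fix p0 and e :: real assume p0: "p0 \<in> Y" and e: "0 < e"
  have cg: "continuous_on UNIV (g p)" if "p \<in> Y" for p
  proof -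
    have "continuous_on UNIV (\<lambda>t. (p, t :: real))" by (intro continuous_on_Pair continuous_on_const continuous_on_id)
    from continuous_on_compose2[OF g this] that show ?thesis by auto
  qed
  define m where "m = U p0 \<i> + 1"
  have m: "0 < m" using U_i_ge(2)[OF p0] by (simp add: m_def)
  define c where "c = pi * (1 + R\<^sup>2)"
  have c: "0 < c" by (simp add: c_def add_pos_nonneg)
  define \<eta> where "\<eta> = e / (2 * (c * m))"
  have \<eta>: "0 < \<eta>" "c * \<eta> * m = e / 2" using e c m by (simp_all add: \<eta>_def)
  have "continuous_on (Y \<times> {-R..R}) (\<lambda>(p, t). g p t)" by (rule continuous_on_subset[OF g]) auto
  then obtain X0 where X0: "p0 \<in> X0" "open X0"
      "\<And>p t. p \<in> X0 \<inter> Y \<Longrightarrow> t \<in> {-R..R} \<Longrightarrow> dist (g p t) (g p0 t) \<le> \<eta>"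
    using continuous_on_prod_compactE[of Y "{-R..R}" "\<lambda>(p, t). g p t" p0 \<eta>] p0 \<eta>(1)
    unfolding prod.case by (metis compact_Icc)
  obtain d0 where d0: "0 < d0" "ball p0 d0 \<subseteq> X0" using X0(1,2) openE by blast
  have "continuous_on Y (boundary_value (g p0))"
    by (rule continuous_boundary_value[OF cg[OF p0] R(1)]) (use R(2) p0 in auto)
  then obtain d1 where d1: "0 < d1" "\<And>p. p \<in> Y \<Longrightarrow> dist p p0 < d1 \<Longrightarrow> dist (boundary_value (g p0) p) (boundary_value (g p0) p0) < e / 2"
    unfolding continuous_on_iff using p0 e by (metis half_gt_zero)
  have "continuous_on Y (\<lambda>p. U p \<i>)" by (rule cont_U_line) simp
  then obtain d2 where d2: "0 < d2" "\<And>p. p \<in> Y \<Longrightarrow> dist p p0 < d2 \<Longrightarrow> dist (U p \<i>) (U p0 \<i>) < 1"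
    unfolding continuous_on_iff using p0 by (metis zero_less_one)
  have "dist (boundary_value (g p) p) (boundary_value (g p0) p0) < e" if p: "p \<in> Y" "dist p p0 < min d0 (min d1 d2)" for p
  proof -
    interpret finite_measure "\<tau> p" by (rule fin[OF p(1)])
    have [measurable_cong]: "sets (\<tau> p) = sets borel" by (rule sets_tau[OF p(1)])
    have [measurable]: "g p \<in> borel_measurable borel" "g p0 \<in> borel_measurable borel"
      using cg p(1) p0 by (auto intro: borel_measurable_continuous_onI)
    have pX: "p \<in> X0 \<inter> Y" using p d0(2) by (auto simp: dist_commute)
    have diff: "norm (g p t - g p0 t) \<le> \<eta>" for t
      using X0(3)[OF pX, of t] R(2)[OF p(1), of t] R(2)[OF p0, of t] \<eta>(1)
      by (cases "R < \<bar>t\<bar>") (auto simp: dist_norm abs_le_iff not_less)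
    have wb: "norm ((pi * (1 + s\<^sup>2)) *\<^sub>R (g p s - g p0 s)) \<le> c * \<eta>" for s
      unfolding c_def by (rule weighted_bounded[OF less_imp_le[OF \<eta>(1)], of "\<lambda>t. g p t - g p0 t"]) (use diff R(2) p(1) p0 in auto)
    have i: "integrable (\<tau> p) (\<lambda>s. (pi * (1 + s\<^sup>2)) *\<^sub>R g q s)" if q: "q \<in> Y" for q
    proof -
      obtain B where B: "0 < B" "\<And>t. norm (g q t) \<le> B"
        by (rule compact_support_bounded[OF cg[OF q], of R]) (use R(2) q in auto)
      have [measurable]: "g q \<in> borel_measurable borel" using cg[OF q] by (rule borel_measurable_continuous_onI)
      show ?thesis
        by (rule integrable_bounded[OF p(1) _ weighted_bounded[OF less_imp_le[OF B(1)] B(2), of R]]) (use R(2) q in auto)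
    qed
    have "boundary_value (g p) p - boundary_value (g p0) p = (\<integral>s. (pi * (1 + s\<^sup>2)) *\<^sub>R (g p s - g p0 s) \<partial>\<tau> p)"
      unfolding boundary_value_def scaleR_diff_right by (rule Bochner_Integration.integral_diff[OF i[OF p(1)] i[OF p0], symmetric])
    also have "norm \<dots> \<le> (\<integral>s. c * \<eta> \<partial>\<tau> p)"
      by (rule Bochner_Integration.integral_norm_bound_integral) (use i[OF p(1)] i[OF p0] wb in \<open>auto simp: scaleR_diff_right\<close>)
    also have "\<dots> = c * \<eta> * measure (\<tau> p) UNIV" using space_tau[OF p(1)] by simp
    also have "\<dots> \<le> c * \<eta> * m"
      using U_i_ge(3)[OF p(1)] d2(2)[OF p(1)] p(2) c \<eta>(1) by (intro mult_left_mono) (auto simp: m_def dist_real_def)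
    finally have "dist (boundary_value (g p) p) (boundary_value (g p0) p) \<le> e / 2" unfolding \<eta>(2) dist_norm .
    moreover have "dist (boundary_value (g p0) p) (boundary_value (g p0) p0) < e / 2" using d1(2)[OF p(1)] p(2) by simp
    ultimately show ?thesis
      using dist_triangle[of "boundary_value (g p) p" "boundary_value (g p0) p0" "boundary_value (g p0) p"] by linarith
  qed
  then show "\<exists>d>0. \<forall>p\<in>Y. dist p p0 < d \<longrightarrow> dist (boundary_value (g p) p) (boundary_value (g p0) p0) < e"
    using d0(1) d1(1) d2(1) by (intro exI[of _ "min d0 (min d1 d2)"]) auto
qed

definition cutoff :: "nat \<Rightarrow> real \<Rightarrow> real" where "cutoff n s = max 0 (min 1 (real n + 1 - \<bar>s\<bar>))"

lemma cutoff: "0 \<le> cutoff n s" "cutoff n s \<le> 1" "real n + 1 < \<bar>s\<bar> \<Longrightarrow> cutoff n s = 0" "continuous_on UNIV (cutoff n)"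
  unfolding cutoff_def by (auto intro!: continuous_intros)

lemma cutoff_tendsto: "(\<lambda>n. cutoff n s) \<longlonglongrightarrow> 1"
proof -
  obtain N where N: "\<bar>s\<bar> < real N" using reals_Archimedean2 by blast
  have "\<forall>\<^sub>F n in sequentially. cutoff n s = 1"
    using eventually_ge_at_top[of N] by eventually_elim (use N in \<open>auto simp: cutoff_def\<close>)
  then show ?thesis by (rule tendsto_eventually)
qed

text \<open>Dividing the test function by the weight pi (1 + s^2) turns boundary values into plain
  integrals against \<open>\<tau> p\<close>.\<close>

lemma continuous_integral_cutoff:
  fixes b :: "real \<Rightarrow> complex"
  assumes b: "continuous_on UNIV b"
  shows "continuous_on Y (\<lambda>p. \<integral>s. cutoff n s *\<^sub>R b s \<partial>\<tau> p)"
proof -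
  define g where "g s = (cutoff n s / (pi * (1 + s\<^sup>2))) *\<^sub>R b s" for s
  have p: "pi * (1 + s\<^sup>2) \<noteq> 0" for s :: real using pi_gt_zero by (simp add: add_nonneg_eq_0_iff)
  have "continuous_on Y (boundary_value g)"
  proof (rule continuous_boundary_value)
    show "continuous_on UNIV g" unfolding g_def by (intro continuous_intros b cutoff) (use p in auto)
    show "0 \<le> real n + 1" by simp
    show "g t = 0" if "real n + 1 < \<bar>t\<bar>" for t using cutoff(3)[OF that] by (simp add: g_def)
  qed
  moreover have "boundary_value g = (\<lambda>p. \<integral>s. cutoff n s *\<^sub>R b s \<partial>\<tau> p)"
    unfolding boundary_value_def g_def using p by simp
  ultimately show ?thesis by simp
qed

text \<open>The defect \<open>def n p\<close> is the integral of 1 minus the cutoff. As the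
  difference of the total mass and an integral of a compactly supported function it is continuous in
  p. For large n it is small at \<open>p0\<close>, hence also near \<open>p0\<close>, so the tails
  are controlled uniformly in a neighbourhood.\<close>

proposition continuous_integral_bounded:
  fixes b :: "real \<Rightarrow> complex"
  assumes b: "continuous_on UNIV b" and B: "\<And>s. norm (b s) \<le> B"
  shows "continuous_on Y (\<lambda>p. \<integral>s. b s \<partial>\<tau> p)"
  unfolding continuous_on_iff
proof (intro ballI allI impI)
  fix p0 and e :: real assume p0: "p0 \<in> Y" and e: "0 < e"
  have B0: "0 \<le> B" using B[of 0] norm_ge_zero order_trans by blast
  have [measurable]: "b \<in> borel_measurable borel" using b by (rule borel_measurable_continuous_onI)
  have [measurable]: "cutoff n \<in> borel_measurable borel" for n using cutoff(4) by (rule borel_measurable_continuous_onI)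
  define def where "def n p = measure (\<tau> p) UNIV - Re (\<integral>s. cutoff n s *\<^sub>R (1::complex) \<partial>\<tau> p)" for n p
  have def_eq: "def n p = (\<integral>s. 1 - cutoff n s \<partial>\<tau> p)" if p: "p \<in> Y" for n p
  proof -
    interpret finite_measure "\<tau> p" by (rule fin[OF p])
    have [measurable_cong]: "sets (\<tau> p) = sets borel" by (rule sets_tau[OF p])
    have ic: "integrable (\<tau> p) (cutoff n)"
      by (rule integrable_const_bound[of _ 1]) (use cutoff(1,2) in auto)
    have "(\<integral>s. cutoff n s *\<^sub>R (1::complex) \<partial>\<tau> p) = of_real (\<integral>s. cutoff n s \<partial>\<tau> p)"
      by (simp add: scaleR_conv_of_real)
    then show ?thesis unfolding def_def using ic space_tau[OF p] by simp
  qed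
  have diff: "norm ((\<integral>s. b s \<partial>\<tau> p) - (\<integral>s. cutoff n s *\<^sub>R b s \<partial>\<tau> p)) \<le> B * def n p" if p: "p \<in> Y" for n p
  proof -
    interpret finite_measure "\<tau> p" by (rule fin[OF p])
    have [measurable_cong]: "sets (\<tau> p) = sets borel" by (rule sets_tau[OF p])
    have cb: "norm (cutoff n s *\<^sub>R b s) \<le> 1 * B" for s
      unfolding norm_scaleR using cutoff(1,2)[of n s] B by (intro mult_mono) auto
    have i: "integrable (\<tau> p) b" "integrable (\<tau> p) (\<lambda>s. cutoff n s *\<^sub>R b s)"
      by (rule integrable_bounded[OF p _ B], simp) (rule integrable_bounded[OF p _ cb], simp)
    have ic: "integrable (\<tau> p) (\<lambda>s. B * (1 - cutoff n s))"
      by (rule integrable_const_bound[of _ B]) (use cutoff(1,2) B0 in \<open>auto simp: abs_mult mult_left_le\<close>)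
    have "norm (\<integral>s. b s - cutoff n s *\<^sub>R b s \<partial>\<tau> p) \<le> (\<integral>s. B * (1 - cutoff n s) \<partial>\<tau> p)"
    proof (rule Bochner_Integration.integral_norm_bound_integral)
      fix s
      have "b s - cutoff n s *\<^sub>R b s = (1 - cutoff n s) *\<^sub>R b s" by (simp add: scaleR_diff_left)
      then have "norm (b s - cutoff n s *\<^sub>R b s) = (1 - cutoff n s) * norm (b s)" using cutoff(2)[of n s] by simp
      also have "\<dots> \<le> (1 - cutoff n s) * B" using cutoff(2)[of n s] B by (intro mult_left_mono) auto
      finally show "norm (b s - cutoff n s *\<^sub>R b s) \<le> B * (1 - cutoff n s)" by (simp add: mult.commute)
    qed (use i ic in auto)
    then show ?thesis using i def_eq[OF p] by simp
  qed
  have "(\<lambda>n. \<integral>s. 1 - cutoff n s \<partial>\<tau> p0) \<longlonglongrightarrow> (\<integral>s. 0 \<partial>\<tau> p0)"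
  proof -
    interpret finite_measure "\<tau> p0" by (rule fin[OF p0])
    have [measurable_cong]: "sets (\<tau> p0) = sets borel" by (rule sets_tau[OF p0])
    show ?thesis
    proof (rule integral_dominated_convergence[where w = "\<lambda>_. 1"])
      show "AE s in \<tau> p0. (\<lambda>n. 1 - cutoff n s) \<longlonglongrightarrow> 0"
        using tendsto_diff[OF tendsto_const cutoff_tendsto, of 1] by simp
      show "AE s in \<tau> p0. norm (1 - cutoff n s) \<le> 1" for n using cutoff(1,2) by auto
    qed auto
  qed
  then have "(\<lambda>n. def n p0) \<longlonglongrightarrow> 0" using def_eq[OF p0] by simp
  then have "\<forall>\<^sub>F n in sequentially. def n p0 < e / (8 * (B + 1))" using e B0 by (intro order_tendstoD(2)) auto
  then obtain n where n: "def n p0 < e / (8 * (B + 1))" by (metis eventually_happens sequentially_bot)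
  have "continuous_on Y (\<lambda>p. U p \<i> - a - Re (\<integral>s. cutoff n s *\<^sub>R (1::complex) \<partial>\<tau> p))"
    by (intro continuous_intros cont_U_line continuous_integral_cutoff) auto
  then have "continuous_on Y (def n)"
    by (rule continuous_on_cong[THEN iffD1, rotated 2]) (auto simp: def_def mass)
  moreover have e8: "0 < e / (8 * (B + 1))" using e B0 by simp
  ultimately obtain d1 where d1: "0 < d1" "\<And>p. p \<in> Y \<Longrightarrow> dist p p0 < d1 \<Longrightarrow> dist (def n p) (def n p0) < e / (8 * (B + 1))"
    unfolding continuous_on_iff using p0 by metis
  obtain d2 where d2: "0 < d2" "\<And>p. p \<in> Y \<Longrightarrow> dist p p0 < d2 \<Longrightarrow>
      dist (\<integral>s. cutoff n s *\<^sub>R b s \<partial>\<tau> p) (\<integral>s. cutoff n s *\<^sub>R b s \<partial>\<tau> p0) < e / 4"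
    using continuous_integral_cutoff[OF b, of n] p0 e unfolding continuous_on_iff by (metis divide_pos_pos zero_less_numeral)
  have small: "B * x \<le> e / 4" if "x \<le> 2 * (e / (8 * (B + 1)))" for x
  proof -
    have "B * x \<le> B * (2 * (e / (8 * (B + 1))))" using that B0 by (rule mult_left_mono)
    also have "\<dots> \<le> (B + 1) * (2 * (e / (8 * (B + 1))))" using e B0 by (intro mult_right_mono) auto
    also have "\<dots> = e / 4"
    proof -
      have "l * (2 * (e / (8 * l))) = e / 4" if "l \<noteq> 0" for l :: real using that by simp
      from this[of "B + 1"] B0 show ?thesis by linarith
    qed
    finally show ?thesis .
  qed
  have "dist (\<integral>s. b s \<partial>\<tau> p) (\<integral>s. b s \<partial>\<tau> p0) < e" if p: "p \<in> Y" "dist p p0 < min d1 d2" for p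
  proof -
    have dp: "def n p \<le> 2 * (e / (8 * (B + 1)))" using d1(2)[OF p(1)] p(2) n by (simp add: dist_real_def)
    have dp0: "def n p0 \<le> 2 * (e / (8 * (B + 1)))" using n e8 by simp
    have "dist (\<integral>s. b s \<partial>\<tau> p) (\<integral>s. cutoff n s *\<^sub>R b s \<partial>\<tau> p) \<le> e / 4"
      unfolding dist_norm by (rule order_trans[OF diff[OF p(1)] small[OF dp]])
    moreover have "dist (\<integral>s. b s \<partial>\<tau> p0) (\<integral>s. cutoff n s *\<^sub>R b s \<partial>\<tau> p0) \<le> e / 4"
      unfolding dist_norm by (rule order_trans[OF diff[OF p0] small[OF dp0]])
    moreover have "dist (\<integral>s. cutoff n s *\<^sub>R b s \<partial>\<tau> p) (\<integral>s. cutoff n s *\<^sub>R b s \<partial>\<tau> p0) < e / 4"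
      using d2(2)[OF p(1)] p(2) by simp
    ultimately show ?thesis
      using dist_triangle[of "\<integral>s. b s \<partial>\<tau> p" "\<integral>s. b s \<partial>\<tau> p0" "\<integral>s. cutoff n s *\<^sub>R b s \<partial>\<tau> p"]
        dist_triangle[of "\<integral>s. cutoff n s *\<^sub>R b s \<partial>\<tau> p" "\<integral>s. b s \<partial>\<tau> p0" "\<integral>s. cutoff n s *\<^sub>R b s \<partial>\<tau> p0"] e
      by (simp add: dist_commute)
  qed
  then show "\<exists>d>0. \<forall>p\<in>Y. dist p p0 < d \<longrightarrow> dist (\<integral>s. b s \<partial>\<tau> p) (\<integral>s. b s \<partial>\<tau> p0) < e"
    using d1(1) d2(1) by (intro exI[of _ "min d1 d2"]) auto
qed

text \<open>Binding a family of measures requires subprobability measures. Adding 1 to the mass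
  keeps the denominator positive even when \<open>\<tau> p\<close> is 0; the normalisation is undone
  later by a density.\<close>

definition kernel :: "'z \<Rightarrow> real measure" where
  "kernel p = density (\<tau> p) (\<lambda>_. ennreal (1 / (1 + measure (\<tau> p) UNIV)))"

lemma emeasure_kernel:
  assumes p: "p \<in> Y" and A: "A \<in> sets borel"
  shows "emeasure (kernel p) A = ennreal (measure (\<tau> p) A / (1 + measure (\<tau> p) UNIV))"
proof -
  interpret finite_measure "\<tau> p" by (rule fin[OF p])
  have "A \<in> sets (\<tau> p)" using A sets_tau[OF p] by simp
  then have "emeasure (kernel p) A = ennreal (1 / (1 + measure (\<tau> p) UNIV)) * ennreal (measure (\<tau> p) A)"
    unfolding kernel_def by (subst emeasure_density_const) (auto simp: emeasure_eq_measure)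
  then show ?thesis by (simp add: ennreal_mult[symmetric] add_nonneg_nonneg)
qed

text \<open>Open sets form an intersection-stable generator. The measure of an open set
  \<open>A\<close> is the limit of the integrals of the continuous functions min(1, n dist(s, -A)),
  each of which depends continuously on p.\<close>

lemma measurable_kernel: "kernel \<in> restrict_space borel Y \<rightarrow>\<^sub>M subprob_algebra borel"
proof -
  have meas_open: "(\<lambda>p. measure (\<tau> p) A) \<in> borel_measurable (restrict_space borel Y)" if A: "open A" for A
  proof (cases "A = UNIV")
    \<comment> \<open>The complement of \<open>UNIV\<close> is empty and \<open>infdist\<close> to
      the empty set is 0 by convention, so the approximation used for other open sets would vanish;
      the mass formula replaces it.\<close>
    case True
    have "continuous_on Y (\<lambda>p. U p \<i> - a)" by (intro continuous_intros cont_U_line) simp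
    then have "continuous_on Y (\<lambda>p. measure (\<tau> p) A)"
      by (rule continuous_on_cong[THEN iffD1, rotated 2]) (auto simp: True mass)
    then show ?thesis by (rule borel_measurable_continuous_on_restrict)
  next
    case False
    define b where "b n s = min 1 (real n * infdist s (- A))" for n s
    have b01: "0 \<le> b n s" "b n s \<le> 1" for n s by (auto simp: b_def infdist_nonneg)
    have bc: "continuous_on UNIV (b n)" for n unfolding b_def by (intro continuous_intros)
    have lim: "(\<lambda>n. b n s) \<longlonglongrightarrow> indicator A s" for s
    proof (cases "s \<in> A")
      case True
      have "0 < infdist s (- A)"
        using True A False by (metis ComplD closed_Compl in_closed_iff_infdist_zero infdist_nonneg less_le Compl_empty_eq double_complement)
      then obtain N where N: "1 < real N * infdist s (- A)" using ex_less_of_nat_mult by blast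
      have "\<forall>\<^sub>F n in sequentially. b n s = 1"
        using eventually_ge_at_top[of N]
      proof eventually_elim
        case (elim n)
        have "real N * infdist s (- A) \<le> real n * infdist s (- A)" using elim by (intro mult_right_mono infdist_nonneg) auto
        then show ?case using N by (simp add: b_def)
      qed
      then show ?thesis using True by (simp add: tendsto_eventually)
    next
      case False
      then have "b n s = 0" for n by (simp add: b_def)
      then show ?thesis using False by simp
    qed
    have "(\<lambda>p. Re (\<integral>s. complex_of_real (b n s) \<partial>\<tau> p)) \<in> borel_measurable (restrict_space borel Y)" for n
    proof (rule borel_measurable_continuous_on_restrict)
      have "continuous_on UNIV (\<lambda>s. complex_of_real (b n s))" by (intro continuous_intros bc)
      from continuous_integral_bounded[OF this, of 1] b01
      show "continuous_on Y (\<lambda>p. Re (\<integral>s. complex_of_real (b n s) \<partial>\<tau> p))" by (intro continuous_intros) auto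
    qed
    then show ?thesis
    proof (rule borel_measurable_LIMSEQ_real[rotated])
      fix p assume "p \<in> space (restrict_space borel Y)"
      then have p: "p \<in> Y" by (simp add: space_restrict_space)
      interpret finite_measure "\<tau> p" by (rule fin[OF p])
      have [measurable_cong]: "sets (\<tau> p) = sets borel" by (rule sets_tau[OF p])
      have [measurable]: "b n \<in> borel_measurable borel" for n using bc by (rule borel_measurable_continuous_onI)
      have "(\<lambda>n. \<integral>s. b n s \<partial>\<tau> p) \<longlonglongrightarrow> (\<integral>s. indicator A s \<partial>\<tau> p)"
        by (rule integral_dominated_convergence[where w = "\<lambda>_. 1"]) (use lim b01 borel_open[OF A] in \<open>auto simp: abs_le_iff\<close>)
      then show "(\<lambda>n. Re (\<integral>s. complex_of_real (b n s) \<partial>\<tau> p)) \<longlonglongrightarrow> measure (\<tau> p) A"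
        using space_tau[OF p] by simp
    qed
  qed
  have gen: "sets (borel :: real measure) = sigma_sets UNIV (Collect open)"
    by (simp add: borel_def)
  show ?thesis
  proof (rule measurable_subprob_algebra_generated[OF gen])
    show "Int_stable (Collect open :: real set set)" by (auto simp: Int_stable_def)
    fix p assume "p \<in> space (restrict_space borel Y)"
    then have p: "p \<in> Y" by (simp add: space_restrict_space)
    show "sets (kernel p) = sets borel" using sets_tau[OF p] by (simp add: kernel_def)
    have UNIV_borel: "UNIV \<in> sets (borel :: real measure)" by simp
    show "subprob_space (kernel p)"
    proof
      have "emeasure (kernel p) UNIV \<le> 1"
        unfolding emeasure_kernel[OF p UNIV_borel] ennreal_le_1
        using measure_nonneg[of "\<tau> p" UNIV] by (simp add: divide_le_eq_1 add_pos_nonneg)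
      then show "emeasure (kernel p) (space (kernel p)) \<le> 1" using space_tau[OF p] by (simp add: kernel_def)
      show "space (kernel p) \<noteq> {}" using space_tau[OF p] by (simp add: kernel_def)
    qed
  next
    have open_meas: "(\<lambda>p. emeasure (kernel p) A) \<in> borel_measurable (restrict_space borel Y)" if "open A" for A
    proof (subst measurable_cong)
      show "emeasure (kernel p) A = ennreal (measure (\<tau> p) A / (1 + measure (\<tau> p) UNIV))" if "p \<in> space (restrict_space borel Y)" for p
        using that \<open>open A\<close> by (intro emeasure_kernel) (auto simp: space_restrict_space)
      note [measurable] = meas_open[OF \<open>open A\<close>] meas_open[OF open_UNIV]
      show "(\<lambda>p. ennreal (measure (\<tau> p) A / (1 + measure (\<tau> p) UNIV))) \<in> borel_measurable (restrict_space borel Y)"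
        by measurable
    qed
    show "(\<lambda>p. emeasure (kernel p) A) \<in> borel_measurable (restrict_space borel Y)" if "A \<in> Collect open" for A
      using that by (intro open_meas) auto
    show "(\<lambda>p. emeasure (kernel p) UNIV) \<in> borel_measurable (restrict_space borel Y)"
      by (rule open_meas) simp
  qed auto
qed

end

section \<open>Disintegrations\<close>

lemma measurable_completion_AE:
  assumes g': "g' \<in> M \<rightarrow>\<^sub>M N" and ae: "AE x in M. g x = g' x" and g: "g \<in> space M \<rightarrow> space N"
  shows "g \<in> completion M \<rightarrow>\<^sub>M N"
proof (rule measurableI)
  fix A assume A: "A \<in> sets N"
  obtain Z where Z: "{x \<in> space M. g x \<noteq> g' x} \<subseteq> Z" "Z \<in> null_sets M"
    using ae unfolding eventually_ae_filter by auto
  have "g -` A \<inter> space M = (g' -` A \<inter> space M - Z) \<union> (g -` A \<inter> space M \<inter> Z)"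
    using Z(1) by auto
  moreover have "g' -` A \<inter> space M - Z \<in> sets (completion M)"
    by (intro sets_completionI_sets sets.Diff null_setsD2 Z(2) measurable_sets[OF g' A])
  moreover have "g -` A \<inter> space M \<inter> Z \<in> sets (completion M)"
    by (rule null_sets_completion[OF Z(2)]) auto
  ultimately show "g -` A \<inter> space (completion M) \<in> sets (completion M)"
    unfolding space_completion by (metis sets.Un)
qed (use g in auto)

lemma integral_completion_AE:
  fixes g g' :: "'a \<Rightarrow> 'b::{banach, second_countable_topology}"
  assumes g': "integrable M g'" and ae: "AE x in M. g x = g' x"
  shows "integrable (completion M) g" "integral\<^sup>L (completion M) g = integral\<^sup>L M g'"
proof -
  have m': "g' \<in> borel_measurable M" using g' by auto
  have m: "g \<in> borel_measurable (completion M)" by (rule measurable_completion_AE[OF m' ae]) auto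
  have i: "integrable (completion M) g'" using g' integrable_completion[OF m'] by simp
  have ae': "AE x in completion M. g x = g' x" using ae by (rule AE_completion)
  show "integrable (completion M) g"
    using integrable_cong_AE[OF m measurable_completion[OF m'] ae'] i by simp
  have "integral\<^sup>L (completion M) g = integral\<^sup>L (completion M) g'"
    by (rule integral_cong_AE[OF m measurable_completion[OF m'] ae'])
  then show "integral\<^sup>L (completion M) g = integral\<^sup>L M g'" using integral_completion[OF m'] by simp
qed

text \<open>The assumptions concern nonnegative functions measurable for the uncompleted measure.
  The definition of a disintegration asks for complex functions that are integrable for the
  completions, and the lemmas below bridge the two.\<close>

locale measure_disintegration =
  fixes \<mu> :: "'x measure" and \<nu> :: "'y measure" and M :: "'y \<Rightarrow> 'x measure"
  assumes sets_M: "\<And>y. y \<in> space \<nu> \<Longrightarrow> sets (M y) = sets \<mu>"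
    and nn_measurable: "\<And>F :: 'x \<Rightarrow> ennreal. F \<in> borel_measurable \<mu> \<Longrightarrow> (\<lambda>y. \<integral>\<^sup>+x. F x \<partial>M y) \<in> borel_measurable \<nu>"
    and nn_integral_eq: "\<And>F :: 'x \<Rightarrow> ennreal. F \<in> borel_measurable \<mu> \<Longrightarrow> (\<integral>\<^sup>+x. F x \<partial>\<mu>) = (\<integral>\<^sup>+y. \<integral>\<^sup>+x. F x \<partial>M y \<partial>\<nu>)"
begin

lemma AE_fibres:
  assumes "AE x in \<mu>. P x"
  shows "AE y in \<nu>. AE x in M y. P x"
proof -
  obtain N where N: "{x \<in> space \<mu>. \<not> P x} \<subseteq> N" "N \<in> null_sets \<mu>"
    using assms unfolding eventually_ae_filter by auto
  have m: "(indicator N :: _ \<Rightarrow> ennreal) \<in> borel_measurable \<mu>" using N(2) by auto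
  have "(\<integral>\<^sup>+y. \<integral>\<^sup>+x. indicator N x \<partial>M y \<partial>\<nu>) = 0"
    using nn_integral_eq[OF m] N(2) by (simp add: null_setsD1 null_setsD2)
  then have "AE y in \<nu>. (\<integral>\<^sup>+x. indicator N x \<partial>M y) = 0"
    using nn_integral_0_iff_AE[OF nn_measurable[OF m]] by simp
  then show ?thesis using AE_space
  proof eventually_elim
    case (elim y)
    note 0 = elim(1) and y = elim(2)
    have sN: "N \<in> sets (M y)" using N(2) sets_M[OF y] by auto
    then have "N \<in> null_sets (M y)" using 0 by (auto simp: null_sets_def)
    moreover have "{x \<in> space (M y). \<not> P x} \<subseteq> N" using N(1) sets_eq_imp_space_eq[OF sets_M[OF y]] by simp
    ultimately show ?case by (rule AE_I')
  qed
qed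

lemma integral_nonneg_fibres:
  fixes F :: "'x \<Rightarrow> ennreal"
  assumes F: "F \<in> borel_measurable \<mu>" and fin: "(\<integral>\<^sup>+x. F x \<partial>\<mu>) < \<infinity>"
  shows "AE y in \<nu>. (\<integral>\<^sup>+x. F x \<partial>M y) < \<infinity>"
    and "integrable \<nu> (\<lambda>y. enn2real (\<integral>\<^sup>+x. F x \<partial>M y))"
    and "(\<integral>y. enn2real (\<integral>\<^sup>+x. F x \<partial>M y) \<partial>\<nu>) = enn2real (\<integral>\<^sup>+x. F x \<partial>\<mu>)"
proof -
  note m = nn_measurable[OF F] and eq = nn_integral_eq[OF F]
  show ae: "AE y in \<nu>. (\<integral>\<^sup>+x. F x \<partial>M y) < \<infinity>"
    using nn_integral_PInf_AE[OF m] fin unfolding eq by (auto simp: less_top)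
  have "(\<integral>\<^sup>+y. ennreal (enn2real (\<integral>\<^sup>+x. F x \<partial>M y)) \<partial>\<nu>) = (\<integral>\<^sup>+y. \<integral>\<^sup>+x. F x \<partial>M y \<partial>\<nu>)"
    by (rule nn_integral_cong_AE) (use ae in \<open>eventually_elim; simp add: less_top\<close>)
  then have e: "(\<integral>\<^sup>+y. ennreal (enn2real (\<integral>\<^sup>+x. F x \<partial>M y)) \<partial>\<nu>) = (\<integral>\<^sup>+x. F x \<partial>\<mu>)" using eq by simp
  have m': "(\<lambda>y. enn2real (\<integral>\<^sup>+x. F x \<partial>M y)) \<in> borel_measurable \<nu>" using m by measurable
  show "integrable \<nu> (\<lambda>y. enn2real (\<integral>\<^sup>+x. F x \<partial>M y))"
    by (rule integrableI_nonneg[OF m']) (use e fin in auto)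
  show "(\<integral>y. enn2real (\<integral>\<^sup>+x. F x \<partial>M y) \<partial>\<nu>) = enn2real (\<integral>\<^sup>+x. F x \<partial>\<mu>)"
    by (subst integral_eq_nn_integral[OF m']) (use e in auto)
qed

text \<open>\<open>J\<close> equals the fibre integral only almost everywhere: where
  \<open>k\<close> is not integrable for \<open>M y\<close> the integral is 0 by convention, while
  \<open>J\<close>, a difference of two truncated nonnegative integrals, need not be.\<close>

lemma integral_real_fibres:
  fixes k :: "'x \<Rightarrow> real"
  assumes k: "integrable \<mu> k"
  obtains J where "AE y in \<nu>. integrable (M y) k" "integrable \<nu> J" "AE y in \<nu>. (\<integral>x. k x \<partial>M y) = J y"
    "(\<integral>y. J y \<partial>\<nu>) = (\<integral>x. k x \<partial>\<mu>)"
proof -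
  have km: "k \<in> borel_measurable \<mu>" using k by auto
  have P: "(\<lambda>x. ennreal (k x)) \<in> borel_measurable \<mu>" "(\<lambda>x. ennreal (- k x)) \<in> borel_measurable \<mu>"
    using km by measurable
  have fin: "(\<integral>\<^sup>+x. ennreal (k x) \<partial>\<mu>) < \<infinity>" "(\<integral>\<^sup>+x. ennreal (- k x) \<partial>\<mu>) < \<infinity>"
    using k unfolding real_integrable_def by (auto simp: less_top)
  note A = integral_nonneg_fibres[OF P(1) fin(1)] and B = integral_nonneg_fibres[OF P(2) fin(2)]
  let ?J = "\<lambda>y. enn2real (\<integral>\<^sup>+x. ennreal (k x) \<partial>M y) - enn2real (\<integral>\<^sup>+x. ennreal (- k x) \<partial>M y)"
  have i: "AE y in \<nu>. integrable (M y) k"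
    using A(1) B(1) AE_space
  proof eventually_elim
    case (elim y)
    have "k \<in> borel_measurable (M y)" using km measurable_cong_sets[OF sets_M[OF elim(3)] refl] by blast
    then show ?case using elim unfolding real_integrable_def by (auto simp: less_top)
  qed
  show ?thesis
  proof (rule that[OF i])
    show "integrable \<nu> ?J" by (intro Bochner_Integration.integrable_diff A B)
    show "AE y in \<nu>. (\<integral>x. k x \<partial>M y) = ?J y"
      using i by eventually_elim (rule real_lebesgue_integral_def)
    show "(\<integral>y. ?J y \<partial>\<nu>) = (\<integral>x. k x \<partial>\<mu>)"
      using A B by (simp add: real_lebesgue_integral_def[OF k])
  qed
qed

text \<open>A completion-integrable \<open>g\<close> agrees off a null set with a version
  \<open>g'\<close> measurable for \<mu> itself. By \<open>AE_fibres\<close> this set is null in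
  almost every fibre too, so both integrals can be computed with \<open>g'\<close>.\<close>

proposition integral_fibres:
  fixes g :: "'x \<Rightarrow> complex"
  assumes g: "integrable (completion \<mu>) g"
  shows "AE y in \<nu>. integrable (completion (M y)) g"
    and "integrable (completion \<nu>) (\<lambda>y. \<integral>x. g x \<partial>completion (M y))"
    and "(\<integral>x. g x \<partial>completion \<mu>) = (\<integral>y. (\<integral>x. g x \<partial>completion (M y)) \<partial>completion \<nu>)"
proof -
  have mR: "(\<lambda>x. Re (g x)) \<in> borel_measurable (completion \<mu>)" "(\<lambda>x. Im (g x)) \<in> borel_measurable (completion \<mu>)"
    using borel_measurable_integrable[OF integrable_Re[OF g]] borel_measurable_integrable[OF integrable_Im[OF g]] by simp_all
  obtain r where rm: "r \<in> borel_measurable \<mu>" "AE x in \<mu>. Re (g x) = r x"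
    using completion_ex_borel_measurable_real[OF mR(1)] by blast
  obtain s where sm: "s \<in> borel_measurable \<mu>" "AE x in \<mu>. Im (g x) = s x"
    using completion_ex_borel_measurable_real[OF mR(2)] by blast
  have ir: "integrable \<mu> r"
    using integrable_Re[OF g] integrable_cong_AE[OF mR(1) measurable_completion[OF rm(1)] AE_completion[OF rm(2)]]
      integrable_completion[OF rm(1)] by simp
  have ims: "integrable \<mu> s"
    using integrable_Im[OF g] integrable_cong_AE[OF mR(2) measurable_completion[OF sm(1)] AE_completion[OF sm(2)]]
      integrable_completion[OF sm(1)] by simp
  define g' where "g' x = complex_of_real (r x) + \<i> * of_real (s x)" for x
  have ae: "AE x in \<mu>. g x = g' x"
    using rm(2) sm(2) by eventually_elim (simp add: g'_def complex_eq_iff)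
  have ig: "integrable \<mu> g'" unfolding g'_def using ir ims by simp
  have intg: "integral\<^sup>L (completion \<mu>) g = complex_of_real (\<integral>x. r x \<partial>\<mu>) + \<i> * of_real (\<integral>x. s x \<partial>\<mu>)"
    unfolding integral_completion_AE(2)[OF ig ae] unfolding g'_def using ir ims by simp
  obtain J where J: "AE y in \<nu>. integrable (M y) r" "integrable \<nu> J" "AE y in \<nu>. (\<integral>x. r x \<partial>M y) = J y"
      "(\<integral>y. J y \<partial>\<nu>) = (\<integral>x. r x \<partial>\<mu>)"
    by (rule integral_real_fibres[OF ir])
  obtain L where L: "AE y in \<nu>. integrable (M y) s" "integrable \<nu> L" "AE y in \<nu>. (\<integral>x. s x \<partial>M y) = L y"
      "(\<integral>y. L y \<partial>\<nu>) = (\<integral>x. s x \<partial>\<mu>)"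
    by (rule integral_real_fibres[OF ims])
  have fib: "AE y in \<nu>. integrable (completion (M y)) g \<and> (\<integral>x. g x \<partial>completion (M y)) = complex_of_real (J y) + \<i> * of_real (L y)"
    using AE_fibres[OF ae] J(1,3) L(1,3)
  proof eventually_elim
    case (elim y)
    have i: "integrable (M y) g'" unfolding g'_def using elim by simp
    have "(\<integral>x. g x \<partial>completion (M y)) = integral\<^sup>L (M y) g'" by (rule integral_completion_AE(2)[OF i elim(1)])
    also have "\<dots> = complex_of_real (J y) + \<i> * of_real (L y)" unfolding g'_def using elim by simp
    finally show ?case using integral_completion_AE(1)[OF i elim(1)] by simp
  qed
  then show "AE y in \<nu>. integrable (completion (M y)) g" by eventually_elim simp
  have iJL: "integrable \<nu> (\<lambda>y. complex_of_real (J y) + \<i> * of_real (L y))" using J L by simp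
  have ae2: "AE y in \<nu>. (\<integral>x. g x \<partial>completion (M y)) = complex_of_real (J y) + \<i> * of_real (L y)"
    using fib by eventually_elim simp
  show "integrable (completion \<nu>) (\<lambda>y. \<integral>x. g x \<partial>completion (M y))"
    by (rule integral_completion_AE(1)[OF iJL ae2])
  show "(\<integral>x. g x \<partial>completion \<mu>) = (\<integral>y. (\<integral>x. g x \<partial>completion (M y)) \<partial>completion \<nu>)"
    unfolding intg integral_completion_AE(2)[OF iJL ae2] using J L by simp
qed

end

section \<open>Hausdorff measures on graphs\<close>

definition hausdorff_cost :: "nat \<Rightarrow> 'a::metric_space set \<Rightarrow> ennreal" where
  "hausdorff_cost k U = (if U = {} then 0 else ennreal (unit_ball_vol (real k) * (diameter U / 2) ^ k))"

definition hausdorff_covers :: "real \<Rightarrow> 'a::metric_space set \<Rightarrow> (nat \<Rightarrow> 'a set) set" where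
  "hausdorff_covers \<delta> A = {U. A \<subseteq> (\<Union>i. U i) \<and> (\<forall>i. bounded (U i) \<and> diameter (U i) \<le> \<delta>)}"

lemma hausdorff_content_altdef:
  "hausdorff_content k \<delta> A = (INF U\<in>hausdorff_covers \<delta> A. \<Sum>i. hausdorff_cost k (U i))"
  by (simp add: hausdorff_content_def hausdorff_covers_def hausdorff_cost_def)

lemma hausdorff_cost_empty [simp]: "hausdorff_cost k {} = 0"
  by (simp add: hausdorff_cost_def)

lemma hausdorff_cost_mono:
  assumes "U \<subseteq> V" "bounded V"
  shows "hausdorff_cost k U \<le> hausdorff_cost k V"
proof (cases "U = {}")
  case False
  then show ?thesis
    using assms diameter_subset[OF assms] diameter_ge_0[OF bounded_subset[OF assms(2,1)]]
    by (auto simp: hausdorff_cost_def intro!: ennreal_leI mult_left_mono power_mono)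
qed simp

lemma hausdorff_cost_le:
  assumes "0 \<le> d" "diameter U \<le> d" "bounded U"
  shows "hausdorff_cost k U \<le> ennreal (unit_ball_vol (real k) * (d / 2) ^ k)"
  using assms diameter_ge_0[OF assms(3)]
  by (auto simp: hausdorff_cost_def intro!: ennreal_leI mult_left_mono power_mono)

lemma hausdorff_content_le:
  assumes "A \<subseteq> (\<Union>i. U i)" "\<And>i. bounded (U i)" "\<And>i. diameter (U i) \<le> \<delta>"
  shows "hausdorff_content k \<delta> A \<le> (\<Sum>i. hausdorff_cost k (U i))"
  unfolding hausdorff_content_altdef
  by (rule INF_lower) (use assms in \<open>auto simp: hausdorff_covers_def\<close>)

lemma hausdorff_content_mono: "A \<subseteq> B \<Longrightarrow> hausdorff_content k \<delta> A \<le> hausdorff_content k \<delta> B"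
  unfolding hausdorff_content_altdef hausdorff_covers_def by (rule INF_superset_mono) auto

lemma hausdorff_content_antimono:
  "\<delta> \<le> \<delta>' \<Longrightarrow> hausdorff_content k \<delta>' A \<le> hausdorff_content k \<delta> A"
  unfolding hausdorff_content_altdef hausdorff_covers_def by (rule INF_superset_mono) (auto intro: order_trans)

lemma hausdorff_content_empty: "0 \<le> \<delta> \<Longrightarrow> hausdorff_content k \<delta> {} = 0"
  using hausdorff_content_le[of "{}" "\<lambda>_. {}" \<delta> k] by simp

lemma hausdorff_content_single:
  assumes "bounded A" "diameter A \<le> \<delta>" "0 \<le> \<delta>"
  shows "hausdorff_content k \<delta> A \<le> hausdorff_cost k A"
proof -
  have "hausdorff_content k \<delta> A \<le> (\<Sum>i. hausdorff_cost k (if i = 0 then A else {}))"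
    by (rule hausdorff_content_le) (use assms in auto)
  also have "\<dots> = (\<Sum>i\<in>{0::nat}. hausdorff_cost k (if i = 0 then A else {}))"
    by (rule Series.suminf_finite) auto
  finally show ?thesis by simp
qed

lemma hausdorff_content_countably_subadditive:
  fixes A :: "nat \<Rightarrow> 'a::metric_space set"
  shows "hausdorff_content k \<delta> (\<Union>i. A i) \<le> (\<Sum>i. hausdorff_content k \<delta> (A i))"
proof (rule ennreal_le_epsilon)
  fix e :: real assume e: "0 < e" and fin: "(\<Sum>i. hausdorff_content k \<delta> (A i)) < top"
  have "\<exists>U\<in>hausdorff_covers \<delta> (A i). (\<Sum>n. hausdorff_cost k (U n)) \<le> hausdorff_content k \<delta> (A i) + ennreal (e * (1/2) ^ Suc i)" for i
  proof -
    have "hausdorff_content k \<delta> (A i) < top"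
      using fin by (rule ennreal_suminf_lessD)
    then have "hausdorff_content k \<delta> (A i) + 0 < hausdorff_content k \<delta> (A i) + ennreal (e * (1/2) ^ Suc i)"
      using e unfolding ennreal_add_left_cancel_less by simp
    then show ?thesis
      unfolding hausdorff_content_altdef[of k \<delta> "A i"] add_0_right INF_less_iff using less_imp_le by blast
  qed
  then obtain U where U: "\<And>i. U i \<in> hausdorff_covers \<delta> (A i)"
    "\<And>i. (\<Sum>n. hausdorff_cost k (U i n)) \<le> hausdorff_content k \<delta> (A i) + ennreal (e * (1/2) ^ Suc i)"
    by metis
  define V where "V n = (case prod_decode n of (i, j) \<Rightarrow> U i j)" for n
  have "hausdorff_content k \<delta> (\<Union>i. A i) \<le> (\<Sum>n. hausdorff_cost k (V n))"
  proof (rule hausdorff_content_le)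
    show "(\<Union>i. A i) \<subseteq> (\<Union>n. V n)"
    proof safe
      fix x i assume "x \<in> A i"
      then obtain j where "x \<in> U i j" using U(1)[of i] by (auto simp: hausdorff_covers_def)
      then have "x \<in> V (prod_encode (i, j))" by (simp add: V_def)
      then show "x \<in> (\<Union>n. V n)" by blast
    qed
  qed (use U(1) in \<open>auto simp: V_def hausdorff_covers_def split: prod.splits\<close>)
  also have "\<dots> = (\<Sum>n. (\<lambda>(i, j). hausdorff_cost k (U i j)) (prod_decode n))"
    by (simp add: V_def split_beta')
  also have "\<dots> = (\<Sum>i. \<Sum>j. hausdorff_cost k (U i j))"
    by (rule suminf_ennreal_2dimen) simp
  also have "\<dots> \<le> (\<Sum>i. hausdorff_content k \<delta> (A i) + ennreal (e * (1/2) ^ Suc i))"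
    by (intro suminf_le U) auto
  also have "\<dots> = (\<Sum>i. hausdorff_content k \<delta> (A i)) + (\<Sum>i. ennreal (e * (1/2) ^ Suc i))"
    by (rule suminf_add[symmetric]) auto
  also have "(\<Sum>i. ennreal (e * (1/2) ^ Suc i)) = ennreal e"
  proof -
    have "(\<lambda>i. e * (1/2) ^ Suc i) sums (e * 1)" by (intro sums_mult power_half_series)
    then show ?thesis using e by (intro suminf_ennreal_eq) auto
  qed
  finally show "hausdorff_content k \<delta> (\<Union>i. A i) \<le> (\<Sum>i. hausdorff_content k \<delta> (A i)) + ennreal e" .
qed

lemma hausdorff_outer_mono: "A \<subseteq> B \<Longrightarrow> hausdorff_outer k A \<le> hausdorff_outer k B"
  unfolding hausdorff_outer_def by (intro SUP_mono' hausdorff_content_mono)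

lemma hausdorff_outer_empty [simp]: "hausdorff_outer k {} = 0"
  unfolding hausdorff_outer_def by (rule antisym) (auto intro!: SUP_least simp: hausdorff_content_empty)

lemma hausdorff_outer_ge: "0 < \<delta> \<Longrightarrow> hausdorff_content k \<delta> A \<le> hausdorff_outer k A"
  unfolding hausdorff_outer_def by (rule SUP_upper) simp

lemma hausdorff_outer_countably_subadditive:
  fixes A :: "nat \<Rightarrow> 'a::metric_space set"
  shows "hausdorff_outer k (\<Union>i. A i) \<le> (\<Sum>i. hausdorff_outer k (A i))"
proof -
  have "hausdorff_content k \<delta> (\<Union>i. A i) \<le> (\<Sum>i. hausdorff_outer k (A i))" if "0 < \<delta>" for \<delta>
    by (rule order_trans[OF hausdorff_content_countably_subadditive])
      (intro suminf_le hausdorff_outer_ge that, auto)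
  then show ?thesis unfolding hausdorff_outer_def[of k "\<Union>i. A i"] by (intro SUP_least) auto
qed

text \<open>A covering set of diameter at most \<open>\<delta>\<close> cannot meet both
  \<open>A\<close> and \<open>B\<close>, so every cover of the union splits into a cover of
  \<open>A\<close> and a cover of \<open>B\<close>.\<close>

lemma hausdorff_content_separated:
  fixes A B :: "'a::metric_space set"
  assumes d: "\<And>a b. a \<in> A \<Longrightarrow> b \<in> B \<Longrightarrow> \<delta> < dist a b"
  shows "hausdorff_content k \<delta> A + hausdorff_content k \<delta> B \<le> hausdorff_content k \<delta> (A \<union> B)"
  unfolding hausdorff_content_altdef[of k \<delta> "A \<union> B"]
proof (rule INF_greatest)
  fix U assume "U \<in> hausdorff_covers \<delta> (A \<union> B)"
  then have U: "A \<union> B \<subseteq> (\<Union>i. U i)" "\<And>i. bounded (U i)" "\<And>i. diameter (U i) \<le> \<delta>"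
    by (auto simp: hausdorff_covers_def)
  have *: "diameter (U i \<inter> C) \<le> \<delta>" "bounded (U i \<inter> C)" for i C
    using diameter_subset[of "U i \<inter> C" "U i"] U(2,3)[of i] by (auto intro: bounded_subset)
  have "hausdorff_content k \<delta> A + hausdorff_content k \<delta> B
      \<le> (\<Sum>i. hausdorff_cost k (U i \<inter> A)) + (\<Sum>i. hausdorff_cost k (U i \<inter> B))"
    using U(1) by (intro add_mono hausdorff_content_le *) auto
  also have "\<dots> = (\<Sum>i. hausdorff_cost k (U i \<inter> A) + hausdorff_cost k (U i \<inter> B))"
    by (rule suminf_add) auto
  also have "\<dots> \<le> (\<Sum>i. hausdorff_cost k (U i))"
  proof (rule suminf_le)
    fix i
    have "U i \<inter> A = {} \<or> U i \<inter> B = {}"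
    proof (rule ccontr)
      assume "\<not> ?thesis"
      then obtain a b where ab: "a \<in> U i" "a \<in> A" "b \<in> U i" "b \<in> B" by blast
      then have "dist a b \<le> diameter (U i)" using diameter_bounded_bound[OF U(2)] by blast
      then show False using d[OF ab(2,4)] U(3)[of i] by simp
    qed
    then show "hausdorff_cost k (U i \<inter> A) + hausdorff_cost k (U i \<inter> B) \<le> hausdorff_cost k (U i)"
      using hausdorff_cost_mono[of "U i \<inter> A" "U i" k] hausdorff_cost_mono[of "U i \<inter> B" "U i" k] U(2)[of i] by auto
  qed auto
  finally show "hausdorff_content k \<delta> A + hausdorff_content k \<delta> B \<le> (\<Sum>i. hausdorff_cost k (U i))" .
qed

text \<open>Contents of \<open>A\<close> and \<open>B\<close> at two different scales are both
  compared with the scale \<open>r\<close>, which lies below either scale and below the distance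
  \<open>d\<close>; then both suprema can be taken independently.\<close>

lemma hausdorff_outer_separated:
  fixes A B :: "'a::metric_space set"
  assumes d: "0 < d" "\<And>a b. a \<in> A \<Longrightarrow> b \<in> B \<Longrightarrow> d \<le> dist a b"
  shows "hausdorff_outer k A + hausdorff_outer k B \<le> hausdorff_outer k (A \<union> B)"
proof -
  have *: "hausdorff_content k \<delta> A + hausdorff_content k \<delta>' B \<le> hausdorff_outer k (A \<union> B)"
    if "0 < \<delta>" "0 < \<delta>'" for \<delta> \<delta>'
  proof -
    define r where "r = min (min \<delta> \<delta>') (d / 2)"
    have r: "0 < r" "r \<le> \<delta>" "r \<le> \<delta>'" "r < d" using that d(1) by (auto simp: r_def)
    have "hausdorff_content k \<delta> A + hausdorff_content k \<delta>' B \<le> hausdorff_content k r A + hausdorff_content k r B"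
      by (intro add_mono hausdorff_content_antimono r)
    also have "\<dots> \<le> hausdorff_content k r (A \<union> B)"
      by (rule hausdorff_content_separated) (use d(2) r(4) less_le_trans in blast)
    also have "\<dots> \<le> hausdorff_outer k (A \<union> B)" by (rule hausdorff_outer_ge[OF r(1)])
    finally show ?thesis .
  qed
  have "hausdorff_content k \<delta> A + hausdorff_outer k B \<le> hausdorff_outer k (A \<union> B)" if "0 < \<delta>" for \<delta>
    unfolding hausdorff_outer_def[of k B]
    by (subst ennreal_SUP_add_right) (use *[OF that] in \<open>auto intro!: SUP_least\<close>)
  then show ?thesis
    unfolding hausdorff_outer_def[of k A]
    by (subst ennreal_SUP_add_left[symmetric]) (auto intro!: SUP_least)
qed

lemma ennreal_suminf_tail:
  fixes f :: "nat \<Rightarrow> ennreal"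
  assumes "suminf f \<noteq> top"
  shows "(\<lambda>n. \<Sum>i. f (i + n)) \<longlonglongrightarrow> 0"
proof -
  define g where "g i = enn2real (f i)" for i
  have "f i < top" for i using assms by (metis ennreal_suminf_lessD less_top)
  then have f: "f i = ennreal (g i)" for i by (simp add: g_def)
  have g0: "0 \<le> g i" for i by (simp add: g_def)
  have s: "summable g" using assms by (intro summable_suminf_not_top g0) (simp add: f[symmetric])
  have "(\<lambda>n. ennreal (\<Sum>i. g (i + n))) \<longlonglongrightarrow> ennreal 0"
    by (intro tendsto_ennrealI suminf_exist_split2 s)
  moreover have "(\<Sum>i. f (i + n)) = ennreal (\<Sum>i. g (i + n))" for n
    unfolding f by (rule suminf_ennreal2) (use g0 s summable_iff_shift in auto)
  ultimately show ?thesis by simp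
qed

text \<open>Caratheodory's criterion for metric outer measures; \<open>A\<^sub>n\<close> is the part of \<open>A - C\<close> at distance at
  least \<open>1/(n+1)\<close> from \<open>C\<close>, and non-consecutive shells \<open>A\<^sub>n\<^sub>+\<^sub>1 - A\<^sub>n\<close> are separated from each other.\<close>

lemma metric_outer_measure_closed:
  fixes \<mu> :: "'a::metric_space set \<Rightarrow> ennreal"
  assumes mono: "\<And>A B. A \<subseteq> B \<Longrightarrow> \<mu> A \<le> \<mu> B" and empty: "\<mu> {} = 0"
    and sub: "\<And>A :: nat \<Rightarrow> 'a set. \<mu> (\<Union>i. A i) \<le> (\<Sum>i. \<mu> (A i))"
    and sep: "\<And>d A B. 0 < d \<Longrightarrow> (\<And>a b. a \<in> A \<Longrightarrow> b \<in> B \<Longrightarrow> d \<le> dist a b) \<Longrightarrow> \<mu> A + \<mu> B \<le> \<mu> (A \<union> B)"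
    and C: "closed C"
  shows "\<mu> (A \<inter> C) + \<mu> (A - C) \<le> \<mu> A"
proof (cases "C = {} \<or> \<mu> A = top")
  case True
  then show ?thesis using empty by auto
next
  case False
  then have C0: "C \<noteq> {}" and fin: "\<mu> A \<noteq> top" by auto
  define S where "S n = {x \<in> A - C. 1 / real (Suc n) \<le> infdist x C}" for n
  define R where "R n = S (Suc n) - S n" for n
  have S_mono: "S m \<subseteq> S n" if "m \<le> n" for m n
  proof -
    have "1 / real (Suc n) \<le> 1 / real (Suc m)" using that by (intro divide_left_mono) (simp_all del: of_nat_Suc)
    then show ?thesis unfolding S_def using order_trans by blast
  qed
  have Un: "A - C \<subseteq> S n \<union> (\<Union>i. R (i + n))" for n
  proof
    fix x assume x: "x \<in> A - C"
    then have "0 < infdist x C" using C C0 by (metis DiffD2 in_closed_iff_infdist_zero infdist_nonneg less_le)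
    then obtain m where "1 / real (Suc m) < infdist x C" using nat_approx_posE by blast
    then have xm: "x \<in> S m" using x by (auto simp: S_def)
    show "x \<in> S n \<union> (\<Union>i. R (i + n))"
    proof (cases "x \<in> S n")
      case False
      define l where "l = (LEAST m. x \<in> S m)"
      have l: "x \<in> S l" using xm unfolding l_def by (rule LeastI)
      have "n < l" using False l S_mono[of l n] by (meson not_less subsetD)
      then obtain i where i: "l = Suc (i + n)" by (metis add.commute less_iff_Suc_add)
      have "x \<notin> S (i + n)" using not_less_Least[of "i + n" "\<lambda>m. x \<in> S m"] i by (simp add: l_def)
      then have "x \<in> R (i + n)" using l i by (simp add: R_def)
      then show ?thesis by blast
    qed simp
  qed
  have R_sep: "1 / real (Suc (Suc m)) - 1 / real (Suc n) \<le> dist a b"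
    if "a \<in> S (Suc m)" "b \<notin> S n" "b \<in> A - C" for a b m n
  proof -
    have "1 / real (Suc (Suc m)) \<le> infdist a C" "infdist b C < 1 / real (Suc n)"
      using that by (auto simp: S_def)
    moreover have "infdist a C \<le> infdist b C + dist a b" by (rule infdist_triangle)
    ultimately show ?thesis by linarith
  qed
  have SA: "S n \<subseteq> A - C" for n by (auto simp: S_def)
  have shells: "(\<Sum>i<n. \<mu> (R (2 * i + c))) \<le> \<mu> (\<Union>i<n. R (2 * i + c))" for n c
  proof (induction n)
    case (Suc n)
    have "(\<Sum>i<Suc n. \<mu> (R (2 * i + c))) \<le> \<mu> (\<Union>i<n. R (2 * i + c)) + \<mu> (R (2 * n + c))"
      using Suc by (simp add: add_right_mono)
    also have "\<dots> \<le> \<mu> ((\<Union>i<n. R (2 * i + c)) \<union> R (2 * n + c))"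
    proof (cases n)
      case (Suc n')
      show ?thesis
      proof (rule sep)
        show "0 < 1 / real (Suc (Suc (2 * n' + c))) - 1 / real (Suc (2 * n + c))"
        proof -
          have "Suc (Suc (2 * n' + c)) < Suc (2 * n + c)" using Suc by simp
          then have "1 / real (Suc (2 * n + c)) < 1 / real (Suc (Suc (2 * n' + c)))"
            by (intro divide_strict_left_mono) (simp_all del: of_nat_Suc)
          then show ?thesis by linarith
        qed
        fix a b assume a: "a \<in> (\<Union>i<n. R (2 * i + c))" and b: "b \<in> R (2 * n + c)"
        then obtain i where i: "i < n" "a \<in> R (2 * i + c)" by blast
        then have "Suc (2 * i + c) \<le> Suc (2 * n' + c)" using Suc by simp
        then have "a \<in> S (Suc (2 * n' + c))" using S_mono i(2) unfolding R_def by blast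
        then show "1 / real (Suc (Suc (2 * n' + c))) - 1 / real (Suc (2 * n + c)) \<le> dist a b"
          using b SA unfolding R_def by (intro R_sep) auto
      qed
    qed (simp add: empty)
    also have "(\<Union>i<n. R (2 * i + c)) \<union> R (2 * n + c) = (\<Union>i<Suc n. R (2 * i + c))"
      by (simp only: lessThan_Suc UN_insert Un_commute)
    finally show ?case .
  qed (simp add: empty)
  have "(\<Sum>i. \<mu> (R (2 * i + c))) \<le> \<mu> A" for c
  proof (rule suminf_le_const)
    show "(\<Sum>i<n. \<mu> (R (2 * i + c))) \<le> \<mu> A" for n
      by (rule order_trans[OF shells mono]) (use SA in \<open>auto simp: R_def\<close>)
  qed auto
  then have finc: "(\<Sum>i. \<mu> (R (2 * i + c))) \<noteq> top" for c
    using fin neq_top_trans by blast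
  have tail: "(\<lambda>n. \<Sum>i. \<mu> (R (2 * (i + n) + c))) \<longlonglongrightarrow> 0" for c
    by (rule ennreal_suminf_tail[OF finc])
  \<comment> \<open>\<open>S (2 * n)\<close> has positive distance from \<open>C\<close>, so it
    enters without loss. What is left of \<open>A - C\<close> is covered by the late shells of even
    and of odd index; each of the two series converges, being bounded by \<open>\<mu> A\<close>, so
    the added tails tend to 0.\<close>
  have bound: "\<mu> (A \<inter> C) + \<mu> (A - C) \<le> \<mu> A + ((\<Sum>i. \<mu> (R (2 * (i + n) + 0))) + (\<Sum>i. \<mu> (R (2 * (i + n) + 1))))" for n
  proof -
    have cov: "A - C \<subseteq> S (2 * n) \<union> ((\<Union>i. R (2 * (i + n) + 0)) \<union> (\<Union>i. R (2 * (i + n) + 1)))"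
    proof -
      have "R (i + 2 * n) \<subseteq> (\<Union>i. R (2 * (i + n) + 0)) \<union> (\<Union>i. R (2 * (i + n) + 1))" for i
      proof (cases "even i")
        case True
        then obtain j where "i = 2 * j" by blast
        then have "i + 2 * n = 2 * (j + n) + 0" by simp
        then have e: "R (i + 2 * n) = R (2 * (j + n) + 0)" by simp
        show ?thesis unfolding e by (rule le_supI1, rule UN_upper) simp
      next
        case False
        then obtain j where "i = 2 * j + 1" by (rule oddE)
        then have "i + 2 * n = 2 * (j + n) + 1" by simp
        then have e: "R (i + 2 * n) = R (2 * (j + n) + 1)" by simp
        show ?thesis unfolding e by (rule le_supI2, rule UN_upper) simp
      qed
      then have "(\<Union>i. R (i + 2 * n)) \<subseteq> (\<Union>i. R (2 * (i + n) + 0)) \<union> (\<Union>i. R (2 * (i + n) + 1))"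
        by (rule UN_least)
      from order_trans[OF Un Un_mono[OF subset_refl this]] show ?thesis .
    qed
    have sub2: "\<mu> (X \<union> Y) \<le> \<mu> X + \<mu> Y" for X Y
    proof -
      have "(\<Sum>i. \<mu> (if i = 0 then X else if i = (1::nat) then Y else {})) = (\<Sum>i\<in>{0, 1}. \<mu> (if i = 0 then X else if i = (1::nat) then Y else {}))"
        by (rule Series.suminf_finite) (auto simp: empty)
      moreover have "(\<Union>i. if i = 0 then X else if i = (1::nat) then Y else {}) = X \<union> Y"
        by (auto split: if_splits)
      ultimately show ?thesis using sub[of "\<lambda>i. if i = 0 then X else if i = (1::nat) then Y else {}"] by simp
    qed
    have "\<mu> (A - C) \<le> \<mu> (S (2 * n)) + (\<mu> (\<Union>i. R (2 * (i + n) + 0)) + \<mu> (\<Union>i. R (2 * (i + n) + 1)))"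
      by (rule order_trans[OF mono[OF cov] order_trans[OF sub2 add_left_mono[OF sub2]]])
    also have "\<dots> \<le> \<mu> (S (2 * n)) + ((\<Sum>i. \<mu> (R (2 * (i + n) + 0))) + (\<Sum>i. \<mu> (R (2 * (i + n) + 1))))"
      by (intro add_left_mono add_mono sub)
    finally have 1: "\<mu> (A - C) \<le> \<mu> (S (2 * n)) + ((\<Sum>i. \<mu> (R (2 * (i + n) + 0))) + (\<Sum>i. \<mu> (R (2 * (i + n) + 1))))" .
    have 2: "\<mu> (A \<inter> C) + \<mu> (S (2 * n)) \<le> \<mu> A"
    proof -
      have "\<mu> (A \<inter> C) + \<mu> (S (2 * n)) \<le> \<mu> (A \<inter> C \<union> S (2 * n))"
      proof (rule sep)
        show "0 < 1 / real (Suc (2 * n))" by simp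
        fix a b assume "a \<in> A \<inter> C" "b \<in> S (2 * n)"
        then show "1 / real (Suc (2 * n)) \<le> dist a b"
          using infdist_le[of a C b] by (auto simp: S_def dist_commute)
      qed
      also have "\<dots> \<le> \<mu> A" by (rule mono) (use SA in auto)
      finally show ?thesis .
    qed
    have "\<mu> (A \<inter> C) + \<mu> (A - C) \<le> \<mu> (A \<inter> C) + (\<mu> (S (2 * n)) + ((\<Sum>i. \<mu> (R (2 * (i + n) + 0))) + (\<Sum>i. \<mu> (R (2 * (i + n) + 1)))))"
      by (intro add_left_mono 1)
    also have "\<dots> \<le> \<mu> A + ((\<Sum>i. \<mu> (R (2 * (i + n) + 0))) + (\<Sum>i. \<mu> (R (2 * (i + n) + 1))))"
      unfolding add.assoc[symmetric] using 2 by (intro add_right_mono)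
    finally show ?thesis .
  qed
  have "(\<lambda>n. \<mu> A + ((\<Sum>i. \<mu> (R (2 * (i + n) + 0))) + (\<Sum>i. \<mu> (R (2 * (i + n) + 1))))) \<longlonglongrightarrow> \<mu> A + (0 + 0)"
    by (intro tendsto_intros tail)
  from LIMSEQ_le_const[OF this exI[of _ 0]] bound show ?thesis by simp
qed

lemma metric_outer_measure_borel:
  fixes \<mu> :: "'a::metric_space set \<Rightarrow> ennreal"
  assumes mono: "\<And>A B. A \<subseteq> B \<Longrightarrow> \<mu> A \<le> \<mu> B" and empty: "\<mu> {} = 0"
    and sub: "\<And>A :: nat \<Rightarrow> 'a set. \<mu> (\<Union>i. A i) \<le> (\<Sum>i. \<mu> (A i))"
    and sep: "\<And>d A B. 0 < d \<Longrightarrow> (\<And>a b. a \<in> A \<Longrightarrow> b \<in> B \<Longrightarrow> d \<le> dist a b) \<Longrightarrow> \<mu> A + \<mu> B \<le> \<mu> (A \<union> B)"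
  shows "measure_space UNIV (sets borel) \<mu>"
proof -
  interpret sigma_algebra "UNIV :: 'a set" "Pow UNIV" by (rule sigma_algebra_Pow)
  have "outer_measure_space (Pow UNIV) \<mu>"
    unfolding outer_measure_space_def positive_def increasing_def countably_subadditive_def
    using mono empty sub by auto
  then have ms: "measure_space UNIV (lambda_system UNIV (Pow UNIV) \<mu>) \<mu>"
    by (rule caratheodory_lemma)
  then interpret L: sigma_algebra UNIV "lambda_system UNIV (Pow UNIV) \<mu>"
    by (simp add: measure_space_def)
  have sub2: "\<mu> (X \<union> Y) \<le> \<mu> X + \<mu> Y" for X Y
  proof -
    have "(\<Sum>i. \<mu> (if i = 0 then X else if i = (1::nat) then Y else {})) = (\<Sum>i\<in>{0, 1}. \<mu> (if i = 0 then X else if i = (1::nat) then Y else {}))"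
      by (rule Series.suminf_finite) (auto simp: empty)
    moreover have "(\<Union>i. if i = 0 then X else if i = (1::nat) then Y else {}) = X \<union> Y"
      by (auto split: if_splits)
    ultimately show ?thesis using sub[of "\<lambda>i. if i = 0 then X else if i = (1::nat) then Y else {}"] by simp
  qed
  have closed: "C \<in> lambda_system UNIV (Pow UNIV) \<mu>" if "closed C" for C
    unfolding lambda_system_def
  proof (intro CollectI conjI ballI antisym)
    fix A
    have e: "C \<inter> A = A \<inter> C" "(UNIV - C) \<inter> A = A - C" by auto
    show "\<mu> (C \<inter> A) + \<mu> ((UNIV - C) \<inter> A) \<le> \<mu> A"
      unfolding e by (rule metric_outer_measure_closed[OF mono empty sub sep that])
    show "\<mu> A \<le> \<mu> (C \<inter> A) + \<mu> ((UNIV - C) \<inter> A)"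
      using sub2[of "C \<inter> A" "(UNIV - C) \<inter> A"] by (simp add: Int_Un_distrib2[symmetric])
  qed auto
  have "sets (borel :: 'a measure) \<subseteq> lambda_system UNIV (Pow UNIV) \<mu>"
  proof -
    have "sigma_sets UNIV (Collect closed) \<subseteq> lambda_system UNIV (Pow UNIV) \<mu>"
      by (rule L.sigma_sets_subset) (use closed in auto)
    then show ?thesis unfolding borel_eq_closed by (simp add: sets_measure_of)
  qed
  then show ?thesis
    using measure_down[OF ms] sets.sigma_algebra_axioms[of "borel :: 'a measure"] by simp
qed

lemma sets_hausdorff_measure [simp, measurable_cong]: "sets (hausdorff_measure k) = sets borel"
  unfolding hausdorff_measure_def using sets.sigma_sets_eq[of borel] by (simp add: sets_measure_of)

lemma space_hausdorff_measure [simp]: "space (hausdorff_measure k) = UNIV"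
  using sets_eq_imp_space_eq[OF sets_hausdorff_measure] by simp

text \<open>\<open>measure_of\<close> yields the zero measure unless it is given a measure on the
  sigma-algebra in question, so countable additivity on Borel sets, here by Caratheodory's
  criterion, is what gives the definition its intended meaning.\<close>

lemma emeasure_hausdorff_measure:
  fixes A :: "'a::metric_space set"
  assumes "A \<in> sets borel"
  shows "emeasure (hausdorff_measure k) A = hausdorff_outer k A"
proof -
  have "measure_space UNIV (sets borel) (hausdorff_outer k :: 'a set \<Rightarrow> ennreal)"
    by (rule metric_outer_measure_borel)
      (auto intro: hausdorff_outer_mono hausdorff_outer_countably_subadditive hausdorff_outer_separated)
  then show ?thesis
    using assms unfolding hausdorff_measure_def
    by (intro emeasure_measure_of_sigma) (auto simp: measure_space_def)
qed

lemma hausdorff_outer_lipschitz_image: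
  fixes f :: "'a::metric_space \<Rightarrow> 'b::real_normed_vector"
  assumes L: "0 < L" "\<And>x y. x \<in> A \<Longrightarrow> y \<in> A \<Longrightarrow> dist (f x) (f y) \<le> L * dist x y"
  shows "hausdorff_outer k (f ` A) \<le> ennreal (L ^ k) * hausdorff_outer k A"
proof -
  have "hausdorff_content k \<delta> (f ` A) \<le> ennreal (L ^ k) * hausdorff_content k (\<delta> / L) A" if d: "0 < \<delta>" for \<delta>
  proof -
    \<comment> \<open>Multiplication by L^k is invertible. The factor is moved to the left, the
      estimate is proved for each single cover of \<open>A\<close>, and after taking the infimum the
      factor is moved back.\<close>
    have c1: "ennreal (L ^ k) * (ennreal (1 / L ^ k) * X) = X" "ennreal (1 / L ^ k) * (ennreal (L ^ k) * X) = X" for X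
      using L(1) by (simp_all add: mult.assoc[symmetric] ennreal_mult[symmetric])
    have "ennreal (1 / L ^ k) * hausdorff_content k \<delta> (f ` A) \<le> hausdorff_content k (\<delta> / L) A"
      unfolding hausdorff_content_altdef[of k "\<delta> / L"]
    proof (rule INF_greatest)
      fix U assume "U \<in> hausdorff_covers (\<delta> / L) A"
      then have U: "A \<subseteq> (\<Union>i. U i)" "\<And>i. bounded (U i)" "\<And>i. diameter (U i) \<le> \<delta> / L"
        by (auto simp: hausdorff_covers_def)
      have dist: "dist (f x) (f y) \<le> L * diameter (U i)" if "x \<in> U i \<inter> A" "y \<in> U i \<inter> A" for x y i
      proof -
        have "dist (f x) (f y) \<le> L * dist x y" using L(2) that by blast
        also have "\<dots> \<le> L * diameter (U i)"
          using diameter_bounded_bound[OF U(2), of x i y] that L(1) by (intro mult_left_mono) auto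
        finally show ?thesis .
      qed
      have dU: "0 \<le> diameter (U i)" for i by (rule diameter_ge_0[OF U(2)])
      have diam: "diameter (f ` (U i \<inter> A)) \<le> L * diameter (U i)" for i
        by (rule diameter_le) (use L(1) dU dist in \<open>auto simp: dist_norm\<close>)
      have bdd: "bounded (f ` (U i \<inter> A))" for i
      proof (cases "U i \<inter> A = {}")
        case False
        then obtain x where "x \<in> U i \<inter> A" by blast
        then show ?thesis unfolding bounded_def using dist by (intro exI[of _ "f x"] exI[of _ "L * diameter (U i)"]) auto
      qed simp
      have "hausdorff_content k \<delta> (f ` A) \<le> (\<Sum>i. hausdorff_cost k (f ` (U i \<inter> A)))"
      proof (rule hausdorff_content_le[OF _ bdd])
        show "diameter (f ` (U i \<inter> A)) \<le> \<delta>" for i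
          using diam[of i] mult_left_mono[OF U(3)[of i], of L] L(1) by simp
        show "f ` A \<subseteq> (\<Union>i. f ` (U i \<inter> A))" using U(1) by blast
      qed
      also have "\<dots> \<le> (\<Sum>i. ennreal (L ^ k) * hausdorff_cost k (U i))"
      proof (rule suminf_le)
        fix i
        show "hausdorff_cost k (f ` (U i \<inter> A)) \<le> ennreal (L ^ k) * hausdorff_cost k (U i)"
        proof (cases "U i \<inter> A = {}")
          case False
          have "hausdorff_cost k (f ` (U i \<inter> A)) \<le> ennreal (unit_ball_vol (real k) * (L * diameter (U i) / 2) ^ k)"
            by (rule hausdorff_cost_le) (use L(1) dU diam bdd in auto)
          also have "\<dots> = ennreal (L ^ k) * hausdorff_cost k (U i)"
            using False L(1) dU[of i] by (auto simp: hausdorff_cost_def ennreal_mult[symmetric] power_mult_distrib[symmetric] mult_ac)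
          finally show ?thesis .
        qed simp
      qed auto
      finally have "hausdorff_content k \<delta> (f ` A) \<le> ennreal (L ^ k) * (\<Sum>i. hausdorff_cost k (U i))" by simp
      from mult_left_mono[OF this, of "ennreal (1 / L ^ k)"]
      show "ennreal (1 / L ^ k) * hausdorff_content k \<delta> (f ` A) \<le> (\<Sum>i. hausdorff_cost k (U i))"
        unfolding c1 by simp
    qed
    from mult_left_mono[OF this, of "ennreal (L ^ k)"] show ?thesis unfolding c1 by simp
  qed
  also have "ennreal (L ^ k) * hausdorff_content k (\<delta> / L) A \<le> ennreal (L ^ k) * hausdorff_outer k A" if d: "0 < \<delta>" for \<delta>
    using d L(1) by (intro mult_left_mono hausdorff_outer_ge) auto
  finally show ?thesis unfolding hausdorff_outer_def[of k "f ` A"] by (intro SUP_least) auto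
qed

section \<open>Steiner symmetrization and the isodiametric inequality\<close>

abbreviation lebesgue_PiM :: "'i set \<Rightarrow> ('i \<Rightarrow> real) measure" where
  "lebesgue_PiM I \<equiv> Pi\<^sub>M I (\<lambda>_. lborel)"

interpretation lebesgue_PiM: product_sigma_finite "\<lambda>_ :: 'i. lborel :: real measure"
  by standard

definition line_measure :: "('i \<Rightarrow> real) set \<Rightarrow> 'i \<Rightarrow> ('i \<Rightarrow> real) \<Rightarrow> ennreal" where
  "line_measure A i x = emeasure lborel {t. x(i := t) \<in> A}"

text \<open>The inequality says that each section in direction i is replaced by the open interval
  centred at 0 of the same length.\<close>

definition steiner :: "'i set \<Rightarrow> 'i \<Rightarrow> ('i \<Rightarrow> real) set \<Rightarrow> ('i \<Rightarrow> real) set" where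
  "steiner I i A = {x \<in> space (lebesgue_PiM I). ennreal (2 * \<bar>x i\<bar>) < line_measure A i x}"

lemma line_measure_upd [simp]: "line_measure A i (x(i := t)) = line_measure A i x"
  by (simp add: line_measure_def)

lemma measurable_upd_coordinate:
  assumes "i \<in> I"
  shows "(\<lambda>(x, t). x(i := t)) \<in> lebesgue_PiM I \<Otimes>\<^sub>M lborel \<rightarrow>\<^sub>M lebesgue_PiM I"
  using measurable_add_dim[of i I "\<lambda>_. lborel"] assms by (simp add: insert_absorb)

lemma upd_coordinate_space:
  "i \<in> I \<Longrightarrow> x \<in> space (lebesgue_PiM I) \<Longrightarrow> x(i := t) \<in> space (lebesgue_PiM I)"
  by (auto simp: space_PiM PiE_def extensional_def)

lemma sets_line_section:
  assumes "i \<in> I" "A \<in> sets (lebesgue_PiM I)" "x \<in> space (lebesgue_PiM I)"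
  shows "{t. x(i := t) \<in> A} \<in> sets lborel"
proof -
  have [measurable]: "(\<lambda>t. x(i := t)) \<in> lborel \<rightarrow>\<^sub>M lebesgue_PiM I"
    using measurable_compose[OF measurable_Pair1'[OF assms(3)] measurable_upd_coordinate[OF assms(1)]] by simp
  show ?thesis using measurable_sets[OF \<open>(\<lambda>t. x(i := t)) \<in> _\<close> assms(2)] by (simp add: vimage_def)
qed

lemma line_measure_eq_nn_integral:
  assumes "i \<in> I" "A \<in> sets (lebesgue_PiM I)" "x \<in> space (lebesgue_PiM I)"
  shows "line_measure A i x = (\<integral>\<^sup>+t. indicator A (x(i := t)) \<partial>lborel)"
proof -
  have "(\<integral>\<^sup>+t. indicator A (x(i := t)) \<partial>lborel) = (\<integral>\<^sup>+t. indicator {t. x(i := t) \<in> A} t \<partial>lborel)"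
    by (rule nn_integral_cong) (simp add: indicator_def)
  then show ?thesis using sets_line_section[OF assms] by (simp add: line_measure_def)
qed

lemma measurable_line_measure:
  assumes "i \<in> I" "A \<in> sets (lebesgue_PiM I)"
  shows "line_measure A i \<in> borel_measurable (lebesgue_PiM I)"
proof -
  note [measurable] = measurable_upd_coordinate[OF assms(1)] assms(2)
  have "(\<lambda>x. \<integral>\<^sup>+t. indicator A (x(i := t)) \<partial>lborel) \<in> borel_measurable (lebesgue_PiM I)"
  proof (rule lborel.borel_measurable_nn_integral)
    have "(\<lambda>z. indicator A ((\<lambda>(x, t). x(i := t)) z) :: ennreal) \<in> borel_measurable (lebesgue_PiM I \<Otimes>\<^sub>M lborel)"
      by measurable
    then show "(\<lambda>(x, t). indicator A (x(i := t)) :: ennreal) \<in> borel_measurable (lebesgue_PiM I \<Otimes>\<^sub>M lborel)"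
      by (simp add: split_beta')
  qed
  then show ?thesis by (subst measurable_cong[OF line_measure_eq_nn_integral[OF assms]])
qed

lemma sets_steiner:
  assumes "i \<in> I" "A \<in> sets (lebesgue_PiM I)"
  shows "steiner I i A \<in> sets (lebesgue_PiM I)"
proof -
  note [measurable] = measurable_line_measure[OF assms]
  have [measurable]: "(\<lambda>x. x i) \<in> borel_measurable (lebesgue_PiM I)"
    using measurable_component_singleton[OF assms(1), of "\<lambda>_. lborel :: real measure"] by simp
  show ?thesis unfolding steiner_def by measurable
qed

lemma emeasure_lebesgue_PiM_lines:
  assumes "finite I" "i \<in> I" "A \<in> sets (lebesgue_PiM I)"
  shows "emeasure (lebesgue_PiM I) A = (\<integral>\<^sup>+x. line_measure A i x \<partial>lebesgue_PiM (I - {i}))"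
proof -
  have I: "insert i (I - {i}) = I" using assms(2) by auto
  have "emeasure (lebesgue_PiM I) A = (\<integral>\<^sup>+x. indicator A x \<partial>lebesgue_PiM (insert i (I - {i})))"
    unfolding I using assms(3) by simp
  also have "\<dots> = (\<integral>\<^sup>+x. \<integral>\<^sup>+t. indicator A (x(i := t)) \<partial>lborel \<partial>lebesgue_PiM (I - {i}))"
    by (rule lebesgue_PiM.product_nn_integral_insert) (use assms I in auto)
  also have "\<dots> = (\<integral>\<^sup>+x. line_measure A i x \<partial>lebesgue_PiM (I - {i}))"
  proof (rule nn_integral_cong)
    fix x assume x: "x \<in> space (lebesgue_PiM (I - {i}))"
    then have x0: "x(i := 0) \<in> space (lebesgue_PiM I)"
      using assms(2) by (auto simp: space_PiM PiE_def extensional_def)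
    show "(\<integral>\<^sup>+t. indicator A (x(i := t)) \<partial>lborel) = line_measure A i x"
      using line_measure_eq_nn_integral[OF assms(2,3) x0] by simp
  qed
  finally show ?thesis .
qed

lemma emeasure_symmetric_interval:
  fixes c :: ennreal
  shows "emeasure lborel {t :: real. ennreal (2 * \<bar>t\<bar>) < c} = c"
proof (cases c)
  case (real r)
  have "{t :: real. ennreal (2 * \<bar>t\<bar>) < c} = {- r / 2 <..< r / 2}"
    using real by (auto simp: ennreal_less_iff abs_less_iff)
  then show ?thesis using real by simp
next
  case top
  then show ?thesis by simp
qed

lemma emeasure_steiner:
  assumes "finite I" "i \<in> I" "A \<in> sets (lebesgue_PiM I)"
  shows "emeasure (lebesgue_PiM I) (steiner I i A) = emeasure (lebesgue_PiM I) A"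
proof -
  have "line_measure (steiner I i A) i x = line_measure A i x" if "x \<in> space (lebesgue_PiM (I - {i}))" for x
  proof -
    have "x(i := t) \<in> space (lebesgue_PiM I)" for t
      using assms(2) that by (auto simp: space_PiM PiE_def extensional_def)
    then have "{t. x(i := t) \<in> steiner I i A} = {t. ennreal (2 * \<bar>t\<bar>) < line_measure A i x}"
      by (simp add: steiner_def)
    then show ?thesis using emeasure_symmetric_interval by (simp add: line_measure_def)
  qed
  then show ?thesis
    using emeasure_lebesgue_PiM_lines[OF assms]
      emeasure_lebesgue_PiM_lines[OF assms(1,2) sets_steiner[OF assms(2,3)]]
    by (simp cong: nn_integral_cong)
qed

text \<open>If all distances between two sections were smaller than \<open>r\<close>, their lengths would add up to at
  most \<open>2 r\<close>.\<close>

lemma steiner_diameter: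
  assumes I: "finite I" "i \<in> I" and A: "A \<in> sets (lebesgue_PiM I)"
    and d: "\<And>x y. x \<in> A \<Longrightarrow> y \<in> A \<Longrightarrow> (\<Sum>j\<in>I. (x j - y j)\<^sup>2) \<le> d"
    and xy: "x \<in> steiner I i A" "y \<in> steiner I i A"
  shows "(\<Sum>j\<in>I. (x j - y j)\<^sup>2) \<le> d"
proof -
  define r where "r = \<bar>x i - y i\<bar>"
  have split: "(\<Sum>j\<in>I. (u j - v j)\<^sup>2) = (u i - v i)\<^sup>2 + (\<Sum>j\<in>I - {i}. (u j - v j)\<^sup>2)" for u v :: "'a \<Rightarrow> real"
    using I by (simp add: sum.remove)
  have "\<exists>s t. x(i := s) \<in> A \<and> y(i := t) \<in> A \<and> r \<le> \<bar>s - t\<bar>"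
  proof (rule ccontr)
    assume "\<not> ?thesis"
    then have less: "\<bar>s - t\<bar> < r" if "x(i := s) \<in> A" "y(i := t) \<in> A" for s t
      using that by (meson not_le)
    define S T where "S = {s. x(i := s) \<in> A}" and "T = {t. y(i := t) \<in> A}"
    have mx: "ennreal (2 * \<bar>x i\<bar>) < emeasure lborel S" and my: "ennreal (2 * \<bar>y i\<bar>) < emeasure lborel T"
      using xy by (auto simp: steiner_def line_measure_def S_def T_def)
    have "S \<noteq> {}" "T \<noteq> {}" using mx my by auto
    then obtain s0 t0 where s0: "s0 \<in> S" and t0: "t0 \<in> T" by blast
    have L: "\<bar>s - t\<bar> < r" if "s \<in> S" "t \<in> T" for s t
      using less that by (simp add: S_def T_def)
    have "bdd_below S" by (rule bdd_belowI[of _ "t0 - r"]) (drule L[OF _ t0], linarith)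
    moreover have "bdd_above S" by (rule bdd_aboveI[of _ "t0 + r"]) (drule L[OF _ t0], linarith)
    ultimately have bS: "bdd_below S" "bdd_above S" .
    have "bdd_below T" by (rule bdd_belowI[of _ "s0 - r"]) (drule L[OF s0], linarith)
    moreover have "bdd_above T" by (rule bdd_aboveI[of _ "s0 + r"]) (drule L[OF s0], linarith)
    ultimately have bT: "bdd_below T" "bdd_above T" .
    have len: "emeasure lborel X \<le> ennreal (Sup X - Inf X)"
      if "bdd_below X" "bdd_above X" "x0 \<in> X" for X :: "real set" and x0
    proof -
      have "emeasure lborel X \<le> emeasure lborel {Inf X .. Sup X}"
        by (rule emeasure_mono) (use that cInf_lower cSup_upper in auto)
      moreover have "Inf X \<le> Sup X" using cInf_lower[OF that(3,1)] cSup_upper[OF that(3,2)] by simp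
      ultimately show ?thesis by simp
    qed
    have "ennreal (2 * \<bar>x i\<bar>) < ennreal (Sup S - Inf S)" "ennreal (2 * \<bar>y i\<bar>) < ennreal (Sup T - Inf T)"
      using less_le_trans[OF mx len[OF bS s0]] less_le_trans[OF my len[OF bT t0]] by auto
    then have "2 * \<bar>x i\<bar> < Sup S - Inf S" "2 * \<bar>y i\<bar> < Sup T - Inf T"
      by (simp_all add: ennreal_less_iff)
    moreover have "Sup S \<le> Inf T + r"
    proof (rule cSup_least)
      fix s assume s: "s \<in> S"
      have "s - r \<le> Inf T"
      proof (rule cInf_greatest)
        fix t assume "t \<in> T"
        then show "s - r \<le> t" using L[OF s, of t] by linarith
      qed (use t0 in auto)
      then show "s \<le> Inf T + r" by simp
    qed (use s0 in auto)
    moreover have "Sup T \<le> Inf S + r"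
    proof (rule cSup_least)
      fix t assume t: "t \<in> T"
      have "t - r \<le> Inf S"
      proof (rule cInf_greatest)
        fix s assume "s \<in> S"
        then show "t - r \<le> s" using L[OF _ t, of s] by linarith
      qed (use s0 in auto)
      then show "t \<le> Inf S + r" by simp
    qed (use t0 in auto)
    moreover have "r \<le> \<bar>x i\<bar> + \<bar>y i\<bar>" unfolding r_def by (rule abs_triangle_ineq4)
    ultimately show False by linarith
  qed
  then obtain s t where st: "x(i := s) \<in> A" "y(i := t) \<in> A" "r \<le> \<bar>s - t\<bar>" by blast
  have "(x i - y i)\<^sup>2 \<le> (s - t)\<^sup>2" using st(3) by (simp add: r_def abs_le_square_iff)
  then have "(\<Sum>j\<in>I. (x j - y j)\<^sup>2) \<le> (\<Sum>j\<in>I. ((x(i := s)) j - (y(i := t)) j)\<^sup>2)"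
    unfolding split by (simp cong: sum.cong_simp)
  also have "\<dots> \<le> d" by (rule d[OF st(1,2)])
  finally show ?thesis .
qed

text \<open>Sections in direction i have the same length over points that are mirror images in
  coordinate j. Hence symmetrizing in a further coordinate preserves the reflections already
  gained.\<close>

lemma line_measure_reflect_other:
  assumes "i \<noteq> j" and sym: "\<And>x. x \<in> A \<Longrightarrow> x(j := - x j) \<in> A"
  shows "line_measure A i (x(j := - x j)) = line_measure A i x"
proof -
  have "(x(j := - x j))(i := t) \<in> A \<longleftrightarrow> x(i := t) \<in> A" for t
  proof -
    have e: "(x(j := - x j))(i := t) = (x(i := t))(j := - (x(i := t)) j)"
      using assms(1) by (simp add: fun_upd_twist)
    have "(x(j := - x j))(i := t) \<in> A" if "x(i := t) \<in> A" unfolding e by (rule sym[OF that])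
    moreover have "x(i := t) \<in> A" if "(x(j := - x j))(i := t) \<in> A"
    proof -
      have "((x(j := - x j))(i := t))(j := - ((x(j := - x j))(i := t)) j) = x(i := t)"
        using assms(1) by (auto simp: fun_eq_iff)
      then show ?thesis using sym[OF that] by simp
    qed
    ultimately show ?thesis by blast
  qed
  then show ?thesis by (simp add: line_measure_def)
qed

lemma symmetrize:
  assumes I: "finite I" and A: "A \<in> sets (lebesgue_PiM I)"
    and d: "\<And>x y. x \<in> A \<Longrightarrow> y \<in> A \<Longrightarrow> (\<Sum>j\<in>I. (x j - y j)\<^sup>2) \<le> d"
    and J: "finite J" "J \<subseteq> I"
  shows "\<exists>B\<in>sets (lebesgue_PiM I). emeasure (lebesgue_PiM I) B = emeasure (lebesgue_PiM I) A \<and>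
    (\<forall>x\<in>B. \<forall>y\<in>B. (\<Sum>j\<in>I. (x j - y j)\<^sup>2) \<le> d) \<and> (\<forall>j\<in>J. \<forall>x\<in>B. x(j := - x j) \<in> B)"
  using J
proof (induction J rule: finite_induct)
  case empty
  then show ?case using A d by blast
next
  case (insert i J)
  then obtain B where B: "B \<in> sets (lebesgue_PiM I)" "emeasure (lebesgue_PiM I) B = emeasure (lebesgue_PiM I) A"
    "\<And>x y. x \<in> B \<Longrightarrow> y \<in> B \<Longrightarrow> (\<Sum>j\<in>I. (x j - y j)\<^sup>2) \<le> d"
    "\<And>j x. j \<in> J \<Longrightarrow> x \<in> B \<Longrightarrow> x(j := - x j) \<in> B"
    by blast
  have i: "i \<in> I" using insert by auto
  show ?case
  proof (intro bexI[of _ "steiner I i B"] conjI ballI)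
    show "steiner I i B \<in> sets (lebesgue_PiM I)" by (rule sets_steiner[OF i B(1)])
    show "emeasure (lebesgue_PiM I) (steiner I i B) = emeasure (lebesgue_PiM I) A"
      using emeasure_steiner[OF I i B(1)] B(2) by simp
    show "(\<Sum>j\<in>I. (x j - y j)\<^sup>2) \<le> d" if "x \<in> steiner I i B" "y \<in> steiner I i B" for x y
      by (rule steiner_diameter[OF I i B(1) B(3) that])
    show "x(j := - x j) \<in> steiner I i B" if j: "j \<in> insert i J" and x: "x \<in> steiner I i B" for j x
    proof -
      have sp: "x(j := - x j) \<in> space (lebesgue_PiM I)"
        by (rule upd_coordinate_space) (use j insert x in \<open>auto simp: steiner_def\<close>)
      show ?thesis
      proof (cases "j = i")
        case True
        then show ?thesis using sp x by (simp add: steiner_def)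
      next
        case False
        then have "line_measure B i (x(j := - x j)) = line_measure B i x"
          using j B(4) by (intro line_measure_reflect_other) auto
        then show ?thesis using sp x False by (simp add: steiner_def)
      qed
    qed
  qed
qed

text \<open>Symmetrizing in all coordinates keeps the volume and the bound on distances and makes
  the set invariant under every coordinate reflection, hence under x \<mapsto> -x. The distance of x
  and -x is at most d, so the set lies in the ball of radius d / 2.\<close>

proposition isodiametric_PiM:
  assumes I: "finite I" and A: "A \<in> sets (lebesgue_PiM I)" and d0: "0 \<le> d"
    and d: "\<And>x y. x \<in> A \<Longrightarrow> y \<in> A \<Longrightarrow> (\<Sum>j\<in>I. (x j - y j)\<^sup>2) \<le> d\<^sup>2"
  shows "emeasure (lebesgue_PiM I) A \<le> ennreal (unit_ball_vol (real (card I)) * (d / 2) ^ card I)"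
proof -
  obtain B where B: "B \<in> sets (lebesgue_PiM I)" "emeasure (lebesgue_PiM I) B = emeasure (lebesgue_PiM I) A"
    "\<And>x y. x \<in> B \<Longrightarrow> y \<in> B \<Longrightarrow> (\<Sum>j\<in>I. (x j - y j)\<^sup>2) \<le> d\<^sup>2"
    "\<And>j x. j \<in> I \<Longrightarrow> x \<in> B \<Longrightarrow> x(j := - x j) \<in> B"
    using symmetrize[OF I A d I subset_refl] by blast
  have refl: "J \<subseteq> I \<Longrightarrow> x \<in> B \<Longrightarrow> (\<lambda>j. if j \<in> J then - x j else x j) \<in> B" for J x
  proof (induction J rule: infinite_finite_induct)
    case (infinite J)
    then show ?case using I finite_subset by blast
  next
    case (insert j J)
    let ?y = "\<lambda>j. if j \<in> J then - x j else x j"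
    have "?y(j := - ?y j) \<in> B" using insert by (intro B(4)) auto
    moreover have "?y(j := - ?y j) = (\<lambda>k. if k \<in> insert j J then - x k else x k)" using insert by auto
    ultimately show ?case by simp
  qed simp
  have sub: "B \<subseteq> {f. sqrt (\<Sum>i\<in>I. (f i)\<^sup>2) \<le> d / 2} \<inter> space (lebesgue_PiM I)"
  proof safe
    fix x assume x: "x \<in> B"
    have "(\<Sum>j\<in>I. (x j - (if j \<in> I then - x j else x j))\<^sup>2) \<le> d\<^sup>2"
      using B(3)[OF x refl[OF subset_refl x]] .
    moreover have "(\<Sum>j\<in>I. (x j - (if j \<in> I then - x j else x j))\<^sup>2) = 4 * (\<Sum>j\<in>I. (x j)\<^sup>2)"
      unfolding sum_distrib_left by (intro sum.cong) (auto simp: power2_eq_square)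
    ultimately have "(\<Sum>j\<in>I. (x j)\<^sup>2) \<le> (d / 2)\<^sup>2" by (simp add: power_divide)
    then show "sqrt (\<Sum>j\<in>I. (x j)\<^sup>2) \<le> d / 2" using d0 by (intro real_le_lsqrt sum_nonneg) auto
    show "x \<in> space (lebesgue_PiM I)" using x B(1) sets.sets_into_space by blast
  qed
  have meas: "{f. sqrt (\<Sum>i\<in>I. (f i)\<^sup>2) \<le> r} \<inter> space (lebesgue_PiM I) \<in> sets (lebesgue_PiM I)" for r
  proof -
    have "{f \<in> space (lebesgue_PiM I). sqrt (\<Sum>i\<in>I. (f i)\<^sup>2) \<le> r} \<in> sets (lebesgue_PiM I)" by measurable
    moreover have "{f. sqrt (\<Sum>i\<in>I. (f i)\<^sup>2) \<le> r} \<inter> space (lebesgue_PiM I) = {f \<in> space (lebesgue_PiM I). sqrt (\<Sum>i\<in>I. (f i)\<^sup>2) \<le> r}"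
      by auto
    ultimately show ?thesis by simp
  qed
  \<comment> \<open>The volume formula for balls is applied with a positive radius, whereas d may be
    0; so the bound is shown for every r > d / 2 and r then tends to d / 2.\<close>
  have le: "emeasure (lebesgue_PiM I) A \<le> ennreal (unit_ball_vol (real (card I)) * r ^ card I)" if r: "d / 2 < r" for r
  proof -
    have "{f. sqrt (\<Sum>i\<in>I. (f i)\<^sup>2) \<le> d / 2} \<inter> space (lebesgue_PiM I) \<subseteq> {f. sqrt (\<Sum>i\<in>I. (f i)\<^sup>2) \<le> r} \<inter> space (lebesgue_PiM I)"
      using r by auto
    then have "emeasure (lebesgue_PiM I) A \<le> emeasure (lebesgue_PiM I) ({f. sqrt (\<Sum>i\<in>I. (f i)\<^sup>2) \<le> r} \<inter> space (lebesgue_PiM I))"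
      unfolding B(2)[symmetric] using sub meas by (intro emeasure_mono) auto
    also have "\<dots> = ennreal (unit_ball_vol (real (card I)) * r ^ card I)"
      by (rule emeasure_cball_aux) (use I d0 r in auto)
    finally show ?thesis .
  qed
  have "((\<lambda>r. ennreal (unit_ball_vol (real (card I)) * r ^ card I)) \<longlongrightarrow> ennreal (unit_ball_vol (real (card I)) * (d / 2) ^ card I)) (at_right (d / 2))"
    by (intro tendsto_intros)
  moreover have "\<forall>\<^sub>F r in at_right (d / 2). emeasure (lebesgue_PiM I) A \<le> ennreal (unit_ball_vol (real (card I)) * r ^ card I)"
    using eventually_at_right_less[of "d / 2"] by eventually_elim (rule le)
  ultimately show ?thesis by (rule tendsto_lowerbound) simp
qed

text \<open>Sign 1 gives translations, sign -1 the reflections that appear when the order of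
  integration is exchanged in the uniqueness proof for invariant measures.\<close>

lemma distr_lebesgue_PiM_affine:
  fixes c :: "'i \<Rightarrow> real" and \<sigma> :: real
  assumes I: "finite I" and s: "\<bar>\<sigma>\<bar> = 1"
  shows "distr (lebesgue_PiM I) (lebesgue_PiM I) (\<lambda>x. \<lambda>i\<in>I. c i + \<sigma> * x i) = lebesgue_PiM I"
proof (rule lebesgue_PiM.PiM_eqI[OF I])
  have meas: "(\<lambda>x. \<lambda>i\<in>I. c i + \<sigma> * x i) \<in> lebesgue_PiM I \<rightarrow>\<^sub>M lebesgue_PiM I"
    by (intro measurable_restrict) measurable
  fix A assume A: "\<And>i. i \<in> I \<Longrightarrow> A i \<in> sets (lborel :: real measure)"
  have "emeasure (distr (lebesgue_PiM I) (lebesgue_PiM I) (\<lambda>x. \<lambda>i\<in>I. c i + \<sigma> * x i)) (Pi\<^sub>E I A)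
    = emeasure (lebesgue_PiM I) ((\<lambda>x. \<lambda>i\<in>I. c i + \<sigma> * x i) -` (Pi\<^sub>E I A) \<inter> space (lebesgue_PiM I))"
    by (intro emeasure_distr meas sets_PiM_I_finite I A)
  also have "(\<lambda>x. \<lambda>i\<in>I. c i + \<sigma> * x i) -` (Pi\<^sub>E I A) \<inter> space (lebesgue_PiM I) = Pi\<^sub>E I (\<lambda>i. (\<lambda>t. c i + \<sigma> * t) -` A i)"
    by (auto simp: space_PiM PiE_iff)
  also have "emeasure (lebesgue_PiM I) \<dots> = (\<Prod>i\<in>I. emeasure lborel ((\<lambda>t. c i + \<sigma> * t) -` A i))"
  proof (rule lebesgue_PiM.emeasure_PiM[OF I])
    fix i assume "i \<in> I"
    have "(\<lambda>t. c i + \<sigma> * t) \<in> borel_measurable borel" by measurable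
    from measurable_sets[OF this, of "A i"] A[OF \<open>i \<in> I\<close>] show "(\<lambda>t. c i + \<sigma> * t) -` A i \<in> sets lborel" by simp
  qed
  also have "\<dots> = (\<Prod>i\<in>I. emeasure lborel (A i))"
  proof (rule prod.cong[OF refl])
    fix i assume i: "i \<in> I"
    have "\<sigma> \<noteq> 0" using s by auto
    then have "(lborel :: real measure) = density (distr lborel borel (\<lambda>t. c i + \<sigma> * t)) (\<lambda>_. ennreal \<bar>\<sigma>\<bar>)"
      by (rule lborel_real_affine)
    then have "lborel = distr lborel borel (\<lambda>t. c i + \<sigma> * t)" by (simp add: s density_1)
    then have "emeasure lborel (A i) = emeasure (distr lborel borel (\<lambda>t. c i + \<sigma> * t)) (A i)" by simp
    also have "\<dots> = emeasure lborel ((\<lambda>t. c i + \<sigma> * t) -` A i)"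
      using A[OF i] by (subst emeasure_distr) auto
    finally show "emeasure lborel ((\<lambda>t. c i + \<sigma> * t) -` A i) = emeasure lborel (A i)" by simp
  qed
  finally show "emeasure (distr (lebesgue_PiM I) (lebesgue_PiM I) (\<lambda>x. \<lambda>i\<in>I. c i + \<sigma> * x i)) (Pi\<^sub>E I A)
    = (\<Prod>i\<in>I. emeasure lborel (A i))" .
qed simp

lemma hausdorff_content_Un:
  assumes "0 \<le> \<delta>"
  shows "hausdorff_content k \<delta> (A \<union> B) \<le> hausdorff_content k \<delta> A + hausdorff_content k \<delta> B"
proof -
  let ?X = "\<lambda>i. if i = 0 then A else if i = (1::nat) then B else {}"
  have "(\<Sum>i. hausdorff_content k \<delta> (?X i)) = (\<Sum>i\<in>{0, 1}. hausdorff_content k \<delta> (?X i))"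
    by (rule Series.suminf_finite) (use assms in \<open>auto simp: hausdorff_content_empty\<close>)
  moreover have "(\<Union>i. ?X i) = A \<union> B" by (auto split: if_splits)
  ultimately show ?thesis using hausdorff_content_countably_subadditive[of k \<delta> ?X] by simp
qed

lemma hausdorff_content_UN:
  assumes "0 \<le> \<delta>" "finite K"
  shows "hausdorff_content k \<delta> (\<Union>i\<in>K. A i) \<le> (\<Sum>i\<in>K. hausdorff_content k \<delta> (A i))"
  using assms(2)
proof induction
  case (insert i K)
  then show ?case
    using order_trans[OF hausdorff_content_Un[OF assms(1)] add_left_mono] by simp
qed (simp add: hausdorff_content_empty assms)

lemma hausdorff_outer_translation:
  fixes A :: "'a::real_normed_vector set"
  shows "hausdorff_outer k ((\<lambda>x. v + x) ` A) = hausdorff_outer k A"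
proof (rule antisym)
  show "hausdorff_outer k ((\<lambda>x. v + x) ` A) \<le> hausdorff_outer k A"
    using hausdorff_outer_lipschitz_image[of 1 A "\<lambda>x. v + x" k] by simp
  have "hausdorff_outer k ((\<lambda>x. - v + x) ` ((\<lambda>x. v + x) ` A)) \<le> hausdorff_outer k ((\<lambda>x. v + x) ` A)"
    using hausdorff_outer_lipschitz_image[of 1 "(\<lambda>x. v + x) ` A" "\<lambda>x. - v + x" k] by (simp add: dist_norm)
  then show "hausdorff_outer k A \<le> hausdorff_outer k ((\<lambda>x. v + x) ` A)" by (simp add: image_image)
qed

section \<open>Lebesgue and Hausdorff measure on a subspace\<close>

locale orthonormal_frame =
  fixes B :: "'z::euclidean_space set"
  assumes fin: "finite B"
    and inner: "\<And>b c. b \<in> B \<Longrightarrow> c \<in> B \<Longrightarrow> b \<bullet> c = (if b = c then 1 else 0)"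
begin

definition emb :: "('z \<Rightarrow> real) \<Rightarrow> 'z" where "emb x = (\<Sum>b\<in>B. x b *\<^sub>R b)"

definition leb :: "'z measure" where "leb = distr (lebesgue_PiM B) borel emb"

definition cube :: "'z set" where "cube = {z \<in> span B. \<forall>b\<in>B. 0 \<le> z \<bullet> b \<and> z \<bullet> b < 1}"

lemma emb_inner: "b \<in> B \<Longrightarrow> emb x \<bullet> b = x b"
  using fin by (simp add: emb_def inner_sum_left inner if_distrib[of "\<lambda>y. _ * y"] sum.delta cong: if_cong)

lemma norm_emb: "(norm (emb x))\<^sup>2 = (\<Sum>b\<in>B. (x b)\<^sup>2)"
proof -
  have "(norm (emb x))\<^sup>2 = emb x \<bullet> (\<Sum>b\<in>B. x b *\<^sub>R b)" by (simp add: power2_norm_eq_inner emb_def)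
  also have "\<dots> = (\<Sum>b\<in>B. x b * (emb x \<bullet> b))" by (simp add: inner_sum_right)
  also have "\<dots> = (\<Sum>b\<in>B. (x b)\<^sup>2)" by (intro sum.cong) (auto simp: emb_inner power2_eq_square)
  finally show ?thesis .
qed

lemma emb_diff: "emb x - emb y = emb (\<lambda>b. x b - y b)"
  by (simp add: emb_def sum_subtractf scaleR_diff_left)

lemma emb_affine: "v + \<sigma> *\<^sub>R emb x = emb (\<lambda>b\<in>B. v \<bullet> b + \<sigma> * x b)" if "emb (\<lambda>b. v \<bullet> b) = v"
proof -
  have "emb (\<lambda>b\<in>B. v \<bullet> b + \<sigma> * x b) = emb (\<lambda>b. v \<bullet> b) + \<sigma> *\<^sub>R emb x"
    by (simp add: emb_def scaleR_add_left sum.distrib scaleR_sum_right)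
  then show ?thesis using that by simp
qed

lemma emb_span: "emb x \<in> span B"
  unfolding emb_def by (intro span_sum span_scale span_base)

lemma emb_coords: "z \<in> span B \<Longrightarrow> emb (\<lambda>b. z \<bullet> b) = z"
proof (induction rule: span_induct_alt)
  case (step c x y)
  have "emb (\<lambda>b. (c *\<^sub>R x + y) \<bullet> b) = c *\<^sub>R emb (\<lambda>b. x \<bullet> b) + emb (\<lambda>b. y \<bullet> b)"
    by (simp add: emb_def inner_add_left scaleR_add_left sum.distrib scaleR_sum_right)
  moreover have "emb (\<lambda>b. x \<bullet> b) = (\<Sum>b\<in>B. if b = x then x else 0)"
    unfolding emb_def by (intro sum.cong) (use step inner in auto)
  ultimately show ?case using step fin by simp
qed (simp add: emb_def)

lemma norm_span: "z \<in> span B \<Longrightarrow> (norm z)\<^sup>2 = (\<Sum>b\<in>B. (z \<bullet> b)\<^sup>2)"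
  using norm_emb[of "\<lambda>b. z \<bullet> b"] emb_coords[of z] by simp

lemma measurable_emb [measurable]: "emb \<in> lebesgue_PiM B \<rightarrow>\<^sub>M borel"
  unfolding emb_def
  by (intro borel_measurable_sum borel_measurable_scaleR borel_measurable_const)
    (use measurable_component_singleton[of _ B "\<lambda>_. lborel :: real measure"] in simp)

lemma sets_leb [simp, measurable_cong]: "sets leb = sets borel" and space_leb [simp]: "space leb = UNIV"
  by (simp_all add: leb_def)

lemma closed_span_frame: "closed (span B)" by (rule closed_subspace) simp

lemma borel_span [measurable]: "span B \<in> sets borel" using closed_span_frame by simp

lemma borel_cube [measurable]: "cube \<in> sets borel"
proof -
  have "cube = span B \<inter> (\<Inter>b\<in>B. {z. 0 \<le> z \<bullet> b} \<inter> {z. z \<bullet> b < 1}) \<inter> UNIV" by (auto simp: cube_def)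
  moreover have "(\<Inter>b\<in>B. {z. 0 \<le> z \<bullet> b} \<inter> {z. z \<bullet> b < 1}) \<in> sets borel"
    using fin by (cases "B = {}") (auto intro!: sets.finite_INT)
  ultimately show ?thesis by (simp add: sets.Int)
qed

lemma emeasure_leb:
  "A \<in> sets borel \<Longrightarrow> emeasure leb A = emeasure (lebesgue_PiM B) (emb -` A \<inter> space (lebesgue_PiM B))"
  unfolding leb_def by (rule emeasure_distr) simp_all

lemma AE_leb_span: "AE z in leb. z \<in> span B"
  unfolding leb_def by (subst AE_distr_iff) (auto simp: emb_span)

lemma emeasure_leb_Int_span: "A \<in> sets borel \<Longrightarrow> emeasure leb (A \<inter> span B) = emeasure leb A"
  by (rule emeasure_eq_AE) (use AE_leb_span in auto)

lemma distr_leb_affine: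
  assumes v: "v \<in> span B" and s: "\<bar>\<sigma>\<bar> = 1"
  shows "distr leb borel (\<lambda>z. v + \<sigma> *\<^sub>R z) = leb"
proof -
  have "distr leb borel (\<lambda>z. v + \<sigma> *\<^sub>R z) = distr (lebesgue_PiM B) borel (\<lambda>x. emb (\<lambda>b\<in>B. v \<bullet> b + \<sigma> * x b))"
    unfolding leb_def by (subst distr_distr) (auto simp: o_def emb_affine[OF emb_coords[OF v]])
  also have "\<dots> = distr (distr (lebesgue_PiM B) (lebesgue_PiM B) (\<lambda>x. \<lambda>b\<in>B. v \<bullet> b + \<sigma> * x b)) borel emb"
    by (subst distr_distr) (auto simp: o_def)
  also have "\<dots> = leb" unfolding distr_lebesgue_PiM_affine[OF fin s] leb_def ..
  finally show ?thesis .
qed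

lemma nn_integral_leb_affine:
  assumes "v \<in> span B" "\<bar>\<sigma>\<bar> = 1" "f \<in> borel_measurable borel"
  shows "(\<integral>\<^sup>+z. f (v + \<sigma> *\<^sub>R z) \<partial>leb) = (\<integral>\<^sup>+z. f z \<partial>leb)"
proof -
  have "(\<integral>\<^sup>+z. f z \<partial>leb) = (\<integral>\<^sup>+z. f z \<partial>distr leb borel (\<lambda>z. v + \<sigma> *\<^sub>R z))"
    unfolding distr_leb_affine[OF assms(1,2)] ..
  also have "\<dots> = (\<integral>\<^sup>+z. f (v + \<sigma> *\<^sub>R z) \<partial>leb)"
    by (rule nn_integral_distr) (use assms(3) in auto)
  finally show ?thesis by simp
qed

lemma leb_le_cost:
  assumes "A \<in> sets borel" "bounded A"
  shows "emeasure leb A \<le> hausdorff_cost (card B) A"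
proof (cases "A = {}")
  case False
  have "emeasure leb A \<le> ennreal (unit_ball_vol (real (card B)) * (diameter A / 2) ^ card B)"
    unfolding emeasure_leb[OF assms(1)]
  proof (rule isodiametric_PiM[OF fin])
    show "emb -` A \<inter> space (lebesgue_PiM B) \<in> sets (lebesgue_PiM B)"
      by (rule measurable_sets[OF measurable_emb assms(1)])
    show "(\<Sum>j\<in>B. (x j - y j)\<^sup>2) \<le> (diameter A)\<^sup>2"
      if "x \<in> emb -` A \<inter> space (lebesgue_PiM B)" "y \<in> emb -` A \<inter> space (lebesgue_PiM B)" for x y
    proof -
      have "dist (emb x) (emb y) \<le> diameter A"
        using that diameter_bounded_bound[OF assms(2)] by blast
      then have "(norm (emb (\<lambda>b. x b - y b)))\<^sup>2 \<le> (diameter A)\<^sup>2"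
        by (intro power_mono) (auto simp: dist_norm emb_diff)
      then show ?thesis unfolding norm_emb .
    qed
  qed (rule diameter_ge_0[OF assms(2)])
  then show ?thesis using False by (simp add: hausdorff_cost_def)
qed simp

text \<open>The isodiametric inequality bounds the volume of each covering set by its cost, whatever
  its diameter, so the single scale 1 is enough. Passing to closures makes the covering sets Borel
  without changing their diameters.\<close>

lemma leb_le_hausdorff:
  assumes "A \<in> sets borel"
  shows "emeasure leb A \<le> hausdorff_outer (card B) A"
proof -
  have "emeasure leb A \<le> hausdorff_content (card B) 1 A"
    unfolding hausdorff_content_altdef
  proof (rule INF_greatest)
    fix U assume "U \<in> hausdorff_covers 1 A"
    then have U: "A \<subseteq> (\<Union>i. U i)" "\<And>i. bounded (U i)" by (auto simp: hausdorff_covers_def)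
    have "emeasure leb A \<le> emeasure leb (\<Union>i. closure (U i))"
      by (rule emeasure_mono) (use U(1) closure_subset in \<open>auto, blast\<close>)
    also have "\<dots> \<le> (\<Sum>i. emeasure leb (closure (U i)))"
      by (rule emeasure_subadditive_countably) auto
    also have "\<dots> \<le> (\<Sum>i. hausdorff_cost (card B) (U i))"
    proof (rule suminf_le)
      fix i
      have "emeasure leb (closure (U i)) \<le> hausdorff_cost (card B) (closure (U i))"
        by (rule leb_le_cost) (use U(2) in \<open>auto simp: bounded_closure\<close>)
      also have "\<dots> = hausdorff_cost (card B) (U i)"
        using diameter_closure[OF U(2)] by (simp add: hausdorff_cost_def)
      finally show "emeasure leb (closure (U i)) \<le> hausdorff_cost (card B) (U i)" .
    qed auto
    finally show "emeasure leb A \<le> (\<Sum>i. hausdorff_cost (card B) (U i))" .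
  qed
  also have "\<dots> \<le> hausdorff_outer (card B) A" by (rule hausdorff_outer_ge) simp
  finally show ?thesis .
qed

lemma leb_cball:
  assumes "p \<in> span B" "0 < r"
  shows "emeasure leb (cball p r) = ennreal (unit_ball_vol (real (card B)) * r ^ card B)"
proof -
  have "emeasure leb (cball p r) = (\<integral>\<^sup>+z. indicator (cball p r) z \<partial>leb)" by simp
  also have "\<dots> = (\<integral>\<^sup>+z. indicator (cball p r) (p + 1 *\<^sub>R z) \<partial>leb)"
    by (rule nn_integral_leb_affine[symmetric]) (use assms in \<open>auto intro!: borel_measurable_indicator\<close>)
  also have "\<dots> = (\<integral>\<^sup>+z. indicator (cball 0 r) z \<partial>leb)"
    by (intro nn_integral_cong) (simp add: indicator_def dist_norm)
  also have "\<dots> = emeasure (lebesgue_PiM B) (emb -` cball 0 r \<inter> space (lebesgue_PiM B))"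
    by (simp add: emeasure_leb)
  also have "emb -` cball 0 r \<inter> space (lebesgue_PiM B) = {f. sqrt (\<Sum>b\<in>B. (f b)\<^sup>2) \<le> r} \<inter> space (lebesgue_PiM B)"
    by (simp add: norm_emb[symmetric] vimage_def)
  also have "emeasure (lebesgue_PiM B) \<dots> = ennreal (unit_ball_vol (real (card B)) * r ^ card B)"
    by (rule emeasure_cball_aux) (use fin assms in auto)
  finally show ?thesis .
qed

lemma leb_cube: "emeasure leb cube = 1"
proof -
  have "emb -` cube \<inter> space (lebesgue_PiM B) = Pi\<^sub>E B (\<lambda>_. {0..<1})"
    by (auto simp: cube_def emb_span emb_inner space_PiM PiE_iff)
  then have "emeasure leb cube = (\<Prod>b\<in>B. emeasure lborel {0..<1::real})"
    by (simp add: emeasure_leb lebesgue_PiM.emeasure_PiM[OF fin])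
  then show ?thesis by simp
qed

text \<open>Kept as a measure on the whole space rather than on the subspace, so that translations
  and product integrals can be handled with ordinary Borel measurability.\<close>

definition hsp :: "'z measure" where
  "hsp = density (hausdorff_measure (card B)) (indicator (span B))"

lemma sets_hsp [simp, measurable_cong]: "sets hsp = sets borel" and space_hsp [simp]: "space hsp = UNIV"
  by (simp_all add: hsp_def)

lemma emeasure_hsp:
  assumes A: "A \<in> sets borel"
  shows "emeasure hsp A = hausdorff_outer (card B) (A \<inter> span B)"
proof -
  have "emeasure hsp A = (\<integral>\<^sup>+x. indicator (span B) x * indicator A x \<partial>hausdorff_measure (card B))"
    unfolding hsp_def by (rule emeasure_density) (use A in auto)
  also have "\<dots> = (\<integral>\<^sup>+x. indicator (A \<inter> span B) x \<partial>hausdorff_measure (card B))"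
    by (intro nn_integral_cong) (auto simp: indicator_def)
  also have "\<dots> = hausdorff_outer (card B) (A \<inter> span B)"
    using A by (simp add: emeasure_hausdorff_measure)
  finally show ?thesis .
qed

lemma AE_hsp_span: "AE z in hsp. z \<in> span B"
proof (rule AE_I')
  show "- span B \<in> null_sets hsp" by (auto simp: null_sets_def emeasure_hsp)
qed auto

lemma distr_hsp_translation:
  assumes v: "v \<in> span B"
  shows "distr hsp borel (\<lambda>z. v + z) = hsp"
proof (rule measure_eqI)
  fix A assume "A \<in> sets (distr hsp borel (\<lambda>z. v + z))"
  then have A: "A \<in> sets borel" by simp
  have "emeasure (distr hsp borel (\<lambda>z. v + z)) A = emeasure hsp ((\<lambda>z. v + z) -` A)"
    using A by (subst emeasure_distr) auto
  also have "\<dots> = hausdorff_outer (card B) ((\<lambda>z. v + z) -` A \<inter> span B)"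
    by (rule emeasure_hsp) (use measurable_sets[of "\<lambda>z. v + z" borel borel A] A in simp)
  also have "\<dots> = hausdorff_outer (card B) ((\<lambda>z. v + z) ` ((\<lambda>z. v + z) -` A \<inter> span B))"
    by (rule hausdorff_outer_translation[symmetric])
  also have "(\<lambda>z. v + z) ` ((\<lambda>z. v + z) -` A \<inter> span B) = A \<inter> span B"
  proof safe
    fix x assume "x \<in> A" "x \<in> span B"
    then have "x - v \<in> (\<lambda>z. v + z) -` A \<inter> span B" using v by (simp add: span_diff)
    then show "x \<in> (\<lambda>z. v + z) ` ((\<lambda>z. v + z) -` A \<inter> span B)"
      by (intro image_eqI[of _ _ "x - v"]) auto
  qed (use v span_add in auto)
  finally show "emeasure (distr hsp borel (\<lambda>z. v + z)) A = emeasure hsp A" using A by (simp add: emeasure_hsp)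
qed simp

lemma nn_integral_hsp_translation:
  assumes "v \<in> span B" "f \<in> borel_measurable borel"
  shows "(\<integral>\<^sup>+z. f (v + z) \<partial>hsp) = (\<integral>\<^sup>+z. f z \<partial>hsp)"
proof -
  have "(\<integral>\<^sup>+z. f z \<partial>hsp) = (\<integral>\<^sup>+z. f z \<partial>distr hsp borel (\<lambda>z. v + z))"
    unfolding distr_hsp_translation[OF assms(1)] ..
  also have "\<dots> = (\<integral>\<^sup>+z. f (v + z) \<partial>hsp)"
    by (rule nn_integral_distr) (use assms(2) in auto)
  finally show ?thesis by simp
qed

definition grid :: "nat \<Rightarrow> ('z \<Rightarrow> nat) set" where "grid n = Pi\<^sub>E B (\<lambda>_. {0..<n})"

definition mid :: "nat \<Rightarrow> ('z \<Rightarrow> nat) \<Rightarrow> 'z" where "mid n \<kappa> = emb (\<lambda>b. (real (\<kappa> b) + 1 / 2) / real n)"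

lemma finite_grid: "finite (grid n)" and card_grid: "card (grid n) = n ^ card B"
  using fin by (simp_all add: grid_def finite_PiE card_PiE)

lemma cube_subset_cells:
  assumes n: "0 < n"
  shows "cube \<subseteq> (\<Union>\<kappa>\<in>grid n. {z \<in> span B. \<forall>b\<in>B. real (\<kappa> b) / real n \<le> z \<bullet> b \<and> z \<bullet> b < (real (\<kappa> b) + 1) / real n})"
proof
  fix z assume z: "z \<in> cube"
  define \<kappa> where "\<kappa> = (\<lambda>b\<in>B. nat \<lfloor>real n * (z \<bullet> b)\<rfloor>)"
  have k: "real (\<kappa> b) \<le> real n * (z \<bullet> b) \<and> real n * (z \<bullet> b) < real (\<kappa> b) + 1 \<and> \<kappa> b < n" if b: "b \<in> B" for b
  proof -
    have zb: "0 \<le> z \<bullet> b" "z \<bullet> b < 1" using z b by (auto simp: cube_def)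
    then have "0 \<le> real n * (z \<bullet> b)" "real n * (z \<bullet> b) < real n * 1"
      using n by (auto intro!: mult_strict_left_mono)
    moreover have "real (\<kappa> b) = real_of_int \<lfloor>real n * (z \<bullet> b)\<rfloor>" using zb b by (simp add: \<kappa>_def)
    ultimately have "real (\<kappa> b) \<le> real n * (z \<bullet> b)" "real n * (z \<bullet> b) < real (\<kappa> b) + 1" "real (\<kappa> b) < real n"
      by linarith+
    then show ?thesis by simp
  qed
  then have "\<kappa> \<in> grid n" by (auto simp: grid_def \<kappa>_def)
  moreover have "z \<in> {z \<in> span B. \<forall>b\<in>B. real (\<kappa> b) / real n \<le> z \<bullet> b \<and> z \<bullet> b < (real (\<kappa> b) + 1) / real n}"
    using k z n by (auto simp: cube_def pos_divide_le_eq pos_less_divide_eq mult.commute)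
  ultimately show "z \<in> (\<Union>\<kappa>\<in>grid n. {z \<in> span B. \<forall>b\<in>B. real (\<kappa> b) / real n \<le> z \<bullet> b \<and> z \<bullet> b < (real (\<kappa> b) + 1) / real n})"
    by blast
qed

text \<open>A grid of n^j cells of diameter sqrt j / n has a total cost that does not depend on n.
  The crude constant suffices: finiteness gives sigma-finiteness and allows the later comparison of
  the cube with itself.\<close>

lemma hausdorff_cube_finite: "hausdorff_outer (card B) cube < top"
proof -
  define j where "j = card B"
  define C where "C = unit_ball_vol (real j) * (sqrt (real j) / 2) ^ j"
  have "hausdorff_content j \<delta> cube \<le> ennreal C" if d: "0 < \<delta>" for \<delta>
  proof -
    obtain n where n: "sqrt (real j) / \<delta> < real n" "0 < n"
      using reals_Archimedean2[of "max 1 (sqrt (real j) / \<delta>)"] by auto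
    then have nd: "sqrt (real j) / real n \<le> \<delta>" using d by (simp add: divide_less_eq pos_divide_le_eq mult.commute)
    let ?cell = "\<lambda>\<kappa>. {z \<in> span B. \<forall>b\<in>B. real (\<kappa> b) / real n \<le> z \<bullet> b \<and> z \<bullet> b < (real (\<kappa> b) + 1) / real n}"
    have dist: "norm (x - y) \<le> sqrt (real j) / real n" if "x \<in> ?cell \<kappa>" "y \<in> ?cell \<kappa>" for x y and \<kappa> :: "'z \<Rightarrow> nat"
    proof -
      have "((x - y) \<bullet> b)\<^sup>2 \<le> (1 / real n)\<^sup>2" if b: "b \<in> B" for b
      proof -
        have "\<bar>(x - y) \<bullet> b\<bar> \<le> 1 / real n"
          using \<open>x \<in> ?cell \<kappa>\<close> \<open>y \<in> ?cell \<kappa>\<close> b by (force simp: inner_diff_left add_divide_distrib abs_le_iff)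
        then show ?thesis using n by (simp add: abs_le_square_iff[symmetric])
      qed
      then have "(\<Sum>b\<in>B. ((x - y) \<bullet> b)\<^sup>2) \<le> (\<Sum>b\<in>B. (1 / real n)\<^sup>2)" by (rule sum_mono)
      also have "\<dots> = (sqrt (real j) / real n)\<^sup>2" by (simp add: j_def power_divide)
      finally have "(norm (x - y))\<^sup>2 \<le> (sqrt (real j) / real n)\<^sup>2"
        using that by (subst norm_span) (auto intro: span_diff)
      then show ?thesis by (rule power2_le_imp_le) simp
    qed
    have bdd: "bounded (?cell \<kappa>)" for \<kappa> :: "'z \<Rightarrow> nat"
    proof (cases "?cell \<kappa> = {}")
      case False
      then obtain x where x: "x \<in> ?cell \<kappa>" by blast
      show ?thesis
        unfolding bounded_def by (rule exI[of _ x], rule exI[of _ "sqrt (real j) / real n"]) (use dist[OF x] in \<open>auto simp: dist_norm\<close>)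
    qed (simp only: bounded_empty)
    have diam: "diameter (?cell \<kappa>) \<le> sqrt (real j) / real n" for \<kappa> :: "'z \<Rightarrow> nat"
      by (rule diameter_le) (use dist in auto)
    have "hausdorff_content j \<delta> cube \<le> hausdorff_content j \<delta> (\<Union>\<kappa>\<in>grid n. ?cell \<kappa>)"
      by (rule hausdorff_content_mono[OF cube_subset_cells[OF n(2)]])
    also have "\<dots> \<le> (\<Sum>\<kappa>\<in>grid n. hausdorff_content j \<delta> (?cell \<kappa>))"
      by (rule hausdorff_content_UN) (use d finite_grid in auto)
    also have "\<dots> \<le> (\<Sum>\<kappa>\<in>grid n. ennreal (unit_ball_vol (real j) * (sqrt (real j) / real n / 2) ^ j))"
    proof (rule sum_mono)
      fix \<kappa> :: "'z \<Rightarrow> nat"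
      have "hausdorff_content j \<delta> (?cell \<kappa>) \<le> hausdorff_cost j (?cell \<kappa>)"
        by (rule hausdorff_content_single[OF bdd order_trans[OF diam nd]]) (use d in simp)
      also have "\<dots> \<le> ennreal (unit_ball_vol (real j) * (sqrt (real j) / real n / 2) ^ j)"
        by (rule hausdorff_cost_le[OF _ diam bdd]) simp
      finally show "hausdorff_content j \<delta> (?cell \<kappa>) \<le> ennreal (unit_ball_vol (real j) * (sqrt (real j) / real n / 2) ^ j)" .
    qed
    also have "\<dots> = ennreal (real n ^ j * (unit_ball_vol (real j) * (sqrt (real j) / real n / 2) ^ j))"
      by (simp add: card_grid j_def ennreal_of_nat_eq_real_of_nat ennreal_mult[symmetric])
    also have "real n ^ j * (unit_ball_vol (real j) * (sqrt (real j) / real n / 2) ^ j) = C"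
      using n(2) by (simp add: C_def power_divide)
    finally show ?thesis .
  qed
  then have "hausdorff_outer j cube \<le> ennreal C"
    unfolding hausdorff_outer_def by (intro SUP_least) auto
  then show ?thesis unfolding j_def using ennreal_less_top le_less_trans by blast
qed

lemma hausdorff_box_finite:
  "hausdorff_outer (card B) ({z. \<forall>b\<in>B. \<bar>z \<bullet> b\<bar> < real (Suc n)} \<inter> span B) < top"
proof -
  define m where "m = real (Suc n)"
  define s where "s = emb (\<lambda>_. m)"
  have m: "0 < m" by (simp add: m_def)
  have "{z. \<forall>b\<in>B. \<bar>z \<bullet> b\<bar> < m} \<inter> span B \<subseteq> (\<lambda>z. (2 * m) *\<^sub>R z - s) ` cube"
  proof
    fix z assume z: "z \<in> {z. \<forall>b\<in>B. \<bar>z \<bullet> b\<bar> < m} \<inter> span B"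
    have "(1 / (2 * m)) *\<^sub>R (z + s) \<in> cube"
      unfolding cube_def
    proof (intro CollectI conjI ballI)
      show "(1 / (2 * m)) *\<^sub>R (z + s) \<in> span B" using z emb_span by (auto simp: s_def intro!: span_scale span_add)
      fix b assume b: "b \<in> B"
      then have "\<bar>z \<bullet> b\<bar> < m" using z by auto
      then have "0 \<le> z \<bullet> b + m" "z \<bullet> b + m < 2 * m" by linarith+
      moreover have "(1 / (2 * m)) *\<^sub>R (z + s) \<bullet> b = (z \<bullet> b + m) / (2 * m)"
        using b by (simp add: s_def inner_add_left emb_inner)
      ultimately show "0 \<le> (1 / (2 * m)) *\<^sub>R (z + s) \<bullet> b" "(1 / (2 * m)) *\<^sub>R (z + s) \<bullet> b < 1"
        using m by (simp_all only:) simp_all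
    qed
    then show "z \<in> (\<lambda>z. (2 * m) *\<^sub>R z - s) ` cube"
      by (intro image_eqI[of _ _ "(1 / (2 * m)) *\<^sub>R (z + s)"]) (use m in auto)
  qed
  then have "hausdorff_outer (card B) ({z. \<forall>b\<in>B. \<bar>z \<bullet> b\<bar> < m} \<inter> span B) \<le> hausdorff_outer (card B) ((\<lambda>z. (2 * m) *\<^sub>R z - s) ` cube)"
    by (rule hausdorff_outer_mono)
  also have "\<dots> \<le> ennreal ((2 * m) ^ card B) * hausdorff_outer (card B) cube"
    by (rule hausdorff_outer_lipschitz_image) (use m in \<open>auto simp: dist_norm scaleR_diff_right[symmetric] simp del: scaleR_diff_right\<close>)
  also have "\<dots> < top" using hausdorff_cube_finite by (simp add: ennreal_mult_less_top)
  finally show ?thesis unfolding m_def .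
qed

lemma borel_box: "{z. \<forall>b\<in>B. \<bar>z \<bullet> b\<bar> < real (Suc n)} \<in> sets borel"
proof -
  have "{z. \<forall>b\<in>B. \<bar>z \<bullet> b\<bar> < real (Suc n)} = (\<Inter>b\<in>B. {z. \<bar>z \<bullet> b\<bar> < real (Suc n)})" by auto
  moreover have "(\<Inter>b\<in>B. {z. \<bar>z \<bullet> b\<bar> < real (Suc n)}) \<in> sets borel"
    using fin by (cases "B = {}") (auto intro!: sets.finite_INT)
  ultimately show ?thesis by simp
qed

lemma UN_box: "(\<Union>n. {z. \<forall>b\<in>B. \<bar>z \<bullet> b\<bar> < real (Suc n)}) = UNIV"
proof -
  have "\<exists>n. \<forall>b\<in>B. \<bar>z \<bullet> b\<bar> < real (Suc n)" for z
  proof -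
    obtain n where n: "norm z < real n" using reals_Archimedean2 by blast
    have "\<bar>z \<bullet> b\<bar> \<le> norm z" if "b \<in> B" for b
      using Cauchy_Schwarz_ineq2[of z b] inner[OF that that] by (simp add: norm_eq_sqrt_inner)
    then show ?thesis using n by (intro exI[of _ n]) force
  qed
  then show ?thesis by auto
qed

lemma sigma_finite_hsp: "sigma_finite_measure hsp"
proof
  show "\<exists>A. countable A \<and> A \<subseteq> sets hsp \<and> \<Union> A = space hsp \<and> (\<forall>a\<in>A. emeasure hsp a \<noteq> \<infinity>)"
    by (rule exI[of _ "range (\<lambda>n. {z. \<forall>b\<in>B. \<bar>z \<bullet> b\<bar> < real (Suc n)})"])
      (use UN_box borel_box hausdorff_box_finite in \<open>auto simp: emeasure_hsp less_top[symmetric] simp del: of_nat_Suc\<close>)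
qed

lemma sigma_finite_leb: "sigma_finite_measure leb"
proof
  have "emeasure leb {z. \<forall>b\<in>B. \<bar>z \<bullet> b\<bar> < real (Suc n)} < top" for n
  proof -
    have "emeasure leb {z. \<forall>b\<in>B. \<bar>z \<bullet> b\<bar> < real (Suc n)} = emeasure leb ({z. \<forall>b\<in>B. \<bar>z \<bullet> b\<bar> < real (Suc n)} \<inter> span B)"
      by (rule emeasure_leb_Int_span[OF borel_box, symmetric])
    also have "\<dots> \<le> hausdorff_outer (card B) ({z. \<forall>b\<in>B. \<bar>z \<bullet> b\<bar> < real (Suc n)} \<inter> span B)"
      by (rule leb_le_hausdorff) (use borel_box in auto)
    also have "\<dots> < top" by (rule hausdorff_box_finite)
    finally show ?thesis .
  qed
  then show "\<exists>A. countable A \<and> A \<subseteq> sets leb \<and> \<Union> A = space leb \<and> (\<forall>a\<in>A. emeasure leb a \<noteq> \<infinity>)"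
    by (intro exI[of _ "range (\<lambda>n. {z. \<forall>b\<in>B. \<bar>z \<bullet> b\<bar> < real (Suc n)})"])
      (use UN_box borel_box in \<open>auto simp: less_top[symmetric] simp del: of_nat_Suc\<close>)
qed

text \<open>Uniqueness of translation invariant measures, by integrating \<open>1\<^sub>A(x) 1\<^sub>Q(x + y)\<close> for the unit cube
  \<open>Q\<close> in both orders.\<close>

lemma hsp_eq_scaled_leb:
  assumes A: "A \<in> sets borel"
  shows "emeasure hsp A = emeasure hsp cube * emeasure leb A"
proof -
  interpret N: sigma_finite_measure hsp by (rule sigma_finite_hsp)
  interpret L: sigma_finite_measure leb by (rule sigma_finite_leb)
  interpret P: pair_sigma_finite hsp leb ..
  interpret P': pair_sigma_finite leb hsp ..
  note [measurable] = A
  let ?a = "indicator A :: 'z \<Rightarrow> ennreal" and ?q = "indicator cube :: 'z \<Rightarrow> ennreal"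
  have [measurable]: "?a \<in> borel_measurable borel" "?q \<in> borel_measurable borel" by measurable
  have "emeasure hsp A = (\<integral>\<^sup>+x. ?a x * (\<integral>\<^sup>+y. ?q y \<partial>leb) \<partial>hsp)"
    using A by (simp add: leb_cube)
  also have "\<dots> = (\<integral>\<^sup>+x. (\<integral>\<^sup>+y. ?a x * ?q (x + y) \<partial>leb) \<partial>hsp)"
  proof (rule nn_integral_cong_AE, use AE_hsp_span in eventually_elim)
    case (elim x)
    have "(\<integral>\<^sup>+y. ?q y \<partial>leb) = (\<integral>\<^sup>+y. ?q (x + 1 *\<^sub>R y) \<partial>leb)"
      by (rule nn_integral_leb_affine[symmetric]) (use elim in auto)
    then show ?case by (subst nn_integral_cmult) auto
  qed
  also have "\<dots> = (\<integral>\<^sup>+y. (\<integral>\<^sup>+x. ?a x * ?q (x + y) \<partial>hsp) \<partial>leb)"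
    by (rule P'.Fubini') measurable
  also have "\<dots> = (\<integral>\<^sup>+y. (\<integral>\<^sup>+x. ?a (x - y) * ?q x \<partial>hsp) \<partial>leb)"
  proof (rule nn_integral_cong_AE, use AE_leb_span in eventually_elim)
    case (elim y)
    have "(\<integral>\<^sup>+x. ?a (x - y) * ?q x \<partial>hsp) = (\<integral>\<^sup>+x. (\<lambda>x. ?a (x - y) * ?q x) (y + x) \<partial>hsp)"
      by (rule nn_integral_hsp_translation[symmetric]) (use elim in auto)
    then show ?case by (simp add: add.commute)
  qed
  also have "\<dots> = (\<integral>\<^sup>+x. (\<integral>\<^sup>+y. ?a (x - y) * ?q x \<partial>leb) \<partial>hsp)"
    by (rule P.Fubini') measurable
  also have "\<dots> = (\<integral>\<^sup>+x. emeasure leb A * ?q x \<partial>hsp)"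
  proof (rule nn_integral_cong_AE, use AE_hsp_span in eventually_elim)
    case (elim x)
    have "(\<integral>\<^sup>+y. ?a (x + (-1) *\<^sub>R y) \<partial>leb) = (\<integral>\<^sup>+y. ?a y \<partial>leb)"
      by (rule nn_integral_leb_affine) (use elim in auto)
    then have "(\<integral>\<^sup>+y. ?a (x - y) \<partial>leb) = emeasure leb A" using A by simp
    then show ?case by (subst nn_integral_multc) auto
  qed
  also have "\<dots> = emeasure leb A * emeasure hsp cube" by (simp add: nn_integral_cmult)
  finally show ?thesis by (simp add: mult.commute)
qed

text \<open>Balls inscribed in the cells of a fine grid fill a fixed positive proportion of the unit cube, and
  they contribute to the Hausdorff measure at most their volume.\<close>

lemma hsp_cube_le: "emeasure hsp cube \<le> 1"
proof -
  define j where "j = card B"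
  \<comment> \<open>The volume of a ball of radius 1/4, which is the proportion of a cell of side
    1/n filled by a concentric ball of radius 1/(4 n). The radius stays below half of the side, so
    the balls lie strictly inside their cells and are disjoint.\<close>
  define \<theta> where "\<theta> = unit_ball_vol (real j) * (1 / 4) ^ j"
  have th: "0 < \<theta>" by (simp add: \<theta>_def)
  have c_eq: "emeasure hsp cube = hausdorff_outer j cube"
  proof -
    have "cube \<inter> span B = cube" by (auto simp: cube_def)
    then show ?thesis by (simp add: emeasure_hsp j_def)
  qed
  obtain c where c: "emeasure hsp cube = ennreal c" "0 \<le> c"
    using hausdorff_cube_finite c_eq unfolding j_def by (metis ennreal_cases less_irrefl top_neq_ennreal)
  have *: "\<theta> \<le> 1 \<and> hausdorff_content j \<delta> cube \<le> ennreal (\<theta> + c * (1 - \<theta>))" if d: "0 < \<delta>" for \<delta>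
  proof -
    obtain n where n: "1 / \<delta> < real n" "0 < n"
      using reals_Archimedean2[of "max 1 (1 / \<delta>)"] by auto
    then have nd: "1 / (2 * real n) \<le> \<delta>" using d by (simp add: divide_less_eq pos_divide_le_eq mult.commute)
    let ?D = "\<lambda>\<kappa>. cball (mid n \<kappa>) (1 / (4 * real n)) \<inter> span B"
    have near: "real (\<kappa> b) / real n < z \<bullet> b \<and> z \<bullet> b < (real (\<kappa> b) + 1) / real n" if "z \<in> ?D \<kappa>" "b \<in> B" for z \<kappa> b
    proof -
      have "\<bar>(mid n \<kappa> - z) \<bullet> b\<bar> \<le> norm (mid n \<kappa> - z)"
        using Cauchy_Schwarz_ineq2[of "mid n \<kappa> - z" b] inner[OF that(2,2)] by (simp add: norm_eq_sqrt_inner)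
      also have "\<dots> \<le> 1 / (4 * real n)" using that(1) by (simp add: dist_norm)
      finally have le: "\<bar>(real (\<kappa> b) + 1 / 2) / real n - z \<bullet> b\<bar> \<le> 1 / (4 * real n)"
        using that(2) by (simp add: inner_diff_left mid_def emb_inner)
      define u q where "u = real (\<kappa> b) / real n" and "q = 1 / (4 * real n)"
      have "(real (\<kappa> b) + 1 / 2) / real n = u + 2 * q" "(real (\<kappa> b) + 1) / real n = u + 4 * q"
        using n by (simp_all add: u_def q_def add_divide_distrib)
      moreover have "0 < q" using n by (simp add: q_def)
      ultimately show ?thesis using le unfolding u_def[symmetric] q_def[symmetric] by linarith
    qed
    have D_cube: "?D \<kappa> \<subseteq> cube" if k: "\<kappa> \<in> grid n" for \<kappa>
    proof
      fix z assume z: "z \<in> ?D \<kappa>"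
      have "0 \<le> z \<bullet> b \<and> z \<bullet> b < 1" if b: "b \<in> B" for b
      proof -
        have "real (\<kappa> b) + 1 \<le> real n" using k b by (auto simp: grid_def PiE_iff)
        then have "(real (\<kappa> b) + 1) / real n \<le> 1" using n by simp
        then show ?thesis
          using near[OF z b] by (meson divide_nonneg_nonneg less_imp_le less_le_trans of_nat_0_le_iff order_le_less_trans)
      qed
      then show "z \<in> cube" using z by (auto simp: cube_def)
    qed
    have disj: "disjoint_family_on ?D (grid n)"
      unfolding disjoint_family_on_def
    proof (intro ballI impI)
      fix \<kappa> \<kappa>' assume k: "\<kappa> \<in> grid n" "\<kappa>' \<in> grid n" "\<kappa> \<noteq> \<kappa>'"
      then obtain b where b: "b \<in> B" "\<kappa> b \<noteq> \<kappa>' b" unfolding grid_def by (metis PiE_ext)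
      show "?D \<kappa> \<inter> ?D \<kappa>' = {}"
      proof (rule ccontr)
        assume "?D \<kappa> \<inter> ?D \<kappa>' \<noteq> {}"
        then obtain z where "z \<in> ?D \<kappa>" "z \<in> ?D \<kappa>'" by blast
        from near[OF this(1) b(1)] near[OF this(2) b(1)]
        have "real (\<kappa> b) / real n < (real (\<kappa>' b) + 1) / real n" "real (\<kappa>' b) / real n < (real (\<kappa> b) + 1) / real n"
          by (blast intro: less_trans)+
        then have "real (\<kappa> b) < real (\<kappa>' b) + 1" "real (\<kappa>' b) < real (\<kappa> b) + 1"
          using n by (simp_all add: divide_less_cancel)
        then show False using b(2) by linarith
      qed
    qed
    define V where "V = (\<Union>\<kappa>\<in>grid n. ?D \<kappa>)"
    have V [measurable]: "V \<in> sets borel"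
      unfolding V_def by (rule sets.finite_UN[OF finite_grid]) auto
    have V_sub: "V \<subseteq> cube" using D_cube by (auto simp: V_def)
    have rn: "real n ^ j * (1 / (4 * real n)) ^ j = (1 / 4) ^ j"
      unfolding power_mult_distrib[symmetric] using n(2) by simp
    have "emeasure leb V = (\<Sum>\<kappa>\<in>grid n. emeasure leb (?D \<kappa>))"
      unfolding V_def by (rule sum_emeasure[symmetric]) (use disj finite_grid in auto)
    also have "\<dots> = (\<Sum>\<kappa>\<in>grid n. ennreal (unit_ball_vol (real j) * (1 / (4 * real n)) ^ j))"
    proof (rule sum.cong[OF refl])
      fix \<kappa>
      have "emeasure leb (?D \<kappa>) = emeasure leb (cball (mid n \<kappa>) (1 / (4 * real n)))"
        by (rule emeasure_leb_Int_span) simp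
      also have "\<dots> = ennreal (unit_ball_vol (real j) * (1 / (4 * real n)) ^ j)"
        unfolding j_def by (rule leb_cball) (use n emb_span in \<open>auto simp: mid_def\<close>)
      finally show "emeasure leb (?D \<kappa>) = ennreal (unit_ball_vol (real j) * (1 / (4 * real n)) ^ j)" .
    qed
    also have "\<dots> = ennreal (real n ^ j * (unit_ball_vol (real j) * (1 / (4 * real n)) ^ j))"
      by (simp add: card_grid j_def ennreal_of_nat_eq_real_of_nat ennreal_mult[symmetric])
    also have "real n ^ j * (unit_ball_vol (real j) * (1 / (4 * real n)) ^ j) = \<theta>"
      unfolding \<theta>_def rn[symmetric] by (rule mult.left_commute)
    finally have LV: "emeasure leb V = ennreal \<theta>" .
    have "ennreal \<theta> \<le> 1" using emeasure_mono[OF V_sub, of leb] LV leb_cube by simp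
    then have th1: "\<theta> \<le> 1" by simp
    have "emeasure leb (cube - V) = emeasure leb cube - emeasure leb V"
      by (rule emeasure_Diff) (use LV V_sub in auto)
    also have "\<dots> = ennreal (1 - \<theta>)" unfolding LV leb_cube using th by (simp add: ennreal_minus flip: ennreal_1)
    finally have LR: "emeasure leb (cube - V) = ennreal (1 - \<theta>)" .
    have h0: "hausdorff_content j \<delta> cube \<le> hausdorff_content j \<delta> V + hausdorff_content j \<delta> (cube - V)"
      using hausdorff_content_Un[of \<delta> j V "cube - V"] d V_sub by (simp add: Un_absorb1)
    have h1: "hausdorff_content j \<delta> V \<le> ennreal \<theta>"
    proof -
      have "hausdorff_content j \<delta> V \<le> (\<Sum>\<kappa>\<in>grid n. hausdorff_content j \<delta> (?D \<kappa>))"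
        unfolding V_def by (rule hausdorff_content_UN) (use d finite_grid in auto)
      also have "\<dots> \<le> (\<Sum>\<kappa>\<in>grid n. ennreal (unit_ball_vol (real j) * (1 / (2 * real n) / 2) ^ j))"
      proof (rule sum_mono)
        fix \<kappa>
        have bdd: "bounded (?D \<kappa>)" by (rule bounded_subset[OF bounded_cball]) auto
        have diam: "diameter (?D \<kappa>) \<le> 1 / (2 * real n)"
        proof (rule diameter_le)
          fix x y assume "x \<in> ?D \<kappa>" "y \<in> ?D \<kappa>"
          then have "dist (mid n \<kappa>) x + dist (mid n \<kappa>) y \<le> 1 / (4 * real n) + 1 / (4 * real n)"
            by (intro add_mono) auto
          also have "\<dots> = 1 / (2 * real n)" by simp
          finally show "norm (x - y) \<le> 1 / (2 * real n)"
            unfolding dist_norm[symmetric] by (rule order_trans[OF dist_triangle3])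
        qed simp
        have "hausdorff_content j \<delta> (?D \<kappa>) \<le> hausdorff_cost j (?D \<kappa>)"
          by (rule hausdorff_content_single[OF bdd order_trans[OF diam nd]]) (use d in simp)
        also have "\<dots> \<le> ennreal (unit_ball_vol (real j) * (1 / (2 * real n) / 2) ^ j)"
          by (rule hausdorff_cost_le[OF _ diam bdd]) simp
        finally show "hausdorff_content j \<delta> (?D \<kappa>) \<le> ennreal (unit_ball_vol (real j) * (1 / (2 * real n) / 2) ^ j)" .
      qed
      also have "\<dots> = ennreal (real n ^ j * (unit_ball_vol (real j) * (1 / (4 * real n)) ^ j))"
        by (simp add: card_grid j_def ennreal_of_nat_eq_real_of_nat ennreal_mult[symmetric])
      also have "real n ^ j * (unit_ball_vol (real j) * (1 / (4 * real n)) ^ j) = \<theta>"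
        unfolding \<theta>_def rn[symmetric] by (rule mult.left_commute)
      finally show ?thesis .
    qed
    have h2: "hausdorff_content j \<delta> (cube - V) \<le> ennreal (c * (1 - \<theta>))"
    proof -
      have "hausdorff_content j \<delta> (cube - V) \<le> hausdorff_outer j ((cube - V) \<inter> span B)"
        using hausdorff_outer_ge[OF d] by (rule order_trans) (auto intro!: hausdorff_outer_mono simp: cube_def)
      also have "\<dots> = emeasure hsp (cube - V)" unfolding j_def by (rule emeasure_hsp[symmetric]) auto
      also have "\<dots> = ennreal (c * (1 - \<theta>))"
        using hsp_eq_scaled_leb[of "cube - V"] c LR by (simp add: ennreal_mult')
      finally show ?thesis .
    qed
    have "hausdorff_content j \<delta> cube \<le> ennreal \<theta> + ennreal (c * (1 - \<theta>))"
      by (rule order_trans[OF h0 add_mono[OF h1 h2]])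
    also have "\<dots> = ennreal (\<theta> + c * (1 - \<theta>))"
      by (rule ennreal_plus[symmetric]) (use th th1 c in auto)
    finally show ?thesis using th1 by blast
  qed
  have th1: "\<theta> \<le> 1" using *[of 1] by simp
  \<comment> \<open>The balls contribute at most \<open>\<theta>\<close>, and the remainder has
    measure c times its volume 1 - \<theta>. As c is finite and \<theta> is positive, this
    self-referential bound forces c \<le> 1.\<close>
  have "ennreal c \<le> ennreal (\<theta> + c * (1 - \<theta>))"
    unfolding c(1)[symmetric] c_eq hausdorff_outer_def[of j cube] using * by (intro SUP_least) auto
  then have "c \<le> \<theta> + c * (1 - \<theta>)" using th th1 c by (subst (asm) ennreal_le_iff) auto
  then have "c * \<theta> \<le> 1 * \<theta>" by (simp add: algebra_simps)
  then have "c \<le> 1" using th by (simp only: mult_le_cancel_right_pos)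
  then show ?thesis using c by simp
qed

proposition hausdorff_eq_leb:
  assumes A: "A \<in> sets borel" "A \<subseteq> span B"
  shows "hausdorff_outer (card B) A = emeasure leb A"
proof (rule antisym)
  have "hausdorff_outer (card B) A = emeasure hsp A"
    using A by (simp add: emeasure_hsp Int_absorb2)
  also have "\<dots> \<le> 1 * emeasure leb A"
    unfolding hsp_eq_scaled_leb[OF A(1)] by (intro mult_right_mono hsp_cube_le) simp
  finally show "hausdorff_outer (card B) A \<le> emeasure leb A" by simp
qed (rule leb_le_hausdorff[OF A(1)])

end

section \<open>Cylinders in the direction of h\<close>

definition cylinder :: "'z::real_vector \<Rightarrow> 'z set \<Rightarrow> real set \<Rightarrow> 'z set" where
  "cylinder h A J = (\<lambda>(p, t). p + t *\<^sub>R h) ` (A \<times> J)"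

lemma cylinder_iff: "z \<in> cylinder h A J \<longleftrightarrow> (\<exists>p\<in>A. \<exists>t\<in>J. z = p + t *\<^sub>R h)"
  by (auto simp: cylinder_def)

lemma hausdorff_outer_Un: "hausdorff_outer k (A \<union> B) \<le> hausdorff_outer k A + hausdorff_outer k B"
proof -
  let ?X = "\<lambda>i. if i = 0 then A else if i = (1::nat) then B else {}"
  have "(\<Sum>i. hausdorff_outer k (?X i)) = (\<Sum>i\<in>{0, 1}. hausdorff_outer k (?X i))"
    by (rule Series.suminf_finite) auto
  moreover have "(\<Union>i. ?X i) = A \<union> B" by (auto split: if_splits)
  ultimately show ?thesis using hausdorff_outer_countably_subadditive[of k ?X] by simp
qed

text \<open>Compares two parametrised sets without assuming either parametrisation injective: equal
  values of \<open>f\<close> force values of \<open>g\<close> at distance 0, so f s \<mapsto> g s is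
  a well-defined Lipschitz map on the image of \<open>f\<close>.\<close>

lemma hausdorff_outer_compare:
  fixes f :: "'i \<Rightarrow> 'a::metric_space" and g :: "'i \<Rightarrow> 'b::real_normed_vector"
  assumes L: "0 < L" "\<And>s s'. s \<in> S \<Longrightarrow> s' \<in> S \<Longrightarrow> dist (g s) (g s') \<le> L * dist (f s) (f s')"
  shows "hausdorff_outer k (g ` S) \<le> ennreal (L ^ k) * hausdorff_outer k (f ` S)"
proof -
  define u where "u y = g (SOME s. s \<in> S \<and> f s = y)" for y
  have u: "u (f s) = g s" if "s \<in> S" for s
  proof -
    have *: "(SOME s'. s' \<in> S \<and> f s' = f s) \<in> S \<and> f (SOME s'. s' \<in> S \<and> f s' = f s) = f s"
      by (rule someI[of _ s]) (use that in simp)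
    have "dist (u (f s)) (g s) \<le> 0"
      unfolding u_def using L(2)[OF conjunct1[OF *] that] * by simp
    then show ?thesis by simp
  qed
  have "u ` (f ` S) = g ` S" using u by (force simp: image_image)
  moreover have "hausdorff_outer k (u ` (f ` S)) \<le> ennreal (L ^ k) * hausdorff_outer k (f ` S)"
    by (rule hausdorff_outer_lipschitz_image[OF L(1)]) (use L(2) u in auto)
  ultimately show ?thesis by simp
qed

lemma subspace_frame:
  fixes W :: "'z::euclidean_space set"
  assumes "subspace W"
  obtains B where "orthonormal_frame B" "span B = W" "card B = dim W"
proof -
  obtain B where B: "B \<subseteq> W" "pairwise orthogonal B" "\<And>x. x \<in> B \<Longrightarrow> norm x = 1"
    "independent B" "card B = dim W" "span B = W"
    using orthonormal_basis_subspace[OF assms] by metis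
  have "orthonormal_frame B"
  proof
    show "finite B" using B(4) by (rule independent_imp_finite)
    show "b \<bullet> c = (if b = c then 1 else 0)" if "b \<in> B" "c \<in> B" for b c
      using B(2,3) that by (auto simp: pairwise_def orthogonal_def norm_eq_1)
  qed
  then show ?thesis using that B by blast
qed

context orthonormal_frame
begin

text \<open>The unit vector along \<open>h\<close> is adjoined to the frame as one more coordinate,
  over which Fubini integrates first; the substitution between this coordinate and the parameter t
  produces the factor |h|.\<close>

lemma emeasure_leb_cylinder:
  assumes h: "h \<noteq> 0" "\<And>b. b \<in> B \<Longrightarrow> b \<bullet> h = 0"
    and A: "A \<in> sets borel" "A \<subseteq> span B" and J: "J \<in> sets borel"
  shows "orthonormal_frame (insert (h /\<^sub>R norm h) B)" "h /\<^sub>R norm h \<notin> B"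
    and "cylinder h A J \<in> sets borel"
    and "emeasure (orthonormal_frame.leb (insert (h /\<^sub>R norm h) B)) (cylinder h A J)
      = ennreal (norm h) * emeasure lborel J * emeasure leb A"
proof -
  define k where "k = h /\<^sub>R norm h"
  have kh: "k \<bullet> h = norm h" using h(1) by (simp add: k_def power2_norm_eq_inner[symmetric] power2_eq_square)
  have kB: "k \<bullet> b = 0" "b \<bullet> k = 0" if "b \<in> B" for b
    using h(2)[OF that] by (simp_all add: k_def inner_commute)
  have kk: "k \<bullet> k = 1" using h(1) kh by (simp add: k_def inner_commute)
  show k: "h /\<^sub>R norm h \<notin> B" using kB kk by (auto simp: k_def[symmetric])
  show fr: "orthonormal_frame (insert (h /\<^sub>R norm h) B)"
    unfolding k_def[symmetric] by standard (use fin inner kB kk in auto)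
  interpret K: orthonormal_frame "insert k B" using fr by (simp add: k_def)
  have perp: "z \<bullet> h = 0" if "z \<in> span B" for z
    using that by (induction rule: span_induct_alt) (auto simp: inner_add_left h(2))
  have mem: "z \<in> cylinder h A J \<longleftrightarrow> z - ((z \<bullet> h) / (h \<bullet> h)) *\<^sub>R h \<in> A \<and> (z \<bullet> h) / (h \<bullet> h) \<in> J" for z
  proof
    assume "z \<in> cylinder h A J"
    then obtain p t where "p \<in> A" "t \<in> J" "z = p + t *\<^sub>R h" by (auto simp: cylinder_def)
    moreover from this have "p \<bullet> h = 0" using perp A(2) by auto
    ultimately show "z - ((z \<bullet> h) / (h \<bullet> h)) *\<^sub>R h \<in> A \<and> (z \<bullet> h) / (h \<bullet> h) \<in> J"
      using h(1) by (simp add: inner_add_left)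
  next
    assume *: "z - ((z \<bullet> h) / (h \<bullet> h)) *\<^sub>R h \<in> A \<and> (z \<bullet> h) / (h \<bullet> h) \<in> J"
    show "z \<in> cylinder h A J" unfolding cylinder_def
      by (rule image_eqI[of _ _ "(z - ((z \<bullet> h) / (h \<bullet> h)) *\<^sub>R h, (z \<bullet> h) / (h \<bullet> h))"]) (use * in auto)
  qed
  note [measurable] = A(1) J
  have "{z \<in> space borel. z - ((z \<bullet> h) / (h \<bullet> h)) *\<^sub>R h \<in> A} \<in> sets borel"
    "{z \<in> space borel. (z \<bullet> h) / (h \<bullet> h) \<in> J} \<in> sets borel"
    by measurable
  then have "{z. z - ((z \<bullet> h) / (h \<bullet> h)) *\<^sub>R h \<in> A} \<inter> {z. (z \<bullet> h) / (h \<bullet> h) \<in> J} \<in> sets borel"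
    by (intro sets.Int) auto
  moreover have "cylinder h A J = {z. z - ((z \<bullet> h) / (h \<bullet> h)) *\<^sub>R h \<in> A} \<inter> {z. (z \<bullet> h) / (h \<bullet> h) \<in> J}"
    using mem by auto
  ultimately show cyl: "cylinder h A J \<in> sets borel" by simp
  have emb_upd: "K.emb (x(k := t)) = emb x + t *\<^sub>R k" for x t
  proof -
    have "k \<notin> B" using k by (simp add: k_def)
    then have "K.emb (x(k := t)) = t *\<^sub>R k + (\<Sum>b\<in>B. (x(k := t)) b *\<^sub>R b)"
      unfolding K.emb_def using fin by simp
    also have "(\<Sum>b\<in>B. (x(k := t)) b *\<^sub>R b) = emb x"
      unfolding emb_def using \<open>k \<notin> B\<close> by (intro sum.cong) auto
    finally show ?thesis unfolding add.commute[of "t *\<^sub>R k"] .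
  qed
  have ind: "emb x + t *\<^sub>R k \<in> cylinder h A J \<longleftrightarrow> emb x \<in> A \<and> 0 + (1 / norm h) * t \<in> J" for x t
  proof -
    have "emb x + t *\<^sub>R k = emb x + (t / norm h) *\<^sub>R h" by (simp add: k_def divide_inverse)
    moreover have "emb x \<bullet> h = 0" by (rule perp[OF emb_span])
    ultimately show ?thesis using h(1) by (simp add: mem inner_add_left)
  qed
  have lJ: "(\<integral>\<^sup>+t. indicator J (0 + (1 / norm h) * t) \<partial>lborel) = ennreal (norm h) * emeasure lborel J"
  proof -
    have "emeasure lborel J = (\<integral>\<^sup>+t. indicator J t \<partial>lborel)" using J by simp
    also have "\<dots> = ennreal \<bar>1 / norm h\<bar> * (\<integral>\<^sup>+t. indicator J (0 + (1 / norm h) * t) \<partial>lborel)"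
      by (rule nn_integral_real_affine) (use J h(1) in \<open>auto intro!: borel_measurable_indicator\<close>)
    finally have "ennreal (norm h) * emeasure lborel J
       = (ennreal (norm h) * ennreal (1 / norm h)) * (\<integral>\<^sup>+t. indicator J (0 + (1 / norm h) * t) \<partial>lborel)"
      by (simp add: mult.assoc)
    also have "ennreal (norm h) * ennreal (1 / norm h) = 1"
      using h(1) by (simp add: ennreal_mult[symmetric])
    finally show ?thesis by simp
  qed
  have "emeasure K.leb (cylinder h A J) = emeasure (lebesgue_PiM (insert k B)) (K.emb -` cylinder h A J \<inter> space (lebesgue_PiM (insert k B)))"
    by (rule K.emeasure_leb[OF cyl])
  also have "\<dots> = (\<integral>\<^sup>+x. indicator (cylinder h A J) (K.emb x) \<partial>lebesgue_PiM (insert k B))"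
  proof -
    have "(\<integral>\<^sup>+x. indicator (cylinder h A J) (K.emb x) \<partial>lebesgue_PiM (insert k B))
      = (\<integral>\<^sup>+x. indicator (K.emb -` cylinder h A J \<inter> space (lebesgue_PiM (insert k B))) x \<partial>lebesgue_PiM (insert k B))"
      by (intro nn_integral_cong) (auto simp: indicator_def)
    also have "\<dots> = emeasure (lebesgue_PiM (insert k B)) (K.emb -` cylinder h A J \<inter> space (lebesgue_PiM (insert k B)))"
      by (rule nn_integral_indicator[OF measurable_sets[OF K.measurable_emb cyl]])
    finally show ?thesis ..
  qed
  also have "\<dots> = (\<integral>\<^sup>+x. \<integral>\<^sup>+t. indicator (cylinder h A J) (K.emb (x(k := t))) \<partial>lborel \<partial>lebesgue_PiM B)"
  proof (rule lebesgue_PiM.product_nn_integral_insert[OF fin])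
    show "k \<notin> B" using k by (simp add: k_def)
    show "(\<lambda>x. indicator (cylinder h A J) (K.emb x)) \<in> borel_measurable (lebesgue_PiM (insert k B))"
      using cyl by (intro measurable_compose[OF K.measurable_emb] borel_measurable_indicator)
  qed
  also have "\<dots> = (\<integral>\<^sup>+x. indicator A (emb x) * (\<integral>\<^sup>+t. indicator J (0 + (1 / norm h) * t) \<partial>lborel) \<partial>lebesgue_PiM B)"
  proof (rule nn_integral_cong)
    fix x
    have "(\<integral>\<^sup>+t. indicator (cylinder h A J) (K.emb (x(k := t))) \<partial>lborel) = (\<integral>\<^sup>+t. indicator A (emb x) * indicator J (0 + (1 / norm h) * t) \<partial>lborel)"
      by (intro nn_integral_cong) (auto simp: emb_upd ind[simplified] indicator_def)
    also have "\<dots> = indicator A (emb x) * (\<integral>\<^sup>+t. indicator J (0 + (1 / norm h) * t) \<partial>lborel)"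
      by (rule nn_integral_cmult) (use J in measurable)
    finally show "(\<integral>\<^sup>+t. indicator (cylinder h A J) (K.emb (x(k := t))) \<partial>lborel) = indicator A (emb x) * (\<integral>\<^sup>+t. indicator J (0 + (1 / norm h) * t) \<partial>lborel)" .
  qed
  also have "\<dots> = (\<integral>\<^sup>+x. indicator A (emb x) \<partial>lebesgue_PiM B) * (ennreal (norm h) * emeasure lborel J)"
    unfolding lJ using A(1) by (intro nn_integral_multc measurable_compose[OF measurable_emb] borel_measurable_indicator)
  also have "(\<integral>\<^sup>+x. indicator A (emb x) \<partial>lebesgue_PiM B) = (\<integral>\<^sup>+z. indicator A z \<partial>leb)"
    unfolding leb_def using A(1) by (intro nn_integral_distr[symmetric]) (auto intro!: borel_measurable_indicator)
  also have "\<dots> = emeasure leb A" using A(1) by simp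
  finally show "emeasure (orthonormal_frame.leb (insert (h /\<^sub>R norm h) B)) (cylinder h A J)
      = ennreal (norm h) * emeasure lborel J * emeasure leb A"
    unfolding k_def by (simp add: mult_ac)
qed

end

text \<open>Both Hausdorff measures are Lebesgue measures, of a frame of \<open>T\<close> and of
  that frame with the unit vector along \<open>h\<close> adjoined. The exact equality is essential:
  a constant left here would survive in the boundary measure.\<close>

lemma hausdorff_flat_cylinder:
  fixes T :: "'z::euclidean_space set"
  assumes T: "subspace T" and h: "h \<noteq> 0" "\<And>v. v \<in> T \<Longrightarrow> v \<bullet> h = 0"
    and A: "A \<in> sets borel" "A \<subseteq> T" and J: "J \<in> sets borel"
  shows "hausdorff_outer (Suc (dim T)) (cylinder h A J) = ennreal (norm h) * emeasure lborel J * hausdorff_outer (dim T) A"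
proof -
  obtain B where B: "orthonormal_frame B" "span B = T" "card B = dim T" by (rule subspace_frame[OF T])
  interpret orthonormal_frame B by fact
  have hB: "b \<bullet> h = 0" if "b \<in> B" for b using h(2) span_base[OF that] B(2) by auto
  note c = emeasure_leb_cylinder[OF h(1) hB A(1) A(2)[folded B(2)] J]
  interpret K: orthonormal_frame "insert (h /\<^sub>R norm h) B" by (rule c(1))
  have "cylinder h A J \<subseteq> span (insert (h /\<^sub>R norm h) B)"
  proof
    fix z assume "z \<in> cylinder h A J"
    then obtain p t where p: "p \<in> A" "z = p + t *\<^sub>R h" by (auto simp: cylinder_def)
    have "h = norm h *\<^sub>R (h /\<^sub>R norm h)" using h(1) by simp
    then have "h \<in> span (insert (h /\<^sub>R norm h) B)" by (metis insertI1 span_base span_scale)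
    moreover have "p \<in> span (insert (h /\<^sub>R norm h) B)"
      using p(1) A(2) B(2) span_mono[of B "insert (h /\<^sub>R norm h) B"] by blast
    ultimately show "z \<in> span (insert (h /\<^sub>R norm h) B)" unfolding p(2) by (intro span_add span_scale)
  qed
  from K.hausdorff_eq_leb[OF c(3) this] c(4) hausdorff_eq_leb[OF A(1) A(2)[folded B(2)]]
  show ?thesis using c(2) fin B(3) by simp
qed

lemma hausdorff_flat_bounded:
  fixes T :: "'z::euclidean_space set"
  assumes T: "subspace T" and A: "A \<subseteq> T" "bounded A"
  shows "hausdorff_outer (dim T) A < top"
proof -
  obtain B where B: "orthonormal_frame B" "span B = T" "card B = dim T" by (rule subspace_frame[OF T])
  interpret orthonormal_frame B by fact
  obtain r where "0 < r" "\<forall>x\<in>A. norm x \<le> r" using A(2) unfolding bounded_pos by blast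
  then have r: "0 < r" "A \<subseteq> cball 0 r" by auto
  have "hausdorff_outer (dim T) A \<le> hausdorff_outer (card B) (cball 0 r \<inter> span B)"
    unfolding B(3) by (rule hausdorff_outer_mono) (use A(1) B(2) r in auto)
  also have "\<dots> = emeasure leb (cball 0 r \<inter> span B)" by (rule hausdorff_eq_leb) auto
  also have "\<dots> = emeasure leb (cball 0 r)" by (rule emeasure_leb_Int_span) simp
  also have "\<dots> < top" using r by (subst leb_cball) (auto simp: span_zero)
  finally show ?thesis .
qed

section \<open>Graphs that are close to their tangent planes\<close>

lemma norm_le_of_orthogonal_part: 
  fixes d x :: "'z::real_inner"
  assumes "d \<bullet> x = d \<bullet> d"
  shows "norm d \<le> norm x"
proof (cases "d = 0")
  case False
  have "norm d * norm d = d \<bullet> x" using assms by (simp add: power2_norm_eq_inner[symmetric] power2_eq_square)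
  also have "\<dots> \<le> norm d * norm x" by (rule norm_cauchy_schwarz)
  finally show ?thesis using False by simp
qed simp

text \<open>A graph over \<open>W\<close> that is uniformly well approximated by its tangent planes. Near a point it is
  \<open>(1 + \<epsilon>)\<close>-bilipschitz to a piece of the tangent plane, compatibly with translation along \<open>h\<close>.\<close>

locale tangent_graph =
  fixes W :: "'z::euclidean_space set" and h :: 'z and \<psi> :: "'z \<Rightarrow> 'z"
  assumes W: "subspace W" and h: "h \<noteq> 0" and Wh: "\<And>w. w \<in> W \<Longrightarrow> w \<bullet> h = 0"
    and psi_h: "\<And>w. w \<in> W \<Longrightarrow> \<psi> w \<bullet> h = 0"
    and psi_W: "\<And>w w'. w \<in> W \<Longrightarrow> w' \<in> W \<Longrightarrow> \<psi> w \<bullet> w' = 0"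
    and cont: "continuous_on UNIV \<psi>"
    and tangent: "\<And>\<epsilon>. 0 < \<epsilon> \<Longrightarrow> \<exists>r>0. \<forall>w0\<in>W. \<exists>L. linear L \<and> (\<forall>w\<in>W. L w \<bullet> h = 0 \<and> (\<forall>w'\<in>W. L w \<bullet> w' = 0)) \<and>
      (\<forall>w\<in>W \<inter> ball w0 r. \<forall>w'\<in>W \<inter> ball w0 r. norm (\<psi> w - \<psi> w' - L (w - w')) \<le> \<epsilon> * norm (w - w'))"
begin

definition tangential :: "('z \<Rightarrow> 'z) \<Rightarrow> bool" where
  "tangential L \<longleftrightarrow> linear L \<and> (\<forall>w\<in>W. L w \<bullet> h = 0 \<and> (\<forall>w'\<in>W. L w \<bullet> w' = 0))"

lemma tangentialD:
  assumes "tangential L"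
  shows "linear L" "\<And>w. w \<in> W \<Longrightarrow> L w \<bullet> h = 0" "\<And>w w'. w \<in> W \<Longrightarrow> w' \<in> W \<Longrightarrow> L w \<bullet> w' = 0"
  using assms by (auto simp: tangential_def)

lemma tangent_approx:
  assumes "0 < \<epsilon>"
  obtains r where "0 < r" "\<And>w0. w0 \<in> W \<Longrightarrow> \<exists>L. tangential L \<and>
    (\<forall>w\<in>W \<inter> ball w0 r. \<forall>w'\<in>W \<inter> ball w0 r. norm (\<psi> w - \<psi> w' - L (w - w')) \<le> \<epsilon> * norm (w - w'))"
  using tangent[OF assms] unfolding tangential_def conj_assoc by blast

definition gr :: "'z \<Rightarrow> 'z" where "gr w = w + \<psi> w"

text \<open>The orthogonal projection onto \<open>W\<close>, selected by the properties that are
  needed; its explicit formula would involve the choice of an orthonormal basis.\<close>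

definition proj :: "'z \<Rightarrow> 'z" where
  "proj = (SOME P. continuous_on UNIV P \<and> linear P \<and> (\<forall>w\<in>W. P w = w) \<and> (\<forall>z. P z \<in> W) \<and>
     (\<forall>z. (\<forall>w\<in>W. z \<bullet> w = 0) \<longrightarrow> P z = 0))"

lemma proj: "continuous_on UNIV proj" "linear proj" "\<And>w. w \<in> W \<Longrightarrow> proj w = w" "\<And>z. proj z \<in> W"
  "\<And>z. (\<And>w. w \<in> W \<Longrightarrow> z \<bullet> w = 0) \<Longrightarrow> proj z = 0"
proof -
  obtain B where B: "orthonormal_frame B" "span B = W" "card B = dim W" by (rule subspace_frame[OF W])
  interpret orthonormal_frame B by fact
  let ?P = "\<lambda>z. emb (\<lambda>b. z \<bullet> b)"
  have "continuous_on UNIV ?P" unfolding emb_def by (intro continuous_intros)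
  moreover have "linear ?P"
    by (rule linearI) (simp_all add: emb_def inner_add_left scaleR_add_left sum.distrib scaleR_sum_right)
  moreover have "\<forall>w\<in>W. ?P w = w" using emb_coords B(2) by auto
  moreover have "\<forall>z. ?P z \<in> W" using emb_span B(2) by auto
  moreover have "?P z = 0" if "\<forall>w\<in>W. z \<bullet> w = 0" for z
    unfolding emb_def by (rule sum.neutral) (use that B(2) span_base in auto)
  ultimately have "\<exists>P. continuous_on UNIV P \<and> linear P \<and> (\<forall>w\<in>W. P w = w) \<and> (\<forall>z. P z \<in> W) \<and>
     (\<forall>z. (\<forall>w\<in>W. z \<bullet> w = 0) \<longrightarrow> P z = 0)" by (intro exI[of _ ?P]) auto
  from someI_ex[OF this] show "continuous_on UNIV proj" "linear proj" "\<And>w. w \<in> W \<Longrightarrow> proj w = w" "\<And>z. proj z \<in> W"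
  "\<And>z. (\<And>w. w \<in> W \<Longrightarrow> z \<bullet> w = 0) \<Longrightarrow> proj z = 0" unfolding proj_def[symmetric] by blast+
qed

lemma measurable_proj [measurable]: "proj \<in> borel_measurable borel"
  by (rule borel_measurable_continuous_onI[OF proj(1)])

lemma measurable_psi [measurable]: "\<psi> \<in> borel_measurable borel"
  by (rule borel_measurable_continuous_onI[OF cont])

lemma proj_cylinder:
  assumes "w \<in> W" "\<And>w'. w' \<in> W \<Longrightarrow> u \<bullet> w' = 0"
  shows "proj (w + u + t *\<^sub>R h) = w"
proof -
  have "proj u = 0" by (rule proj(5)[OF assms(2)])
  moreover have "proj h = 0" by (rule proj(5)) (use Wh in \<open>simp add: inner_commute\<close>)
  ultimately show ?thesis using proj(3)[OF assms(1)] by (simp add: linear_add[OF proj(2)] linear_scale[OF proj(2)])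
qed

text \<open>Images of Borel sets need not be Borel. Here the parameters of a point can be recovered
  continuously, w by \<open>proj\<close> and t by the component along \<open>h\<close>, so the
  cylinder is cut out by Borel conditions. It is stated for general \<open>u0\<close> because it
  serves both the graph and its tangent planes.\<close>

lemma graph_cylinder_borel:
  assumes chi: "u0 \<in> borel_measurable borel" "\<And>w. w \<in> W \<Longrightarrow> u0 w \<bullet> h = 0" "\<And>w w'. w \<in> W \<Longrightarrow> w' \<in> W \<Longrightarrow> u0 w \<bullet> w' = 0"
    and A: "A \<in> sets borel" "A \<subseteq> W" and J: "J \<in> sets borel"
  shows "cylinder h ((\<lambda>w. w + u0 w) ` A) J \<in> sets borel"
proof -
  have eq: "cylinder h ((\<lambda>w. w + u0 w) ` A) J = {z. proj z \<in> A} \<inter> ({z. (z \<bullet> h) / (h \<bullet> h) \<in> J}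
     \<inter> {z. z - (proj z + u0 (proj z) + ((z \<bullet> h) / (h \<bullet> h)) *\<^sub>R h) = 0})" (is "_ = ?R")
  proof
    show "cylinder h ((\<lambda>w. w + u0 w) ` A) J \<subseteq> ?R"
    proof
      fix z assume "z \<in> cylinder h ((\<lambda>w. w + u0 w) ` A) J"
      then obtain w t where w: "w \<in> A" "t \<in> J" and z: "z = w + u0 w + t *\<^sub>R h" by (auto simp: cylinder_def)
      have wW: "w \<in> W" using w A(2) by auto
      have "proj z = w" unfolding z by (rule proj_cylinder[OF wW chi(3)[OF wW]])
      moreover have "(z \<bullet> h) / (h \<bullet> h) = t" unfolding z using Wh[OF wW] chi(2)[OF wW] h by (simp add: inner_add_left)
      ultimately show "z \<in> ?R" using w z by simp
    qed
    show "?R \<subseteq> cylinder h ((\<lambda>w. w + u0 w) ` A) J"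
    proof
      fix z assume z: "z \<in> ?R"
      then show "z \<in> cylinder h ((\<lambda>w. w + u0 w) ` A) J"
        unfolding cylinder_def by (intro image_eqI[of _ _ "(proj z + u0 (proj z), (z \<bullet> h) / (h \<bullet> h))"]) auto
    qed
  qed
  note [measurable] = chi(1) A(1) J
  have "{z \<in> space borel. proj z \<in> A} \<in> sets borel" "{z \<in> space borel. (z \<bullet> h) / (h \<bullet> h) \<in> J} \<in> sets borel"
    "{z \<in> space borel. z - (proj z + u0 (proj z) + ((z \<bullet> h) / (h \<bullet> h)) *\<^sub>R h) = 0} \<in> sets borel"
    by measurable
  then show ?thesis unfolding eq by (intro sets.Int) auto
qed

text \<open>With this a graph counts as a cylinder of height {0}, so that each comparison needs to
  be proved only for cylinders.\<close>

lemma cylinder_zero: "cylinder h A {0} = A"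
  by (auto simp: cylinder_def image_def)

text \<open>Let X and Y be the differences of two corresponding points of the graph cylinder and of
  the tangent cylinder. Both have the same component d in \<open>W\<close>, orthogonal to the rest,
  so |d| \<le> |X| and |d| \<le> |Y|; the components along \<open>h\<close> cancel in X - Y, whence
  |X - Y| \<le> \<epsilon> |d|. Each of |X|, |Y| is therefore at most (1 + \<epsilon>) times the
  other.\<close>

lemma tangent_piece:
  assumes e: "0 < \<epsilon>" and L0: "tangential L"
    and A: "A \<subseteq> W" and approx: "\<And>w w'. w \<in> A \<Longrightarrow> w' \<in> A \<Longrightarrow> norm (\<psi> w - \<psi> w' - L (w - w')) \<le> \<epsilon> * norm (w - w')"
  shows "hausdorff_outer k (cylinder h (gr ` A) J) \<le> ennreal ((1 + \<epsilon>) ^ k) * hausdorff_outer k (cylinder h ((\<lambda>w. w + L w) ` A) J)"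
    and "hausdorff_outer k (cylinder h ((\<lambda>w. w + L w) ` A) J) \<le> ennreal ((1 + \<epsilon>) ^ k) * hausdorff_outer k (cylinder h (gr ` A) J)"
proof -
  note L = tangentialD[OF L0]
  let ?g = "\<lambda>(w, t). gr w + t *\<^sub>R h" and ?f = "\<lambda>(w, t). w + L w + t *\<^sub>R h"
  have c: "cylinder h (gr ` A) J = ?g ` (A \<times> J)" "cylinder h ((\<lambda>w. w + L w) ` A) J = ?f ` (A \<times> J)"
    unfolding cylinder_def by force+
  have *: "dist (?g s) (?g s') \<le> (1 + \<epsilon>) * dist (?f s) (?f s') \<and> dist (?f s) (?f s') \<le> (1 + \<epsilon>) * dist (?g s) (?g s')"
    if s: "s \<in> A \<times> J" "s' \<in> A \<times> J" for s s'
  proof -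
    obtain w t w' t' where st: "s = (w, t)" "s' = (w', t')" by (cases s, cases s')
    have w: "w \<in> A" "w' \<in> A" "w \<in> W" "w' \<in> W" using s A unfolding st by auto
    define d where "d = w - w'"
    have dW: "d \<in> W" unfolding d_def using w W by (simp add: subspace_diff)
    define X where "X = ?g s - ?g s'"
    define Y where "Y = ?f s - ?f s'"
    have X: "X = d + (\<psi> w - \<psi> w') + (t - t') *\<^sub>R h" and Y: "Y = d + L d + (t - t') *\<^sub>R h"
      by (simp_all add: X_def Y_def st gr_def d_def linear_diff[OF L(1)] algebra_simps)
    have "d \<bullet> h = 0" using Wh[OF dW] .
    moreover have "d \<bullet> \<psi> w = 0" "d \<bullet> \<psi> w' = 0" "d \<bullet> L d = 0"
      using psi_W[OF w(3) dW] psi_W[OF w(4) dW] L(3)[OF dW dW] by (simp_all add: inner_commute)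
    ultimately have "d \<bullet> X = d \<bullet> d" "d \<bullet> Y = d \<bullet> d" by (simp_all add: X Y inner_add_right inner_diff_right)
    then have dXY: "norm d \<le> norm X" "norm d \<le> norm Y" by (simp_all add: norm_le_of_orthogonal_part)
    have "norm (X - Y) \<le> \<epsilon> * norm d" using approx[OF w(1,2)] by (simp add: X Y d_def algebra_simps)
    moreover have "\<epsilon> * norm d \<le> \<epsilon> * norm X" "\<epsilon> * norm d \<le> \<epsilon> * norm Y" using dXY e by simp_all
    moreover have "norm X \<le> norm Y + norm (X - Y)" "norm Y \<le> norm X + norm (X - Y)"
      using norm_triangle_ineq[of Y "X - Y"] norm_triangle_ineq[of X "Y - X"] by (simp_all add: norm_minus_commute)
    ultimately have "norm X \<le> norm Y + \<epsilon> * norm Y" "norm Y \<le> norm X + \<epsilon> * norm X" by linarith+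
    then show ?thesis unfolding dist_norm X_def[symmetric] Y_def[symmetric] by (simp add: distrib_right)
  qed
  show "hausdorff_outer k (cylinder h (gr ` A) J) \<le> ennreal ((1 + \<epsilon>) ^ k) * hausdorff_outer k (cylinder h ((\<lambda>w. w + L w) ` A) J)"
    "hausdorff_outer k (cylinder h ((\<lambda>w. w + L w) ` A) J) \<le> ennreal ((1 + \<epsilon>) ^ k) * hausdorff_outer k (cylinder h (gr ` A) J)"
    unfolding c using * e by (intro hausdorff_outer_compare; blast intro: add_pos_pos zero_less_one)+
qed

lemma tangent_plane:
  assumes L0: "tangential L"
  shows "subspace ((\<lambda>w. w + L w) ` W)" "dim ((\<lambda>w. w + L w) ` W) = dim W"
    "\<And>v. v \<in> (\<lambda>w. w + L w) ` W \<Longrightarrow> v \<bullet> h = 0"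
proof -
  note L = tangentialD[OF L0]
  have lin: "linear (\<lambda>w. w + L w)" by (intro linear_compose_add linear_ident L(1))
  show "subspace ((\<lambda>w. w + L w) ` W)" by (rule linear_subspace_image[OF lin W])
  have "inj_on (\<lambda>w. w + L w) (span W)"
    unfolding span_eq_iff[THEN iffD2, OF W]
  proof (rule inj_onI)
    fix w w' assume w: "w \<in> W" "w' \<in> W" "w + L w = w' + L w'"
    define d where "d = w - w'"
    have d: "d \<in> W" using w W by (simp add: d_def subspace_diff)
    have "d + L d = 0" using w(3) by (simp add: d_def linear_diff[OF L(1)] algebra_simps)
    then have "d \<bullet> (d + L d) = 0" by simp
    then have "d \<bullet> d = 0" using L(3)[OF d d] by (simp add: inner_add_right inner_commute)
    then show "w = w'" by (simp add: d_def)
  qed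
  then show "dim ((\<lambda>w. w + L w) ` W) = dim W" by (rule dim_image_eq[OF lin])
  show "v \<bullet> h = 0" if "v \<in> (\<lambda>w. w + L w) ` W" for v
    using that L(2) Wh by (auto simp: inner_add_left)
qed

text \<open>The exponent is (dim W + 1) + dim W: one comparison between the cylinder over the graph
  and the flat cylinder, one between the two bases.\<close>

lemma graph_piece_compare:
  assumes e: "0 < \<epsilon>" and L0: "tangential L"
    and A: "A \<in> sets borel" "A \<subseteq> W" and J: "J \<in> sets borel"
    and approx: "\<And>w w'. w \<in> A \<Longrightarrow> w' \<in> A \<Longrightarrow> norm (\<psi> w - \<psi> w' - L (w - w')) \<le> \<epsilon> * norm (w - w')"
  defines "c \<equiv> ennreal ((1 + \<epsilon>) ^ (2 * dim W + 1))" and "m \<equiv> ennreal (norm h) * emeasure lborel J"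
  shows "hausdorff_outer (Suc (dim W)) (cylinder h (gr ` A) J) \<le> c * (m * hausdorff_outer (dim W) (gr ` A))"
    and "m * hausdorff_outer (dim W) (gr ` A) \<le> c * hausdorff_outer (Suc (dim W)) (cylinder h (gr ` A) J)"
proof -
  let ?j = "dim W" and ?\<phi> = "\<lambda>w. w + L w"
  note L = tangentialD[OF L0]
  note T = tangent_plane[OF L0]
  note P = tangent_piece[OF e L0 A(2) approx]
  have c: "c = ennreal ((1 + \<epsilon>) ^ Suc ?j) * ennreal ((1 + \<epsilon>) ^ ?j)"
    using e by (simp add: c_def ennreal_mult[symmetric] power_add[symmetric] mult_2)
  have Lb: "L \<in> borel_measurable borel"
    by (intro borel_measurable_continuous_onI linear_continuous_on L(1)[unfolded linear_conv_bounded_linear])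
  have phiA: "?\<phi> ` A \<in> sets borel"
    using graph_cylinder_borel[OF Lb L(2,3) A, of "{0}"] by (simp add: cylinder_zero)
  have "hausdorff_outer (Suc (dim (?\<phi> ` W))) (cylinder h (?\<phi> ` A) J) = ennreal (norm h) * emeasure lborel J * hausdorff_outer (dim (?\<phi> ` W)) (?\<phi> ` A)"
    by (rule hausdorff_flat_cylinder[OF T(1) h T(3) phiA _ J]) (use A(2) in auto)
  then have flat: "hausdorff_outer (Suc ?j) (cylinder h (?\<phi> ` A) J) = m * hausdorff_outer ?j (?\<phi> ` A)"
    unfolding T(2) m_def .
  have b: "hausdorff_outer ?j (?\<phi> ` A) \<le> ennreal ((1 + \<epsilon>) ^ ?j) * hausdorff_outer ?j (gr ` A)"
    "hausdorff_outer ?j (gr ` A) \<le> ennreal ((1 + \<epsilon>) ^ ?j) * hausdorff_outer ?j (?\<phi> ` A)"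
    using P[of ?j "{0}"] by (simp_all add: cylinder_zero)
  have "hausdorff_outer (Suc ?j) (cylinder h (gr ` A) J) \<le> ennreal ((1 + \<epsilon>) ^ Suc ?j) * (m * hausdorff_outer ?j (?\<phi> ` A))"
    using P(1)[of "Suc ?j" J] unfolding flat .
  also have "\<dots> \<le> ennreal ((1 + \<epsilon>) ^ Suc ?j) * (m * (ennreal ((1 + \<epsilon>) ^ ?j) * hausdorff_outer ?j (gr ` A)))"
    by (intro mult_left_mono b) auto
  also have "\<dots> = c * (m * hausdorff_outer ?j (gr ` A))" unfolding c by (simp add: mult_ac)
  finally show "hausdorff_outer (Suc ?j) (cylinder h (gr ` A) J) \<le> c * (m * hausdorff_outer ?j (gr ` A))" .
  have "m * hausdorff_outer ?j (gr ` A) \<le> m * (ennreal ((1 + \<epsilon>) ^ ?j) * hausdorff_outer ?j (?\<phi> ` A))"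
    by (intro mult_left_mono b) auto
  also have "\<dots> = ennreal ((1 + \<epsilon>) ^ ?j) * hausdorff_outer (Suc ?j) (cylinder h (?\<phi> ` A) J)"
    unfolding flat by (simp add: mult_ac)
  also have "\<dots> \<le> ennreal ((1 + \<epsilon>) ^ ?j) * (ennreal ((1 + \<epsilon>) ^ Suc ?j) * hausdorff_outer (Suc ?j) (cylinder h (gr ` A) J))"
    by (intro mult_left_mono P) auto
  also have "\<dots> = c * hausdorff_outer (Suc ?j) (cylinder h (gr ` A) J)" unfolding c by (simp add: mult_ac)
  finally show "m * hausdorff_outer ?j (gr ` A) \<le> c * hausdorff_outer (Suc ?j) (cylinder h (gr ` A) J)" .
qed

lemma cylinder_gr_borel:
  "A \<in> sets borel \<Longrightarrow> A \<subseteq> W \<Longrightarrow> J \<in> sets borel \<Longrightarrow> cylinder h (gr ` A) J \<in> sets borel"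
  using graph_cylinder_borel[OF measurable_psi psi_h psi_W, of A J] by (simp add: gr_def[abs_def])

lemma gr_borel: "A \<in> sets borel \<Longrightarrow> A \<subseteq> W \<Longrightarrow> gr ` A \<in> sets borel"
  using cylinder_gr_borel[of A "{0}"] by (simp add: cylinder_zero)

lemma gr_h: "w \<in> W \<Longrightarrow> gr w \<bullet> h = 0"
  by (simp add: gr_def inner_add_left Wh psi_h)

lemma suminf_hausdorff_cylinder_gr:
  assumes A: "\<And>n. A n \<in> sets borel" "\<And>n. A n \<subseteq> W" "disjoint_family A" and J: "J \<in> sets borel"
  shows "(\<Sum>n. hausdorff_outer k (cylinder h (gr ` A n) J)) = hausdorff_outer k (cylinder h (gr ` (\<Union>n. A n)) J)"
proof -
  have U: "cylinder h (gr ` (\<Union>n. A n)) J = (\<Union>n. cylinder h (gr ` A n) J)"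
    by (auto simp: cylinder_iff) blast
  have b: "cylinder h (gr ` A n) J \<in> sets borel" for n by (rule cylinder_gr_borel[OF A(1,2) J])
  have "disjoint_family (\<lambda>n. cylinder h (gr ` A n) J)"
    unfolding disjoint_family_on_def
  proof (intro ballI impI)
    fix m n :: nat assume mn: "m \<noteq> n"
    show "cylinder h (gr ` A m) J \<inter> cylinder h (gr ` A n) J = {}"
    proof (rule ccontr)
      assume "\<not> ?thesis"
      then obtain w t w' t' where w: "w \<in> A m" "w' \<in> A n" and e: "gr w + t *\<^sub>R h = gr w' + t' *\<^sub>R h"
        by (auto simp: cylinder_def)
      have W': "w \<in> W" "w' \<in> W" using w A(2) by auto
      have p: "proj (gr w + t *\<^sub>R h) = w" if "w \<in> W" for w t
        unfolding gr_def by (rule proj_cylinder[OF that psi_W[OF that]])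
      have "w = w'" using p[OF W'(1), of t] p[OF W'(2), of t'] e by simp
      then show False using w A(3) mn unfolding disjoint_family_on_def by blast
    qed
  qed
  then have "(\<Sum>n. emeasure (hausdorff_measure k) (cylinder h (gr ` A n) J)) = emeasure (hausdorff_measure k) (\<Union>n. cylinder h (gr ` A n) J)"
    using b by (intro suminf_emeasure) auto
  then show ?thesis unfolding U using b by (subst (asm) (1 2) emeasure_hausdorff_measure) auto
qed

lemma countable_ball_cover:
  assumes "0 < r"
  obtains c :: "nat \<Rightarrow> 'z" where "\<And>n. c n \<in> W" "W \<subseteq> (\<Union>n. ball (c n) r)"
proof -
  obtain F where F: "F \<subseteq> (\<lambda>w. ball w r) ` W" "countable F" "\<Union> F = \<Union> ((\<lambda>w. ball w r) ` W)"
    using Lindelof[of "(\<lambda>w. ball w r) ` W"] by auto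
  have W0: "0 \<in> W" using W by (rule subspace_0)
  obtain C where C: "countable C" "C \<subseteq> W" "F = (\<lambda>w. ball w r) ` C"
    using countable_subset_image[THEN iffD1, OF conjI[OF F(2,1)]] by blast
  define f where "f = from_nat_into (insert 0 C)"
  have f: "range f = insert 0 C"
    unfolding f_def by (rule range_from_nat_into) (use C(1) in auto)
  show ?thesis
  proof (rule that[of f])
    show "f n \<in> W" for n using f C(2) W0 by (metis insert_iff rangeI subsetD)
    have "W \<subseteq> \<Union> F" unfolding F(3) using assms by auto
    also have "\<dots> \<subseteq> (\<Union>w\<in>range f. ball w r)" unfolding f C(3) by auto
    finally show "W \<subseteq> (\<Union>n. ball (f n) r)" by simp
  qed
qed

text \<open>The base is cut into countably many disjoint Borel pieces, each inside a ball on which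
  one tangent plane approximates. The constant is the same for all pieces, so the inequalities can
  be summed.\<close>

lemma graph_compare:
  assumes e: "0 < \<epsilon>" and A: "A \<in> sets borel" "A \<subseteq> W" and J: "J \<in> sets borel"
  defines "c \<equiv> ennreal ((1 + \<epsilon>) ^ (2 * dim W + 1))" and "m \<equiv> ennreal (norm h) * emeasure lborel J"
  shows "hausdorff_outer (Suc (dim W)) (cylinder h (gr ` A) J) \<le> c * (m * hausdorff_outer (dim W) (gr ` A))"
    and "m * hausdorff_outer (dim W) (gr ` A) \<le> c * hausdorff_outer (Suc (dim W)) (cylinder h (gr ` A) J)"
proof -
  obtain r where r: "0 < r" "\<And>w0. w0 \<in> W \<Longrightarrow> \<exists>L. tangential L \<and>
      (\<forall>w\<in>W \<inter> ball w0 r. \<forall>w'\<in>W \<inter> ball w0 r. norm (\<psi> w - \<psi> w' - L (w - w')) \<le> \<epsilon> * norm (w - w'))"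
    by (rule tangent_approx[OF e]) blast
  obtain x :: "nat \<Rightarrow> 'z" where x: "\<And>n. x n \<in> W" "W \<subseteq> (\<Union>n. ball (x n) r)"
    by (rule countable_ball_cover[OF r(1)]) blast
  define D where "D n = A \<inter> disjointed (\<lambda>n. ball (x n) r) n" for n
  have D_borel: "D n \<in> sets borel" for n
    unfolding D_def
    by (rule sets.Int[OF A(1) subsetD[OF sets.range_disjointed_sets rangeI]]) auto
  have D_W: "D n \<subseteq> W" for n using A(2) by (auto simp: D_def)
  have D_disj: "disjoint_family D"
    using disjoint_family_disjointed[of "\<lambda>n. ball (x n) r"] by (auto simp: D_def disjoint_family_on_def)
  have D_UN: "(\<Union>n. D n) = A"
    using A(2) x(2) UN_disjointed_eq[of "\<lambda>n. ball (x n) r"] by (force simp: D_def)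
  have piece: "hausdorff_outer (Suc (dim W)) (cylinder h (gr ` D n) J) \<le> c * (m * hausdorff_outer (dim W) (gr ` D n))"
    "m * hausdorff_outer (dim W) (gr ` D n) \<le> c * hausdorff_outer (Suc (dim W)) (cylinder h (gr ` D n) J)" for n
  proof -
    obtain L where L: "tangential L"
      "\<And>w w'. w \<in> W \<inter> ball (x n) r \<Longrightarrow> w' \<in> W \<inter> ball (x n) r \<Longrightarrow> norm (\<psi> w - \<psi> w' - L (w - w')) \<le> \<epsilon> * norm (w - w')"
      using r(2)[OF x(1)[of n]] by blast
    have "D n \<subseteq> W \<inter> ball (x n) r" using D_W[of n] disjointed_subset[of "\<lambda>n. ball (x n) r" n] by (auto simp: D_def)
    then have "norm (\<psi> w - \<psi> w' - L (w - w')) \<le> \<epsilon> * norm (w - w')" if "w \<in> D n" "w' \<in> D n" for w w'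
      using L(2) that by blast
    from graph_piece_compare[OF e L(1) D_borel D_W J this]
    show "hausdorff_outer (Suc (dim W)) (cylinder h (gr ` D n) J) \<le> c * (m * hausdorff_outer (dim W) (gr ` D n))"
      "m * hausdorff_outer (dim W) (gr ` D n) \<le> c * hausdorff_outer (Suc (dim W)) (cylinder h (gr ` D n) J)"
      unfolding c_def m_def by blast+
  qed
  have s1: "(\<Sum>n. hausdorff_outer (Suc (dim W)) (cylinder h (gr ` D n) J)) = hausdorff_outer (Suc (dim W)) (cylinder h (gr ` A) J)"
    using suminf_hausdorff_cylinder_gr[OF D_borel D_W D_disj J] unfolding D_UN .
  have s2: "(\<Sum>n. hausdorff_outer (dim W) (gr ` D n)) = hausdorff_outer (dim W) (gr ` A)"
    using suminf_hausdorff_cylinder_gr[OF D_borel D_W D_disj, of "{0}"] unfolding D_UN by (simp add: cylinder_zero)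
  show "hausdorff_outer (Suc (dim W)) (cylinder h (gr ` A) J) \<le> c * (m * hausdorff_outer (dim W) (gr ` A))"
    unfolding s1[symmetric] s2[symmetric] ennreal_suminf_cmult[symmetric] by (intro suminf_le piece) auto
  show "m * hausdorff_outer (dim W) (gr ` A) \<le> c * hausdorff_outer (Suc (dim W)) (cylinder h (gr ` A) J)"
    unfolding s1[symmetric] s2[symmetric] ennreal_suminf_cmult[symmetric] by (intro suminf_le piece) auto
qed

lemma ennreal_le_of_power_mult_le:
  fixes X Y :: ennreal
  assumes "\<And>\<epsilon>::real. 0 < \<epsilon> \<Longrightarrow> X \<le> ennreal ((1 + \<epsilon>) ^ k) * Y"
  shows "X \<le> Y"
proof (cases "Y = top")
  case False
  have "((\<lambda>\<epsilon>. Y * ennreal ((1 + \<epsilon>) ^ k)) \<longlongrightarrow> Y * ennreal ((1 + 0) ^ k)) (at_right 0)"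
    using False by (intro ennreal_tendsto_cmult tendsto_intros) (simp add: less_top)
  moreover have "\<forall>\<^sub>F \<epsilon> in at_right (0::real). X \<le> Y * ennreal ((1 + \<epsilon>) ^ k)"
    using eventually_at_right_less[of "0::real"] by eventually_elim (use assms in \<open>simp add: mult.commute\<close>)
  ultimately have "X \<le> Y * ennreal ((1 + 0) ^ k)" by (rule tendsto_lowerbound) simp
  then show ?thesis by simp
qed simp

proposition hausdorff_graph_cylinder:
  assumes A: "A \<in> sets borel" "A \<subseteq> W" and J: "J \<in> sets borel"
  shows "hausdorff_outer (Suc (dim W)) (cylinder h (gr ` A) J)
    = ennreal (norm h) * emeasure lborel J * hausdorff_outer (dim W) (gr ` A)"
  by (rule antisym; rule ennreal_le_of_power_mult_le) (use graph_compare[OF _ A J] in blast)+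

text \<open>The tangent approximation with error 1, which gives the constant 2^dim W at all points.
  The map \<phi> onto the tangent plane stretches by an amount depending on \<open>w0\<close>, so
  about \<phi> itself only boundedness and the preservation of null sets are recorded.\<close>

lemma gr_lipschitz_local:
  obtains r C where "0 < r" "0 < C"
    "\<And>w0. w0 \<in> W \<Longrightarrow> \<exists>T \<phi> :: 'z \<Rightarrow> 'z. subspace T \<and> dim T = dim W \<and> \<phi> ` W = T \<and> bounded (\<phi> ` (W \<inter> ball w0 r)) \<and>
      (\<forall>S\<subseteq>W \<inter> ball w0 r. hausdorff_outer (dim W) (gr ` S) \<le> ennreal C * hausdorff_outer (dim W) (\<phi> ` S))
      \<and> (\<forall>S\<subseteq>W. hausdorff_outer (dim W) S = 0 \<longrightarrow> hausdorff_outer (dim W) (\<phi> ` S) = 0)"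
proof -
  obtain r where r: "0 < r" "\<And>w0. w0 \<in> W \<Longrightarrow> \<exists>L. tangential L \<and>
      (\<forall>w\<in>W \<inter> ball w0 r. \<forall>w'\<in>W \<inter> ball w0 r. norm (\<psi> w - \<psi> w' - L (w - w')) \<le> 1 * norm (w - w'))"
    by (rule tangent_approx[OF zero_less_one]) blast
  show ?thesis
  proof (rule that[OF r(1), of "2 ^ dim W"])
    fix w0 assume w0: "w0 \<in> W"
    obtain L where L: "tangential L"
      "\<And>w w'. w \<in> W \<inter> ball w0 r \<Longrightarrow> w' \<in> W \<inter> ball w0 r \<Longrightarrow> norm (\<psi> w - \<psi> w' - L (w - w')) \<le> 1 * norm (w - w')"
      using r(2)[OF w0] by blast
    let ?\<phi> = "\<lambda>w. w + L w"
    have lin: "linear ?\<phi>" by (intro linear_compose_add linear_ident tangentialD(1)[OF L(1)])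
    then have bl: "bounded_linear ?\<phi>" by (simp add: linear_conv_bounded_linear)
    have bdd: "bounded (?\<phi> ` (W \<inter> ball w0 r))"
      by (rule bounded_linear_image[OF bounded_subset[OF bounded_ball] bl]) auto
    have cmp: "hausdorff_outer (dim W) (gr ` S) \<le> ennreal (2 ^ dim W) * hausdorff_outer (dim W) (?\<phi> ` S)"
      if S: "S \<subseteq> W \<inter> ball w0 r" for S
    proof -
      have "hausdorff_outer (dim W) (cylinder h (gr ` S) {0}) \<le> ennreal ((1 + 1) ^ dim W) * hausdorff_outer (dim W) (cylinder h (?\<phi> ` S) {0})"
        by (rule tangent_piece(1)[OF zero_less_one L(1)]) (use S L(2) in blast)+
      then show ?thesis by (simp add: cylinder_zero)
    qed
    have null: "hausdorff_outer (dim W) (?\<phi> ` S) = 0" if "hausdorff_outer (dim W) S = 0" for S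
    proof -
      obtain K where K: "0 < K" "\<And>w. norm (?\<phi> w) \<le> norm w * K" using bounded_linear.pos_bounded[OF bl] by blast
      have "hausdorff_outer (dim W) (?\<phi> ` S) \<le> ennreal (K ^ dim W) * hausdorff_outer (dim W) S"
        by (rule hausdorff_outer_lipschitz_image[OF K(1)])
          (use K(2) in \<open>simp add: dist_norm linear_diff[OF lin, symmetric] mult.commute\<close>)
      then show ?thesis using that by simp
    qed
    show "\<exists>T \<phi> :: 'z \<Rightarrow> 'z. subspace T \<and> dim T = dim W \<and> \<phi> ` W = T \<and> bounded (\<phi> ` (W \<inter> ball w0 r)) \<and>
      (\<forall>S\<subseteq>W \<inter> ball w0 r. hausdorff_outer (dim W) (gr ` S) \<le> ennreal (2 ^ dim W) * hausdorff_outer (dim W) (\<phi> ` S))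
      \<and> (\<forall>S\<subseteq>W. hausdorff_outer (dim W) S = 0 \<longrightarrow> hausdorff_outer (dim W) (\<phi> ` S) = 0)"
      by (intro exI[of _ "?\<phi> ` W"] exI[of _ ?\<phi>] conjI allI impI tangent_plane[OF L(1)] bdd cmp null refl)
  qed simp
qed

lemma hausdorff_graph_bounded:
  assumes "A \<subseteq> W" "bounded A"
  shows "hausdorff_outer (dim W) (gr ` A) < top"
proof -
  obtain r C where r: "0 < r" "0 < C"
    and loc: "\<And>w0. w0 \<in> W \<Longrightarrow> \<exists>T \<phi> :: 'z \<Rightarrow> 'z. subspace T \<and> dim T = dim W \<and> \<phi> ` W = T \<and> bounded (\<phi> ` (W \<inter> ball w0 r)) \<and>
      (\<forall>S\<subseteq>W \<inter> ball w0 r. hausdorff_outer (dim W) (gr ` S) \<le> ennreal C * hausdorff_outer (dim W) (\<phi> ` S))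
      \<and> (\<forall>S\<subseteq>W. hausdorff_outer (dim W) S = 0 \<longrightarrow> hausdorff_outer (dim W) (\<phi> ` S) = 0)"
    by (rule gr_lipschitz_local) blast
  have ball: "hausdorff_outer (dim W) (gr ` (W \<inter> ball w0 r)) < top" if w0: "w0 \<in> W" for w0
  proof -
    obtain T and \<phi> :: "'z \<Rightarrow> 'z" where T: "subspace T" "dim T = dim W" "\<phi> ` W = T" "bounded (\<phi> ` (W \<inter> ball w0 r))"
      "hausdorff_outer (dim W) (gr ` (W \<inter> ball w0 r)) \<le> ennreal C * hausdorff_outer (dim W) (\<phi> ` (W \<inter> ball w0 r))"
      using loc[OF w0] by blast
    have "hausdorff_outer (dim W) (\<phi> ` (W \<inter> ball w0 r)) < top"
      using hausdorff_flat_bounded[OF T(1) _ T(4)] T(3) unfolding T(2) by blast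
    then have "ennreal C * hausdorff_outer (dim W) (\<phi> ` (W \<inter> ball w0 r)) < top"
      by (simp add: ennreal_mult_less_top)
    then show ?thesis using T(5) by (rule le_less_trans[rotated])
  qed
  have cpt: "compact (closure A)" using assms(2) by (simp add: compact_closure)
  have cl: "closure A \<subseteq> W" using closure_minimal[OF assms(1) closed_subspace[OF W]] .
  obtain F where F: "finite F" "F \<subseteq> closure A" "closure A \<subseteq> (\<Union>w\<in>F. ball w r)"
  proof (rule compactE_image[OF cpt, of "closure A" "\<lambda>w. ball w r"])
    show "closure A \<subseteq> (\<Union>w\<in>closure A. ball w r)" using r(1) by auto
  qed auto
  have fin: "hausdorff_outer (dim W) (\<Union>w\<in>F. gr ` (W \<inter> ball w r)) < top"
  proof -
    have "hausdorff_outer k (\<Union>w\<in>F. X w) \<le> (\<Sum>w\<in>F. hausdorff_outer k (X w))" if "finite F" for k and X :: "'z \<Rightarrow> 'z set" and F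
      using that
    proof induction
      case (insert w F)
      have "hausdorff_outer k (X w \<union> (\<Union>w\<in>F. X w)) \<le> hausdorff_outer k (X w) + hausdorff_outer k (\<Union>w\<in>F. X w)"
        by (rule hausdorff_outer_Un)
      then show ?case using insert by (simp add: order_trans[OF _ add_left_mono])
    qed simp
    from this[OF F(1)] show ?thesis
      by (rule le_less_trans) (use ball F(1,2) cl in \<open>auto simp: less_top\<close>)
  qed
  have "gr ` A \<subseteq> (\<Union>w\<in>F. gr ` (W \<inter> ball w r))"
    using F(3) closure_subset[of A] assms(1) by blast
  then show ?thesis using hausdorff_outer_mono fin le_less_trans by blast
qed

lemma hausdorff_graph_null:
  assumes A: "A \<subseteq> W" "hausdorff_outer (dim W) A = 0"
  shows "hausdorff_outer (dim W) (gr ` A) = 0"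
proof -
  obtain r C where r: "0 < r" "0 < C"
    and loc: "\<And>w0. w0 \<in> W \<Longrightarrow> \<exists>T \<phi> :: 'z \<Rightarrow> 'z. subspace T \<and> dim T = dim W \<and> \<phi> ` W = T \<and> bounded (\<phi> ` (W \<inter> ball w0 r)) \<and>
      (\<forall>S\<subseteq>W \<inter> ball w0 r. hausdorff_outer (dim W) (gr ` S) \<le> ennreal C * hausdorff_outer (dim W) (\<phi> ` S))
      \<and> (\<forall>S\<subseteq>W. hausdorff_outer (dim W) S = 0 \<longrightarrow> hausdorff_outer (dim W) (\<phi> ` S) = 0)"
    by (rule gr_lipschitz_local) blast
  obtain x :: "nat \<Rightarrow> 'z" where x: "\<And>n. x n \<in> W" "W \<subseteq> (\<Union>n. ball (x n) r)"
    by (rule countable_ball_cover[OF r(1)]) blast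
  have "hausdorff_outer (dim W) (gr ` (A \<inter> ball (x n) r)) = 0" for n
  proof -
    obtain \<phi> :: "'z \<Rightarrow> 'z" where p: "hausdorff_outer (dim W) (gr ` (A \<inter> ball (x n) r)) \<le> ennreal C * hausdorff_outer (dim W) (\<phi> ` (A \<inter> ball (x n) r))"
      "hausdorff_outer (dim W) (A \<inter> ball (x n) r) = 0 \<longrightarrow> hausdorff_outer (dim W) (\<phi> ` (A \<inter> ball (x n) r)) = 0"
    proof -
      have "A \<inter> ball (x n) r \<subseteq> W \<inter> ball (x n) r" "A \<inter> ball (x n) r \<subseteq> W" using A(1) by auto
      then show ?thesis using loc[OF x(1)[of n]] that by blast
    qed
    have "hausdorff_outer (dim W) (A \<inter> ball (x n) r) = 0"
      using hausdorff_outer_mono[of "A \<inter> ball (x n) r" A "dim W"] A(2) by simp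
    then show ?thesis using p by simp
  qed
  moreover have "gr ` A = (\<Union>n. gr ` (A \<inter> ball (x n) r))" using A(1) x(2) by blast
  ultimately show ?thesis
    using hausdorff_outer_countably_subadditive[of "dim W" "\<lambda>n. gr ` (A \<inter> ball (x n) r)"] by simp
qed

end

section \<open>Zero sets of functions that are analytic on lines\<close>

text \<open>A form of the theorem on zero sets of real-analytic functions that uses only coordinate
  lines. By induction the slice through a point with nonzero value is nonzero almost everywhere;
  over such points the line in the last coordinate contains only countably many zeros, and Fubini
  concludes.\<close>

lemma lebesgue_PiM_zero_set:
  fixes z :: "('i \<Rightarrow> real) \<Rightarrow> real"
  assumes "finite I"
    and "z \<in> borel_measurable (lebesgue_PiM I)"
    and "\<And>x i. x \<in> space (lebesgue_PiM I) \<Longrightarrow> i \<in> I \<Longrightarrow> countable {t. z (x(i := t)) = 0} \<or> (\<forall>t. z (x(i := t)) = 0)"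
    and "\<exists>x\<in>space (lebesgue_PiM I). z x \<noteq> 0"
  shows "emeasure (lebesgue_PiM I) {x \<in> space (lebesgue_PiM I). z x = 0} = 0"
  using assms
proof (induction I arbitrary: z rule: finite_induct)
  case empty
  have "space (lebesgue_PiM ({} :: 'i set)) = {\<lambda>_. undefined}" by (simp add: space_PiM)
  then have "{x \<in> space (lebesgue_PiM {}). z x = 0} = {}" using empty(3) by force
  then show ?case by (metis emeasure_empty)
next
  case (insert i I)
  obtain x where x: "x \<in> space (lebesgue_PiM (insert i I))" "z x \<noteq> 0" using insert.prems(3) by blast
  \<comment> \<open>Freezing coordinate i at its value in the point \<open>x\<close> guarantees a
    nonzero value of the slice, as the induction hypothesis demands.\<close>
  define z' where "z' y = z (y(i := x i))" for y
  have upd: "y(i := t) \<in> space (lebesgue_PiM (insert i I))" if "y \<in> space (lebesgue_PiM I)" for y t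
    using that by (auto simp: space_PiM PiE_def extensional_def)
  have mupd: "(\<lambda>y. y(i := t)) \<in> lebesgue_PiM I \<rightarrow>\<^sub>M lebesgue_PiM (insert i I)" for t
    using measurable_compose[OF measurable_Pair2' measurable_add_dim[of i I "\<lambda>_. lborel :: real measure"], of t] by simp
  have z' [measurable]: "z' \<in> borel_measurable (lebesgue_PiM I)"
    unfolding z'_def by (rule measurable_compose[OF mupd insert.prems(1)])
  have null: "emeasure (lebesgue_PiM I) {y \<in> space (lebesgue_PiM I). z' y = 0} = 0"
  proof (rule insert.IH)
    show "z' \<in> borel_measurable (lebesgue_PiM I)" by (rule z')
    show "countable {t. z' (y(j := t)) = 0} \<or> (\<forall>t. z' (y(j := t)) = 0)"
      if y: "y \<in> space (lebesgue_PiM I)" and j: "j \<in> I" for y j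
    proof -
      have e: "(y(j := t))(i := x i) = (y(i := x i))(j := t)" for t
        using j insert.hyps by (auto simp: fun_eq_iff)
      show ?thesis unfolding z'_def e by (rule insert.prems(2)[OF upd[OF y]]) (use j in simp)
    qed
    have "(restrict x I)(i := x i) = x"
      using x(1) by (auto simp: fun_eq_iff space_PiM PiE_def extensional_def restrict_def)
    then show "\<exists>y\<in>space (lebesgue_PiM I). z' y \<noteq> 0"
      using x by (intro bexI[of _ "restrict x I"]) (auto simp: z'_def space_PiM)
  qed
  let ?Z = "{x \<in> space (lebesgue_PiM (insert i I)). z x = 0}"
  note [measurable] = insert.prems(1)
  have Z: "?Z \<in> sets (lebesgue_PiM (insert i I))" by measurable
  have "emeasure (lebesgue_PiM (insert i I)) ?Z = (\<integral>\<^sup>+y. line_measure ?Z i y \<partial>lebesgue_PiM I)"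
    using emeasure_lebesgue_PiM_lines[OF _ _ Z, of i] insert.hyps by simp
  also have "\<dots> = (\<integral>\<^sup>+y. 0 \<partial>lebesgue_PiM I)"
  proof (rule nn_integral_cong_AE)
    have "AE y in lebesgue_PiM I. z' y \<noteq> 0"
    proof (rule AE_I[OF _ null])
      show "{y \<in> space (lebesgue_PiM I). z' y = 0} \<in> sets (lebesgue_PiM I)"
        by measurable
    qed auto
    then show "AE y in lebesgue_PiM I. line_measure ?Z i y = 0"
    proof (rule AE_mp, intro AE_I2 impI)
      fix y assume y: "y \<in> space (lebesgue_PiM I)" and "z' y \<noteq> 0"
      then have ne: "\<not> (\<forall>t. z ((y(i := x i))(i := t)) = 0)" by (auto simp: z'_def)
      have "countable {t. z ((y(i := x i))(i := t)) = 0}"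
        using insert.prems(2)[OF upd[OF y], of i "x i"] ne by blast
      then have "countable {t. y(i := t) \<in> ?Z}" using upd[OF y] by simp
      then show "line_measure ?Z i y = 0" unfolding line_measure_def by (rule emeasure_lborel_countable)
    qed
  qed
  finally show ?case by simp
qed

lemma (in orthonormal_frame) hausdorff_zero_set:
  fixes F :: "'z \<Rightarrow> real"
  assumes cont: "continuous_on (span B) F"
    and lines: "\<And>w v. w \<in> span B \<Longrightarrow> v \<in> span B \<Longrightarrow> countable {t. F (w + t *\<^sub>R v) = 0} \<or> (\<forall>t. F (w + t *\<^sub>R v) = 0)"
    and ne: "w0 \<in> span B" "F w0 \<noteq> 0"
  shows "hausdorff_outer (card B) {w \<in> span B. F w = 0} = 0"
proof -
  have "closed {w \<in> span B. F w = 0}"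
    by (rule continuous_closed_preimage_constant[OF cont closed_span_frame])
  then have bor: "{w \<in> span B. F w = 0} \<in> sets borel" by simp
  have meas: "(\<lambda>x. F (emb x)) \<in> borel_measurable (lebesgue_PiM B)"
  proof (rule measurable_compose[OF _ borel_measurable_continuous_on_restrict[OF cont]])
    show "emb \<in> lebesgue_PiM B \<rightarrow>\<^sub>M restrict_space borel (span B)"
      by (rule measurable_restrict_space2) (auto simp: emb_span)
  qed
  have upd: "emb (x(b := t)) = emb (x(b := 0)) + t *\<^sub>R b" if b: "b \<in> B" for x b t
  proof -
    have "emb (x(b := t)) - emb (x(b := 0)) = (\<Sum>c\<in>B. if c = b then t *\<^sub>R b else 0)"
      unfolding emb_diff unfolding emb_def by (rule sum.cong) auto
    also have "\<dots> = t *\<^sub>R b" using fin b by simp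
    finally show ?thesis by (simp add: algebra_simps)
  qed
  have "emeasure (lebesgue_PiM B) {x \<in> space (lebesgue_PiM B). F (emb x) = 0} = 0"
  proof (rule lebesgue_PiM_zero_set[OF fin meas])
    show "countable {t. F (emb (x(b := t))) = 0} \<or> (\<forall>t. F (emb (x(b := t))) = 0)" if b: "b \<in> B" for x b
    proof -
      define w where "w = emb (x(b := 0))"
      have u: "emb (x(b := t)) = w + t *\<^sub>R b" for t unfolding w_def by (rule upd[OF b])
      have "w \<in> span B" unfolding w_def by (rule emb_span)
      then show ?thesis unfolding u by (rule lines[OF _ span_base[OF b]])
    qed
    show "\<exists>x\<in>space (lebesgue_PiM B). F (emb x) \<noteq> 0"
    proof (rule bexI[of _ "\<lambda>b\<in>B. w0 \<bullet> b"])
      have e: "emb (\<lambda>b\<in>B. w0 \<bullet> b) = emb (\<lambda>b. w0 \<bullet> b)" unfolding emb_def by (rule sum.cong) auto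
      show "F (emb (\<lambda>b\<in>B. w0 \<bullet> b)) \<noteq> 0" unfolding e emb_coords[OF ne(1)] by (rule ne(2))
    qed (simp add: space_PiM)
  qed
  moreover have e: "emb -` {w \<in> span B. F w = 0} \<inter> space (lebesgue_PiM B) = {x \<in> space (lebesgue_PiM B). F (emb x) = 0}"
    using emb_span by auto
  ultimately have "emeasure leb {w \<in> span B. F w = 0} = 0" unfolding emeasure_leb[OF bor] by simp
  then show ?thesis using hausdorff_eq_leb[OF bor Collect_restrict] by (rule trans[rotated])
qed

section \<open>Positive Hermitian Jordan triple systems\<close>

context positive_hermitian_jts
begin

lemma real_independent:
  assumes "independent B"
  shows "\<not> Real_Vector_Spaces.dependent B"
proof
  assume "Real_Vector_Spaces.dependent B"
  then obtain t u where t: "finite t" "t \<subseteq> B" "(\<Sum>v\<in>t. u v *\<^sub>R v) = 0" "\<exists>v\<in>t. u v \<noteq> 0"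
    unfolding real_vector.dependent_explicit by blast
  have "(\<Sum>v\<in>t. sc (of_real (u v)) v) = 0" using t(3) by (simp add: sc_of_real)
  then have "dependent B"
    unfolding dependent_explicit using t
    by (intro exI[of _ t] exI[of _ "\<lambda>v. complex_of_real (u v)"]) auto
  then show False using assms by simp
qed

lemma finite_independent: "independent B \<Longrightarrow> finite B"
  using real_independent independent_imp_finite by blast

definition tr :: "('z \<Rightarrow> 'z) \<Rightarrow> complex" where "tr = complex_trace sc"

lemma trace_basis:
  obtains B where "finite B" "independent B" "span B = UNIV"
    "\<And>T. tr T = (\<Sum>b\<in>B. representation B (T b) b)"
proof -
  define B where "B = (SOME B. independent B \<and> span B = UNIV)"
  have "\<exists>B. independent B \<and> span B = UNIV"
    using basis_exists[of UNIV] by (metis top.extremum_uniqueI)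
  then have B: "independent B" "span B = UNIV" unfolding B_def by (metis (mono_tags, lifting) someI_ex)+
  have "tr T = (\<Sum>b\<in>B. representation B (T b) b)" for T
    by (simp add: tr_def complex_trace_def B_def[symmetric] Let_def)
  then show ?thesis using that B finite_independent by blast
qed

lemma tr_add: "tr (\<lambda>x. S x + T x) = tr S + tr T"
proof -
  obtain B where B: "finite B" "independent B" "span B = UNIV" "\<And>T. tr T = (\<Sum>b\<in>B. representation B (T b) b)"
    by (rule trace_basis) blast
  show ?thesis by (simp add: B(4) representation_add[OF B(2)] B(3) sum.distrib)
qed

lemma tr_scale: "tr (\<lambda>x. sc c (T x)) = c * tr T"
proof -
  obtain B where B: "finite B" "independent B" "span B = UNIV" "\<And>T. tr T = (\<Sum>b\<in>B. representation B (T b) b)"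
    by (rule trace_basis) blast
  show ?thesis by (simp add: B(4) representation_scale[OF B(2)] B(3) sum_distrib_left)
qed

lemma tr_comm:
  assumes "Vector_Spaces.linear sc sc S" "Vector_Spaces.linear sc sc T"
  shows "tr (\<lambda>x. S (T x)) = tr (\<lambda>x. T (S x))"
proof -
  obtain B where B: "finite B" "independent B" "span B = UNIV" "\<And>T. tr T = (\<Sum>b\<in>B. representation B (T b) b)"
    by (rule trace_basis) blast
  have rep: "v = (\<Sum>c\<in>B. sc (representation B v c) c)" for v
    using sum_representation_eq[OF B(2) _ B(1) order_refl, of v] B(3) by simp
  have *: "tr (\<lambda>x. S (T x)) = (\<Sum>b\<in>B. \<Sum>c\<in>B. representation B (T b) c * representation B (S c) b)"
    if "Vector_Spaces.linear sc sc S" for S T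
  proof -
    interpret S: Vector_Spaces.linear sc sc S by fact
    have "representation B (S (T b)) b = (\<Sum>c\<in>B. representation B (T b) c * representation B (S c) b)" for b
    proof -
      have "S (T b) = (\<Sum>c\<in>B. sc (representation B (T b) c) (S c))"
        by (subst rep[of "T b"]) (simp add: S.sum S.scale)
      then show ?thesis
        by (simp add: representation_sum[OF B(2)] representation_scale[OF B(2)] B(3))
    qed
    then show ?thesis by (simp add: B(4))
  qed
  show ?thesis
    unfolding *[OF assms(1)] *[OF assms(2)] by (subst sum.swap) (simp add: mult.commute)
qed

lemma tp_add_left: "tp (x + x') y z = tp x y z + tp x' y z"
  using Vector_Spaces.linear.axioms(3)[OF tp_linear[of y z]] by (simp add: module_hom_axioms_def module_hom_def module_hom_iff)

lemma tp_sc_left: "tp (sc c x) y z = sc c (tp x y z)"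
  using Vector_Spaces.linear.axioms(3)[OF tp_linear[of y z]] by (simp add: module_hom_iff)

lemma tp_add_right: "tp x y (z + z') = tp x y z + tp x y z'"
  by (metis tp_commute tp_add_left)

lemma tp_sc_right: "tp x y (sc c z) = sc c (tp x y z)"
  by (metis tp_commute tp_sc_left)

lemma linear_D: "Vector_Spaces.linear sc sc (tp a b)"
  using tp_linear[of b a] by (subst (asm) tp_commute) simp

lemma tp_scaleR: "tp (r *\<^sub>R x) y z = r *\<^sub>R tp x y z" "tp x (r *\<^sub>R y) z = r *\<^sub>R tp x y z" "tp x y (r *\<^sub>R z) = r *\<^sub>R tp x y z"
  using tp_sc_left[of "of_real r" x y z] tp_sc_middle[of x "of_real r" y z] tp_sc_right[of x y "of_real r" z]
  by (simp_all add: sc_of_real)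

lemma tp_minus: "tp (- x) y z = - tp x y z" "tp x (- y) z = - tp x y z" "tp x y (- z) = - tp x y z"
  using tp_scaleR(1)[of "-1" x y z] tp_scaleR(2)[of x "-1" y z] tp_scaleR(3)[of x y "-1" z] by simp_all

lemma tp_diff: "tp (x - x') y z = tp x y z - tp x' y z" "tp x (y - y') z = tp x y z - tp x y' z" "tp x y (z - z') = tp x y z - tp x y z'"
  using tp_add_left[of x "- x'"] tp_add_middle[of x y "- y'"] tp_add_right[of x y z "- z'"] by (simp_all add: tp_minus)

lemma inner_tr: "x \<bullet> y = Re (tr (tp x y))" by (simp add: inner_eq_trace tr_def)

text \<open>By the Jordan identity D(D(a,b)x, y) and D(x, D(b,a)y) differ by the commutator of
  D(a,b) and D(x,y), and a commutator has trace 0.\<close>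

lemma adjoint: "tp a b x \<bullet> y = x \<bullet> tp b a y"
proof -
  have D: "tp (tp a b x) y = (\<lambda>z. tp x (tp b a y) z + (tp a b (tp x y z) + sc (-1) (tp x y (tp a b z))))"
    using jordan_identity[of a b x y] by (auto simp: fun_eq_iff algebra_simps)
  have "tr (tp (tp a b x) y) = tr (tp x (tp b a y)) + (tr (\<lambda>z. tp a b (tp x y z)) + (-1) * tr (\<lambda>z. tp x y (tp a b z)))"
    unfolding D tr_add tr_scale ..
  also have "tr (\<lambda>z. tp a b (tp x y z)) = tr (\<lambda>z. tp x y (tp a b z))" by (rule tr_comm[OF linear_D linear_D])
  finally show ?thesis by (simp add: inner_tr)
qed

lemma inner_sc: "sc w x \<bullet> sc w y = (norm w)\<^sup>2 * (x \<bullet> y)"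
proof -
  have "tp (sc w x) (sc w y) = (\<lambda>z. sc (of_real ((norm w)\<^sup>2)) (tp x y z))"
    unfolding complex_norm_square by (auto simp: fun_eq_iff tp_sc_left tp_sc_middle mult.commute)
  then show ?thesis unfolding inner_tr by (simp only: tr_scale) simp
qed

lemma norm_sc: "norm (sc w x) = norm w * norm x"
proof -
  have "(norm (sc w x))\<^sup>2 = (norm w * norm x)\<^sup>2"
    unfolding power2_norm_eq_inner inner_sc by (simp add: power_mult_distrib power2_norm_eq_inner)
  then show ?thesis by (metis norm_ge_zero power2_eq_imp_eq mult_nonneg_nonneg)
qed

lemma inner_i: "sc \<i> x \<bullet> y = - (x \<bullet> sc \<i> y)"
  using inner_sc[of \<i> "sc \<i> x" y] by (simp add: inner_minus_left)

lemma sc_decomp: "sc w x = Re w *\<^sub>R x + Im w *\<^sub>R sc \<i> x"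
proof -
  have "sc w x = sc (of_real (Re w) + of_real (Im w) * \<i>) x" by (simp add: complex_eq mult.commute)
  also have "\<dots> = sc (of_real (Re w)) x + sc (of_real (Im w)) (sc \<i> x)" by (simp only: scale_left_distrib scale_scale)
  also have "sc (of_real (Im w)) (sc \<i> x) = Im w *\<^sub>R sc \<i> x" by (rule sc_of_real)
  finally show ?thesis by (simp only: sc_of_real)
qed

lemma sc_scaleR: "sc w (r *\<^sub>R x) = r *\<^sub>R sc w x"
  by (metis sc_of_real scale_left_commute)

lemma bounded_bilinear_sc: "bounded_bilinear sc"
proof
  show "sc (a + a') b = sc a b + sc a' b" for a a' b by (rule scale_left_distrib)
  show "sc a (b + b') = sc a b + sc a b'" for a b b' by (rule scale_right_distrib)
  show "sc (r *\<^sub>R a) b = r *\<^sub>R sc a b" for r a b by (simp add: scaleR_conv_of_real sc_of_real[symmetric])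
  show "sc a (r *\<^sub>R b) = r *\<^sub>R sc a b" for r a b by (rule sc_scaleR)
  show "\<exists>K. \<forall>a b. norm (sc a b) \<le> norm a * norm b * K" by (rule exI[of _ 1]) (simp add: norm_sc)
qed

lemma continuous_on_sc [continuous_intros]:
  "continuous_on S f \<Longrightarrow> continuous_on S g \<Longrightarrow> continuous_on S (\<lambda>x. sc (f x) (g x))"
  by (rule bounded_bilinear.continuous_on[OF bounded_bilinear_sc])

end

section \<open>Peirce spaces, the cone and the Siegel domain\<close>

locale jts_boundary = positive_hermitian_jts sc tp
  for sc :: "complex \<Rightarrow> 'z::euclidean_space \<Rightarrow> 'z" and tp :: "'z \<Rightarrow> 'z \<Rightarrow> 'z \<Rightarrow> 'z" +
  fixes e h :: 'z
  assumes e: "tp e e e = e" "e \<noteq> 0" and h_cone: "h \<in> jts_cone tp e"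
begin

abbreviation "EE \<equiv> jts_E tp e"
abbreviation "FF \<equiv> jts_F tp e"
abbreviation "\<Omega> \<equiv> jts_cone tp e"
abbreviation "\<Phi> \<equiv> jts_Phi tp e"

lemma E_iff: "x \<in> EE \<longleftrightarrow> tp e e x = (1/2) *\<^sub>R x"
  by (simp add: jts_E_def peirce_space_def)

lemma F_iff: "x \<in> FF \<longleftrightarrow> tp e e x = x \<and> tp e x e = x"
  by (simp add: jts_F_def peirce_space_def)

lemma subspace_E: "Real_Vector_Spaces.subspace EE"
  unfolding real_vector.subspace_def E_iff
  using tp_scaleR(3)[of e e 0 0] by (auto simp: E_iff tp_add_right tp_scaleR scaleR_add_right)

lemma subspace_F: "Real_Vector_Spaces.subspace FF"
  unfolding real_vector.subspace_def F_iff
  using tp_scaleR(3)[of e e 0 0] tp_scaleR(2)[of e 0 0 e] by (auto simp: F_iff tp_add_right tp_add_middle tp_scaleR)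

lemma sc_E: "x \<in> EE \<Longrightarrow> sc c x \<in> EE"
  by (simp add: E_iff tp_sc_right sc_scaleR)

lemma e_F: "e \<in> FF" by (simp add: F_iff e)

lemma E_orth: "x \<in> EE \<Longrightarrow> tp e e y = y \<Longrightarrow> x \<bullet> y = 0"
  using adjoint[of e e x y] by (simp add: E_iff)

lemma E_orth_F: "x \<in> EE \<Longrightarrow> y \<in> FF \<Longrightarrow> x \<bullet> y = 0" "x \<in> EE \<Longrightarrow> y \<in> FF \<Longrightarrow> x \<bullet> sc \<i> y = 0"
  using E_orth[of x y] E_orth[of x "sc \<i> y"] by (simp_all add: F_iff tp_sc_right)

text \<open>The inner product of i x and y is antisymmetric in x, y because i is skew-adjoint for
  the real inner product. Writing y as {e,y,e} and moving the operator D(e,y) across shows that it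
  is also symmetric.\<close>

lemma iF_orth_F:
  assumes "x \<in> FF" "y \<in> FF"
  shows "sc \<i> x \<bullet> y = 0"
proof -
  have *: "sc \<i> x \<bullet> y = tp x e (sc \<i> y) \<bullet> e" if "x \<in> FF" "y \<in> FF" for x y
  proof -
    have "sc \<i> x \<bullet> y = sc \<i> x \<bullet> tp e y e" using that by (simp add: F_iff)
    also have "\<dots> = tp y e (sc \<i> x) \<bullet> e" by (rule adjoint[symmetric])
    also have "tp y e (sc \<i> x) = tp x e (sc \<i> y)" by (simp add: tp_sc_right tp_commute[of y])
    finally show ?thesis .
  qed
  have "sc \<i> x \<bullet> y = sc \<i> y \<bullet> x"
    using *[OF assms] *[OF assms(2,1)] by (simp add: tp_sc_right tp_commute[of x])
  moreover have "sc \<i> x \<bullet> y = - (sc \<i> y \<bullet> x)" using inner_i[of x y] by (simp add: inner_commute)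
  ultimately show ?thesis by simp
qed

text \<open>The Peirce rule for \<open>\<Phi>\<close>: the Jordan identity for \<open>[D(e,e), D(\<zeta>,\<zeta>)]\<close> and for \<open>D(\<zeta>,\<zeta>) {e,e,e}\<close>.\<close>

lemma Phi_F:
  assumes "\<zeta> \<in> EE"
  shows "\<Phi> \<zeta> \<zeta> \<in> FF"
proof -
  define v where "v = tp \<zeta> \<zeta> e"
  have "tp e e v = v"
    using jordan_identity[of e e \<zeta> \<zeta> e] assms by (simp add: v_def E_iff e tp_scaleR)
  moreover have "tp e v e = v"
  proof -
    have "tp \<zeta> \<zeta> e - tp e e v = tp v e e - tp e v e"
      using jordan_identity[of \<zeta> \<zeta> e e e] by (simp add: v_def e)
    moreover have "tp v e e = v" using \<open>tp e e v = v\<close> by (simp add: tp_commute[of v])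
    ultimately show ?thesis using \<open>tp e e v = v\<close> by (simp add: v_def[symmetric])
  qed
  ultimately have "v \<in> FF" by (simp add: F_iff)
  then show ?thesis using real_vector.subspace_scale[OF subspace_F, of v 2] by (simp add: jts_Phi_def v_def[symmetric])
qed

lemma Phi_add: "\<Phi> (a + b) (a + b) = \<Phi> a a + (\<Phi> a b + \<Phi> b a) + \<Phi> b b"
  by (simp add: jts_Phi_def tp_add_left tp_add_middle scaleR_add_right)

lemma Phi_sym_F:
  assumes "a \<in> EE" "b \<in> EE"
  shows "\<Phi> a b + \<Phi> b a \<in> FF"
proof -
  have "\<Phi> a b + \<Phi> b a = \<Phi> (a + b) (a + b) - \<Phi> a a - \<Phi> b b" by (simp add: Phi_add)
  then show ?thesis
    using assms by (simp only:) (intro real_vector.subspace_diff real_vector.subspace_add Phi_F subspace_F subspace_E)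
qed

lemma bounded_bilinear_Phi: "bounded_bilinear \<Phi>"
  unfolding bilinear_conv_bounded_bilinear[symmetric] bilinear_def
  by (auto intro!: linearI simp: jts_Phi_def tp_add_left tp_add_middle tp_scaleR scaleR_add_right)

definition squares :: "'z set" where "squares = {tp x e x | x. x \<in> FF}"

lemma cone_iff: "v \<in> \<Omega> \<longleftrightarrow> v \<in> FF \<and> (\<exists>\<delta>>0. ball v \<delta> \<inter> FF \<subseteq> squares)"
proof
  assume "v \<in> \<Omega>"
  then obtain T where T: "openin (top_of_set FF) T" "v \<in> T" "T \<subseteq> squares"
    by (auto simp: jts_cone_def interior_of_def squares_def)
  then show "v \<in> FF \<and> (\<exists>\<delta>>0. ball v \<delta> \<inter> FF \<subseteq> squares)"
    unfolding openin_contains_ball by blast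
next
  assume *: "v \<in> FF \<and> (\<exists>\<delta>>0. ball v \<delta> \<inter> FF \<subseteq> squares)"
  then obtain \<delta> where d: "\<delta> > 0" "ball v \<delta> \<inter> FF \<subseteq> squares" by blast
  have "openin (top_of_set FF) (FF \<inter> ball v \<delta>)" by (rule openin_open_Int) simp
  then show "v \<in> \<Omega>" using * d
    unfolding jts_cone_def interior_of_def squares_def[symmetric] by (intro CollectI exI[of _ "FF \<inter> ball v \<delta>"]) auto
qed

lemma cone_F: "v \<in> \<Omega> \<Longrightarrow> v \<in> FF" by (simp add: cone_iff)

lemma openin_cone: "openin (top_of_set FF) \<Omega>"
  by (simp add: jts_cone_def openin_interior_of)

lemma squares_scale: "0 \<le> t \<Longrightarrow> v \<in> squares \<Longrightarrow> t *\<^sub>R v \<in> squares"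
proof -
  assume t: "0 \<le> t" and "v \<in> squares"
  then obtain x where x: "x \<in> FF" "v = tp x e x" by (auto simp: squares_def)
  have "t *\<^sub>R v = tp (sqrt t *\<^sub>R x) e (sqrt t *\<^sub>R x)" using t x by (simp add: tp_scaleR)
  moreover have "sqrt t *\<^sub>R x \<in> FF" using x by (intro real_vector.subspace_scale[OF subspace_F])
  ultimately show "t *\<^sub>R v \<in> squares" unfolding squares_def by blast
qed

lemma cone_scale:
  assumes "0 < t" "v \<in> \<Omega>"
  shows "t *\<^sub>R v \<in> \<Omega>"
proof -
  obtain \<delta> where d: "\<delta> > 0" "ball v \<delta> \<inter> FF \<subseteq> squares" and v: "v \<in> FF" using assms(2) cone_iff by blast
  have "ball (t *\<^sub>R v) (t * \<delta>) \<inter> FF \<subseteq> squares"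
  proof
    fix u assume u: "u \<in> ball (t *\<^sub>R v) (t * \<delta>) \<inter> FF"
    have "t *\<^sub>R v - u = t *\<^sub>R (v - (1 / t) *\<^sub>R u)" using assms(1) by (simp add: scaleR_diff_right)
    then have "t * norm (v - (1 / t) *\<^sub>R u) < t * \<delta>" using u assms(1) by (simp add: dist_norm)
    then have "(1 / t) *\<^sub>R u \<in> ball v \<delta> \<inter> FF"
      using assms(1) u real_vector.subspace_scale[OF subspace_F, of u "1 / t"] by (simp add: dist_norm)
    then have "(1 / t) *\<^sub>R u \<in> squares" using d(2) by blast
    from squares_scale[OF less_imp_le[OF assms(1)] this] show "u \<in> squares" using assms(1) by simp
  qed
  then show ?thesis unfolding cone_iff
    using assms(1) d(1) real_vector.subspace_scale[OF subspace_F v, of t] by (auto intro!: exI[of _ "t * \<delta>"])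
qed

lemma h_F: "h \<in> FF" using h_cone by (rule cone_F)

text \<open>\<open>-s e\<close> is not a square, since \<open>\<langle>x\<^sup>2 | e\<rangle> = |x|\<^sup>2\<close> for \<open>x \<in> F\<close>.\<close>

lemma h_nonzero: "h \<noteq> 0"
proof
  assume "h = 0"
  then obtain \<delta> where d: "\<delta> > 0" "ball 0 \<delta> \<inter> FF \<subseteq> squares" using h_cone cone_iff by blast
  define s where "s = \<delta> / (2 * norm e)"
  have s: "s > 0" using d(1) e(2) by (simp add: s_def)
  have "(- s) *\<^sub>R e \<in> ball 0 \<delta> \<inter> FF"
  proof
    show "(- s) *\<^sub>R e \<in> FF" by (rule real_vector.subspace_scale[OF subspace_F e_F])
    show "(- s) *\<^sub>R e \<in> ball 0 \<delta>" using d(1) e(2) s by (simp add: s_def)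
  qed
  then have "(- s) *\<^sub>R e \<in> squares" using d(2) by (rule rev_subsetD)
  then obtain x where x: "x \<in> FF" "(- s) *\<^sub>R e = tp x e x" unfolding squares_def by blast
  have "- s * (e \<bullet> e) = tp x e x \<bullet> e" unfolding x(2)[symmetric] by simp
  also have "\<dots> = x \<bullet> x" using adjoint[of x e x e] x(1) by (simp add: F_iff)
  finally have "s * (e \<bullet> e) \<le> 0" using inner_ge_zero[of x] by linarith
  moreover have "0 < s * (e \<bullet> e)" using s e(2) by simp
  ultimately show False by linarith
qed

text \<open>The cone is relatively open and invariant under positive scaling, so a ball of radius
  \<open>\<delta>\<close> around \<open>h\<close> becomes a ball of radius
  \<open>\<delta> * y\<close> around y h.\<close>

lemma cone_absorb:
  obtains \<delta> where "0 < \<delta>" "\<And>y v. 0 < y \<Longrightarrow> v \<in> FF \<Longrightarrow> norm v < \<delta> * y \<Longrightarrow> y *\<^sub>R h + v \<in> \<Omega>"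
proof -
  obtain \<delta> where d: "\<delta> > 0" "ball h \<delta> \<inter> FF \<subseteq> \<Omega>"
    using openin_cone h_cone unfolding openin_contains_ball by blast
  show ?thesis
  proof (rule that[OF d(1)])
    fix y v assume y: "0 < y" and v: "v \<in> FF" "norm v < \<delta> * y"
    have "norm ((1 / y) *\<^sub>R v) < \<delta>" using y v(2) by (simp add: divide_less_eq)
    moreover have "h + (1 / y) *\<^sub>R v \<in> FF" by (intro real_vector.subspace_add real_vector.subspace_scale subspace_F v(1) h_F)
    ultimately have "h + (1 / y) *\<^sub>R v \<in> \<Omega>" using d(2) by (auto simp: dist_norm)
    from cone_scale[OF y this] show "y *\<^sub>R h + v \<in> \<Omega>" using y by (simp add: scaleR_add_right)
  qed
qed

definition VV :: "'z set" where "VV = {\<zeta> + (x + sc \<i> y) | \<zeta> x y. \<zeta> \<in> EE \<and> x \<in> FF \<and> y \<in> FF}"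

text \<open>The projection onto E along the eigenspace for 1: the operator 1 - D(e,e) acts as 1/2 on
  E and as 0 on that eigenspace.\<close>

definition pE :: "'z \<Rightarrow> 'z" where "pE z = 2 *\<^sub>R (z - tp e e z)"

text \<open>\<open>kappa(\<zeta>, z) = Im z - \<Phi>(\<zeta>)\<close>, extended to the whole space; \<open>z \<mapsto> {e,z,e}\<close> is the conjugation of
  \<open>F\<^sub>\<complex>\<close> with respect to \<open>F\<close>.\<close>

definition kappa :: "'z \<Rightarrow> 'z" where
  "kappa z = sc (- \<i> / 2) (z - pE z - tp e (z - pE z) e) - \<Phi> (pE z) (pE z)"

lemma tp_e_iF: "y \<in> FF \<Longrightarrow> tp e e (sc \<i> y) = sc \<i> y"
  by (simp add: tp_sc_right F_iff)

lemma pE_VV: "\<zeta> \<in> EE \<Longrightarrow> x \<in> FF \<Longrightarrow> y \<in> FF \<Longrightarrow> pE (\<zeta> + (x + sc \<i> y)) = \<zeta>"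
  by (simp add: pE_def tp_add_right tp_e_iF) (simp add: E_iff F_iff algebra_simps scaleR_2[symmetric])

lemma kappa_VV:
  assumes "\<zeta> \<in> EE" "x \<in> FF" "y \<in> FF"
  shows "kappa (\<zeta> + (x + sc \<i> y)) = y - \<Phi> \<zeta> \<zeta>"
proof -
  have "tp e (x + sc \<i> y) e = x - sc \<i> y" using assms by (simp add: tp_add_middle tp_sc_middle F_iff)
  then have "sc (- \<i> / 2) (x + sc \<i> y - tp e (x + sc \<i> y) e) = sc (- \<i> / 2) (sc \<i> y + sc \<i> y)" by simp
  also have "\<dots> = y" by (simp add: scale_right_distrib scale_left_distrib[symmetric])
  finally show ?thesis by (simp add: kappa_def pE_VV[OF assms])
qed

lemma VV_I: "\<zeta> \<in> EE \<Longrightarrow> x \<in> FF \<Longrightarrow> y \<in> FF \<Longrightarrow> \<zeta> + (x + sc \<i> y) \<in> VV"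
  unfolding VV_def by blast

lemma VV_E: "\<zeta> \<in> EE \<Longrightarrow> \<zeta> \<in> VV"
  using VV_I[of \<zeta> 0 0] real_vector.subspace_0[OF subspace_F] by simp

lemma VV_F: "x \<in> FF \<Longrightarrow> x \<in> VV"
  using VV_I[of 0 x 0] real_vector.subspace_0[OF subspace_E] real_vector.subspace_0[OF subspace_F] by simp

lemma VV_add:
  assumes "u \<in> VV" "v \<in> VV"
  shows "u + v \<in> VV"
proof -
  obtain \<zeta> x y \<zeta>' x' y' where u: "u = \<zeta> + (x + sc \<i> y)" "\<zeta> \<in> EE" "x \<in> FF" "y \<in> FF"
    and v: "v = \<zeta>' + (x' + sc \<i> y')" "\<zeta>' \<in> EE" "x' \<in> FF" "y' \<in> FF"
    using assms unfolding VV_def by blast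
  have "u + v = (\<zeta> + \<zeta>') + ((x + x') + sc \<i> (y + y'))" by (simp add: u v scale_right_distrib)
  then show ?thesis unfolding VV_def using u v subspace_E subspace_F by (blast intro: real_vector.subspace_add)
qed

lemma VV_sc:
  assumes "u \<in> VV"
  shows "sc w u \<in> VV"
proof -
  obtain \<zeta> x y where u: "u = \<zeta> + (x + sc \<i> y)" "\<zeta> \<in> EE" "x \<in> FF" "y \<in> FF"
    using assms unfolding VV_def by blast
  have "sc w (sc \<i> y) = sc \<i> (sc w y)" by (simp add: mult.commute)
  then have "sc w u = sc w \<zeta> + ((Re w *\<^sub>R x - Im w *\<^sub>R y) + sc \<i> (Im w *\<^sub>R x + Re w *\<^sub>R y))"
    by (simp add: u scale_right_distrib sc_decomp[of w x] sc_decomp[of w y] sc_scaleR)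
  moreover have "Re w *\<^sub>R x - Im w *\<^sub>R y \<in> FF" "Im w *\<^sub>R x + Re w *\<^sub>R y \<in> FF"
    using u by (intro real_vector.subspace_diff real_vector.subspace_add real_vector.subspace_scale subspace_F; simp)+
  ultimately show ?thesis unfolding VV_def using sc_E[OF u(2)] by blast
qed

lemma subspace_VV: "Real_Vector_Spaces.subspace VV"
  unfolding real_vector.subspace_def
  using VV_add VV_sc[of _ "of_real _"] VV_E[OF real_vector.subspace_0[OF subspace_E]] by (simp add: sc_of_real)

lemma VV_diff: "u \<in> VV \<Longrightarrow> v \<in> VV \<Longrightarrow> u - v \<in> VV"
  by (rule real_vector.subspace_diff[OF subspace_VV])

lemma kappa_F:
  assumes "z \<in> VV"
  shows "kappa z \<in> FF"
proof -
  obtain \<zeta> x y where z: "z = \<zeta> + (x + sc \<i> y)" "\<zeta> \<in> EE" "x \<in> FF" "y \<in> FF"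
    using assms unfolding VV_def by blast
  show ?thesis unfolding z(1) kappa_VV[OF z(2-4)] by (intro real_vector.subspace_diff[OF subspace_F] z Phi_F)
qed

lemma siegel_iff: "z \<in> siegel_domain sc tp e \<longleftrightarrow> z \<in> VV \<and> kappa z \<in> \<Omega>"
proof
  assume "z \<in> siegel_domain sc tp e"
  then obtain \<zeta> x y where z: "z = \<zeta> + (x + sc \<i> y)" "\<zeta> \<in> EE" "x \<in> FF" "y \<in> FF" "y - \<Phi> \<zeta> \<zeta> \<in> \<Omega>"
    unfolding siegel_domain_def by blast
  then show "z \<in> VV \<and> kappa z \<in> \<Omega>" using kappa_VV[OF z(2-4)] VV_I[OF z(2-4)] by simp
next
  assume *: "z \<in> VV \<and> kappa z \<in> \<Omega>"
  then obtain \<zeta> x y where z: "z = \<zeta> + (x + sc \<i> y)" "\<zeta> \<in> EE" "x \<in> FF" "y \<in> FF"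
    unfolding VV_def by blast
  then have "y - \<Phi> \<zeta> \<zeta> \<in> \<Omega>" using * kappa_VV[OF z(2-4)] by simp
  then show "z \<in> siegel_domain sc tp e" unfolding siegel_domain_def using z by blast
qed

lemma silov_iff: "z \<in> silov_boundary sc tp e \<longleftrightarrow> z \<in> VV \<and> kappa z = 0"
proof
  assume "z \<in> silov_boundary sc tp e"
  then obtain \<zeta> x y where z: "z = \<zeta> + (x + sc \<i> y)" "\<zeta> \<in> EE" "x \<in> FF" "y \<in> FF" "y - \<Phi> \<zeta> \<zeta> = 0"
    unfolding silov_boundary_def by blast
  then show "z \<in> VV \<and> kappa z = 0" using kappa_VV[OF z(2-4)] VV_I[OF z(2-4)] by simp
next
  assume *: "z \<in> VV \<and> kappa z = 0"
  then obtain \<zeta> x y where z: "z = \<zeta> + (x + sc \<i> y)" "\<zeta> \<in> EE" "x \<in> FF" "y \<in> FF"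
    unfolding VV_def by blast
  then have "y - \<Phi> \<zeta> \<zeta> = 0" using * kappa_VV[OF z(2-4)] by simp
  then show "z \<in> silov_boundary sc tp e" unfolding silov_boundary_def using z by blast
qed

lemma linear_pE: "linear pE"
  by (rule linearI) (simp_all add: pE_def tp_add_right tp_scaleR algebra_simps)

lemma continuous_pE [continuous_intros]: "continuous_on S f \<Longrightarrow> continuous_on S (\<lambda>x. pE (f x))"
  by (rule continuous_on_compose2[OF linear_continuous_on[OF linear_pE[unfolded linear_conv_bounded_linear], of UNIV]]) auto

lemma continuous_Phi [continuous_intros]:
  "continuous_on S f \<Longrightarrow> continuous_on S g \<Longrightarrow> continuous_on S (\<lambda>x. \<Phi> (f x) (g x))"
  by (rule bounded_bilinear.continuous_on[OF bounded_bilinear_Phi])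

definition kappa1 :: "'z \<Rightarrow> 'z" where "kappa1 z = sc (- \<i> / 2) (z - pE z - tp e (z - pE z) e)"

lemma linear_kappa1: "linear kappa1"
  by (rule linearI) (simp_all add: kappa1_def linear_add[OF linear_pE] linear_scale[OF linear_pE] tp_diff tp_add_middle tp_scaleR
     scale_right_diff_distrib scale_right_distrib sc_scaleR algebra_simps)

lemma kappa_split: "kappa z = kappa1 z - \<Phi> (pE z) (pE z)" by (simp add: kappa_def kappa1_def)

lemma continuous_kappa [continuous_intros]: "continuous_on S f \<Longrightarrow> continuous_on S (\<lambda>x. kappa (f x))"
proof -
  have "continuous_on UNIV kappa1" by (rule linear_continuous_on[OF linear_kappa1[unfolded linear_conv_bounded_linear]])
  then have "continuous_on UNIV kappa" unfolding kappa_split[abs_def] by (intro continuous_intros) auto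
  then show "continuous_on S f \<Longrightarrow> continuous_on S (\<lambda>x. kappa (f x))"
    by (rule continuous_on_compose2) auto
qed

text \<open>\<open>kappa\<close> is a linear map minus a quadratic one. This growth, set against the
  linear gain from y h, determines the radius of order sqrt y in the Harnack argument.\<close>

lemma kappa_growth:
  obtains C where "0 < C" "\<And>z. norm (kappa z) \<le> C * (1 + norm z)\<^sup>2"
proof -
  obtain K1 where K1: "0 < K1" "\<And>z. norm (kappa1 z) \<le> norm z * K1"
    using bounded_linear.pos_bounded[OF linear_kappa1[unfolded linear_conv_bounded_linear]] by blast
  obtain K2 where K2: "0 < K2" "\<And>z. norm (pE z) \<le> norm z * K2"
    using bounded_linear.pos_bounded[OF linear_pE[unfolded linear_conv_bounded_linear]] by blast
  obtain K3 where K3: "0 < K3" "\<And>a b. norm (\<Phi> a b) \<le> norm a * norm b * K3"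
    using bounded_bilinear.pos_bounded[OF bounded_bilinear_Phi] by blast
  show ?thesis
  proof (rule that[of "K1 + K2 * K2 * K3"])
    show "0 < K1 + K2 * K2 * K3" using K1 K2 K3 by (simp add: add_pos_pos)
    fix z :: 'z
    define n where "n = norm z"
    have n: "0 \<le> n" by (simp add: n_def)
    have "norm (pE z) * norm (pE z) \<le> (n * K2) * (n * K2)"
      using K2(2)[of z] K2(1) n by (intro mult_mono) (auto simp: n_def)
    then have "norm (\<Phi> (pE z) (pE z)) \<le> (n * K2) * (n * K2) * K3"
      using K3(2)[of "pE z" "pE z"] K3(1) by (meson less_imp_le mult_right_mono order_trans)
    moreover have "n * K1 \<le> (1 + n)\<^sup>2 * K1"
      using K1(1) n by (intro mult_right_mono) (auto simp: power2_eq_square algebra_simps)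
    moreover have "(n * K2) * (n * K2) * K3 \<le> (1 + n)\<^sup>2 * (K2 * K2 * K3)"
    proof -
      have "n * n * (K2 * K2 * K3) \<le> (1 + n)\<^sup>2 * (K2 * K2 * K3)"
        using K2(1) K3(1) n by (intro mult_right_mono) (auto simp: power2_eq_square algebra_simps)
      then show ?thesis by (simp add: mult_ac)
    qed
    ultimately have "norm (kappa z) \<le> (1 + n)\<^sup>2 * K1 + (1 + n)\<^sup>2 * (K2 * K2 * K3)"
      unfolding kappa_split using norm_triangle_ineq4[of "kappa1 z" "\<Phi> (pE z) (pE z)"] K1(2)[of z] by (simp add: n_def)
    then show "norm (kappa z) \<le> (K1 + K2 * K2 * K3) * (1 + norm z)\<^sup>2" by (simp add: n_def algebra_simps)
  qed
qed

lemma kappa_add_line: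
  assumes "z \<in> VV"
  shows "kappa (z + sc w h) = kappa z + Im w *\<^sub>R h"
proof -
  obtain \<zeta> x y where z: "z = \<zeta> + (x + sc \<i> y)" "\<zeta> \<in> EE" "x \<in> FF" "y \<in> FF"
    using assms unfolding VV_def by blast
  have "z + sc w h = \<zeta> + ((x + Re w *\<^sub>R h) + sc \<i> (y + Im w *\<^sub>R h))"
    by (simp add: z sc_decomp[of w] scale_right_distrib sc_scaleR)
  then have "kappa (z + sc w h) = y + Im w *\<^sub>R h - \<Phi> \<zeta> \<zeta>"
    by (simp only:) (intro kappa_VV z real_vector.subspace_add real_vector.subspace_scale subspace_F h_F)
  then show ?thesis using kappa_VV[OF z(2-4)] by (simp add: z)
qed

lemma h_VV: "sc w h \<in> VV" by (rule VV_sc[OF VV_F[OF h_F]])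

lemma silov_line: "p \<in> silov_boundary sc tp e \<Longrightarrow> p + t *\<^sub>R h \<in> silov_boundary sc tp e"
  using kappa_add_line[of p "of_real t"] h_VV[of "of_real t"] VV_add by (simp add: silov_iff sc_of_real)

lemma siegel_line: "p \<in> silov_boundary sc tp e \<Longrightarrow> 0 < Im w \<Longrightarrow> p + sc w h \<in> siegel_domain sc tp e"
  using kappa_add_line[of p w] h_VV[of w] VV_add cone_scale[OF _ h_cone] by (simp add: silov_iff siegel_iff)

lemma closed_silov: "closed (silov_boundary sc tp e)"
proof -
  have "silov_boundary sc tp e = VV \<inter> {z. kappa z = 0}" using silov_iff by auto
  moreover have "closed {z. kappa z = 0}" by (intro closed_Collect_eq continuous_intros)
  ultimately show ?thesis using closed_subspace[OF subspace_VV] by auto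
qed

text \<open>The complex line through \<open>p + i y h\<close> and \<open>p' + i y h\<close> stays in the domain within a radius of order
  \<open>\<surd>y\<close>.\<close>

lemma siegel_disc:
  assumes p: "p \<in> silov_boundary sc tp e" "p' \<in> silov_boundary sc tp e"
  obtains C where "0 < C" "\<And>y s. C * (1 + norm s)\<^sup>2 < y \<Longrightarrow> p + sc (\<i> * of_real y) h + sc s (p' - p) \<in> siegel_domain sc tp e"
proof -
  obtain \<delta> where d: "0 < \<delta>" "\<And>y v. 0 < y \<Longrightarrow> v \<in> FF \<Longrightarrow> norm v < \<delta> * y \<Longrightarrow> y *\<^sub>R h + v \<in> \<Omega>"
    by (rule cone_absorb) blast
  obtain K where K: "0 < K" "\<And>z. norm (kappa z) \<le> K * (1 + norm z)\<^sup>2" by (rule kappa_growth) blast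
  \<comment> \<open>Chosen so that the point z = p + s (p' - p) satisfies 1 + |z| \<le> A (1 + |s|).
    Then |kappa z| is at most K A^2 (1 + |s|)^2, and y h absorbs it as soon as this is below
    \<delta> y.\<close>
  define A where "A = 1 + norm p + norm (p' - p)"
  have A: "0 < A" by (simp add: A_def add_pos_nonneg)
  show ?thesis
  proof (rule that[of "K * A\<^sup>2 / \<delta>"])
    show "0 < K * A\<^sup>2 / \<delta>" using K A d by simp
    fix y and s :: complex assume y: "K * A\<^sup>2 / \<delta> * (1 + norm s)\<^sup>2 < y"
    have y0: "0 < y"
      using y K A d by (meson divide_nonneg_pos le_less_trans mult_nonneg_nonneg zero_le_power2 less_imp_le)
    define z where "z = p + sc s (p' - p)"
    have zV: "z \<in> VV" unfolding z_def using p by (intro VV_add VV_sc VV_diff) (auto simp: silov_iff)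
    have "norm z \<le> norm p + norm s * norm (p' - p)"
      unfolding z_def using norm_triangle_ineq[of p "sc s (p' - p)"] by (simp add: norm_sc)
    moreover have "A * (1 + norm s) = 1 + norm p + norm s * norm (p' - p) + (norm (p' - p) + norm s + norm s * norm p)"
      by (simp add: A_def algebra_simps)
    moreover have "0 \<le> norm (p' - p) + norm s + norm s * norm p" by simp
    ultimately have "1 + norm z \<le> A * (1 + norm s)" by linarith
    then have "(1 + norm z)\<^sup>2 \<le> (A * (1 + norm s))\<^sup>2" by (intro power_mono) auto
    then have "norm (kappa z) \<le> K * (A * (1 + norm s))\<^sup>2"
      using K by (meson order_trans mult_left_mono less_imp_le)
    also have "\<dots> < \<delta> * y"
    proof -
      have "\<delta> * (K * A\<^sup>2 / \<delta> * (1 + norm s)\<^sup>2) < \<delta> * y" using y d(1) by (rule mult_strict_left_mono)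
      moreover have "\<delta> * (K * A\<^sup>2 / \<delta> * (1 + norm s)\<^sup>2) = K * (A * (1 + norm s))\<^sup>2"
        using d(1) by (simp only: power_mult_distrib) simp
      ultimately show ?thesis by linarith
    qed
    finally have "y *\<^sub>R h + kappa z \<in> \<Omega>" by (intro d y0 kappa_F zV)
    then have "z + sc (\<i> * of_real y) h \<in> siegel_domain sc tp e"
      using kappa_add_line[OF zV, of "\<i> * of_real y"] VV_add[OF zV h_VV] by (simp add: siegel_iff add.commute)
    then show "p + sc (\<i> * of_real y) h + sc s (p' - p) \<in> siegel_domain sc tp e"
      by (simp add: z_def add_ac)
  qed
qed

end

section \<open>Real and complex dimensions\<close>

context positive_hermitian_jts
begin

text \<open>Each new basis vector contributes the real plane of its complex multiples, which meets
  the previous complex span only in 0.\<close>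

lemma real_dim_complex_span:
  assumes "finite C" "independent C"
  shows "Real_Vector_Spaces.subspace (span C) \<and> Real_Vector_Spaces.dim (span C) = 2 * card C"
  using assms
proof (induction C rule: finite_induct)
  case empty
  then show ?case by (simp add: real_vector.subspace_def)
next
  case (insert c C)
  have ind: "independent C" "c \<notin> span C"
    using insert.prems insert.hyps by (simp_all add: independent_insert)
  have sub: "Real_Vector_Spaces.subspace (span X)" for X
    unfolding real_vector.subspace_def by (auto simp: sc_of_real[symmetric] span_add span_scale span_zero)
  let ?L = "range (\<lambda>w. sc w c)"
  have lin: "linear (\<lambda>w. sc w c)"
    by (rule linearI) (simp_all add: scale_left_distrib scaleR_conv_of_real sc_of_real[symmetric])
  have subL: "Real_Vector_Spaces.subspace ?L"
    by (rule linear_subspace_image[OF lin real_vector.subspace_UNIV])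
  have c0: "c \<noteq> 0" using ind(2) span_zero by auto
  have dimL: "Real_Vector_Spaces.dim ?L = 2"
  proof -
    have "inj_on (\<lambda>w. sc w c) (Real_Vector_Spaces.span UNIV)" using c0 by (auto simp: inj_on_def)
    then have "Real_Vector_Spaces.dim ?L = Real_Vector_Spaces.dim (UNIV :: complex set)" by (rule dim_image_eq[OF lin])
    then show ?thesis by simp
  qed
  have sum: "{x + y | x y. x \<in> ?L \<and> y \<in> span C} = span (insert c C)"
  proof
    show "{x + y | x y. x \<in> ?L \<and> y \<in> span C} \<subseteq> span (insert c C)"
      using span_mono[OF subset_insertI, of C c] by (auto intro!: span_add span_scale intro: span_base)
    show "span (insert c C) \<subseteq> {x + y | x y. x \<in> ?L \<and> y \<in> span C}"
    proof
      fix x assume "x \<in> span (insert c C)"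
      then obtain k where k: "x - sc k c \<in> span C" unfolding span_insert by blast
      have "x = sc k c + (x - sc k c)" by simp
      then show "x \<in> {x + y | x y. x \<in> ?L \<and> y \<in> span C}" using k by blast
    qed
  qed
  have "?L \<inter> span C = {0}"
  proof -
    have "w = 0" if "sc w c \<in> span C" for w
    proof (rule ccontr)
      assume "w \<noteq> 0"
      have "sc (1 / w) (sc w c) \<in> span C" by (rule span_scale[OF that])
      then show False using ind(2) \<open>w \<noteq> 0\<close> by simp
    qed
    moreover have "0 \<in> ?L" by (rule range_eqI[of _ _ 0]) simp
    ultimately show ?thesis using span_zero by auto
  qed
  then have "Real_Vector_Spaces.dim (span (insert c C)) = 2 + 2 * card C"
    using dim_sums_Int[OF subL sub[of C]] dimL insert.IH[OF ind(1)] by (simp add: sum)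
  then show ?case using sub insert.hyps by simp
qed

lemma real_dim_eq:
  assumes "subspace S"
  shows "Real_Vector_Spaces.dim S = 2 * dim S"
proof -
  obtain C where C: "C \<subseteq> S" "independent C" "S \<subseteq> span C" "card C = dim S"
    by (rule basis_exists)
  have "span C = S" using C(1,3) assms by (metis span_minimal subset_antisym)
  then show ?thesis using real_dim_complex_span[OF finite_independent[OF C(2)] C(2)] C(4) by simp
qed

end

section \<open>The boundary as a graph over the orthogonal complement of h\<close>

context jts_boundary
begin

definition WW :: "'z set" where "WW = {\<zeta> + x | \<zeta> x. \<zeta> \<in> EE \<and> x \<in> FF \<and> x \<bullet> h = 0}"

text \<open>The imaginary part that the equation Im z = \<Phi>(\<zeta>) prescribes, multiplied by i.
  It lies in iF, which is orthogonal to E and to F, hence to \<open>WW\<close> and to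
  \<open>h\<close>.\<close>

definition psi :: "'z \<Rightarrow> 'z" where "psi w = sc \<i> (\<Phi> (pE w) (pE w))"

lemma WW_cases:
  assumes "w \<in> WW"
  obtains \<zeta> x where "w = \<zeta> + x" "\<zeta> \<in> EE" "x \<in> FF" "x \<bullet> h = 0" "pE w = \<zeta>"
proof -
  obtain \<zeta> x where w: "w = \<zeta> + x" "\<zeta> \<in> EE" "x \<in> FF" "x \<bullet> h = 0" using assms unfolding WW_def by blast
  have "pE w = \<zeta>" using pE_VV[OF w(2,3) real_vector.subspace_0[OF subspace_F]] by (simp add: w(1))
  then show ?thesis using that w by blast
qed

lemma pE_WW: "w \<in> WW \<Longrightarrow> pE w \<in> EE" by (metis WW_cases)

lemma subspace_WW: "Real_Vector_Spaces.subspace WW"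
proof -
  have "Real_Vector_Spaces.subspace (FF \<inter> {x. h \<bullet> x = 0})"
    by (intro real_vector.subspace_inter subspace_F subspace_hyperplane)
  from real_vector.subspace_sums[OF subspace_E this]
  show ?thesis unfolding WW_def by (simp add: inner_commute conj_assoc)
qed

lemma WW_h: "w \<in> WW \<Longrightarrow> w \<bullet> h = 0"
  by (erule WW_cases) (simp add: inner_add_left E_orth_F(1)[OF _ h_F])

lemma iF_orth_WW:
  assumes "y \<in> FF" "w \<in> WW"
  shows "sc \<i> y \<bullet> w = 0"
proof -
  obtain \<zeta> x where w: "w = \<zeta> + x" "\<zeta> \<in> EE" "x \<in> FF" by (rule WW_cases[OF assms(2)]) blast
  show ?thesis
    using iF_orth_F[OF assms(1) w(3)] E_orth_F(2)[OF w(2) assms(1)]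
    by (simp add: w(1) inner_add_right inner_commute[of "sc \<i> y" \<zeta>])
qed

text \<open>The increment of the quadratic map minus its linearisation at \<zeta>. Every remaining
  term contains the factor a - b together with a or b, so it is small compared with a - b near
  \<zeta>.\<close>

lemma Phi_diff_expand:
  "\<Phi> (\<zeta> + a) (\<zeta> + a) - \<Phi> (\<zeta> + b) (\<zeta> + b) - (\<Phi> \<zeta> (a - b) + \<Phi> (a - b) \<zeta>) = \<Phi> (a - b) a + \<Phi> b (a - b)"
  by (simp add: jts_Phi_def tp_add_left tp_add_middle tp_diff scaleR_add_right scaleR_diff_right)

lemma linear_Phi_sym: "linear (\<lambda>d. sc \<i> (\<Phi> \<zeta> (pE d) + \<Phi> (pE d) \<zeta>))"
  by (rule linearI) (simp_all add: linear_add[OF linear_pE] linear_scale[OF linear_pE] jts_Phi_def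
      tp_add_left tp_add_middle tp_scaleR scaleR_add_right scale_right_distrib sc_scaleR algebra_simps)

text \<open>The derivative of \<open>psi\<close> at \<open>w0\<close> is d \<mapsto> i
  (\<Phi>(\<zeta>, d) + \<Phi>(d, \<zeta>)), with d replaced by its E-component. Since
  \<open>psi\<close> is quadratic, its deviation from the derivative has the same size at every
  point, which is why one radius serves for all of \<open>WW\<close>.\<close>

sublocale tangent_graph WW h psi
proof
  show "Real_Vector_Spaces.subspace WW" by (rule subspace_WW)
  show "h \<noteq> 0" by (rule h_nonzero)
  show "w \<in> WW \<Longrightarrow> w \<bullet> h = 0" for w by (rule WW_h)
  show "psi w \<bullet> h = 0" if "w \<in> WW" for w
    unfolding psi_def by (rule iF_orth_F[OF Phi_F[OF pE_WW[OF that]] h_F])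
  show "psi w \<bullet> w' = 0" if "w \<in> WW" "w' \<in> WW" for w w'
    unfolding psi_def by (rule iF_orth_WW[OF Phi_F[OF pE_WW[OF that(1)]] that(2)])
  show "continuous_on UNIV psi" unfolding psi_def[abs_def] by (intro continuous_intros)
  obtain K where K: "0 < K" "\<And>z. norm (pE z) \<le> norm z * K"
    using bounded_linear.pos_bounded[OF linear_pE[unfolded linear_conv_bounded_linear]] by blast
  obtain K3 where K3: "0 < K3" "\<And>a b. norm (\<Phi> a b) \<le> norm a * norm b * K3"
    using bounded_bilinear.pos_bounded[OF bounded_bilinear_Phi] by blast
  fix \<epsilon> :: real assume e: "0 < \<epsilon>"
  \<comment> \<open>With a and b of norm at most r K and a - b of norm at most K |w - w'|, the
    remainder is at most 2 K^2 K3 r |w - w'|, which is to equal \<epsilon> |w - w'|.\<close>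
  define r where "r = \<epsilon> / (2 * K * K * K3)"
  have r: "0 < r" "2 * K * K * K3 * r = \<epsilon>" using e K(1) K3(1) by (simp_all add: r_def)
  show "\<exists>r>0. \<forall>w0\<in>WW. \<exists>L. linear L \<and> (\<forall>w\<in>WW. L w \<bullet> h = 0 \<and> (\<forall>w'\<in>WW. L w \<bullet> w' = 0)) \<and>
      (\<forall>w\<in>WW \<inter> ball w0 r. \<forall>w'\<in>WW \<inter> ball w0 r. norm (psi w - psi w' - L (w - w')) \<le> \<epsilon> * norm (w - w'))"
  proof (rule exI[of _ r], intro conjI ballI r(1))
    fix w0 assume w0: "w0 \<in> WW"
    define \<zeta> where "\<zeta> = pE w0"
    let ?L = "\<lambda>d. sc \<i> (\<Phi> \<zeta> (pE d) + \<Phi> (pE d) \<zeta>)"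
    have LF: "\<Phi> \<zeta> (pE w) + \<Phi> (pE w) \<zeta> \<in> FF" if "w \<in> WW" for w
      unfolding \<zeta>_def by (rule Phi_sym_F[OF pE_WW[OF w0] pE_WW[OF that]])
    have est: "norm (psi w - psi w' - ?L (w - w')) \<le> \<epsilon> * norm (w - w')"
      if w: "w \<in> WW \<inter> ball w0 r" "w' \<in> WW \<inter> ball w0 r" for w w'
    proof -
      define a b where "a = pE (w - w0)" and "b = pE (w' - w0)"
      have ab: "pE w = \<zeta> + a" "pE w' = \<zeta> + b" "pE (w - w') = a - b"
        by (simp_all add: a_def b_def \<zeta>_def linear_diff[OF linear_pE])
      have "norm (w - w0) \<le> r" "norm (w' - w0) \<le> r" using w by (auto simp: dist_norm norm_minus_commute)
      then have na: "norm a \<le> r * K" "norm b \<le> r * K"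
        unfolding a_def b_def using K by (meson mult_right_mono less_imp_le order_trans)+
      have nd: "norm (a - b) \<le> norm (w - w') * K" unfolding ab(3)[symmetric] by (rule K(2))
      have "psi w - psi w' - ?L (w - w') = sc \<i> (\<Phi> (a - b) a + \<Phi> b (a - b))"
        unfolding psi_def ab Phi_diff_expand[of \<zeta> a b, symmetric] by (simp add: scale_right_diff_distrib scale_right_distrib)
      then have "norm (psi w - psi w' - ?L (w - w')) = norm (\<Phi> (a - b) a + \<Phi> b (a - b))"
        by (simp add: norm_sc)
      also have "\<dots> \<le> norm (a - b) * norm a * K3 + norm b * norm (a - b) * K3"
        by (rule order_trans[OF norm_triangle_ineq add_mono[OF K3(2) K3(2)]])
      also have "\<dots> = norm (a - b) * (norm a + norm b) * K3" by (simp add: algebra_simps)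
      also have "\<dots> \<le> (norm (w - w') * K) * (r * K + r * K) * K3"
        using nd na K(1) K3(1) r(1) by (intro mult_right_mono mult_mono add_mono) (auto intro!: mult_nonneg_nonneg)
      also have "\<dots> = \<epsilon> * norm (w - w')" unfolding r(2)[symmetric] by (simp add: algebra_simps)
      finally show ?thesis .
    qed
    show "\<exists>L. linear L \<and> (\<forall>w\<in>WW. L w \<bullet> h = 0 \<and> (\<forall>w'\<in>WW. L w \<bullet> w' = 0)) \<and>
      (\<forall>w\<in>WW \<inter> ball w0 r. \<forall>w'\<in>WW \<inter> ball w0 r. norm (psi w - psi w' - L (w - w')) \<le> \<epsilon> * norm (w - w'))"
    proof (rule exI[of _ ?L], intro conjI ballI)
      show "linear ?L" by (rule linear_Phi_sym)
      show "?L w \<bullet> h = 0" if "w \<in> WW" for w by (rule iF_orth_F[OF LF[OF that] h_F])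
      show "?L w \<bullet> w' = 0" if "w \<in> WW" "w' \<in> WW" for w w' by (rule iF_orth_WW[OF LF[OF that(1)] that(2)])
    qed (rule est)
  qed
qed

abbreviation "XX \<equiv> silov_boundary sc tp e"
abbreviation "DD \<equiv> siegel_domain sc tp e"
abbreviation "YY \<equiv> orth_projector h ` XX"

text \<open>The boundary equation fixes the imaginary part and leaves the real part in F free.
  Splitting the real part along \<open>h\<close> gives the height t, and what is orthogonal to
  \<open>h\<close>, together with \<zeta>, the parameter in \<open>WW\<close>.\<close>

lemma XX_cylinder: "XX = cylinder h (gr ` WW) UNIV"
proof
  show "XX \<subseteq> cylinder h (gr ` WW) UNIV"
  proof
    fix z assume "z \<in> XX"
    then obtain \<zeta> x y where z: "z = \<zeta> + (x + sc \<i> y)" "\<zeta> \<in> EE" "x \<in> FF" "y = \<Phi> \<zeta> \<zeta>"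
      unfolding silov_boundary_def by force
    define t where "t = (x \<bullet> h) / (h \<bullet> h)"
    have x': "x - t *\<^sub>R h \<in> FF" "(x - t *\<^sub>R h) \<bullet> h = 0"
      by (intro real_vector.subspace_diff real_vector.subspace_scale subspace_F z(3) h_F)
        (use h_nonzero in \<open>simp add: t_def inner_diff_left\<close>)
    have W: "\<zeta> + (x - t *\<^sub>R h) \<in> WW" unfolding WW_def using z(2) x' by blast
    have "pE (\<zeta> + (x - t *\<^sub>R h)) = \<zeta>"
      using pE_VV[OF z(2) x'(1) real_vector.subspace_0[OF subspace_F]] by simp
    then have "z = gr (\<zeta> + (x - t *\<^sub>R h)) + t *\<^sub>R h" by (simp add: gr_def psi_def z)
    then show "z \<in> cylinder h (gr ` WW) UNIV" using W by (auto simp: cylinder_iff)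
  qed
  show "cylinder h (gr ` WW) UNIV \<subseteq> XX"
  proof
    fix z assume "z \<in> cylinder h (gr ` WW) UNIV"
    then obtain w t where w: "w \<in> WW" "z = gr w + t *\<^sub>R h" by (auto simp: cylinder_iff)
    obtain \<zeta> x where x: "w = \<zeta> + x" "\<zeta> \<in> EE" "x \<in> FF" "x \<bullet> h = 0" "pE w = \<zeta>" by (rule WW_cases[OF w(1)])
    have "gr w \<in> XX"
      unfolding silov_iff gr_def psi_def x(5) unfolding x(1) add.assoc
      using VV_I[OF x(2,3) Phi_F[OF x(2)]] kappa_VV[OF x(2,3) Phi_F[OF x(2)]] by simp
    then show "z \<in> XX" unfolding w(2) by (rule silov_line)
  qed
qed

lemma YY_gr: "YY = gr ` WW"
proof -
  have pr: "orth_projector h (gr w + t *\<^sub>R h) = gr w" if "w \<in> WW" for w t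
    using gr_h[OF that] h_nonzero by (simp add: orth_projector_def inner_add_left power2_norm_eq_inner)
  show ?thesis
  proof
    show "YY \<subseteq> gr ` WW"
    proof
      fix p assume "p \<in> YY"
      then obtain z where z: "z \<in> XX" "p = orth_projector h z" by blast
      then obtain w t where w: "w \<in> WW" "z = gr w + t *\<^sub>R h"
        unfolding XX_cylinder cylinder_iff by blast
      then show "p \<in> gr ` WW" using pr z(2) by simp
    qed
    show "gr ` WW \<subseteq> YY"
    proof
      fix z assume "z \<in> gr ` WW"
      then obtain w where w: "w \<in> WW" "z = gr w" by blast
      have "gr w + 0 *\<^sub>R h \<in> XX" unfolding XX_cylinder cylinder_iff using w(1) by blast
      then have "orth_projector h (gr w + 0 *\<^sub>R h) \<in> YY" by (rule imageI)
      then show "z \<in> YY" using pr[OF w(1), of 0] w(2) by simp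
    qed
  qed
qed

lemma YY_h:
  assumes "p \<in> YY"
  shows "p \<bullet> h = 0"
proof -
  obtain w where "w \<in> WW" "p = gr w" using assms unfolding YY_gr by blast
  then show ?thesis using gr_h by simp
qed

lemma orth_projector_line: "p \<in> YY \<Longrightarrow> orth_projector h (p + t *\<^sub>R h) = p"
  using YY_h[of p] h_nonzero by (simp add: orth_projector_def inner_add_left power2_norm_eq_inner)

lemma XX_YY: "XX = cylinder h YY UNIV" unfolding YY_gr by (rule XX_cylinder)

lemma YY_XX: "YY \<subseteq> XX"
proof
  fix p assume "p \<in> YY"
  moreover have "p = p + 0 *\<^sub>R h" by simp
  ultimately have "p \<in> cylinder h YY UNIV" unfolding cylinder_iff by blast
  then show "p \<in> XX" by (rule XX_YY[THEN equalityD2, THEN subsetD])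
qed

lemma YY_eq: "YY = {z \<in> XX. z \<bullet> h = 0}"
proof
  show "YY \<subseteq> {z \<in> XX. z \<bullet> h = 0}" using YY_XX YY_h by blast
  show "{z \<in> XX. z \<bullet> h = 0} \<subseteq> YY"
  proof
    fix z assume "z \<in> {z \<in> XX. z \<bullet> h = 0}"
    then have z: "z \<in> XX" "orth_projector h z = z" by (simp_all add: orth_projector_def)
    show "z \<in> YY" using imageI[OF z(1), of "orth_projector h"] unfolding z(2) .
  qed
qed

lemma closed_YY: "closed YY"
proof -
  have "closed {z. z \<bullet> h = 0}" by (intro closed_Collect_eq continuous_intros)
  then have "closed (XX \<inter> {z. z \<bullet> h = 0})" by (rule closed_Int[OF closed_silov])
  then show ?thesis unfolding YY_eq Collect_conj_eq by simp
qed

text \<open>The space E + F is decomposed in two ways, as E and F and as \<open>WW\<close> and the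
  line through \<open>h\<close>. It matches the dimensions used to define the boundary measures with
  those of the graph and of its cylinder.\<close>

lemma real_dim_boundary_eq: "real_dim_boundary sc tp e = Suc (Real_Vector_Spaces.dim WW)"
proof -
  let ?V = "{\<zeta> + x | \<zeta> x. \<zeta> \<in> EE \<and> x \<in> FF}" and ?H = "Real_Vector_Spaces.span {h}"
  have cE: "subspace EE"
    unfolding subspace_def using real_vector.subspace_0[OF subspace_E] real_vector.subspace_add[OF subspace_E] sc_E by blast
  have EF: "EE \<inter> FF = {0}"
  proof
    show "EE \<inter> FF \<subseteq> {0}"
    proof
      fix z assume "z \<in> EE \<inter> FF"
      then have "z \<bullet> z = 0" by (intro E_orth_F(1)) auto
      then show "z \<in> {0}" by simp
    qed
    show "{0} \<subseteq> EE \<inter> FF" using real_vector.subspace_0[OF subspace_E] real_vector.subspace_0[OF subspace_F] by auto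
  qed
  have V1: "Real_Vector_Spaces.dim ?V = 2 * dim EE + Real_Vector_Spaces.dim FF"
    using dim_sums_Int[OF subspace_E subspace_F] EF real_dim_eq[OF cE] by simp
  have WH: "WW \<inter> ?H = {0}"
  proof
    show "WW \<inter> ?H \<subseteq> {0}"
    proof
      fix z assume z: "z \<in> WW \<inter> ?H"
      then obtain t where t: "z = t *\<^sub>R h" by (auto simp: real_vector.span_singleton)
      then have "t * (h \<bullet> h) = 0" using WW_h[of z] z by simp
      then show "z \<in> {0}" using h_nonzero t by simp
    qed
    show "{0} \<subseteq> WW \<inter> ?H" using real_vector.subspace_0[OF subspace_WW] real_vector.span_zero by auto
  qed
  have "?V = {w + y | w y. w \<in> WW \<and> y \<in> ?H}"
  proof
    show "?V \<subseteq> {w + y | w y. w \<in> WW \<and> y \<in> ?H}"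
    proof
      fix z assume "z \<in> ?V"
      then obtain \<zeta> x where z: "z = \<zeta> + x" "\<zeta> \<in> EE" "x \<in> FF" by blast
      define t where "t = (x \<bullet> h) / (h \<bullet> h)"
      have x': "x - t *\<^sub>R h \<in> FF" "(x - t *\<^sub>R h) \<bullet> h = 0"
        by (intro real_vector.subspace_diff real_vector.subspace_scale subspace_F z(3) h_F)
        (use h_nonzero in \<open>simp add: t_def inner_diff_left\<close>)
      have "\<zeta> + (x - t *\<^sub>R h) \<in> WW" unfolding WW_def using z(2) x' by blast
      moreover have "t *\<^sub>R h \<in> ?H" by (simp add: real_vector.span_scale real_vector.span_base)
      moreover have "z = (\<zeta> + (x - t *\<^sub>R h)) + t *\<^sub>R h" by (simp add: z)
      ultimately show "z \<in> {w + y | w y. w \<in> WW \<and> y \<in> ?H}" by blast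
    qed
    show "{w + y | w y. w \<in> WW \<and> y \<in> ?H} \<subseteq> ?V"
    proof
      fix z assume "z \<in> {w + y | w y. w \<in> WW \<and> y \<in> ?H}"
      then obtain w y where z: "z = w + y" "w \<in> WW" "y \<in> ?H" by blast
      then obtain t where t: "y = t *\<^sub>R h" by (auto simp: real_vector.span_singleton)
      obtain \<zeta> x where x: "w = \<zeta> + x" "\<zeta> \<in> EE" "x \<in> FF" by (rule WW_cases[OF z(2)]) blast
      have "x + t *\<^sub>R h \<in> FF" using x(3) h_F by (intro real_vector.subspace_add real_vector.subspace_scale subspace_F)
      moreover have "z = \<zeta> + (x + t *\<^sub>R h)" by (simp add: z(1) x(1) t)
      ultimately show "z \<in> ?V" using x(2) by blast
    qed
  qed
  moreover have "Real_Vector_Spaces.dim ?H = 1" using h_nonzero by (simp add: dim_singleton)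
  ultimately have "Real_Vector_Spaces.dim ?V = Real_Vector_Spaces.dim WW + 1"
    using dim_sums_Int[OF subspace_WW real_vector.subspace_span, of "{h}"] WH by simp
  then show ?thesis unfolding real_dim_boundary_def using V1 by simp
qed

end

section \<open>The boundary measure and its projection\<close>

context jts_boundary
begin

abbreviation "jj \<equiv> Real_Vector_Spaces.dim WW"

definition \<nu> :: "'z measure" where "\<nu> = projected_measure sc tp e h"

definition \<beta> :: "'z measure" where "\<beta> = boundary_measure sc tp e"

lemma nu_def': "\<nu> = restrict_space (hausdorff_measure jj) YY"
  by (simp add: \<nu>_def projected_measure_def real_dim_boundary_eq)

lemma beta_def': "\<beta> = restrict_space (hausdorff_measure (Suc jj)) XX"
  by (simp add: \<beta>_def boundary_measure_def real_dim_boundary_eq)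

lemma XX_borel [measurable]: "XX \<in> sets borel" using closed_silov by simp
lemma YY_borel [measurable]: "YY \<in> sets borel" using closed_YY by simp

lemma space_nu [simp]: "space \<nu> = YY" by (simp add: nu_def' space_restrict_space)
lemma space_beta [simp]: "space \<beta> = XX" by (simp add: beta_def' space_restrict_space)
lemma sets_nu [measurable_cong]: "sets \<nu> = sets (restrict_space borel YY)"
  unfolding nu_def' by (rule sets_restrict_space_cong) simp
lemma sets_beta [measurable_cong]: "sets \<beta> = sets (restrict_space borel XX)"
  unfolding beta_def' by (rule sets_restrict_space_cong) simp

lemma sets_nu_iff: "A \<in> sets \<nu> \<longleftrightarrow> A \<in> sets borel \<and> A \<subseteq> YY"
  unfolding sets_nu using YY_borel by (subst sets_restrict_space_iff) auto
lemma sets_beta_iff: "A \<in> sets \<beta> \<longleftrightarrow> A \<in> sets borel \<and> A \<subseteq> XX"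
  unfolding sets_beta using XX_borel by (subst sets_restrict_space_iff) auto

lemma emeasure_nu: "A \<in> sets borel \<Longrightarrow> A \<subseteq> YY \<Longrightarrow> emeasure \<nu> A = hausdorff_outer jj A"
  unfolding nu_def' by (subst emeasure_restrict_space) (auto simp: emeasure_hausdorff_measure)

lemma emeasure_beta: "A \<in> sets borel \<Longrightarrow> A \<subseteq> XX \<Longrightarrow> emeasure \<beta> A = hausdorff_outer (Suc jj) A"
  unfolding beta_def' by (subst emeasure_restrict_space) (auto simp: emeasure_hausdorff_measure)

lemma YY_preimage:
  assumes "A \<subseteq> YY"
  shows "A = gr ` {w \<in> WW. gr w \<in> A}"
proof
  show "A \<subseteq> gr ` {w \<in> WW. gr w \<in> A}"
  proof
    fix p assume p: "p \<in> A"
    then obtain w where "w \<in> WW" "p = gr w" using assms unfolding YY_gr by blast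
    then show "p \<in> gr ` {w \<in> WW. gr w \<in> A}" using p by blast
  qed
qed blast

lemma continuous_gr: "continuous_on UNIV gr"
  unfolding gr_def[abs_def] by (intro continuous_intros cont)

lemma WW_closed: "closed WW" by (rule closed_subspace[OF subspace_WW])

lemma preimage_borel:
  assumes "A \<in> sets borel"
  shows "{w \<in> WW. gr w \<in> A} \<in> sets borel"
proof -
  have [measurable]: "gr \<in> borel_measurable borel" by (rule borel_measurable_continuous_onI[OF continuous_gr])
  have [measurable]: "WW \<in> sets borel" using WW_closed by simp
  note [measurable] = assms
  have "{w \<in> space borel. w \<in> WW \<and> gr w \<in> A} \<in> sets borel" by measurable
  then show ?thesis by simp
qed

lemma norm_le_gr: "w \<in> WW \<Longrightarrow> norm w \<le> norm (gr w)"
  by (rule norm_le_of_orthogonal_part) (simp add: gr_def inner_add_right inner_commute[of w "psi w"] psi_W)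

lemma nu_bounded:
  assumes "A \<in> sets borel" "A \<subseteq> YY" "bounded A"
  shows "emeasure \<nu> A < top"
proof -
  obtain r where r: "\<forall>p\<in>A. norm p \<le> r" using assms(3) unfolding bounded_iff by blast
  have "bounded {w \<in> WW. gr w \<in> A}"
    unfolding bounded_iff
  proof (rule exI[of _ r], rule ballI)
    fix w assume "w \<in> {w \<in> WW. gr w \<in> A}"
    then show "norm w \<le> r" using norm_le_gr[of w] r by (auto intro: order_trans)
  qed
  then have "hausdorff_outer jj (gr ` {w \<in> WW. gr w \<in> A}) < top" by (intro hausdorff_graph_bounded) auto
  then show ?thesis unfolding YY_preimage[OF assms(2), symmetric] emeasure_nu[OF assms(1,2)] .
qed

lemma sigma_finite_nu: "sigma_finite_measure \<nu>"
proof
  have "emeasure \<nu> (YY \<inter> cball 0 (real n)) \<noteq> \<infinity>" for n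
    using nu_bounded[of "YY \<inter> cball 0 (real n)"] by (auto simp: less_top intro: bounded_subset[OF bounded_cball])
  moreover have "(\<Union>n. YY \<inter> cball 0 (real n)) = YY"
    using real_arch_simple by (fastforce simp: dist_norm)
  ultimately show "\<exists>A. countable A \<and> A \<subseteq> sets \<nu> \<and> \<Union> A = space \<nu> \<and> (\<forall>a\<in>A. emeasure \<nu> a \<noteq> \<infinity>)"
    by (intro exI[of _ "range (\<lambda>n. YY \<inter> cball 0 (real n))"]) (auto simp: sets_nu_iff)
qed

section \<open>The product structure of the boundary measure\<close>

text \<open>Arc length along the line t \<mapsto> p + t h, expressed in the parameter t.\<close>

definition lamh :: "real measure" where "lamh = density lborel (\<lambda>_. ennreal (norm h))"

lemma sets_lambda_h [simp, measurable_cong]: "sets lamh = sets borel" and space_lambda_h [simp]: "space lamh = UNIV"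
  by (simp_all add: lamh_def)

lemma emeasure_lambda_h: "J \<in> sets borel \<Longrightarrow> emeasure lamh J = ennreal (norm h) * emeasure lborel J"
  unfolding lamh_def by (subst emeasure_density) (auto simp: nn_integral_cmult)

lemma sigma_finite_lambda_h: "sigma_finite_measure lamh"
  unfolding lamh_def by (subst sigma_finite_measure.sigma_finite_iff_density_finite[OF lborel.sigma_finite_measure_axioms]) auto

definition height :: "'z \<Rightarrow> real" where "height x = (x \<bullet> h) / (h \<bullet> h)"

definition split_line :: "'z \<Rightarrow> 'z \<times> real" where "split_line x = (orth_projector h x, height x)"

lemma continuous_height [continuous_intros]: "continuous_on S f \<Longrightarrow> continuous_on S (\<lambda>x. height (f x))"
  unfolding height_def divide_inverse by (intro continuous_intros)

lemma continuous_orth_projector [continuous_intros]: "continuous_on S f \<Longrightarrow> continuous_on S (\<lambda>x. orth_projector h (f x))"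
  unfolding orth_projector_def divide_inverse by (intro continuous_intros)

lemma height_line: "p \<in> YY \<Longrightarrow> height (p + t *\<^sub>R h) = t"
  using YY_h[of p] h_nonzero by (simp add: height_def inner_add_left)

lemma orth_projector_height: "orth_projector h x + height x *\<^sub>R h = x"
  using h_nonzero by (simp add: orth_projector_def height_def power2_norm_eq_inner)

lemma YY_line_XX: "p \<in> YY \<Longrightarrow> p + t *\<^sub>R h \<in> XX"
  using YY_XX silov_line by blast

lemma measurable_height [measurable]: "height \<in> borel_measurable borel"
  by (rule borel_measurable_continuous_onI) (intro continuous_intros)

lemma measurable_orth_projector: "orth_projector h \<in> restrict_space borel XX \<rightarrow>\<^sub>M restrict_space borel YY"
proof -
  have m: "orth_projector h \<in> borel_measurable borel"
    by (rule borel_measurable_continuous_onI) (intro continuous_intros)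
  show ?thesis
    by (rule measurable_restrict_space2[OF _ measurable_restrict_space1[OF m]]) (auto simp: space_restrict_space)
qed

lemma measurable_split_line: "split_line \<in> \<beta> \<rightarrow>\<^sub>M \<nu> \<Otimes>\<^sub>M lamh"
  unfolding split_line_def[abs_def]
proof (rule measurable_Pair)
  show "orth_projector h \<in> \<beta> \<rightarrow>\<^sub>M \<nu>"
    using measurable_orth_projector by (simp cong: measurable_cong_sets add: sets_nu sets_beta)
  show "height \<in> \<beta> \<rightarrow>\<^sub>M lamh"
    using measurable_restrict_space1[OF measurable_height, of XX] by (simp cong: measurable_cong_sets add: sets_beta)
qed

lemma line_measurable: "(\<lambda>(p, t). p + t *\<^sub>R h) \<in> \<nu> \<Otimes>\<^sub>M (borel :: real measure) \<rightarrow>\<^sub>M restrict_space borel XX"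
proof (rule measurable_restrict_space2)
  show "(\<lambda>(p, t). p + t *\<^sub>R h) \<in> space (\<nu> \<Otimes>\<^sub>M borel) \<rightarrow> XX"
    by (auto simp: space_pair_measure YY_line_XX)
  have [measurable]: "(\<lambda>p. p) \<in> \<nu> \<rightarrow>\<^sub>M borel"
    by (simp cong: measurable_cong_sets add: sets_nu) (rule measurable_restrict_space1, simp)
  show "(\<lambda>(p, t). p + t *\<^sub>R h) \<in> \<nu> \<Otimes>\<^sub>M borel \<rightarrow>\<^sub>M borel"
    unfolding split_beta'
    by (intro borel_measurable_add borel_measurable_scaleR borel_measurable_const
        measurable_compose[OF measurable_fst \<open>(\<lambda>p. p) \<in> \<nu> \<rightarrow>\<^sub>M borel\<close>] measurable_snd)
qed

text \<open>A product measure is determined by its values on rectangles. The preimage of a rectangle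
  is a cylinder over a piece of the graph, whose Hausdorff measure is given by
  \<open>hausdorff_graph_cylinder\<close>.\<close>

lemma distr_beta_split: "distr \<beta> (\<nu> \<Otimes>\<^sub>M lamh) split_line = \<nu> \<Otimes>\<^sub>M lamh"
proof (rule pair_measure_eqI[OF sigma_finite_nu sigma_finite_lambda_h, symmetric])
  fix A J assume A: "A \<in> sets \<nu>" and J: "J \<in> sets lamh"
  have A': "A \<in> sets borel" "A \<subseteq> YY" and J': "J \<in> sets borel" using A J by (auto simp: sets_nu_iff)
  let ?A = "{w \<in> WW. gr w \<in> A}"
  have c: "split_line -` (A \<times> J) \<inter> XX = cylinder h A J"
  proof
    show "split_line -` (A \<times> J) \<inter> XX \<subseteq> cylinder h A J"
    proof
      fix x assume "x \<in> split_line -` (A \<times> J) \<inter> XX"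
      then have "orth_projector h x \<in> A" "height x \<in> J" by (auto simp: split_line_def)
      then show "x \<in> cylinder h A J"
        unfolding cylinder_iff using orth_projector_height[of x, symmetric] by blast
    qed
    show "cylinder h A J \<subseteq> split_line -` (A \<times> J) \<inter> XX"
    proof
      fix x assume "x \<in> cylinder h A J"
      then obtain p t where p: "p \<in> A" "t \<in> J" "x = p + t *\<^sub>R h" by (auto simp: cylinder_iff)
      then have pY: "p \<in> YY" using A' by blast
      show "x \<in> split_line -` (A \<times> J) \<inter> XX"
        using p pY height_line[OF pY] orth_projector_line[OF pY] YY_line_XX[OF pY] by (simp add: split_line_def)
    qed
  qed
  have cyl: "cylinder h A J = cylinder h (gr ` ?A) J" using YY_preimage[OF A'(2)] by simp
  have cb: "cylinder h A J \<in> sets borel"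
    unfolding cyl by (rule cylinder_gr_borel[OF preimage_borel[OF A'(1)] _ J']) auto
  have cX: "cylinder h A J \<subseteq> XX" unfolding c[symmetric] by blast
  have "emeasure (distr \<beta> (\<nu> \<Otimes>\<^sub>M lamh) split_line) (A \<times> J) = emeasure \<beta> (cylinder h A J)"
    using A J by (subst emeasure_distr[OF measurable_split_line]) (auto simp: c)
  also have "\<dots> = hausdorff_outer (Suc jj) (cylinder h (gr ` ?A) J)"
    using emeasure_beta[OF cb cX] cyl by simp
  also have "\<dots> = ennreal (norm h) * emeasure lborel J * hausdorff_outer jj (gr ` ?A)"
    by (rule hausdorff_graph_cylinder[OF preimage_borel[OF A'(1)] _ J']) auto
  also have "hausdorff_outer jj (gr ` ?A) = emeasure \<nu> A"
    using YY_preimage[OF A'(2)] by (simp add: emeasure_nu[OF A'])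
  finally show "emeasure \<nu> A * emeasure lamh J = emeasure (distr \<beta> (\<nu> \<Otimes>\<^sub>M lamh) split_line) (A \<times> J)"
    by (simp add: emeasure_lambda_h[OF J'] mult_ac)
qed simp

lemma beta_eq_distr: "distr (\<nu> \<Otimes>\<^sub>M lamh) (restrict_space borel XX) (\<lambda>(p, t). p + t *\<^sub>R h) = \<beta>"
proof -
  have lm: "(\<lambda>(p, t). p + t *\<^sub>R h) \<in> \<nu> \<Otimes>\<^sub>M lamh \<rightarrow>\<^sub>M restrict_space borel XX"
    using line_measurable by (simp cong: measurable_cong_sets sets_pair_measure_cong)
  have "distr (\<nu> \<Otimes>\<^sub>M lamh) (restrict_space borel XX) (\<lambda>(p, t). p + t *\<^sub>R h)
     = distr (distr \<beta> (\<nu> \<Otimes>\<^sub>M lamh) split_line) (restrict_space borel XX) (\<lambda>(p, t). p + t *\<^sub>R h)"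
    unfolding distr_beta_split ..
  also have "\<dots> = distr \<beta> (restrict_space borel XX) (\<lambda>x. x)"
    unfolding distr_distr[OF lm measurable_split_line] by (simp add: o_def split_line_def orth_projector_height)
  also have "\<dots> = \<beta>" by (rule distr_id2[OF sets_beta[symmetric]])
  finally show ?thesis .
qed

lemma radon_nu: "compact K \<Longrightarrow> K \<subseteq> YY \<Longrightarrow> emeasure \<nu> K < \<infinity>"
  using nu_bounded[of K] by (simp add: compact_imp_bounded borel_compact)

lemma radon_beta:
  assumes "compact K" "K \<subseteq> XX"
  shows "emeasure \<beta> K < \<infinity>"
proof -
  let ?P = "orth_projector h ` K" and ?J = "height ` K"
  have P: "compact ?P" by (intro compact_continuous_image continuous_intros assms)
  have J: "compact ?J" by (intro compact_continuous_image continuous_intros assms)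
  have PY: "?P \<subseteq> YY" using assms(2) by blast
  have "K \<in> sets borel" using assms by (simp add: borel_compact)
  then have "emeasure \<beta> K = emeasure (\<nu> \<Otimes>\<^sub>M lamh) ((\<lambda>(p, t). p + t *\<^sub>R h) -` K \<inter> space (\<nu> \<Otimes>\<^sub>M lamh))"
    unfolding beta_eq_distr[symmetric]
    using line_measurable assms(2) by (subst emeasure_distr) (auto cong: measurable_cong_sets sets_pair_measure_cong simp: sets_restrict_space_iff)
  also have "\<dots> \<le> emeasure (\<nu> \<Otimes>\<^sub>M lamh) (?P \<times> ?J)"
  proof (rule emeasure_mono)
    show "?P \<times> ?J \<in> sets (\<nu> \<Otimes>\<^sub>M lamh)"
      using P J PY by (intro pair_measureI) (auto simp: sets_nu_iff borel_compact)
    show "(\<lambda>(p, t). p + t *\<^sub>R h) -` K \<inter> space (\<nu> \<Otimes>\<^sub>M lamh) \<subseteq> ?P \<times> ?J"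
    proof
      fix z assume z: "z \<in> (\<lambda>(p, t). p + t *\<^sub>R h) -` K \<inter> space (\<nu> \<Otimes>\<^sub>M lamh)"
      obtain p t where pt: "z = (p, t)" by (cases z)
      have p: "p \<in> YY" "p + t *\<^sub>R h \<in> K" using z by (auto simp: pt space_pair_measure)
      have "orth_projector h (p + t *\<^sub>R h) \<in> ?P" "height (p + t *\<^sub>R h) \<in> ?J" using p(2) by (rule imageI)+
      then show "z \<in> ?P \<times> ?J" by (simp add: pt orth_projector_line[OF p(1)] height_line[OF p(1)])
    qed
  qed
  also have "\<dots> = emeasure \<nu> ?P * emeasure lamh ?J"
    using P J PY by (intro sigma_finite_measure.emeasure_pair_measure_Times[OF sigma_finite_lambda_h]) (auto simp: sets_nu_iff borel_compact)
  also have "\<dots> < \<infinity>"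
    using radon_nu[OF P PY] emeasure_compact_finite[OF J] J
    by (simp add: emeasure_lambda_h borel_compact ennreal_mult_less_top)
  finally show ?thesis .
qed

end

section \<open>Restrictions of f to complex lines and curves\<close>

locale jts_pluriharmonic = jts_boundary sc tp e h
  for sc :: "complex \<Rightarrow> 'z::euclidean_space \<Rightarrow> 'z" and tp :: "'z \<Rightarrow> 'z \<Rightarrow> 'z \<Rightarrow> 'z" and e h :: 'z +
  fixes G :: "'z \<Rightarrow> complex" and f :: "'z \<Rightarrow> real"
  assumes hol: "vs_holomorphic_on sc G DD" and f_eq: "\<And>x. x \<in> DD \<Longrightarrow> f x = Re (G x)"
    and f_nonneg: "\<And>x. x \<in> DD \<Longrightarrow> 0 \<le> f x"
begin

lemma continuous_G: "continuous_on DD G"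
proof (rule continuous_at_imp_continuous_on, rule ballI)
  fix x assume "x \<in> DD"
  then show "isCont G x" using hol has_derivative_continuous unfolding vs_holomorphic_on_def by blast
qed

lemma continuous_f: "continuous_on DD f"
proof -
  have "continuous_on DD (\<lambda>x. Re (G x))" by (intro continuous_intros continuous_G)
  then show ?thesis by (rule continuous_on_cong[THEN iffD1, rotated 2]) (auto simp: f_eq)
qed

lemma field_differentiable_curve:
  assumes "(q has_derivative (\<lambda>c. sc c d)) (at s)" "q s \<in> DD"
  shows "(\<lambda>s. G (q s)) field_differentiable at s"
proof -
  obtain G' where G': "(G has_derivative G') (at (q s))" "\<And>c v. G' (sc c v) = c * G' v"
    using hol assms(2) unfolding vs_holomorphic_on_def by blast
  have "((\<lambda>s. G (q s)) has_derivative (\<lambda>c. G' (sc c d))) (at s)"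
    by (rule has_derivative_compose[OF assms(1) G'(1)])
  then have "((\<lambda>s. G (q s)) has_field_derivative G' d) (at s)"
    unfolding has_field_derivative_def G'(2) mult.commute[of _ "G' d"] .
  then show ?thesis by (auto simp: field_differentiable_def)
qed

lemma has_derivative_quadratic:
  "((\<lambda>s. a + sc s b + sc (s\<^sup>2) c) has_derivative (\<lambda>w. sc w (b + sc (2 * s) c))) (at s)"
proof -
  have l: "bounded_linear (\<lambda>w. sc w v)" for v by (rule bounded_bilinear.bounded_linear_left[OF bounded_bilinear_sc])
  have "((\<lambda>s. s\<^sup>2) has_derivative (\<lambda>w. 2 * s * w)) (at s)"
  proof -
    have "((\<lambda>s. s\<^sup>2) has_field_derivative 2 * s) (at s)" by (auto intro!: derivative_eq_intros)
    then show ?thesis unfolding has_field_derivative_def .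
  qed
  from bounded_linear.has_derivative[OF l this]
  have "((\<lambda>s. sc (s\<^sup>2) c) has_derivative (\<lambda>w. sc (2 * s * w) c)) (at s)" .
  moreover have "((\<lambda>s. sc s b) has_derivative (\<lambda>w. sc w b)) (at s)"
    by (rule bounded_linear_imp_has_derivative[OF l])
  ultimately have "((\<lambda>s. a + sc s b + sc (s\<^sup>2) c) has_derivative (\<lambda>w. 0 + sc w b + sc (2 * s * w) c)) (at s)"
    by (intro has_derivative_add has_derivative_const)
  moreover have "(\<lambda>w. 0 + sc w b + sc (2 * s * w) c) = (\<lambda>w. sc w (b + sc (2 * s) c))"
    by (auto simp: fun_eq_iff scale_right_distrib mult_ac)
  ultimately show ?thesis by simp
qed

text \<open>Straight lines give the Herglotz and Harnack arguments. The quadratic term is there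
  because a line in \<open>WW\<close> lifts to a parabola on the graph.\<close>

lemma holomorphic_quadratic:
  assumes "\<And>s. s \<in> S \<Longrightarrow> a + sc s b + sc (s\<^sup>2) c \<in> DD"
  shows "(\<lambda>s. G (a + sc s b + sc (s\<^sup>2) c)) holomorphic_on S"
  unfolding holomorphic_on_def
proof
  fix s assume "s \<in> S"
  from field_differentiable_curve[OF has_derivative_quadratic assms[OF this]]
  show "(\<lambda>s. G (a + sc s b + sc (s\<^sup>2) c)) field_differentiable at s within S"
    by (rule field_differentiable_at_within)
qed

lemma holomorphic_line:
  assumes "\<And>s. s \<in> S \<Longrightarrow> a + sc s b \<in> DD"
  shows "(\<lambda>s. G (a + sc s b)) holomorphic_on S"
  using holomorphic_quadratic[of S a b 0] assms by simp

definition u :: "'z \<Rightarrow> complex \<Rightarrow> real" where "u p w = f (p + sc w h)"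

lemma YY_DD: "p \<in> YY \<Longrightarrow> 0 < Im w \<Longrightarrow> p + sc w h \<in> DD"
  using YY_XX siegel_line by blast

lemma u_nonneg: "p \<in> YY \<Longrightarrow> 0 < Im w \<Longrightarrow> 0 \<le> u p w"
  unfolding u_def by (intro f_nonneg YY_DD)

lemma u_herglotz:
  assumes "p \<in> YY"
  shows "\<exists>a \<tau>. 0 \<le> a \<and> finite_measure \<tau> \<and> sets \<tau> = sets (borel :: real measure) \<and>
    (\<forall>w. 0 < Im w \<longrightarrow> u p w = a * Im w + (\<integral>s. (1 + s\<^sup>2) * poisson_half w s \<partial>\<tau>))"
proof -
  have h: "(\<lambda>w. G (p + sc w h)) holomorphic_on {w. 0 < Im w}"
    by (rule holomorphic_line) (use YY_DD[OF assms] in auto)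
  have "\<exists>a \<tau>. 0 \<le> a \<and> finite_measure \<tau> \<and> sets \<tau> = sets (borel :: real measure) \<and>
    (\<forall>w. 0 < Im w \<longrightarrow> Re (G (p + sc w h)) = a * Im w + (\<integral>s. (1 + s\<^sup>2) * poisson_half w s \<partial>\<tau>))"
    by (rule herglotz_half[OF h]) (use f_nonneg f_eq YY_DD[OF assms] in force)
  moreover have "u p w = Re (G (p + sc w h))" if "0 < Im w" for w
    unfolding u_def by (rule f_eq[OF YY_DD[OF assms that]])
  ultimately show ?thesis by simp
qed

text \<open>Harnack's inequality in the variable s of p + i y h + s (p' - p), where s = 0 gives the
  line through p and s = 1 that through p'. After division by y the limit y \<rightarrow>
  \<infinity> turns the two values into the slopes.\<close>

lemma u_slope_le:
  assumes p: "p \<in> YY" "p' \<in> YY"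
    and a: "((\<lambda>y. u p (\<i> * of_real y) / y) \<longlongrightarrow> a) at_top" and a': "((\<lambda>y. u p' (\<i> * of_real y) / y) \<longlongrightarrow> a') at_top"
  shows "a \<le> a'"
proof -
  obtain C where C: "0 < C" "\<And>y s. C * (1 + norm s)\<^sup>2 < y \<Longrightarrow> p + sc (\<i> * of_real y) h + sc s (p' - p) \<in> DD"
    using siegel_disc[of p p'] p YY_XX by blast
  \<comment> \<open>Solves the condition C (1 + |s|)^2 < y of \<open>siegel_disc\<close> for
    |s|.\<close>
  define R where "R y = sqrt (y / C) - 1" for y
  have lim: "((\<lambda>y. (R y - 1) / (R y + 1)) \<longlongrightarrow> 1) at_top"
    unfolding R_def using C(1) by real_asymp
  have "\<forall>\<^sub>F y in at_top. (R y - 1) / (R y + 1) * (u p (\<i> * of_real y) / y) \<le> u p' (\<i> * of_real y) / y"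
    using eventually_gt_at_top[of "4 * C"]
  proof eventually_elim
    case (elim y)
    have y: "0 < y" using elim C(1) by linarith
    \<comment> \<open>The threshold 4 C makes the radius exceed 1, so that s = 1 lies in the
      disc.\<close>
    have "4 < y / C" using elim C(1) by (simp add: pos_less_divide_eq)
    then have "sqrt 4 < sqrt (y / C)" by (rule real_sqrt_less_mono)
    then have R1: "1 < R y" by (simp add: R_def)
    have D: "p + sc (\<i> * of_real y) h + sc s (p' - p) \<in> DD" if "norm s < R y" for s
    proof (rule C(2))
      have "1 + norm s < sqrt (y / C)" using that by (simp add: R_def)
      then have "(1 + norm s)\<^sup>2 < (sqrt (y / C))\<^sup>2" by (intro power_strict_mono) auto
      then show "C * (1 + norm s)\<^sup>2 < y" using y C(1) by (simp add: pos_less_divide_eq mult.commute)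
    qed
    have hol1: "(\<lambda>s. G (p + sc (\<i> * of_real y) h + sc s (p' - p))) holomorphic_on ball 0 (R y)"
      by (rule holomorphic_line) (use D in auto)
    have nn: "0 \<le> Re (G (p + sc (\<i> * of_real y) h + sc s (p' - p)))" if "norm s < R y" for s
      using f_nonneg[OF D[OF that]] f_eq[OF D[OF that]] by simp
    have "(R y - norm (1::complex)) / (R y + norm (1::complex)) * Re (G (p + sc (\<i> * of_real y) h + sc 0 (p' - p)))
        \<le> Re (G (p + sc (\<i> * of_real y) h + sc 1 (p' - p)))"
      by (rule harnack_disc[OF hol1 nn]) (use R1 in auto)
    moreover have "Re (G (p + sc (\<i> * of_real y) h + sc 0 (p' - p))) = u p (\<i> * of_real y)"
      using f_eq[OF YY_DD[OF p(1), of "\<i> * of_real y"]] y by (simp add: u_def)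
    moreover have "Re (G (p + sc (\<i> * of_real y) h + sc 1 (p' - p))) = u p' (\<i> * of_real y)"
      using f_eq[OF YY_DD[OF p(2), of "\<i> * of_real y"]] y by (simp add: u_def add.commute)
    ultimately have "(R y - 1) / (R y + 1) * u p (\<i> * of_real y) \<le> u p' (\<i> * of_real y)" by simp
    from divide_right_mono[OF this, of y] y show ?case by simp
  qed
  moreover have "((\<lambda>y. (R y - 1) / (R y + 1) * (u p (\<i> * of_real y) / y)) \<longlongrightarrow> 1 * a) at_top"
    by (intro tendsto_mult lim a)
  ultimately have "1 * a \<le> a'" by (intro tendsto_le[OF _ a']) auto
  then show ?thesis by simp
qed

text \<open>Along a real line in \<open>WW\<close> the point gr(w + t v) + i h is a quadratic
  polynomial in t, which makes sense for complex t. The function f - a on the line is then the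
  restriction of a function holomorphic in a neighbourhood of the real axis, and a nonzero one has
  at most countably many zeros.\<close>

lemma zero_set_line:
  assumes w: "w \<in> WW" "v \<in> WW"
  shows "countable {t::real. f (gr (w + t *\<^sub>R v) + sc \<i> h) - a = 0} \<or> (\<forall>t. f (gr (w + t *\<^sub>R v) + sc \<i> h) - a = 0)"
proof -
  define B where "B = \<Phi> (pE w) (pE v) + \<Phi> (pE v) (pE w)"
  define q where "q s = (gr w + sc \<i> h) + sc s (v + sc \<i> B) + sc (s\<^sup>2) (sc \<i> (\<Phi> (pE v) (pE v)))" for s
  have qr: "q (of_real t) = gr (w + t *\<^sub>R v) + sc \<i> h" for t
  proof -
    have "pE (w + t *\<^sub>R v) = pE w + t *\<^sub>R pE v" by (simp add: linear_add[OF linear_pE] linear_scale[OF linear_pE])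
    then have "\<Phi> (pE (w + t *\<^sub>R v)) (pE (w + t *\<^sub>R v)) = \<Phi> (pE w) (pE w) + t *\<^sub>R B + (t\<^sup>2) *\<^sub>R \<Phi> (pE v) (pE v)"
      unfolding B_def by (simp add: Phi_add) (simp add: jts_Phi_def tp_scaleR power2_eq_square algebra_simps)
    then have "gr (w + t *\<^sub>R v) = w + t *\<^sub>R v + (sc \<i> (\<Phi> (pE w) (pE w)) + t *\<^sub>R sc \<i> B + (t\<^sup>2) *\<^sub>R sc \<i> (\<Phi> (pE v) (pE v)))"
      unfolding gr_def psi_def by (simp only: scale_right_distrib sc_scaleR)
    moreover have "sc ((of_real t)\<^sup>2) x = (t\<^sup>2) *\<^sub>R x" for x using sc_of_real[of "t\<^sup>2" x] by simp
    ultimately show ?thesis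
      unfolding q_def sc_of_real by (simp only: gr_def[of w] psi_def[of w] scaleR_add_right add_ac)
  qed
  have gX: "gr x \<in> XX" if "x \<in> WW" for x using that YY_gr YY_XX by blast
  have line: "w + t *\<^sub>R v \<in> WW" for t
    by (intro real_vector.subspace_add real_vector.subspace_scale subspace_WW w)
  have qD: "q (of_real t) \<in> DD" for t
    unfolding qr using siegel_line[OF gX[OF line], of \<i>] by simp
  have wV: "x \<in> VV" if "x \<in> WW" for x
  proof -
    obtain \<zeta> y where "x = \<zeta> + y" "\<zeta> \<in> EE" "y \<in> FF" by (rule WW_cases[OF \<open>x \<in> WW\<close>]) blast
    then show ?thesis using VV_add VV_E VV_F by blast
  qed
  have qV: "q s \<in> VV" for s
    unfolding q_def
    using gX[OF w(1)] wV[OF w(2)] VV_F[OF Phi_sym_F[OF pE_WW[OF w(1)] pE_WW[OF w(2)]]] VV_F[OF Phi_F[OF pE_WW[OF w(2)]]]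
    by (intro VV_add VV_sc h_VV) (auto simp: silov_iff B_def)
  have contq: "continuous_on UNIV (\<lambda>s. kappa (q s))"
    unfolding q_def by (intro continuous_intros)
  have "openin (top_of_set UNIV) (UNIV \<inter> (\<lambda>s. kappa (q s)) -` \<Omega>)"
    by (rule continuous_openin_preimage[OF contq _ openin_cone]) (use kappa_F[OF qV] in auto)
  then have oS: "open {s. kappa (q s) \<in> \<Omega>}" by (simp add: vimage_def)
  define S where "S = {s. q s \<in> DD}"
  have S: "open S" using oS qV by (simp add: S_def siegel_iff)
  define S2 where "S2 = S \<inter> cnj -` S"
  have oS2: "open S2"
    unfolding S2_def using S by (intro open_Int open_vimage continuous_intros) auto
  \<comment> \<open>The argument on zeros needs a connected domain. \<open>S2\<close> is invariant
    under conjugation, so that both \<open>q s\<close> and \<open>q (cnj s)\<close> lie in the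
    domain there, and its component of 0 contains the whole real axis.\<close>
  define T where "T = connected_component_set S2 0"
  have T: "open T" "connected T" unfolding T_def by (auto intro: open_connected_component oS2)
  have R_S2: "range complex_of_real \<subseteq> S2"
  proof
    fix s assume "s \<in> range complex_of_real"
    then obtain t where t: "s = of_real t" by blast
    have "s \<in> S" unfolding S_def t using qD by simp
    moreover have "cnj s = s" by (simp add: t)
    ultimately show "s \<in> S2" unfolding S2_def by simp
  qed
  have "connected (range complex_of_real)"
    by (intro connected_continuous_image continuous_intros) simp
  moreover have "0 \<in> range complex_of_real" by (rule range_eqI[of _ _ 0]) simp
  ultimately have RT: "range complex_of_real \<subseteq> T"
    unfolding T_def using R_S2 by (intro connected_component_maximal)
  have TS2: "T \<subseteq> S2" unfolding T_def by (rule connected_component_subset)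
  \<comment> \<open>On the real axis f is half the sum of G and its conjugate. Conjugating the
    argument as well makes the second term holomorphic, so that \<open>K\<close> extends 2 (f -
    a).\<close>
  define K where "K s = G (q s) + cnj (G (q (cnj s))) - 2 * of_real a" for s
  have "(\<lambda>s. G (q s)) holomorphic_on S"
    unfolding q_def by (rule holomorphic_quadratic) (simp add: S_def q_def)
  then have h1: "(\<lambda>s. G (q s)) holomorphic_on T" using TS2 by (auto simp: S2_def intro: holomorphic_on_subset)
  have "cnj ` T \<subseteq> S" using TS2 by (auto simp: S2_def)
  then have "(\<lambda>s. G (q s)) holomorphic_on cnj ` T"
    using \<open>(\<lambda>s. G (q s)) holomorphic_on S\<close> by (rule holomorphic_on_subset[rotated])
  from holomorphic_on_compose_cnj_cnj[OF this T(1)]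
  have h2: "(\<lambda>s. cnj (G (q (cnj s)))) holomorphic_on T" by (simp add: o_def)
  have hK: "K holomorphic_on T" unfolding K_def by (intro holomorphic_intros h1 h2)
  have KR: "K (of_real t) = of_real (2 * (f (gr (w + t *\<^sub>R v) + sc \<i> h) - a))" for t
    unfolding K_def using f_eq[OF qD[of t]] by (simp add: qr complex_eq_iff)
  show ?thesis
  proof (cases "K constant_on T")
    case True
    then obtain k where k: "\<And>s. s \<in> T \<Longrightarrow> K s = k" by (auto simp: constant_on_def)
    have "K (of_real t) = K 0" for t using k RT by (metis of_real_0 rangeI subsetD)
    then have "f (gr (w + t *\<^sub>R v) + sc \<i> h) - a = f (gr (w + 0 *\<^sub>R v) + sc \<i> h) - a" for t
      using KR[of t] KR[of 0] by (simp only: of_real_0) (simp only: of_real_eq_iff mult_cancel_left, simp)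
    then have "(\<forall>t. f (gr (w + t *\<^sub>R v) + sc \<i> h) - a = 0) \<or> {t. f (gr (w + t *\<^sub>R v) + sc \<i> h) - a = 0} = {}"
      by (cases "f (gr (w + 0 *\<^sub>R v) + sc \<i> h) - a = 0") auto
    then show ?thesis by (metis countable_empty)
  next
    case False
    have fsigT: "fsigma T"
    proof (rule open_Union_compact_subsets[OF T(1)])
      fix Q :: "nat \<Rightarrow> complex set" assume "\<And>n. compact (Q n)" and Q: "\<Union> (range Q) = T"
      then show "fsigma T" using fsigma.intros[of Q] compact_imp_closed by metis
    qed
    have "countable {z \<in> T. K z = 0}"
      by (rule holomorphic_countable_zeros[OF hK T fsigT False])
    moreover have "complex_of_real ` {t. f (gr (w + t *\<^sub>R v) + sc \<i> h) - a = 0} \<subseteq> {z \<in> T. K z = 0}"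
      using RT KR by auto
    ultimately have "countable (complex_of_real ` {t. f (gr (w + t *\<^sub>R v) + sc \<i> h) - a = 0})"
      by (rule countable_subset[rotated])
    then show ?thesis using countable_image_inj_on[OF _ inj_on_subset[OF inj_of_real subset_UNIV]] by blast
  qed
qed

text \<open>The lines of \<open>WW\<close> give a null set in the parameter space, and the graph map
  carries null sets to null sets.\<close>

lemma zero_set_null:
  assumes "p0 \<in> YY" "f (p0 + sc \<i> h) \<noteq> a"
  shows "emeasure \<nu> {p \<in> YY. f (p + sc \<i> h) = a} = 0" "{p \<in> YY. f (p + sc \<i> h) = a} \<in> sets \<nu>"
proof -
  obtain B where B: "orthonormal_frame B" "Real_Vector_Spaces.span B = WW" "card B = jj" by (rule subspace_frame[OF subspace_WW])
  interpret B: orthonormal_frame B by fact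
  define F where "F w = f (gr w + sc \<i> h) - a" for w
  have gD: "gr w + sc \<i> h \<in> DD" if "w \<in> WW" for w
  proof -
    have "gr w \<in> YY" using that unfolding YY_gr by blast
    from YY_DD[OF this, of \<i>] show ?thesis by simp
  qed
  have cont: "continuous_on WW F"
    unfolding F_def
    by (intro continuous_intros continuous_on_compose2[OF continuous_f] continuous_on_subset[OF continuous_gr]) (use gD in auto)
  obtain w0 where w0: "w0 \<in> WW" "p0 = gr w0" using assms(1) unfolding YY_gr by blast
  have "hausdorff_outer (card B) {w \<in> Real_Vector_Spaces.span B. F w = 0} = 0"
  proof (rule B.hausdorff_zero_set[of F w0])
    show "continuous_on (Real_Vector_Spaces.span B) F" unfolding B(2) by (rule cont)
    show "countable {t. F (w + t *\<^sub>R v) = 0} \<or> (\<forall>t. F (w + t *\<^sub>R v) = 0)"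
      if "w \<in> Real_Vector_Spaces.span B" "v \<in> Real_Vector_Spaces.span B" for w v
      unfolding F_def by (rule zero_set_line) (use that B(2) in auto)
  qed (use w0 assms(2) B(2) in \<open>auto simp: F_def\<close>)
  then have "hausdorff_outer jj {w \<in> WW. F w = 0} = 0" unfolding B(2,3) .
  then have "hausdorff_outer jj (gr ` {w \<in> WW. F w = 0}) = 0" by (intro hausdorff_graph_null) auto
  moreover have eq: "gr ` {w \<in> WW. F w = 0} = {p \<in> YY. f (p + sc \<i> h) = a}"
    unfolding YY_gr F_def by auto
  have "closed {w \<in> WW. F w = 0}" by (rule continuous_closed_preimage_constant[OF cont WW_closed])
  then have "gr ` {w \<in> WW. F w = 0} \<in> sets borel" by (intro gr_borel) auto
  then have b: "{p \<in> YY. f (p + sc \<i> h) = a} \<in> sets borel" unfolding eq .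
  ultimately show "emeasure \<nu> {p \<in> YY. f (p + sc \<i> h) = a} = 0"
    unfolding eq by (subst emeasure_nu) auto
  show "{p \<in> YY. f (p + sc \<i> h) = a} \<in> sets \<nu>" using b by (auto simp: sets_nu_iff)
qed

end

section \<open>The Poisson formula on complex lines\<close>

context jts_pluriharmonic
begin

lemma YY_nonempty: "YY \<noteq> {}"
  unfolding YY_gr using real_vector.subspace_0[OF subspace_WW] by blast

text \<open>The Herglotz representations are chosen separately for each p. Each slope is recovered
  as the limit of u(p, i y) / y, and \<open>u_slope_le\<close> in both directions makes all of them
  equal.\<close>

lemma ex_poisson_family: "\<exists>a \<tau>. poisson_family YY a \<tau> u"
proof -
  have "\<forall>p\<in>YY. \<exists>x. 0 \<le> fst x \<and> finite_measure (snd x) \<and> sets (snd x) = sets (borel :: real measure) \<and>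
      (\<forall>w. 0 < Im w \<longrightarrow> u p w = fst x * Im w + (\<integral>s. (1 + s\<^sup>2) * poisson_half w s \<partial>snd x))"
  proof
    fix p assume "p \<in> YY"
    from u_herglotz[OF this] obtain a \<tau> where "0 \<le> a \<and> finite_measure \<tau> \<and> sets \<tau> = sets (borel :: real measure) \<and>
      (\<forall>w. 0 < Im w \<longrightarrow> u p w = a * Im w + (\<integral>s. (1 + s\<^sup>2) * poisson_half w s \<partial>\<tau>))" by blast
    then show "\<exists>x. 0 \<le> fst x \<and> finite_measure (snd x) \<and> sets (snd x) = sets (borel :: real measure) \<and>
      (\<forall>w. 0 < Im w \<longrightarrow> u p w = fst x * Im w + (\<integral>s. (1 + s\<^sup>2) * poisson_half w s \<partial>snd x))"
      by (intro exI[of _ "(a, \<tau>)"]) simp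
  qed
  from bchoice[OF this] obtain X where X: "\<And>p. p \<in> YY \<Longrightarrow> 0 \<le> fst (X p)" "\<And>p. p \<in> YY \<Longrightarrow> finite_measure (snd (X p))"
      "\<And>p. p \<in> YY \<Longrightarrow> sets (snd (X p)) = sets (borel :: real measure)"
      "\<And>p w. p \<in> YY \<Longrightarrow> 0 < Im w \<Longrightarrow> u p w = fst (X p) * Im w + (\<integral>s. (1 + s\<^sup>2) * poisson_half w s \<partial>snd (X p))"
    by blast
  obtain p0 where p0: "p0 \<in> YY" using YY_nonempty by blast
  have slope: "((\<lambda>y. u p (\<i> * of_real y) / y) \<longlongrightarrow> fst (X p)) at_top" if "p \<in> YY" for p
    by (rule herglotz_half_slope[OF X(2-4)[OF that]]) simp_all
  have a: "fst (X p) = fst (X p0)" if "p \<in> YY" for p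
    using u_slope_le[OF that p0 slope[OF that] slope[OF p0]] u_slope_le[OF p0 that slope[OF p0] slope[OF that]] by simp
  have "poisson_family YY (fst (X p0)) (\<lambda>p. snd (X p)) u"
  proof (rule poisson_family.intro)
    show "0 \<le> fst (X p0)" by (rule X(1)[OF p0])
    show "finite_measure (snd (X p))" "sets (snd (X p)) = sets borel" if "p \<in> YY" for p using X(2,3)[OF that] .
    show "u p w = fst (X p0) * Im w + (\<integral>s. (1 + s\<^sup>2) * poisson_half w s \<partial>snd (X p))" if "p \<in> YY" "0 < Im w" for p w
      using X(4)[OF that] a[OF that(1)] by simp
    have "continuous_on (YY \<times> {w. 0 < Im w}) (\<lambda>z. fst z + sc (snd z) h)"
      by (intro continuous_on_add continuous_on_fst continuous_on_id
          bounded_linear.continuous_on[OF bounded_bilinear.bounded_linear_left[OF bounded_bilinear_sc]] continuous_on_snd)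
    moreover have "(\<lambda>z. fst z + sc (snd z) h) ` (YY \<times> {w. 0 < Im w}) \<subseteq> DD" using YY_DD by auto
    ultimately have "continuous_on (YY \<times> {w. 0 < Im w}) (\<lambda>z. f (fst z + sc (snd z) h))"
      by (rule continuous_on_compose2[OF continuous_f])
    then show "continuous_on (YY \<times> {w. 0 < Im w}) (\<lambda>(p, w). u p w)"
      by (simp add: u_def split_beta')
  qed
  then show ?thesis by blast
qed

end

section \<open>Construction of the limit measure and its fibres\<close>

locale jts_poisson = jts_pluriharmonic sc tp e h G f
  for sc :: "complex \<Rightarrow> 'z::euclidean_space \<Rightarrow> 'z" and tp :: "'z \<Rightarrow> 'z \<Rightarrow> 'z \<Rightarrow> 'z" and e h :: 'z
    and G :: "'z \<Rightarrow> complex" and f :: "'z \<Rightarrow> real" +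
  fixes a :: real and \<tau> :: "'z \<Rightarrow> real measure"
  assumes family: "poisson_family YY a \<tau> u"
begin

sublocale fam: poisson_family YY a \<tau> u by (rule family)

abbreviation "BX \<equiv> restrict_space borel XX"

lemma line_borel [measurable]: "p \<in> YY \<Longrightarrow> (\<lambda>t. p + t *\<^sub>R h) \<in> borel \<rightarrow>\<^sub>M BX"
  by (rule measurable_restrict_space2) (use YY_line_XX in auto)

text \<open>The factor pi is the integral of the Poisson kernel, 1 + s^2 the weight kept out of
  \<tau>, and |h| the density of arc length along the line, which appears since the disintegration
  is relative to the Hausdorff measure of the projection.\<close>

definition M' :: "'z \<Rightarrow> real measure" where
  "M' p = density (\<tau> p) (\<lambda>s. ennreal (norm h * (pi * (1 + s\<^sup>2))))"

definition M :: "'z \<Rightarrow> 'z measure" where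
  "M p = distr (M' p) BX (\<lambda>t. p + t *\<^sub>R h)"

lemma weight_nonneg: "0 \<le> norm h * (pi * (1 + s\<^sup>2))" for s :: real
  by (intro mult_nonneg_nonneg) (auto intro: add_nonneg_nonneg)

lemma sets_M' [simp]: "p \<in> YY \<Longrightarrow> sets (M' p) = sets borel"
  by (simp add: M'_def fam.sets_tau)

lemma sets_M [simp]: "sets (M p) = sets BX" by (simp add: M_def)
lemma space_M [simp]: "space (M p) = XX" using sets_eq_imp_space_eq[OF sets_M] by (simp add: space_restrict_space)

lemma line_M' [measurable]: "p \<in> YY \<Longrightarrow> (\<lambda>t. p + t *\<^sub>R h) \<in> M' p \<rightarrow>\<^sub>M BX"
  using line_borel by (simp cong: measurable_cong_sets)

lemma nn_integral_M:
  assumes p: "p \<in> YY" and F: "F \<in> borel_measurable BX"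
  shows "(\<integral>\<^sup>+x. F x \<partial>M p) = (\<integral>\<^sup>+s. ennreal (norm h * (pi * (1 + s\<^sup>2))) * F (p + s *\<^sub>R h) \<partial>\<tau> p)"
proof -
  have [measurable_cong]: "sets (\<tau> p) = sets borel" by (rule fam.sets_tau[OF p])
  note [measurable] = F line_borel[OF p]
  have "(\<integral>\<^sup>+x. F x \<partial>M p) = (\<integral>\<^sup>+s. F (p + s *\<^sub>R h) \<partial>M' p)"
    unfolding M_def by (rule nn_integral_distr[OF line_M'[OF p]]) simp
  also have "\<dots> = (\<integral>\<^sup>+s. ennreal (norm h * (pi * (1 + s\<^sup>2))) * F (p + s *\<^sub>R h) \<partial>\<tau> p)"
    unfolding M'_def by (rule nn_integral_density) measurable
  finally show ?thesis .
qed

lemma integral_M':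
  fixes g :: "real \<Rightarrow> 'c::{banach, second_countable_topology}"
  assumes p: "p \<in> YY" and g: "g \<in> borel_measurable borel"
  shows "(\<integral>s. g s \<partial>M' p) = (\<integral>s. (norm h * (pi * (1 + s\<^sup>2))) *\<^sub>R g s \<partial>\<tau> p)"
    and "integrable (M' p) g \<longleftrightarrow> integrable (\<tau> p) (\<lambda>s. (norm h * (pi * (1 + s\<^sup>2))) *\<^sub>R g s)"
proof -
  have [measurable_cong]: "sets (\<tau> p) = sets borel" by (rule fam.sets_tau[OF p])
  note [measurable] = g
  show "(\<integral>s. g s \<partial>M' p) = (\<integral>s. (norm h * (pi * (1 + s\<^sup>2))) *\<^sub>R g s \<partial>\<tau> p)"
    unfolding M'_def by (rule integral_density) (use weight_nonneg in auto)
  show "integrable (M' p) g \<longleftrightarrow> integrable (\<tau> p) (\<lambda>s. (norm h * (pi * (1 + s\<^sup>2))) *\<^sub>R g s)"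
    unfolding M'_def by (rule integrable_density) (use weight_nonneg in auto)
qed

lemma integral_M:
  fixes g :: "'z \<Rightarrow> 'c::{banach, second_countable_topology}"
  assumes p: "p \<in> YY" and g: "g \<in> borel_measurable BX"
  shows "(\<integral>x. g x \<partial>M p) = (\<integral>s. (norm h * (pi * (1 + s\<^sup>2))) *\<^sub>R g (p + s *\<^sub>R h) \<partial>\<tau> p)"
proof -
  have "(\<integral>x. g x \<partial>M p) = (\<integral>s. g (p + s *\<^sub>R h) \<partial>M' p)"
    unfolding M_def by (rule integral_distr[OF line_M'[OF p] g])
  also have "\<dots> = (\<integral>s. (norm h * (pi * (1 + s\<^sup>2))) *\<^sub>R g (p + s *\<^sub>R h) \<partial>\<tau> p)"
    by (rule integral_M'(1)[OF p measurable_compose[OF line_borel[OF p] g]])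
  finally show ?thesis .
qed

text \<open>The distance from p + w h to p + s h is |w - s| |h|, which brings a factor |h|^-2 into
  the kernel. The density of \<open>M'\<close> brings |h| pi (1 + s^2), so the constant |h| / pi
  restores the Herglotz formula.\<close>

theorem poisson_formula:
  assumes p: "p \<in> YY" and w: "0 < Im w"
  shows "f (p + sc w h) = norm h / pi * (\<integral>x. Im w / (norm (p + sc w h - x))\<^sup>2 \<partial>M p) + a * Im w"
proof -
  have [measurable]: "(\<lambda>x. Im w / (norm (p + sc w h - x))\<^sup>2) \<in> borel_measurable BX"
    by (rule measurable_restrict_space1) measurable
  have ph: "norm h * norm h * (Im w / (norm (p + sc w h - (p + s *\<^sub>R h)))\<^sup>2) = poisson_half w s" for s
  proof -
    have "p + sc w h - (p + s *\<^sub>R h) = sc (w - of_real s) h" by (simp add: scale_left_diff_distrib sc_of_real)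
    then have "(norm (p + sc w h - (p + s *\<^sub>R h)))\<^sup>2 = (norm (w - of_real s))\<^sup>2 * (norm h)\<^sup>2"
      by (simp only: norm_sc power_mult_distrib)
    then show ?thesis using h_nonzero by (simp add: poisson_half_def power2_eq_square)
  qed
  then have k: "norm h / pi * ((norm h * (pi * (1 + s\<^sup>2))) *\<^sub>R (Im w / (norm (p + sc w h - (p + s *\<^sub>R h)))\<^sup>2))
      = (1 + s\<^sup>2) * poisson_half w s" for s
    unfolding ph[symmetric] by simp
  have "norm h / pi * (\<integral>x. Im w / (norm (p + sc w h - x))\<^sup>2 \<partial>M p) = (\<integral>s. (1 + s\<^sup>2) * poisson_half w s \<partial>\<tau> p)"
    by (subst integral_M[OF p], measurable) (simp only: integral_mult_right_zero[symmetric] k)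
  then show ?thesis using fam.rep[OF p w] by (simp add: u_def)
qed

text \<open>An intermediate measure: the fibre measures \<open>M p\<close> may have infinite mass,
  so the normalised kernels are bound together first, and the density \<open>weight\<close> then
  restores the fibres.\<close>

definition S :: "'z measure" where
  "S = \<nu> \<bind> (\<lambda>p. distr (fam.kernel p) BX (\<lambda>t. p + t *\<^sub>R h))"

text \<open>On the line through p this is the density of \<open>M' p\<close> with respect to
  \<open>\<tau> p\<close>, times the factor by which \<open>kernel\<close> was scaled down. The
  projector and \<open>height\<close> let it be written as a function of the boundary point
  alone.\<close>

definition weight :: "'z \<Rightarrow> real" where
  "weight x = norm h * (pi * (1 + (height x)\<^sup>2)) * (1 + measure (\<tau> (orth_projector h x)) UNIV)"

definition \<mu> :: "'z measure" where
  "\<mu> = density S (\<lambda>x. ennreal (weight x))"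

lemma kernel_BX: "(\<lambda>p. distr (fam.kernel p) BX (\<lambda>t. p + t *\<^sub>R h)) \<in> \<nu> \<rightarrow>\<^sub>M subprob_algebra BX"
proof (rule measurable_distr2)
  show "(\<lambda>(p, t). p + t *\<^sub>R h) \<in> \<nu> \<Otimes>\<^sub>M borel \<rightarrow>\<^sub>M BX" by (rule line_measurable)
  show "fam.kernel \<in> \<nu> \<rightarrow>\<^sub>M subprob_algebra borel"
    using fam.measurable_kernel measurable_cong_sets[OF sets_nu refl] by blast
qed

lemma sets_S: "sets S = sets BX"
  unfolding S_def by (rule sets_bind_measurable[OF kernel_BX]) (use YY_nonempty in simp)

lemma sets_mu [measurable_cong, simp]: "sets \<mu> = sets BX" unfolding \<mu>_def using sets_S by simp
lemma space_mu [simp]: "space \<mu> = XX" using sets_eq_imp_space_eq[OF sets_mu] by (simp add: space_restrict_space)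

lemma weight_measurable [measurable]: "weight \<in> borel_measurable BX"
proof -
  have "continuous_on YY (\<lambda>p. u p \<i> - a)" by (intro continuous_intros fam.cont_U_line) simp
  then have "continuous_on YY (\<lambda>p. measure (\<tau> p) UNIV)"
    by (rule continuous_on_cong[THEN iffD1, rotated 2]) (auto simp: fam.mass)
  then have "(\<lambda>p. measure (\<tau> p) UNIV) \<in> borel_measurable (restrict_space borel YY)"
    by (rule borel_measurable_continuous_on_restrict)
  note [measurable] = measurable_compose[OF measurable_orth_projector this]
  have [measurable]: "height \<in> borel_measurable BX" by (rule measurable_restrict_space1) simp
  show ?thesis unfolding weight_def[abs_def] by measurable
qed

lemma nn_integral_line_kernel:
  assumes p: "p \<in> YY" and F: "F \<in> borel_measurable BX"
  shows "(\<integral>\<^sup>+x. ennreal (weight x) * F x \<partial>distr (fam.kernel p) BX (\<lambda>t. p + t *\<^sub>R h)) = (\<integral>\<^sup>+x. F x \<partial>M p)"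
proof -
  have [measurable_cong]: "sets (\<tau> p) = sets borel" by (rule fam.sets_tau[OF p])
  note [measurable] = F line_borel[OF p]
  let ?m = "measure (\<tau> p) UNIV"
  have "(\<lambda>t. p + t *\<^sub>R h) \<in> fam.kernel p \<rightarrow>\<^sub>M BX"
    using line_borel[OF p] by (simp add: fam.kernel_def cong: measurable_cong_sets)
  then have "(\<integral>\<^sup>+x. ennreal (weight x) * F x \<partial>distr (fam.kernel p) BX (\<lambda>t. p + t *\<^sub>R h))
      = (\<integral>\<^sup>+t. ennreal (weight (p + t *\<^sub>R h)) * F (p + t *\<^sub>R h) \<partial>fam.kernel p)"
    by (rule nn_integral_distr) simp
  also have "\<dots> = (\<integral>\<^sup>+t. ennreal (1 / (1 + ?m)) * (ennreal (weight (p + t *\<^sub>R h)) * F (p + t *\<^sub>R h)) \<partial>\<tau> p)"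
    unfolding fam.kernel_def by (rule nn_integral_density) measurable
  also have "\<dots> = (\<integral>\<^sup>+s. ennreal (norm h * (pi * (1 + s\<^sup>2))) * F (p + s *\<^sub>R h) \<partial>\<tau> p)"
  proof (rule nn_integral_cong)
    fix t
    have "0 < 1 + ?m" by (simp add: add_pos_nonneg)
    then have "1 / (1 + ?m) * weight (p + t *\<^sub>R h) = norm h * (pi * (1 + t\<^sup>2))"
      by (simp add: weight_def height_line[OF p] orth_projector_line[OF p])
    then have "ennreal (1 / (1 + ?m)) * ennreal (weight (p + t *\<^sub>R h)) = ennreal (norm h * (pi * (1 + t\<^sup>2)))"
      using \<open>0 < 1 + ?m\<close> by (simp add: ennreal_mult'[symmetric])
    then show "ennreal (1 / (1 + ?m)) * (ennreal (weight (p + t *\<^sub>R h)) * F (p + t *\<^sub>R h)) = ennreal (norm h * (pi * (1 + t\<^sup>2))) * F (p + t *\<^sub>R h)"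
      by (simp add: mult.assoc[symmetric])
  qed
  also have "\<dots> = (\<integral>\<^sup>+x. F x \<partial>M p)" by (rule nn_integral_M[OF p F, symmetric])
  finally show ?thesis .
qed

sublocale dis: measure_disintegration \<mu> \<nu> M
proof
  show "sets (M y) = sets \<mu>" for y by simp
  fix F :: "'z \<Rightarrow> ennreal" assume "F \<in> borel_measurable \<mu>"
  then have F: "F \<in> borel_measurable BX" by (simp cong: measurable_cong_sets)
  have WF: "(\<lambda>x. ennreal (weight x) * F x) \<in> borel_measurable BX" using F by measurable
  have "(\<lambda>p. \<integral>\<^sup>+x. ennreal (weight x) * F x \<partial>distr (fam.kernel p) BX (\<lambda>t. p + t *\<^sub>R h)) \<in> borel_measurable \<nu>"
    by (rule measurable_compose[OF kernel_BX nn_integral_measurable_subprob_algebra[OF WF]])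
  then show "(\<lambda>p. \<integral>\<^sup>+x. F x \<partial>M p) \<in> borel_measurable \<nu>"
    by (rule measurable_cong[THEN iffD1, rotated]) (simp add: nn_integral_line_kernel[OF _ F])
  have mS: "borel_measurable S = borel_measurable BX" by (rule measurable_cong_sets[OF sets_S refl])
  have "(\<integral>\<^sup>+x. F x \<partial>\<mu>) = (\<integral>\<^sup>+x. ennreal (weight x) * F x \<partial>S)"
    unfolding \<mu>_def by (rule nn_integral_density) (use F in \<open>simp_all add: mS\<close>)
  also have "\<dots> = (\<integral>\<^sup>+p. \<integral>\<^sup>+x. ennreal (weight x) * F x \<partial>distr (fam.kernel p) BX (\<lambda>t. p + t *\<^sub>R h) \<partial>\<nu>)"
    unfolding S_def by (rule nn_integral_bind[OF WF kernel_BX])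
  also have "\<dots> = (\<integral>\<^sup>+p. \<integral>\<^sup>+x. F x \<partial>M p \<partial>\<nu>)"
    by (rule nn_integral_cong) (simp add: nn_integral_line_kernel[OF _ F])
  finally show "(\<integral>\<^sup>+x. F x \<partial>\<mu>) = (\<integral>\<^sup>+p. \<integral>\<^sup>+x. F x \<partial>M p \<partial>\<nu>)" .
qed

lemma emeasure_mu:
  assumes "A \<in> sets BX"
  shows "emeasure \<mu> A = (\<integral>\<^sup>+p. emeasure (M p) A \<partial>\<nu>)"
  using dis.nn_integral_eq[of "indicator A"] assms by simp

lemma emeasure_M:
  assumes p: "p \<in> YY" and A: "A \<in> sets BX"
  shows "emeasure (M p) A = (\<integral>\<^sup>+s. ennreal (norm h * (pi * (1 + s\<^sup>2))) * indicator A (p + s *\<^sub>R h) \<partial>\<tau> p)"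
  using nn_integral_M[OF p, of "indicator A"] A by simp

lemma emeasure_tau_le: "p \<in> YY \<Longrightarrow> emeasure (\<tau> p) UNIV \<le> ennreal (u p \<i>)"
  using fam.U_i_ge(3) by (simp add: finite_measure.emeasure_eq_measure[OF fam.fin] ennreal_leI)

lemma emeasure_M_le:
  assumes p: "p \<in> YY" and A: "A \<in> sets BX" and R: "\<And>x. x \<in> A \<Longrightarrow> \<bar>height x\<bar> \<le> R"
  shows "emeasure (M p) A \<le> ennreal (norm h * (pi * (1 + R\<^sup>2))) * ennreal (u p \<i>) * indicator (orth_projector h ` A) p"
proof -
  let ?c = "ennreal (norm h * (pi * (1 + R\<^sup>2)))"
  have "ennreal (norm h * (pi * (1 + s\<^sup>2))) * indicator A (p + s *\<^sub>R h) \<le> ?c * indicator (orth_projector h ` A) p" for s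
  proof (cases "p + s *\<^sub>R h \<in> A")
    case True
    have "\<bar>s\<bar> \<le> R" using R[OF True] by (simp add: height_line[OF p])
    then have "s\<^sup>2 \<le> R\<^sup>2" using abs_le_square_iff[of s R] by simp
    then have "norm h * (pi * (1 + s\<^sup>2)) \<le> norm h * (pi * (1 + R\<^sup>2))" by (intro mult_left_mono) auto
    moreover have "p \<in> orth_projector h ` A" using imageI[OF True, of "orth_projector h"] by (simp only: orth_projector_line[OF p])
    ultimately show ?thesis using True by (simp add: ennreal_leI)
  qed simp
  then have "emeasure (M p) A \<le> (\<integral>\<^sup>+s. ?c * indicator (orth_projector h ` A) p \<partial>\<tau> p)"
    unfolding emeasure_M[OF p A] by (rule nn_integral_mono)
  also have "\<dots> = ?c * indicator (orth_projector h ` A) p * emeasure (\<tau> p) UNIV"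
    by (simp add: fam.space_tau[OF p])
  also have "\<dots> \<le> ?c * indicator (orth_projector h ` A) p * ennreal (u p \<i>)"
    by (rule mult_left_mono[OF emeasure_tau_le[OF p]]) simp
  finally show ?thesis by (simp add: mult_ac)
qed

lemma height_bound:
  assumes "compact K"
  obtains R where "0 \<le> R" "\<And>x. x \<in> K \<Longrightarrow> \<bar>height x\<bar> \<le> R"
proof -
  have "compact (height ` K)" by (intro compact_continuous_image continuous_intros assms)
  then obtain R where "0 < R" "\<forall>t\<in>height ` K. norm t \<le> R" using compact_imp_bounded bounded_pos by metis
  then show ?thesis using that[of R] by auto
qed

lemma u_bound:
  assumes "compact P" "P \<subseteq> YY"
  obtains B where "0 \<le> B" "\<And>p. p \<in> P \<Longrightarrow> u p \<i> \<le> B"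
proof -
  have "continuous_on P (\<lambda>p. u p \<i>)" by (rule continuous_on_subset[OF fam.cont_U_line assms(2)]) simp
  then have "compact ((\<lambda>p. u p \<i>) ` P)" using assms(1) by (rule compact_continuous_image)
  then obtain B where "0 < B" "\<forall>t\<in>(\<lambda>p. u p \<i>) ` P. norm t \<le> B" using compact_imp_bounded bounded_pos by metis
  then have "0 \<le> B" "\<And>p. p \<in> P \<Longrightarrow> u p \<i> \<le> B" by (auto simp: abs_le_iff)
  then show ?thesis by (rule that)
qed

lemma compact_BX: "compact K \<Longrightarrow> K \<subseteq> XX \<Longrightarrow> K \<in> sets BX"
  by (auto simp: sets_restrict_space_iff borel_compact)

lemma compact_projection: "compact K \<Longrightarrow> compact (orth_projector h ` K)"
  by (intro compact_continuous_image continuous_intros)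

lemma radon_M: "p \<in> YY \<Longrightarrow> radon_measure_on XX (M p)"
  unfolding radon_measure_on_def
proof (intro conjI allI impI)
  fix K assume p: "p \<in> YY" and K: "compact K \<and> K \<subseteq> XX"
  obtain R where R: "0 \<le> R" "\<And>x. x \<in> K \<Longrightarrow> \<bar>height x\<bar> \<le> R" by (rule height_bound[OF conjunct1[OF K]]) blast
  have "K \<in> sets BX" using K compact_BX by blast
  from emeasure_M_le[OF p this R(2)]
  have "emeasure (M p) K \<le> ennreal (norm h * (pi * (1 + R\<^sup>2))) * ennreal (u p \<i>) * 1"
    by (rule order_trans) (auto intro!: mult_left_mono simp: indicator_def)
  also have "\<dots> < \<infinity>" by (simp add: ennreal_mult_less_top)
  finally show "emeasure (M p) K < \<infinity>" .
qed simp

lemma radon_mu: "radon_measure_on XX \<mu>"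
  unfolding radon_measure_on_def
proof (intro conjI allI impI)
  fix K assume K: "compact K \<and> K \<subseteq> XX"
  then have KB: "K \<in> sets BX" using compact_BX by blast
  obtain R where R: "0 \<le> R" "\<And>x. x \<in> K \<Longrightarrow> \<bar>height x\<bar> \<le> R" by (rule height_bound[OF conjunct1[OF K]]) blast
  let ?P = "orth_projector h ` K" and ?c = "ennreal (norm h * (pi * (1 + R\<^sup>2)))"
  have P: "compact ?P" "?P \<subseteq> YY" using K compact_projection by auto
  obtain B where B: "0 \<le> B" "\<And>p. p \<in> ?P \<Longrightarrow> u p \<i> \<le> B" by (rule u_bound[OF P]) blast
  have Ps: "?P \<in> sets \<nu>" using P by (simp add: sets_nu_iff borel_compact)
  have "emeasure (M p) K \<le> ?c * ennreal B * indicator ?P p" if "p \<in> space \<nu>" for p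
  proof (rule order_trans[OF emeasure_M_le[OF _ KB R(2)]])
    show "p \<in> YY" using that by simp
    show "?c * ennreal (u p \<i>) * indicator ?P p \<le> ?c * ennreal B * indicator ?P p"
      using B(2)[of p] by (cases "p \<in> ?P") (auto intro!: mult_left_mono ennreal_leI)
  qed
  then have "emeasure \<mu> K \<le> (\<integral>\<^sup>+p. ?c * ennreal B * indicator ?P p \<partial>\<nu>)"
    unfolding emeasure_mu[OF KB] by (rule nn_integral_mono)
  also have "\<dots> = ?c * ennreal B * emeasure \<nu> ?P" by (rule nn_integral_cmult_indicator[OF Ps])
  also have "\<dots> < \<infinity>" using radon_nu[OF P] by (simp add: ennreal_mult_less_top)
  finally show "emeasure \<mu> K < \<infinity>" .
qed simp

lemma radon_nu': "radon_measure_on YY \<nu>"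
  unfolding radon_measure_on_def using radon_nu sets_nu by blast

lemma sets_restrict_UNIV: "sets (restrict_space borel UNIV) = sets borel"
  by (rule set_eqI) (simp add: sets_restrict_space_iff)

lemma M'_MP:
  assumes p: "p \<in> YY"
  shows "M' p \<in> MP"
proof -
  interpret finite_measure "\<tau> p" by (rule fam.fin[OF p])
  have [measurable_cong]: "sets (\<tau> p) = sets borel" by (rule fam.sets_tau[OF p])
  have "emeasure (M' p) K < \<infinity>" if K: "compact K" for K
  proof -
    obtain R where R: "\<And>s. s \<in> K \<Longrightarrow> \<bar>s\<bar> \<le> R"
      using compact_imp_bounded[OF K] unfolding bounded_iff by auto
    have Ks: "K \<in> sets (\<tau> p)" using K by (simp add: fam.sets_tau[OF p] borel_compact)
    have "emeasure (M' p) K = (\<integral>\<^sup>+s. ennreal (norm h * (pi * (1 + s\<^sup>2))) * indicator K s \<partial>\<tau> p)"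
      unfolding M'_def by (rule emeasure_density[OF _ Ks]) measurable
    also have "\<dots> \<le> (\<integral>\<^sup>+s. ennreal (norm h * (pi * (1 + R\<^sup>2))) \<partial>\<tau> p)"
    proof (rule nn_integral_mono)
      fix s
      have "norm h * (pi * (1 + s\<^sup>2)) \<le> norm h * (pi * (1 + R\<^sup>2))" if "s \<in> K"
        using abs_le_square_iff[of s R] R[OF that] by (intro mult_left_mono) auto
      then show "ennreal (norm h * (pi * (1 + s\<^sup>2))) * indicator K s \<le> ennreal (norm h * (pi * (1 + R\<^sup>2)))"
        by (cases "s \<in> K") (auto intro: ennreal_leI)
    qed
    also have "\<dots> < \<infinity>" by (simp add: emeasure_eq_measure ennreal_mult_less_top)
    finally show ?thesis .
  qed
  moreover have "integrable (M' p) (\<lambda>x. 1 / (1 + x\<^sup>2))"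
  proof -
    have "(norm h * (pi * (1 + s\<^sup>2))) *\<^sub>R (1 / (1 + s\<^sup>2)) = norm h * pi" for s :: real
      using add_pos_nonneg[of 1 "s\<^sup>2"] by simp
    then show ?thesis by (subst integral_M'(2)[OF p]) simp_all
  qed
  ultimately show ?thesis using p by (simp add: MP_def radon_measure_on_def sets_restrict_UNIV)
qed

text \<open>\<open>height\<close> inverts the parametrisation of the line, so the image measure on
  the boundary determines the measure on the real line. This is the uniqueness asserted in
  (4).\<close>

lemma distr_line_height:
  assumes p: "p \<in> YY" and N: "sets N = sets (borel :: real measure)"
  shows "distr (distr N BX (\<lambda>t. p + t *\<^sub>R h)) borel height = N"
proof -
  have l: "(\<lambda>t. p + t *\<^sub>R h) \<in> N \<rightarrow>\<^sub>M BX" using line_borel[OF p] by (simp add: N cong: measurable_cong_sets)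
  have "height \<in> BX \<rightarrow>\<^sub>M borel" by (rule measurable_restrict_space1) simp
  from distr_distr[OF this l]
  have "distr (distr N BX (\<lambda>t. p + t *\<^sub>R h)) borel height = distr N borel (\<lambda>t. t)"
    by (simp add: comp_def height_line[OF p])
  also have "\<dots> = N" using N by (intro distr_id2) simp
  finally show ?thesis .
qed

lemma M'_unique:
  assumes p: "p \<in> YY" and N: "N \<in> MP" "M p = distr N BX (\<lambda>t. p + t *\<^sub>R h)"
  shows "N = M' p"
proof -
  have "sets N = sets borel" using N(1) by (simp add: MP_def radon_measure_on_def sets_restrict_UNIV)
  from distr_line_height[OF p this] have "N = distr (M p) borel height" unfolding N(2) by (rule sym)
  also have "\<dots> = M' p" unfolding M_def by (rule distr_line_height[OF p sets_M'[OF p]])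
  finally show ?thesis .
qed

end

section \<open>Continuity of the fibres, pseudo-images and the vague limit\<close>

context jts_poisson
begin

text \<open>The growth 1 + s^2 of the density is compensated by the decay of the test function. What
  remains is a bounded continuous function integrated against \<open>\<tau> p\<close>.\<close>

lemma tightly_continuous_M': "tightly_continuous_on YY M'"
  unfolding tightly_continuous_on_def
proof (intro allI impI)
  fix g :: "real \<Rightarrow> complex"
  assume g: "continuous_on UNIV g \<and> bounded (range (\<lambda>x. of_real (1 + x\<^sup>2) * g x))"
  then obtain B where B: "\<And>x. norm (of_real (1 + x\<^sup>2) * g x) \<le> B" unfolding bounded_iff by blast
  have gm: "g \<in> borel_measurable borel" by (rule borel_measurable_continuous_onI[OF conjunct1[OF g]])
  have "continuous_on YY (\<lambda>p. \<integral>s. (norm h * (pi * (1 + s\<^sup>2))) *\<^sub>R g s \<partial>\<tau> p)"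
  proof (rule fam.continuous_integral_bounded)
    show "continuous_on UNIV (\<lambda>s. (norm h * (pi * (1 + s\<^sup>2))) *\<^sub>R g s)"
      by (intro continuous_on_scaleR continuous_on_mult continuous_on_const continuous_on_add continuous_on_power continuous_on_id conjunct1[OF g])
    show "norm ((norm h * (pi * (1 + s\<^sup>2))) *\<^sub>R g s) \<le> norm h * pi * B" for s
    proof -
      have "(norm h * (pi * (1 + s\<^sup>2))) *\<^sub>R g s = (norm h * pi) *\<^sub>R (of_real (1 + s\<^sup>2) * g s)"
        by (simp only: scaleR_conv_of_real of_real_mult mult.assoc)
      then have "norm ((norm h * (pi * (1 + s\<^sup>2))) *\<^sub>R g s) = norm h * pi * norm (of_real (1 + s\<^sup>2) * g s)"
        by (simp only: norm_scaleR abs_mult abs_norm_cancel abs_of_pos[OF pi_gt_zero])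
      also have "\<dots> \<le> norm h * pi * B" using B by (intro mult_left_mono) auto
      finally show ?thesis .
    qed
  qed
  then show "continuous_on YY (\<lambda>p. \<integral>s. g s \<partial>M' p)"
    by (rule continuous_on_cong[THEN iffD1, rotated 2]) (simp_all add: integral_M'(1)[OF _ gm])
qed

lemma Cc_support:
  assumes "g \<in> Cc XX"
  obtains K where "compact K" "K \<subseteq> XX" "\<forall>x\<in>XX - K. g x = 0" "continuous_on XX g"
proof -
  have cg: "continuous_on XX g" and ex: "\<exists>K. compact K \<and> K \<subseteq> XX \<and> (\<forall>x\<in>XX - K. g x = 0)"
    using assms by (simp_all only: Cc_def mem_Collect_eq)
  from ex obtain K where K: "compact K \<and> K \<subseteq> XX \<and> (\<forall>x\<in>XX - K. g x = 0)" by (rule exE)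
  show ?thesis by (rule that[of K]) (use K cg in simp_all)
qed

lemma Cc_bounds:
  assumes g: "g \<in> Cc XX"
  obtains R B P where "0 \<le> R" "0 \<le> B" "compact P" "P \<subseteq> YY"
    "\<forall>p t. p \<in> YY \<longrightarrow> R < \<bar>t\<bar> \<longrightarrow> g (p + t *\<^sub>R h) = 0" "\<forall>x. x \<in> XX \<longrightarrow> norm (g x) \<le> B"
    "\<forall>p t. p \<in> YY \<longrightarrow> p \<notin> P \<longrightarrow> g (p + t *\<^sub>R h) = 0"
proof -
  obtain K where K0: "compact K" "K \<subseteq> XX" "\<forall>x\<in>XX - K. g x = 0" and cg: "continuous_on XX g"
    by (rule Cc_support[OF g])
  then have K: "compact K" "K \<subseteq> XX" "\<And>x. x \<in> XX \<Longrightarrow> x \<notin> K \<Longrightarrow> g x = 0" by auto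
  obtain R where R: "0 \<le> R" "\<And>x. x \<in> K \<Longrightarrow> \<bar>height x\<bar> \<le> R" by (rule height_bound[OF K(1)]) blast
  have "compact (g ` K)" by (rule compact_continuous_image[OF continuous_on_subset[OF cg K(2)] K(1)])
  then obtain B where B: "0 < B" "\<forall>z\<in>g ` K. norm z \<le> B" using compact_imp_bounded bounded_pos by metis
  show ?thesis
  proof (rule that[OF R(1) less_imp_le[OF B(1)] compact_projection[OF K(1)]]; (intro allI impI)?)
    show "orth_projector h ` K \<subseteq> YY" using K(2) by blast
    show "g (p + t *\<^sub>R h) = 0" if p: "p \<in> YY" and t: "R < \<bar>t\<bar>" for p t
    proof (rule K(3)[OF YY_line_XX[OF p]])
      show "p + t *\<^sub>R h \<notin> K"
      proof
        assume "p + t *\<^sub>R h \<in> K"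
        from R(2)[OF this] t show False by (simp only: height_line[OF p] not_le[symmetric] not_True_eq_False simp_thms)
      qed
    qed
    show "norm (g x) \<le> B" if "x \<in> XX" for x
    proof (cases "x \<in> K")
      case True
      then show ?thesis using B(2) by blast
    next
      case False
      show ?thesis unfolding K(3)[OF that False] using B(1) by simp
    qed
    show "g (p + t *\<^sub>R h) = 0" if p: "p \<in> YY" and P: "p \<notin> orth_projector h ` K" for p t
    proof (rule K(3)[OF YY_line_XX[OF p]])
      show "p + t *\<^sub>R h \<notin> K"
      proof
        assume "p + t *\<^sub>R h \<in> K"
        from imageI[OF this, of "orth_projector h"] P show False by (simp only: orth_projector_line[OF p])
      qed
    qed
  qed
qed

lemma Cc_measurable: "g \<in> Cc XX \<Longrightarrow> g \<in> borel_measurable BX"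
  by (rule borel_measurable_continuous_on_restrict) (simp add: Cc_def)

lemma Cc_integrable:
  assumes g: "g \<in> Cc XX" and N: "radon_measure_on XX N" and w: "continuous_on XX w"
  shows "integrable N (\<lambda>x. w x *\<^sub>R g x)"
proof -
  obtain K where K0: "compact K" "K \<subseteq> XX" "\<forall>x\<in>XX - K. g x = 0" and cg: "continuous_on XX g"
    by (rule Cc_support[OF g])
  then have K: "compact K" "K \<subseteq> XX" "\<And>x. x \<in> XX \<Longrightarrow> x \<notin> K \<Longrightarrow> g x = 0" by auto
  have c: "continuous_on XX (\<lambda>x. w x *\<^sub>R g x)" by (intro continuous_intros w cg)
  have "compact ((\<lambda>x. w x *\<^sub>R g x) ` K)" by (rule compact_continuous_image[OF continuous_on_subset[OF c K(2)] K(1)])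
  then obtain B where B: "0 < B" "\<forall>z\<in>(\<lambda>x. w x *\<^sub>R g x) ` K. norm z \<le> B" using compact_imp_bounded bounded_pos by metis
  have sN: "sets N = sets BX" and fin: "emeasure N K < \<infinity>" using N K unfolding radon_measure_on_def by auto
  have spN: "space N = XX" using sets_eq_imp_space_eq[OF sN] by (simp add: space_restrict_space)
  show ?thesis
  proof (rule Bochner_Integration.integrable_bound)
    show "integrable N (\<lambda>x. indicator K x * B)"
      using compact_BX[OF K(1,2)] fin by (intro integrable_mult_left integrable_real_indicator) (auto simp: sN)
    show "(\<lambda>x. w x *\<^sub>R g x) \<in> borel_measurable N"
      using borel_measurable_continuous_on_restrict[OF c] by (simp add: measurable_cong_sets[OF sN refl])
    show "AE x in N. norm (w x *\<^sub>R g x) \<le> norm (indicator K x * B)"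
    proof (rule AE_I2)
      fix x assume "x \<in> space N"
      then show "norm (w x *\<^sub>R g x) \<le> norm (indicator K x * B)"
        using B K(3)[of x] by (cases "x \<in> K") (auto simp: spN)
    qed
  qed
qed

lemma integral_M_boundary_value:
  assumes g: "g \<in> Cc XX" and p: "p \<in> YY"
  shows "(\<integral>x. g x \<partial>M p) = fam.boundary_value (\<lambda>t. norm h *\<^sub>R g (p + t *\<^sub>R h)) p"
proof -
  have "(norm h * (pi * (1 + s\<^sup>2))) *\<^sub>R x = (pi * (1 + s\<^sup>2)) *\<^sub>R (norm h *\<^sub>R x)" for s and x :: complex
    unfolding scaleR_scaleR by (simp only: mult.commute)
  then show ?thesis unfolding integral_M[OF p Cc_measurable[OF g]] fam.boundary_value_def by (simp only:)
qed

lemma continuous_line_product: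
  fixes g :: "'z \<Rightarrow> complex"
  assumes "continuous_on XX g"
  shows "continuous_on (YY \<times> UNIV) (\<lambda>(p, t). norm h *\<^sub>R g (p + t *\<^sub>R h))"
  unfolding split_beta'
proof (rule continuous_on_scaleR[OF continuous_on_const], rule continuous_on_compose2[OF assms])
  show "continuous_on (YY \<times> UNIV) (\<lambda>z. fst z + snd z *\<^sub>R h)" by (intro continuous_intros)
qed (use YY_line_XX in auto)

lemma vaguely_continuous_M: "vaguely_continuous XX YY M"
  unfolding vaguely_continuous_def
proof
  fix g assume g: "g \<in> Cc XX"
  obtain R B P where R: "0 \<le> R" "0 \<le> B" "compact P" "P \<subseteq> YY"
    "\<forall>p t. p \<in> YY \<longrightarrow> R < \<bar>t\<bar> \<longrightarrow> g (p + t *\<^sub>R h) = 0" "\<forall>x. x \<in> XX \<longrightarrow> norm (g x) \<le> B"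
    "\<forall>p t. p \<in> YY \<longrightarrow> p \<notin> P \<longrightarrow> g (p + t *\<^sub>R h) = 0"
    by (rule Cc_bounds[OF g])
  note R = R[rule_format]
  have "continuous_on XX g" using g by (simp add: Cc_def)
  then have "continuous_on YY (\<lambda>p. fam.boundary_value (\<lambda>t. norm h *\<^sub>R g (p + t *\<^sub>R h)) p)"
    by (rule fam.continuous_boundary_value_param[OF continuous_line_product R(1)]) (simp add: R(5))
  then show "continuous_on YY (\<lambda>p. \<integral>x. g x \<partial>M p)"
    by (rule continuous_on_cong[THEN iffD1, rotated 2]) (simp_all add: integral_M_boundary_value[OF g])
qed

lemma integral_M_measurable:
  assumes "g \<in> Cc XX"
  shows "(\<lambda>p. \<integral>x. g x \<partial>M p) \<in> borel_measurable \<nu>"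
  unfolding measurable_cong_sets[OF sets_nu refl]
  by (rule borel_measurable_continuous_on_restrict) (rule vaguely_continuous_M[unfolded vaguely_continuous_def, rule_format, OF assms])

lemma projector_mu: "orth_projector h \<in> \<mu> \<rightarrow>\<^sub>M \<nu>"
  unfolding measurable_cong_sets[OF sets_mu sets_nu] by (rule measurable_orth_projector)

text \<open>The preimage of a set of base points is a union of whole lines, and \<mu> is obtained by
  integrating the measures of the single lines over the base points.\<close>

lemma weak_pseudo_image_mu: "weak_pseudo_image XX YY \<mu> \<nu> (orth_projector h)"
  unfolding weak_pseudo_image_def
proof (intro conjI allI impI radon_mu radon_nu' measurable_completion projector_mu)
  fix N assume "N \<subseteq> YY" "negligible_for \<nu> N"
  then obtain N' where N': "N' \<in> null_sets \<nu>" "N \<subseteq> N'"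
    unfolding negligible_for_def null_sets_completion_iff2 by blast
  let ?Z = "orth_projector h -` N' \<inter> XX"
  have Z: "?Z \<in> sets BX" using measurable_sets[OF projector_mu, of N'] N'(1) by (simp add: null_setsD2)
  have "AE p in \<nu>. emeasure (M p) ?Z = 0"
    using AE_not_in[OF N'(1)] AE_space
  proof eventually_elim
    case (elim p)
    then have p: "p \<in> YY" by simp
    show ?case unfolding emeasure_M[OF p Z] using elim(1) by (simp add: orth_projector_line[OF p])
  qed
  then have "(\<integral>\<^sup>+p. emeasure (M p) ?Z \<partial>\<nu>) = (\<integral>\<^sup>+p. 0 \<partial>\<nu>)" by (rule nn_integral_cong_AE)
  then have "emeasure \<mu> ?Z = 0" unfolding emeasure_mu[OF Z] by simp
  then have "?Z \<in> null_sets \<mu>" using Z by (simp add: null_sets_def)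
  then show "negligible_for \<mu> (orth_projector h -` N \<inter> XX)"
    unfolding negligible_for_def null_sets_completion_iff2 using N'(2) by (intro bexI[of _ ?Z]) auto
qed

text \<open>The density is everywhere positive, so the fibre measure vanishes exactly if \<tau> has
  mass 0, and this mass is f(p + i h) - a.\<close>

lemma M_zero_iff:
  assumes p: "p \<in> YY"
  shows "emeasure (M p) XX = 0 \<longleftrightarrow> f (p + sc \<i> h) = a"
proof -
  interpret finite_measure "\<tau> p" by (rule fam.fin[OF p])
  have [measurable_cong]: "sets (\<tau> p) = sets borel" by (rule fam.sets_tau[OF p])
  have X: "XX \<in> sets BX" by (simp add: sets_restrict_space_iff)
  have "0 < norm h * (pi * (1 + s\<^sup>2))" for s :: real
    using h_nonzero by (intro mult_pos_pos add_pos_nonneg) auto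
  then have pos: "ennreal (norm h * (pi * (1 + s\<^sup>2))) \<noteq> 0" for s :: real by (simp add: ennreal_eq_0_iff not_le)
  have "emeasure (M p) XX = (\<integral>\<^sup>+s. ennreal (norm h * (pi * (1 + s\<^sup>2))) \<partial>\<tau> p)"
    unfolding emeasure_M[OF p X] by (simp add: YY_line_XX[OF p])
  then have "emeasure (M p) XX = 0 \<longleftrightarrow> (AE s in \<tau> p. False)"
    using pos by (simp add: nn_integral_0_iff_AE)
  also have "\<dots> \<longleftrightarrow> emeasure (\<tau> p) (space (\<tau> p)) = 0"
    by (auto simp: AE_iff_null null_sets_def)
  also have "\<dots> \<longleftrightarrow> measure (\<tau> p) UNIV = 0" by (simp add: fam.space_tau[OF p] emeasure_eq_measure)
  finally show ?thesis by (auto simp: fam.mass[OF p] u_def)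
qed

text \<open>If \<open>Z\<close> is a null set containing all lines over \<open>N\<close>, then for p
  in \<open>N\<close> the set \<open>Z\<close> has full measure in the fibre, while for almost every
  p it has measure 0. So almost every p in \<open>N\<close> has fibre measure 0, and such p form a
  null set because the total measure is not 0.\<close>

lemma pseudo_image_mu:
  assumes "emeasure \<mu> XX \<noteq> 0"
  shows "pseudo_image XX YY \<mu> \<nu> (orth_projector h)"
proof -
  have X: "XX \<in> sets BX" by (simp add: sets_restrict_space_iff)
  have "\<exists>p\<in>YY. emeasure (M p) XX \<noteq> 0"
  proof (rule ccontr)
    assume "\<not> ?thesis"
    then have "emeasure (M p) XX = 0" if "p \<in> space \<nu>" for p using that unfolding space_nu by blast
    then have "(\<integral>\<^sup>+p. emeasure (M p) XX \<partial>\<nu>) = (\<integral>\<^sup>+p. 0 \<partial>\<nu>)" by (rule nn_integral_cong)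
    then have "emeasure \<mu> XX = 0" unfolding emeasure_mu[OF X] by simp
    then show False using assms by simp
  qed
  then obtain p0 where "p0 \<in> YY" "emeasure (M p0) XX \<noteq> 0" by (rule bexE)
  then have p0: "p0 \<in> YY" "f (p0 + sc \<i> h) \<noteq> a" using M_zero_iff[of p0] by simp_all
  have null: "negligible_for \<nu> N" if N: "N \<subseteq> YY" and neg: "negligible_for \<mu> (orth_projector h -` N \<inter> XX)" for N
  proof -
    obtain Z where Z: "Z \<in> null_sets \<mu>" "orth_projector h -` N \<inter> XX \<subseteq> Z"
      using neg unfolding negligible_for_def null_sets_completion_iff2 by blast
    have ZB: "Z \<in> sets BX" using Z(1) by auto
    have m: "(\<lambda>p. emeasure (M p) Z) \<in> borel_measurable \<nu>"
      using dis.nn_measurable[of "indicator Z"] ZB by simp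
    have "(\<integral>\<^sup>+p. emeasure (M p) Z \<partial>\<nu>) = 0" using Z(1) by (simp add: emeasure_mu[OF ZB, symmetric] null_setsD1)
    then have "AE p in \<nu>. emeasure (M p) Z = 0" by (simp add: nn_integral_0_iff_AE[OF m])
    then obtain W where W: "{p \<in> space \<nu>. emeasure (M p) Z \<noteq> 0} \<subseteq> W" "W \<in> null_sets \<nu>"
      unfolding eventually_ae_filter by auto
    let ?V = "{p \<in> YY. f (p + sc \<i> h) = a}"
    have V: "?V \<in> null_sets \<nu>" using zero_set_null[OF p0] by (simp add: null_sets_def)
    have "N \<subseteq> W \<union> ?V"
    proof
      fix p assume pN: "p \<in> N"
      then have p: "p \<in> YY" using N by blast
      have "p + s *\<^sub>R h \<in> Z" for s using Z(2) pN YY_line_XX[OF p] orth_projector_line[OF p] by auto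
      then have "emeasure (M p) Z = emeasure (M p) XX"
        unfolding emeasure_M[OF p X] emeasure_M[OF p ZB] by (simp add: YY_line_XX[OF p])
      then show "p \<in> W \<union> ?V" using W(1) p M_zero_iff[OF p] by (cases "emeasure (M p) Z = 0") auto
    qed
    moreover have "W \<union> ?V \<in> null_sets \<nu>" by (rule null_sets.Un[OF W(2) V])
    ultimately show ?thesis unfolding negligible_for_def null_sets_completion_iff2 by (rule bexI)
  qed
  note W = weak_pseudo_image_mu[unfolded weak_pseudo_image_def]
  show ?thesis
    unfolding pseudo_image_def
  proof (intro conjI allI impI iffI)
    show "radon_measure_on XX \<mu>" "radon_measure_on YY \<nu>" "orth_projector h \<in> completion \<mu> \<rightarrow>\<^sub>M \<nu>"
      using W by simp_all
    show "negligible_for \<mu> (orth_projector h -` N \<inter> XX)" if "N \<subseteq> YY" "negligible_for \<nu> N" for N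
      by (rule conjunct2[OF conjunct2[OF conjunct2[OF W]], rule_format, OF that])
    show "negligible_for \<nu> N" if "N \<subseteq> YY" "negligible_for \<mu> (orth_projector h -` N \<inter> XX)" for N
      by (rule null[OF that])
  qed
qed

lemma disintegration_mu: "disintegration XX YY \<mu> \<nu> (orth_projector h) M"
  unfolding disintegration_def
proof (intro conjI allI impI ballI weak_pseudo_image_mu radon_M dis.integral_fibres)
  show "AE p in \<nu>. negligible_for (M p) (XX - orth_projector h -` {p})"
  proof (rule AE_I2)
    fix p assume "p \<in> space \<nu>"
    then have p: "p \<in> YY" by simp
    have "orth_projector h -` {p} \<inter> space BX \<in> sets BX"
      by (rule measurable_sets[OF measurable_orth_projector]) (use p in \<open>auto simp: sets_restrict_space_iff\<close>)
    then have "XX - orth_projector h -` {p} \<inter> XX \<in> sets BX"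
      by (intro sets.Diff) (auto simp: sets_restrict_space_iff space_restrict_space)
    moreover have "XX - orth_projector h -` {p} \<inter> XX = XX - orth_projector h -` {p}" by blast
    ultimately have F: "XX - orth_projector h -` {p} \<in> sets BX" by simp
    have "emeasure (M p) (XX - orth_projector h -` {p}) = 0"
      unfolding emeasure_M[OF p F] by (simp add: orth_projector_line[OF p])
    then have "XX - orth_projector h -` {p} \<in> null_sets (M p)" using F by (simp add: null_sets_def)
    then show "negligible_for (M p) (XX - orth_projector h -` {p})"
      unfolding negligible_for_def null_sets_completion_iff2 by (intro bexI[of _ "XX - orth_projector h -` {p}"]) auto
  qed
qed

lemma shift_DD: "x \<in> XX \<Longrightarrow> 0 < y \<Longrightarrow> x + sc (\<i> * of_real y) h \<in> DD"
  using siegel_line[of x "\<i> * of_real y"] by simp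

lemma continuous_shift: "0 < y \<Longrightarrow> continuous_on XX (\<lambda>x. f (x + sc (\<i> * of_real y) h))"
  by (rule continuous_on_compose2[OF continuous_f]) (use shift_DD in \<open>auto intro!: continuous_intros\<close>)

lemma shift_line: "f (p + t *\<^sub>R h + sc (\<i> * of_real y) h) = u p (Complex t y)"
proof -
  have "Complex t y = of_real t + \<i> * of_real y" by (simp add: complex_eq_iff)
  then have "sc (Complex t y) h = t *\<^sub>R h + sc (\<i> * of_real y) h" by (simp only: scale_left_distrib sc_of_real)
  then show ?thesis by (simp add: u_def add.assoc)
qed

lemma radon_beta': "radon_measure_on XX \<beta>"
  unfolding radon_measure_on_def using radon_beta sets_beta by blast

lemma radon_shift:
  assumes y: "0 < y"
  shows "radon_measure_on XX (density \<beta> (\<lambda>x. ennreal (f (x + sc (\<i> * of_real y) h))))"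
  unfolding radon_measure_on_def
proof (intro conjI allI impI)
  let ?f = "\<lambda>x. f (x + sc (\<i> * of_real y) h)"
  fix K assume K: "compact K \<and> K \<subseteq> XX"
  have "compact (?f ` K)" 
    by (rule compact_continuous_image[OF continuous_on_subset[OF continuous_shift[OF y] conjunct2[OF K]] conjunct1[OF K]])
  then obtain B where B: "0 < B" "\<forall>z\<in>?f ` K. norm z \<le> B" using compact_imp_bounded bounded_pos by metis
  have Ks: "K \<in> sets \<beta>" using K by (simp add: sets_beta_iff borel_compact)
  have fm: "?f \<in> borel_measurable \<beta>"
    using borel_measurable_continuous_on_restrict[OF continuous_shift[OF y]] by (simp add: measurable_cong_sets[OF sets_beta refl])
  have "emeasure (density \<beta> (\<lambda>x. ennreal (?f x))) K = (\<integral>\<^sup>+x. ennreal (?f x) * indicator K x \<partial>\<beta>)"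
    by (rule emeasure_density[OF _ Ks]) (use fm in measurable)
  also have "\<dots> \<le> (\<integral>\<^sup>+x. ennreal B * indicator K x \<partial>\<beta>)"
  proof (rule nn_integral_mono)
    fix x
    have "?f x \<le> B" if "x \<in> K" using bspec[OF B(2) imageI[OF that]] by (simp add: abs_le_iff)
    then show "ennreal (?f x) * indicator K x \<le> ennreal B * indicator K x" by (cases "x \<in> K") (auto intro: ennreal_leI)
  qed
  also have "\<dots> = ennreal B * emeasure \<beta> K" by (rule nn_integral_cmult_indicator[OF Ks])
  also have "\<dots> < \<infinity>" using radon_beta K by (simp add: ennreal_mult_less_top)
  finally show "emeasure (density \<beta> (\<lambda>x. ennreal (?f x))) K < \<infinity>" .
qed (simp add: sets_beta)

text \<open>Fubini in the coordinates (p, t) of the boundary. The factor |h| of the arc length is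
  moved into the test function, which brings the inner integral into the form treated by
  \<open>boundary_value\<close>.\<close>

lemma integral_shift:
  fixes g :: "'z \<Rightarrow> complex"
  assumes g: "g \<in> Cc XX" and y: "0 < y"
  defines "J \<equiv> \<lambda>p. \<integral>t. u p (Complex t y) *\<^sub>R (norm h *\<^sub>R g (p + t *\<^sub>R h)) \<partial>lborel"
  shows "(\<integral>x. g x \<partial>density \<beta> (\<lambda>x. ennreal (f (x + sc (\<i> * of_real y) h)))) = (\<integral>p. J p \<partial>\<nu>)"
    and "J \<in> borel_measurable \<nu>"
proof -
  let ?f = "\<lambda>x. f (x + sc (\<i> * of_real y) h)"
  interpret P: pair_sigma_finite \<nu> lamh
    using sigma_finite_nu sigma_finite_lambda_h by (simp add: pair_sigma_finite_def)
  have mB: "borel_measurable \<beta> = borel_measurable BX" by (rule measurable_cong_sets[OF sets_beta refl])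
  have fm: "?f \<in> borel_measurable \<beta>"
    unfolding mB by (rule borel_measurable_continuous_on_restrict[OF continuous_shift[OF y]])
  have gm: "g \<in> borel_measurable BX" by (rule Cc_measurable[OF g])
  have int: "integrable \<beta> (\<lambda>x. ?f x *\<^sub>R g x)" by (rule Cc_integrable[OF g radon_beta' continuous_shift[OF y]])
  have fgm: "(\<lambda>x. ?f x *\<^sub>R g x) \<in> borel_measurable BX" using int mB by auto
  have lm: "(\<lambda>(p, t). p + t *\<^sub>R h) \<in> \<nu> \<Otimes>\<^sub>M lamh \<rightarrow>\<^sub>M BX"
    using line_measurable by (simp cong: measurable_cong_sets sets_pair_measure_cong)
  have "integrable (distr (\<nu> \<Otimes>\<^sub>M lamh) BX (\<lambda>(p, t). p + t *\<^sub>R h)) (\<lambda>x. ?f x *\<^sub>R g x)" using int by (simp add: beta_eq_distr)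
  then have "integrable (\<nu> \<Otimes>\<^sub>M lamh) (\<lambda>z. (\<lambda>x. ?f x *\<^sub>R g x) ((\<lambda>(p, t). p + t *\<^sub>R h) z))"
    using integrable_distr_eq[OF lm fgm] by blast
  then have i2: "integrable (\<nu> \<Otimes>\<^sub>M lamh) (\<lambda>(p, t). u p (Complex t y) *\<^sub>R g (p + t *\<^sub>R h))"
    unfolding split_beta' by (simp only: shift_line)
  have J: "(\<integral>t. u p (Complex t y) *\<^sub>R g (p + t *\<^sub>R h) \<partial>lamh) = J p" if p: "p \<in> YY" for p
  proof -
    have l: "(\<lambda>t. p + t *\<^sub>R h) \<in> lborel \<rightarrow>\<^sub>M BX" using line_borel[OF p] by simp
    have "(\<lambda>t. u p (Complex t y) *\<^sub>R g (p + t *\<^sub>R h)) \<in> borel_measurable lborel"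
      using measurable_compose[OF l fgm] by (simp only: shift_line)
    then show ?thesis unfolding lamh_def J_def
      by (subst integral_density) (simp_all add: mult.commute[of "norm h"])
  qed
  have i3: "integrable \<nu> (\<lambda>p. \<integral>t. u p (Complex t y) *\<^sub>R g (p + t *\<^sub>R h) \<partial>lamh)"
    using P.integrable_fst'[OF i2] by simp
  then have "(\<lambda>p. \<integral>t. u p (Complex t y) *\<^sub>R g (p + t *\<^sub>R h) \<partial>lamh) \<in> borel_measurable \<nu>" by auto
  then show "J \<in> borel_measurable \<nu>"
    by (rule measurable_cong[THEN iffD1, rotated]) (simp add: J)
  have "(\<integral>x. g x \<partial>density \<beta> (\<lambda>x. ennreal (?f x))) = (\<integral>x. ?f x *\<^sub>R g x \<partial>\<beta>)"
    by (rule integral_density[OF _ fm]) (use gm mB f_nonneg shift_DD[OF _ y] in auto)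
  also have "\<dots> = (\<integral>x. ?f x *\<^sub>R g x \<partial>distr (\<nu> \<Otimes>\<^sub>M lamh) BX (\<lambda>(p, t). p + t *\<^sub>R h))" by (simp only: beta_eq_distr)
  also have "\<dots> = (\<integral>z. (\<lambda>x. ?f x *\<^sub>R g x) ((\<lambda>(p, t). p + t *\<^sub>R h) z) \<partial>(\<nu> \<Otimes>\<^sub>M lamh))" by (rule integral_distr[OF lm fgm])
  also have "\<dots> = (\<integral>z. (\<lambda>(p, t). u p (Complex t y) *\<^sub>R g (p + t *\<^sub>R h)) z \<partial>(\<nu> \<Otimes>\<^sub>M lamh))"
    unfolding split_beta' by (simp only: shift_line)
  also have "\<dots> = (\<integral>p. \<integral>t. u p (Complex t y) *\<^sub>R g (p + t *\<^sub>R h) \<partial>lamh \<partial>\<nu>)"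
    using P.integral_fst'[OF i2] by simp
  also have "\<dots> = (\<integral>p. J p \<partial>\<nu>)" by (rule Bochner_Integration.integral_cong) (simp_all add: J)
  finally show "(\<integral>x. g x \<partial>density \<beta> (\<lambda>x. ennreal (?f x))) = (\<integral>p. J p \<partial>\<nu>)" .
qed

lemma integral_mu:
  assumes g: "g \<in> Cc XX"
  shows "(\<integral>x. g x \<partial>\<mu>) = (\<integral>p. (\<integral>x. g x \<partial>M p) \<partial>\<nu>)"
proof -
  have gm: "g \<in> borel_measurable BX" by (rule Cc_measurable[OF g])
  have gmu: "g \<in> borel_measurable \<mu>" using gm by (simp cong: measurable_cong_sets)
  have gM: "g \<in> borel_measurable (M p)" for p using gm by (simp cong: measurable_cong_sets)
  note cM = integral_M_measurable[OF g]
  have "integrable \<mu> (\<lambda>x. 1 *\<^sub>R g x)" by (rule Cc_integrable[OF g radon_mu]) (rule continuous_on_const)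
  then have "integrable (completion \<mu>) g" using integrable_completion[OF gmu] by simp
  from dis.integral_fibres(3)[OF this]
  show ?thesis by (simp only: integral_completion[OF gmu] integral_completion[OF gM] integral_completion[OF cM])
qed

lemma boundary_value_limit:
  assumes g: "continuous_on UNIV g" and R: "0 \<le> R" "\<And>t. R < \<bar>t\<bar> \<Longrightarrow> g t = 0" and p: "p \<in> YY"
  shows "((\<lambda>y. \<integral>t. u p (Complex t y) *\<^sub>R g t \<partial>lborel) \<longlongrightarrow> fam.boundary_value g p) (at_right 0)"
proof (rule tendstoI)
  fix \<epsilon> :: real assume e: "0 < \<epsilon>"
  define m where "m = u p \<i> + 1"
  have m: "0 < m" using fam.U_i_ge(2)[OF p] by (simp add: m_def)
  have em: "0 < \<epsilon> / m" "\<epsilon> / m * m = \<epsilon>" using e m by simp_all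
  have "\<forall>\<^sub>F y in at_right 0. \<forall>p\<in>YY. norm ((\<integral>t. u p (Complex t y) *\<^sub>R g t \<partial>lborel) - fam.boundary_value g p) \<le> \<epsilon> / m * u p \<i>"
    by (rule fam.boundary_value_uniform[OF g R(1) _ em(1)]) (use R(2) in auto)
  then show "\<forall>\<^sub>F y in at_right 0. dist (\<integral>t. u p (Complex t y) *\<^sub>R g t \<partial>lborel) (fam.boundary_value g p) < \<epsilon>"
  proof eventually_elim
    case (elim y)
    then have "dist (\<integral>t. u p (Complex t y) *\<^sub>R g t \<partial>lborel) (fam.boundary_value g p) \<le> \<epsilon> / m * u p \<i>"
      using p unfolding dist_norm by blast
    also have "\<dots> < \<epsilon> / m * m" using em(1) by (intro mult_strict_left_mono) (simp_all add: m_def)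
    finally show ?case using em(2) by simp
  qed
qed

text \<open>The inner integral over each line converges to the integral against the fibre measure.
  The domination for y \<le> 1 comes from \<open>interval_bound\<close>, the boundedness of f(p + i
  h) on compact sets of p, and the compactness of the projected support.\<close>

theorem vague_limit_mu:
  "vague_limit XX (\<lambda>y. density \<beta> (\<lambda>x. ennreal (f (x + sc (\<i> * of_real y) h)))) \<mu> (at_right 0)"
  unfolding vague_limit_def
proof (intro conjI radon_mu ballI)
  have pos: "\<forall>\<^sub>F y in at_right 0. 0 < (y::real)" by (rule eventually_at_right_less)
  then show "\<forall>\<^sub>F y in at_right 0. radon_measure_on XX (density \<beta> (\<lambda>x. ennreal (f (x + sc (\<i> * of_real y) h))))"
    by eventually_elim (rule radon_shift)
  fix g assume g: "g \<in> Cc XX"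
  obtain R B P where R: "0 \<le> R" "0 \<le> B" "compact P" "P \<subseteq> YY"
    "\<forall>p t. p \<in> YY \<longrightarrow> R < \<bar>t\<bar> \<longrightarrow> g (p + t *\<^sub>R h) = 0" "\<forall>x. x \<in> XX \<longrightarrow> norm (g x) \<le> B"
    "\<forall>p t. p \<in> YY \<longrightarrow> p \<notin> P \<longrightarrow> g (p + t *\<^sub>R h) = 0"
    by (rule Cc_bounds[OF g])
  note R = R[rule_format]
  obtain U where U: "0 \<le> U" "\<And>p. p \<in> P \<Longrightarrow> u p \<i> \<le> U" by (rule u_bound[OF R(3,4)]) blast
  define k where "k p t = norm h *\<^sub>R g (p + t *\<^sub>R h)" for p t
  define J where "J y p = (\<integral>t. u p (Complex t y) *\<^sub>R k p t \<partial>lborel)" for y p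
  define C where "C = (2 * R + (pi * (1 + (R + 1)\<^sup>2) + 8 * R * (1 + R\<^sup>2)))"
  have C: "0 \<le> C" unfolding C_def using R(1) by (intro add_nonneg_nonneg mult_nonneg_nonneg) auto
  have gc: "continuous_on XX g" using g by (simp add: Cc_def)
  have kc: "continuous_on UNIV (k p)" if p: "p \<in> YY" for p
    unfolding k_def[abs_def]
    by (intro continuous_on_scaleR continuous_on_const continuous_on_compose2[OF gc])
      (use YY_line_XX[OF p] in \<open>auto intro!: continuous_intros\<close>)
  have k0: "k p t = 0" if "p \<in> YY" "R < \<bar>t\<bar>" for p t using R(5)[OF that] by (simp add: k_def)
  have Jlim: "((\<lambda>y. J y p) \<longlongrightarrow> (\<integral>x. g x \<partial>M p)) (at_right 0)" if p: "p \<in> YY" for p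
    using boundary_value_limit[OF kc[OF p] R(1) k0[OF p] p]
    unfolding J_def integral_M_boundary_value[OF g p] k_def by simp
  have Jbound: "norm (J y p) \<le> C * U * (norm h * B) * indicator P p" if p: "p \<in> YY" and y: "0 < y" "y \<le> 1" for y p
  proof (cases "p \<in> P")
    case False
    then have "k p t = 0" for t using R(7)[OF p] by (simp add: k_def)
    then show ?thesis using False by (simp add: J_def)
  next
    case True
    note I = fam.interval_bound[OF p y R(1)]
    have nn: "0 \<le> u p (Complex t y)" for t using u_nonneg[OF p] y by simp
    obtain B' where B': "0 < B'" "\<And>t. norm (k p t) \<le> B'"
      by (rule fam.compact_support_bounded[OF kc[OF p], of R]) (use k0[OF p] in auto)
    have "norm (J y p) \<le> (\<integral>t. (u p (Complex t y) * indicator {-R..R} t) * (norm h * B) \<partial>lborel)"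
      unfolding J_def
    proof (rule Bochner_Integration.integral_norm_bound_integral)
      show "integrable lborel (\<lambda>t. u p (Complex t y) *\<^sub>R k p t)"
        by (rule fam.poisson_smoothing(1)[OF p y(1) borel_measurable_continuous_onI[OF kc[OF p]] B'(2), of R]) (rule k0[OF p])
      show "integrable lborel (\<lambda>t. (u p (Complex t y) * indicator {-R..R} t) * (norm h * B))"
        by (intro integrable_mult_left I(2))
      show "norm (u p (Complex t y) *\<^sub>R k p t) \<le> (u p (Complex t y) * indicator {-R..R} t) * (norm h * B)" for t
      proof (cases "R < \<bar>t\<bar>")
        case True
        then show ?thesis using k0[OF p True] nn R(2) by simp
      next
        case False
        then have "t \<in> {-R..R}" by (auto simp: abs_le_iff not_less)
        moreover have "norm (k p t) \<le> norm h * B"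
          unfolding k_def using R(6)[OF YY_line_XX[OF p]] by (simp add: mult_left_mono)
        ultimately show ?thesis using nn[of t] by (simp add: mult_left_mono)
      qed
    qed
    also have "\<dots> = (\<integral>t. u p (Complex t y) * indicator {-R..R} t \<partial>lborel) * (norm h * B)" by simp
    also have "\<dots> \<le> (C * U) * (norm h * B)"
    proof (rule mult_right_mono)
      have "C * u p \<i> \<le> C * U" by (rule mult_left_mono[OF U(2)[OF True] C])
      with I(1) show "(\<integral>t. u p (Complex t y) * indicator {-R..R} t \<partial>lborel) \<le> C * U" unfolding C_def by linarith
    qed (use R(2) in simp)
    finally show ?thesis using True by simp
  qed
  \<comment> \<open>Dominated convergence is applied at infinity, with 1/y in place of y. The value
    0 for nonpositive y keeps the integrand measurable for every real y.\<close>
  have "((\<lambda>y. \<integral>p. (if 0 < y then J (inverse y) p else 0) \<partial>\<nu>) \<longlongrightarrow> (\<integral>p. (\<integral>x. g x \<partial>M p) \<partial>\<nu>)) at_top"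
  proof (rule integral_dominated_convergence_at_top[where w = "\<lambda>p. C * U * (norm h * B) * indicator P p"])
    show "(\<lambda>p. \<integral>x. g x \<partial>M p) \<in> borel_measurable \<nu>"
      by (rule integral_M_measurable[OF g])
    show "(\<lambda>p. if 0 < y then J (inverse y) p else 0) \<in> borel_measurable \<nu>" for y
      using integral_shift(2)[OF g, of "inverse y"] by (cases "0 < y") (simp_all add: J_def k_def)
    show "integrable \<nu> (\<lambda>p. C * U * (norm h * B) * indicator P p)"
      using R(3,4) radon_nu[OF R(3,4)]
      by (intro integrable_mult_right integrable_real_indicator) (auto simp: sets_nu_iff borel_compact)
    show "\<forall>\<^sub>F y in at_top. AE p in \<nu>. norm (if 0 < y then J (inverse y) p else 0) \<le> C * U * (norm h * B) * indicator P p"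
      using eventually_ge_at_top[of "1::real"]
    proof eventually_elim
      case (elim y)
      show ?case
      proof (rule AE_I2)
        fix p assume "p \<in> space \<nu>"
        then show "norm (if 0 < y then J (inverse y) p else 0) \<le> C * U * (norm h * B) * indicator P p"
          using Jbound[of p "inverse y"] elim by (simp add: inverse_le_1_iff)
      qed
    qed
    show "AE p in \<nu>. ((\<lambda>y. if 0 < y then J (inverse y) p else 0) \<longlongrightarrow> (\<integral>x. g x \<partial>M p)) at_top"
    proof (rule AE_I2)
      fix p assume "p \<in> space \<nu>"
      then have "((\<lambda>y. J (inverse y) p) \<longlongrightarrow> (\<integral>x. g x \<partial>M p)) at_top"
        using Jlim[of p] unfolding filterlim_at_right_to_top by simp
      then show "((\<lambda>y. if 0 < y then J (inverse y) p else 0) \<longlongrightarrow> (\<integral>x. g x \<partial>M p)) at_top"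
        by (rule Lim_transform_eventually) (use eventually_gt_at_top[of "0::real"] in eventually_elim, simp)
    qed
  qed
  then have "((\<lambda>y. \<integral>x. g x \<partial>density \<beta> (\<lambda>x. ennreal (f (x + sc (\<i> * of_real (inverse y)) h)))) \<longlongrightarrow> (\<integral>p. (\<integral>x. g x \<partial>M p) \<partial>\<nu>)) at_top"
  proof (rule Lim_transform_eventually)
    show "\<forall>\<^sub>F y in at_top. (\<integral>p. (if 0 < y then J (inverse y) p else 0) \<partial>\<nu>)
        = (\<integral>x. g x \<partial>density \<beta> (\<lambda>x. ennreal (f (x + sc (\<i> * of_real (inverse y)) h))))"
      using eventually_gt_at_top[of "0::real"]
    proof eventually_elim
      case (elim y)
      then have "0 < inverse y" by simp
      from integral_shift(1)[OF g this] elim show ?case unfolding J_def k_def by simp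
    qed
  qed
  then show "((\<lambda>y. \<integral>x. g x \<partial>density \<beta> (\<lambda>x. ennreal (f (x + sc (\<i> * of_real y) h)))) \<longlongrightarrow> (\<integral>x. g x \<partial>\<mu>)) (at_right 0)"
    unfolding filterlim_at_right_to_top integral_mu[OF g] .
qed

end

theorem proposition6p8:
  fixes sc :: "complex \<Rightarrow> 'z::euclidean_space \<Rightarrow> 'z"
    and tp :: "'z \<Rightarrow> 'z \<Rightarrow> 'z \<Rightarrow> 'z"
    and e h :: 'z
    and f :: "'z \<Rightarrow> real"
  assumes "positive_hermitian_jts sc tp"
    and "maximal_tripotent tp e"
    and "pluriharmonic_on sc f (siegel_domain sc tp e)"
    and "\<forall>x\<in>siegel_domain sc tp e. 0 \<le> f x"
    and "h \<in> jts_cone tp e"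
  shows
    "let X = silov_boundary sc tp e;
         Y = orth_projector h ` X;
         \<beta> = boundary_measure sc tp e;
         \<beta>\<^sub>h = projected_measure sc tp e h
     in \<exists>\<mu>.
          vague_limit X (\<lambda>y. density \<beta> (\<lambda>x. ennreal (f (x + sc (\<i> * of_real y) h)))) \<mu> (at_right 0)
        \<and> weak_pseudo_image X Y \<mu> \<beta>\<^sub>h (orth_projector h)
        \<and> (emeasure \<mu> X \<noteq> 0 \<longrightarrow> pseudo_image X Y \<mu> \<beta>\<^sub>h (orth_projector h))
        \<and> (\<exists>M a.
              disintegration X Y \<mu> \<beta>\<^sub>h (orth_projector h) M
            \<and> vaguely_continuous X Y M
            \<and> 0 \<le> a
            \<and> (\<forall>p\<in>Y. \<forall>w. Im w > 0 \<longrightarrow>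
                 f (p + sc w h) =
                   norm h / pi * (\<integral>x. Im w / (norm (p + sc w h - x))\<^sup>2 \<partial>M p) + a * Im w)
            \<and> (\<exists>M'. (\<forall>p\<in>Y. M' p \<in> MP
                   \<and> M p = distr (M' p) (restrict_space borel X) (\<lambda>t. p + t *\<^sub>R h)
                   \<and> (\<forall>\<nu>\<in>MP. M p = distr \<nu> (restrict_space borel X) (\<lambda>t. p + t *\<^sub>R h) \<longrightarrow> \<nu> = M' p))
                 \<and> tightly_continuous_on Y M'))"
proof -
  obtain G where G: "vs_holomorphic_on sc G (siegel_domain sc tp e)" "\<forall>x\<in>siegel_domain sc tp e. f x = Re (G x)"
    using assms(3) unfolding pluriharmonic_on_def by (elim exE conjE)
  have e: "tp e e e = e" "e \<noteq> 0" using assms(2) by (simp_all add: maximal_tripotent_def tripotent_def)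
  have "jts_boundary sc tp e h"
    by (intro jts_boundary.intro jts_boundary_axioms.intro assms(1,5) e)
  moreover have "jts_pluriharmonic_axioms sc tp e G f"
    using G assms(4) by (simp add: jts_pluriharmonic_axioms_def)
  ultimately have pl: "jts_pluriharmonic sc tp e h G f" by (rule jts_pluriharmonic.intro)
  then interpret jts_pluriharmonic sc tp e h G f .
  obtain a \<tau> where "poisson_family YY a \<tau> u" using ex_poisson_family by (elim exE)
  then have "jts_poisson sc tp e h G f a \<tau>" by (intro jts_poisson.intro jts_poisson_axioms.intro pl)
  then interpret P: jts_poisson sc tp e h G f a \<tau> .
  show ?thesis
    unfolding Let_def \<beta>_def[symmetric] \<nu>_def[symmetric]
  proof (intro exI[of _ P.\<mu>] exI[of _ P.M] exI[of _ a] exI[of _ P.M'] conjI ballI allI impI)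
    show "vague_limit XX (\<lambda>y. density \<beta> (\<lambda>x. ennreal (f (x + sc (\<i> * of_real y) h)))) P.\<mu> (at_right 0)"
      by (rule P.vague_limit_mu)
    show "weak_pseudo_image XX YY P.\<mu> \<nu> (orth_projector h)" by (rule P.weak_pseudo_image_mu)
    show "pseudo_image XX YY P.\<mu> \<nu> (orth_projector h)" if "emeasure P.\<mu> XX \<noteq> 0"
      using that by (rule P.pseudo_image_mu)
    show "disintegration XX YY P.\<mu> \<nu> (orth_projector h) P.M" by (rule P.disintegration_mu)
    show "vaguely_continuous XX YY P.M" by (rule P.vaguely_continuous_M)
    show "0 \<le> a" by (rule P.fam.a_nonneg)
    show "tightly_continuous_on YY P.M'" by (rule P.tightly_continuous_M')
    fix p assume p: "p \<in> YY"
    show "f (p + sc w h) = norm h / pi * (\<integral>x. Im w / (norm (p + sc w h - x))\<^sup>2 \<partial>P.M p) + a * Im w" if "0 < Im w" for w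
      by (rule P.poisson_formula[OF p that])
    show "P.M' p \<in> MP" by (rule P.M'_MP[OF p])
    show "P.M p = distr (P.M' p) (restrict_space borel XX) (\<lambda>t. p + t *\<^sub>R h)" by (rule P.M_def)
    show "N = P.M' p" if "N \<in> MP" "P.M p = distr N (restrict_space borel XX) (\<lambda>t. p + t *\<^sub>R h)" for N
      by (rule P.M'_unique[OF p that])
  qed
qed

end
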